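(* Let $A$ be a stationary Yang--Mills connection with $\frac{1}{|B_4|}\int_{B_4(p)}|F_A|^2\le\Lambda$ and with $B_4(p)$ a $\delta$-weakly flat ball. For each $\epsilon>0$, if $\delta<\delta(n,k,\Lambda,\epsilon)$, then there exists a harmonic $\epsilon$-gauge $V^1,\dots,V^k\in\Gamma(B_2(p),E)$ on $B_2(p)$.
   Context: Setting. $n\ge4$; $G\subseteq SO(k)$ is compact; a stationary Yang--Mills connection $A$ is a smooth critical point of $\int|F_A|^2$ on a principal $G$-bundle $P$ over a ball. $E$ is the rank $k$ real vector bundle with inner product associated to $P$ by $G\subseteq SO(k)$, with metric connection $\nabla=\nabla_A$ and Laplacian $\Delta=\Delta_A:\Gamma(E)\to\Gamma(E)$. The ball is identified with a Euclidean ball carrying a metric $g_{ij}$ with $\|g_{ij}-\delta_{ij}\|_{C^{1,\alpha}}\le C(n,\alpha)K$ for all $\alpha<1$ ($C(n,\alpha)$ fixed constants); "$K$" always refers to this bound. Balls, distances, norms and volumes are with respect to $g$; $B_s(S)$ is the $s$-neighbourhood of $S$. For a linear subspace $\mathcal L$, $\mathcal L_x=x+\mathcal L$; $F[v]=F_A(v,\cdot)$, $|F[\mathcal L]|^2=\sum_i|F[e_i]|^2$ for an orthonormal basis of $\mathcal L$. Weakly flat. If $K<\delta$, $A$ is $\delta$-weakly flat on $B_1(p)$ with respect to an $(n-4)$-dimensional subspace $\mathcal L$ if (1) for each $y\in\mathcal L_p\cap B_1$ and $\delta\le r\le1$, $r^4\frac{1}{|B_r|}\int_{B_r(y)}|F[\mathcal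 L]|^2<\delta$; (2) $|F_A|(y)\le\delta\,d(y,\mathcal L_p)^{-2}$ for $y\in B_1(p)\setminus B_\delta(\mathcal L_p)$. A ball $B_r(p)$ is $\delta$-weakly flat if this holds (for some $\mathcal L$) after rescaling it to unit size. Harmonic $\epsilon$-gauge. Sections $V^1,\dots,V^k\in\Gamma(B_r(x),E)$ form a harmonic $\epsilon$-gauge on $B_r(x)$ if on $B_r(x)$: (1) $\Delta V^a=0$; (2) $|V^a|\le1+\epsilon$; (3) $\frac1{|B_r|}\int_{B_r}|\langle V^a,V^b\rangle-\delta^{ab}|<\epsilon$; (4) $r^2\frac1{|B_r|}\int_{B_r}|\nabla V|^2<\epsilon^2$, where $|\nabla V|^2=\sum_a|\nabla V^a|^2$. *)

theory Defs
  imports "HOL-Analysis.Analysis"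
begin

section \<open>Calculus on open subsets of Euclidean space\<close>

definition pd :: "'n::finite \<Rightarrow> (real^'n \<Rightarrow> 'b::real_normed_vector) \<Rightarrow> real^'n \<Rightarrow> 'b" where
  "pd i f x = frechet_derivative f (at x) (axis i 1)"

fun Ck_on :: "nat \<Rightarrow> (real^'n::finite) set \<Rightarrow> (real^'n \<Rightarrow> 'b::real_normed_vector) \<Rightarrow> bool" where
  "Ck_on 0 S f \<longleftrightarrow> continuous_on S f"
| "Ck_on (Suc m) S f \<longleftrightarrow> (\<forall>x\<in>S. f differentiable (at x)) \<and> (\<forall>i. Ck_on m S (pd i f))"

text \<open>Only used for open \<open>S\<close>.\<close>
definition smooth_on :: "(real^'n::finite) set \<Rightarrow> (real^'n \<Rightarrow> 'b::real_normed_vector) \<Rightarrow> bool" where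
  "smooth_on S f \<longleftrightarrow> (\<forall>m. Ck_on m S f)"

definition C1_holder_norm :: "real \<Rightarrow> (real^'n::finite) set \<Rightarrow> (real^'n \<Rightarrow> real) \<Rightarrow> ennreal" where
  "C1_holder_norm \<alpha> S u =
     (SUP x\<in>S. ennreal \<bar>u x\<bar>)
   + (\<Sum>i\<in>UNIV. SUP x\<in>S. ennreal \<bar>pd i u x\<bar>)
   + (\<Sum>i\<in>UNIV. SUP (x, y)\<in>{(x, y). x \<in> S \<and> y \<in> S \<and> x \<noteq> y}.
        ennreal (\<bar>pd i u x - pd i u y\<bar> / dist x y powr \<alpha>))"


section \<open>Riemannian metrics on an open subset \<open>M\<close> of Euclidean space\<close>

definition riemannian_metric :: "(real^'n::finite) set \<Rightarrow> (real^'n \<Rightarrow> real^'n^'n) \<Rightarrow> bool" where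
  "riemannian_metric M g \<longleftrightarrow>
     smooth_on M g \<and>
     (\<forall>x\<in>M. transpose (g x) = g x \<and> (\<forall>v. v \<noteq> 0 \<longrightarrow> v \<bullet> (g x *v v) > 0))"

text \<open>The bound \<open>\<parallel>g\<^sub>i\<^sub>j - \<delta>\<^sub>i\<^sub>j\<parallel> \<le> C(\<alpha>) K\<close> in \<open>C\<^sup>1\<close>-Hoelder norm, for all exponents \<open>\<alpha> < 1\<close>.\<close>
definition metric_bound ::
    "(real \<Rightarrow> real) \<Rightarrow> (real^'n::finite) set \<Rightarrow> (real^'n \<Rightarrow> real^'n^'n) \<Rightarrow> real \<Rightarrow> bool" where
  "metric_bound C M g K \<longleftrightarrow>
     (\<forall>\<alpha>. 0 < \<alpha> \<and> \<alpha> < 1 \<longrightarrow>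
       (\<forall>i j. C1_holder_norm \<alpha> M (\<lambda>x. g x $ i $ j - (if i = j then 1 else 0)) \<le> ennreal (C \<alpha> * K)))"

definition curve_length :: "(real^'n::finite \<Rightarrow> real^'n^'n) \<Rightarrow> (real \<Rightarrow> real^'n) \<Rightarrow> real" where
  "curve_length g \<gamma> = integral {0..1} (\<lambda>t.
     let v = vector_derivative \<gamma> (at t) in sqrt (v \<bullet> (g (\<gamma> t) *v v)))"

definition gdist ::
    "(real^'n::finite) set \<Rightarrow> (real^'n \<Rightarrow> real^'n^'n) \<Rightarrow> real^'n \<Rightarrow> real^'n \<Rightarrow> real" where
  "gdist M g x y = Inf {curve_length g \<gamma> | \<gamma>.
     \<gamma> C1_differentiable_on {0..1} \<and> \<gamma> ` {0..1} \<subseteq> M \<and> \<gamma> 0 = x \<and> \<gamma> 1 = y}"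

definition gball ::
    "(real^'n::finite) set \<Rightarrow> (real^'n \<Rightarrow> real^'n^'n) \<Rightarrow> real^'n \<Rightarrow> real \<Rightarrow> (real^'n) set" where
  "gball M g x r = {y\<in>M. gdist M g x y < r}"

text \<open>Open balls of radius less than or equal to \<open>r\<close> around \<open>p\<close> do not run into the boundary of
  \<open>M\<close>; \<open>M\<close> itself may be the open ball of radius \<open>r\<close>.\<close>
definition genuine_ball ::
    "(real^'n::finite) set \<Rightarrow> (real^'n \<Rightarrow> real^'n^'n) \<Rightarrow> real^'n \<Rightarrow> real \<Rightarrow> bool" where
  "genuine_ball M g p r \<longleftrightarrow> (\<forall>s<r. compact {x\<in>M. gdist M g p x \<le> s})"

definition setgdist ::
    "(real^'n::finite) set \<Rightarrow> (real^'n \<Rightarrow> real^'n^'n) \<Rightarrow> real^'n \<Rightarrow> (real^'n) set \<Rightarrow> real" where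
  "setgdist M g x S = Inf (gdist M g x ` (S \<inter> M))"

definition gnbhd ::
    "(real^'n::finite) set \<Rightarrow> (real^'n \<Rightarrow> real^'n^'n) \<Rightarrow> (real^'n) set \<Rightarrow> real \<Rightarrow> (real^'n) set" where
  "gnbhd M g S r = (\<Union>x\<in>S \<inter> M. gball M g x r)"

text \<open>Average of a nonnegative function with respect to the Riemannian volume; in \<open>ennreal\<close>, so
  that a divergent integral is infinite rather than zero.\<close>
definition gavg :: "(real^'n::finite \<Rightarrow> real^'n^'n) \<Rightarrow> (real^'n) set \<Rightarrow> (real^'n \<Rightarrow> real) \<Rightarrow> ennreal" where
  "gavg g B f = (\<integral>\<^sup>+x\<in>B. ennreal (f x * sqrt (det (g x))) \<partial>lborel)
              / (\<integral>\<^sup>+x\<in>B. ennreal (sqrt (det (g x))) \<partial>lborel)"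

abbreviation ginv :: "(real^'n::finite \<Rightarrow> real^'n^'n) \<Rightarrow> real^'n \<Rightarrow> 'n \<Rightarrow> 'n \<Rightarrow> real" where
  "ginv g x i j \<equiv> matrix_inv (g x) $ i $ j"

definition g_orthonormal_basis ::
    "(real^'n::finite \<Rightarrow> real^'n^'n) \<Rightarrow> real^'n \<Rightarrow> (real^'n) set \<Rightarrow> (real^'n) set \<Rightarrow> bool" where
  "g_orthonormal_basis g x L B \<longleftrightarrow>
     span B = L \<and> (\<forall>u\<in>B. \<forall>v\<in>B. u \<bullet> (g x *v v) = (if u = v then 1 else 0))"


section \<open>Principal bundles, connections and sections\<close>

definition compact_subgroup_SO :: "(real^'k::finite^'k) set \<Rightarrow> bool" where
  "compact_subgroup_SO G \<longleftrightarrow>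
     compact G \<and> G \<subseteq> {Q. orthogonal_matrix Q \<and> det Q = 1} \<and> mat 1 \<in> G \<and>
     (\<forall>Q\<in>G. \<forall>S\<in>G. Q ** S \<in> G) \<and> (\<forall>Q\<in>G. transpose Q \<in> G)"

text \<open>Generators of one-parameter subgroups.\<close>
definition lie_algebra :: "(real^'k::finite^'k) set \<Rightarrow> (real^'k^'k) set" where
  "lie_algebra G = {X. \<exists>\<gamma>::real \<Rightarrow> real^'k^'k.
     range \<gamma> \<subseteq> G \<and> (\<forall>s t. \<gamma> (s + t) = \<gamma> s ** \<gamma> t) \<and> (\<gamma> has_vector_derivative X) (at 0)}"

text \<open>
  A principal \<open>G\<close>-bundle over \<open>M\<close> is given by a trivialisation over a neighbourhood \<open>U x\<close> of each
  point \<open>x\<close>, with transition functions \<open>\<tau> x y\<close> on \<open>U x \<inter> U y\<close>. All further objects are families of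
  local representatives indexed by the same points: a section of the associated bundle \<open>E\<close> is
  represented by \<open>V x\<close> in the trivialisation over \<open>U x\<close>, with \<open>V x = \<tau> x y V y\<close> on overlaps.
  Gauge-invariant functions are evaluated at a point \<open>x\<close> in the trivialisation over \<open>U x\<close>.
\<close>
definition principal_bundle ::
    "(real^'k::finite^'k) set \<Rightarrow> (real^'n::finite) set \<Rightarrow> (real^'n \<Rightarrow> (real^'n) set)
      \<Rightarrow> (real^'n \<Rightarrow> real^'n \<Rightarrow> real^'n \<Rightarrow> real^'k^'k) \<Rightarrow> bool" where
  "principal_bundle G M U \<tau> \<longleftrightarrow>
     (\<forall>x\<in>M. open (U x) \<and> x \<in> U x \<and> U x \<subseteq> M) \<and>
     (\<forall>x\<in>M. \<forall>y\<in>M. smooth_on (U x \<inter> U y) (\<tau> x y) \<and> (\<forall>z\<in>U x \<inter> U y. \<tau> x y z \<in> G)) \<and>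
     (\<forall>x\<in>M. \<forall>z\<in>U x. \<tau> x x z = mat 1) \<and>
     (\<forall>x\<in>M. \<forall>y\<in>M. \<forall>w\<in>M. \<forall>z\<in>U x \<inter> U y \<inter> U w. \<tau> x y z ** \<tau> y w z = \<tau> x w z)"

text \<open>\<open>A x z i\<close> is the \<open>i\<close>-th component at \<open>z\<close> of the connection form in the trivialisation over
  \<open>U x\<close>; the covariant derivative there is \<open>d + A x\<close>.\<close>
definition connection ::
    "(real^'k::finite^'k) set \<Rightarrow> (real^'n::finite) set \<Rightarrow> (real^'n \<Rightarrow> (real^'n) set)
      \<Rightarrow> (real^'n \<Rightarrow> real^'n \<Rightarrow> real^'n \<Rightarrow> real^'k^'k)
      \<Rightarrow> (real^'n \<Rightarrow> real^'n \<Rightarrow> 'n \<Rightarrow> real^'k^'k) \<Rightarrow> bool" where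
  "connection G M U \<tau> A \<longleftrightarrow>
     (\<forall>x\<in>M. \<forall>i. smooth_on (U x) (\<lambda>z. A x z i) \<and> (\<forall>z\<in>U x. A x z i \<in> lie_algebra G)) \<and>
     (\<forall>x\<in>M. \<forall>y\<in>M. \<forall>z\<in>U x \<inter> U y. \<forall>i.
        A x z i = \<tau> x y z ** A y z i ** transpose (\<tau> x y z)
                - pd i (\<tau> x y) z ** transpose (\<tau> x y z))"

definition adjoint_one_form ::
    "(real^'k::finite^'k) set \<Rightarrow> (real^'n::finite) set \<Rightarrow> (real^'n \<Rightarrow> (real^'n) set)
      \<Rightarrow> (real^'n \<Rightarrow> real^'n \<Rightarrow> real^'n \<Rightarrow> real^'k^'k)
      \<Rightarrow> (real^'n \<Rightarrow> real^'n \<Rightarrow> 'n \<Rightarrow> real^'k^'k) \<Rightarrow> bool" where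
  "adjoint_one_form G M U \<tau> a \<longleftrightarrow>
     (\<forall>x\<in>M. \<forall>i. smooth_on (U x) (\<lambda>z. a x z i) \<and> (\<forall>z\<in>U x. a x z i \<in> lie_algebra G)) \<and>
     (\<forall>x\<in>M. \<forall>y\<in>M. \<forall>z\<in>U x \<inter> U y. \<forall>i.
        a x z i = \<tau> x y z ** a y z i ** transpose (\<tau> x y z))"

definition bundle_section ::
    "(real^'n::finite) set \<Rightarrow> (real^'n \<Rightarrow> (real^'n) set)
      \<Rightarrow> (real^'n \<Rightarrow> real^'n \<Rightarrow> real^'n \<Rightarrow> real^'k::finite^'k)
      \<Rightarrow> (real^'n) set \<Rightarrow> (real^'n \<Rightarrow> real^'n \<Rightarrow> real^'k) \<Rightarrow> bool" where
  "bundle_section M U \<tau> D V \<longleftrightarrow>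
     (\<forall>x\<in>M. smooth_on (U x \<inter> D) (V x)) \<and>
     (\<forall>x\<in>M. \<forall>y\<in>M. \<forall>z\<in>U x \<inter> U y \<inter> D. V x z = \<tau> x y z *v V y z)"


subsection \<open>Curvature\<close>

text \<open>Here \<open>a\<close> is a local connection form.\<close>
definition curv :: "(real^'n::finite \<Rightarrow> 'n \<Rightarrow> real^'k::finite^'k) \<Rightarrow> 'n \<Rightarrow> 'n \<Rightarrow> real^'n \<Rightarrow> real^'k^'k" where
  "curv a i j z = pd i (\<lambda>w. a w j) z - pd j (\<lambda>w. a w i) z + a z i ** a z j - a z j ** a z i"

text \<open>\<open>|F\<^sub>A|\<^sup>2\<close> is the sum of \<open>|F(e\<^sub>i, e\<^sub>j)|\<^sup>2\<close> over all pairs \<open>(i, j)\<close> for an orthonormal frame, with the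
  norm \<open>|X|\<^sup>2 = - tr (X X)\<close> on the Lie algebra, so that it agrees with \<open>|F[\<L>]|\<^sup>2\<close> for \<open>\<L>\<close> the whole
  tangent space.\<close>
definition curv_norm2 ::
    "(real^'n::finite \<Rightarrow> real^'n^'n) \<Rightarrow> (real^'n \<Rightarrow> real^'n \<Rightarrow> 'n \<Rightarrow> real^'k::finite^'k) \<Rightarrow> real^'n \<Rightarrow> real" where
  "curv_norm2 g A z = (\<Sum>i\<in>UNIV. \<Sum>j\<in>UNIV. \<Sum>k\<in>UNIV. \<Sum>l\<in>UNIV.
     ginv g z i k * ginv g z j l * (curv (A z) i j z \<bullet> curv (A z) k l z))"

text \<open>\<open>|F[v]|\<^sup>2\<close> for the one-form \<open>F[v] = F\<^sub>A(v, \<cdot>)\<close>.\<close>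
definition curv_vec_norm2 ::
    "(real^'n::finite \<Rightarrow> real^'n^'n) \<Rightarrow> (real^'n \<Rightarrow> real^'n \<Rightarrow> 'n \<Rightarrow> real^'k::finite^'k)
      \<Rightarrow> real^'n \<Rightarrow> real^'n \<Rightarrow> real" where
  "curv_vec_norm2 g A v z = (\<Sum>j\<in>UNIV. \<Sum>l\<in>UNIV. ginv g z j l *
     ((\<Sum>i\<in>UNIV. (v $ i) *\<^sub>R curv (A z) i j z) \<bullet> (\<Sum>i\<in>UNIV. (v $ i) *\<^sub>R curv (A z) i l z)))"

definition curv_sub_norm2 ::
    "(real^'n::finite \<Rightarrow> real^'n^'n) \<Rightarrow> (real^'n \<Rightarrow> real^'n \<Rightarrow> 'n \<Rightarrow> real^'k::finite^'k)
      \<Rightarrow> (real^'n) set \<Rightarrow> real^'n \<Rightarrow> real" where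
  "curv_sub_norm2 g A L z =
     (\<Sum>e\<in>(SOME B. g_orthonormal_basis g z L B). curv_vec_norm2 g A e z)"

text \<open>Criticality of \<open>\<integral>|F\<^sub>A|\<^sup>2\<close> under compactly supported variations; outside the support \<open>S\<close> the
  integrand does not change, and the total energy over \<open>M\<close> need not be finite.\<close>
definition yang_mills ::
    "(real^'k::finite^'k) set \<Rightarrow> (real^'n::finite) set \<Rightarrow> (real^'n \<Rightarrow> real^'n^'n)
      \<Rightarrow> (real^'n \<Rightarrow> (real^'n) set) \<Rightarrow> (real^'n \<Rightarrow> real^'n \<Rightarrow> real^'n \<Rightarrow> real^'k^'k)
      \<Rightarrow> (real^'n \<Rightarrow> real^'n \<Rightarrow> 'n \<Rightarrow> real^'k^'k) \<Rightarrow> bool" where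
  "yang_mills G M g U \<tau> A \<longleftrightarrow>
     (\<forall>a S. adjoint_one_form G M U \<tau> a \<and> compact S \<and> S \<subseteq> M \<and>
        (\<forall>x\<in>M. \<forall>z\<in>U x - S. \<forall>i. a x z i = 0) \<longrightarrow>
        ((\<lambda>t. set_lebesgue_integral lborel S
            (\<lambda>z. curv_norm2 g (\<lambda>x w i. A x w i + t *\<^sub>R a x w i) z * sqrt (det (g z))))
          has_real_derivative 0) (at 0))"


subsection \<open>Weak flatness\<close>

text \<open>The balls in the first condition are balls of \<open>M\<close>.\<close>
definition weakly_flat_unit ::
    "(real \<Rightarrow> real) \<Rightarrow> (real^'n::finite) set \<Rightarrow> (real^'n \<Rightarrow> real^'n^'n)
      \<Rightarrow> (real^'n \<Rightarrow> real^'n \<Rightarrow> 'n \<Rightarrow> real^'k::finite^'k)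
      \<Rightarrow> real \<Rightarrow> real^'n \<Rightarrow> (real^'n) set \<Rightarrow> bool" where
  "weakly_flat_unit C M g A \<delta> p L \<longleftrightarrow>
     (\<exists>K. 0 \<le> K \<and> K < \<delta> \<and> metric_bound C M g K) \<and>
     subspace L \<and> dim L = CARD('n) - 4 \<and>
     (\<forall>y\<in>(+) p ` L \<inter> gball M g p 1. \<forall>r. \<delta> \<le> r \<and> r \<le> 1 \<longrightarrow>
        ennreal (r ^ 4) * gavg g (gball M g y r) (curv_sub_norm2 g A L) < ennreal \<delta>) \<and>
     (\<forall>y\<in>gball M g p 1 - gnbhd M g ((+) p ` L) \<delta>.
        sqrt (curv_norm2 g A y) \<le> \<delta> / (setgdist M g y ((+) p ` L))\<^sup>2)"

text \<open>
  Rescaling \<open>B\<^sub>r(p)\<close> to unit size: all data are pulled back along \<open>z \<mapsto> p + r (z - p)\<close>, and the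
  pulled back metric is divided by \<open>r\<^sup>2\<close>, which leaves the components \<open>g\<^sub>i\<^sub>j\<close> unchanged. The bound
  \<open>K\<close> is thus that of the rescaled metric.
\<close>
definition scale_map :: "real^'n::finite \<Rightarrow> real \<Rightarrow> real^'n \<Rightarrow> real^'n" where
  "scale_map p r z = p + r *\<^sub>R (z - p)"

definition weakly_flat_ball ::
    "(real \<Rightarrow> real) \<Rightarrow> (real^'n::finite) set \<Rightarrow> (real^'n \<Rightarrow> real^'n^'n)
      \<Rightarrow> (real^'n \<Rightarrow> real^'n \<Rightarrow> 'n \<Rightarrow> real^'k::finite^'k)
      \<Rightarrow> real \<Rightarrow> real^'n \<Rightarrow> real \<Rightarrow> bool" where
  "weakly_flat_ball C M g A \<delta> p r \<longleftrightarrow>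
     (let \<phi> = scale_map p r in
       \<exists>L. weakly_flat_unit C (\<phi> -` M) (g \<circ> \<phi>) (\<lambda>x z i. r *\<^sub>R A (\<phi> x) (\<phi> z) i) \<delta> p L)"


subsection \<open>Harmonic gauges\<close>

definition cov ::
    "(real^'n::finite \<Rightarrow> 'n \<Rightarrow> real^'k::finite^'k) \<Rightarrow> (real^'n \<Rightarrow> real^'k) \<Rightarrow> 'n \<Rightarrow> real^'n \<Rightarrow> real^'k" where
  "cov a v i z = pd i v z + a z i *v v z"

text \<open>The connection Laplacian \<open>tr \<nabla>\<^sup>2\<close>, in divergence form.\<close>
definition laplacian ::
    "(real^'n::finite \<Rightarrow> real^'n^'n) \<Rightarrow> (real^'n \<Rightarrow> 'n \<Rightarrow> real^'k::finite^'k)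
      \<Rightarrow> (real^'n \<Rightarrow> real^'k) \<Rightarrow> real^'n \<Rightarrow> real^'k" where
  "laplacian g a v z = (1 / sqrt (det (g z))) *\<^sub>R
     (\<Sum>i\<in>UNIV. cov a (\<lambda>w. \<Sum>j\<in>UNIV. (sqrt (det (g w)) * ginv g w i j) *\<^sub>R cov a v j w) i z)"

definition cov_norm2 ::
    "(real^'n::finite \<Rightarrow> real^'n^'n) \<Rightarrow> (real^'n \<Rightarrow> real^'n \<Rightarrow> 'n \<Rightarrow> real^'k::finite^'k)
      \<Rightarrow> (real^'n \<Rightarrow> real^'n \<Rightarrow> real^'k) \<Rightarrow> real^'n \<Rightarrow> real" where
  "cov_norm2 g A V z = (\<Sum>i\<in>UNIV. \<Sum>j\<in>UNIV. ginv g z i j * (cov (A z) (V z) i z \<bullet> cov (A z) (V z) j z))"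

text \<open>The sections are indexed by \<open>'k\<close>, so there are \<open>k\<close> of them; \<open>V a x\<close> is the representative of
  the section \<open>V a\<close> over \<open>U x\<close>.\<close>
definition harmonic_gauge ::
    "(real^'n::finite) set \<Rightarrow> (real^'n \<Rightarrow> real^'n^'n) \<Rightarrow> (real^'n \<Rightarrow> (real^'n) set)
      \<Rightarrow> (real^'n \<Rightarrow> real^'n \<Rightarrow> real^'n \<Rightarrow> real^'k::finite^'k)
      \<Rightarrow> (real^'n \<Rightarrow> real^'n \<Rightarrow> 'n \<Rightarrow> real^'k^'k)
      \<Rightarrow> real \<Rightarrow> real^'n \<Rightarrow> real \<Rightarrow> ('k \<Rightarrow> real^'n \<Rightarrow> real^'n \<Rightarrow> real^'k) \<Rightarrow> bool" where
  "harmonic_gauge M g U \<tau> A \<epsilon> p r V \<longleftrightarrow>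
     (let B = gball M g p r in
       (\<forall>a. bundle_section M U \<tau> B (V a)) \<and>
       (\<forall>a. \<forall>z\<in>B. laplacian g (A z) (V a z) z = 0) \<and>
       (\<forall>a. \<forall>z\<in>B. norm (V a z z) \<le> 1 + \<epsilon>) \<and>
       (\<forall>a b. gavg g B (\<lambda>z. \<bar>V a z z \<bullet> V b z z - (if a = b then 1 else 0)\<bar>) < ennreal \<epsilon>) \<and>
       ennreal (r\<^sup>2) * gavg g B (\<lambda>z. \<Sum>a\<in>UNIV. cov_norm2 g A (V a) z) < ennreal (\<epsilon>\<^sup>2))"

end

theory Submission
 imports Defs
begin

text \<open>
  The bundle is trivialised by an orthonormal frame over a neighbourhood of the closed ball of radius
  \<open>16/5\<close>, gluing local frames across common faces of boxes. Let \<open>e\<close> be a unit vector orthogonal to \<open>L\<close>. In a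
  frame which is approximately radial about \<open>p + e\<close>, a product of Cayley transforms, the connection form is
  controlled by the curvature along segments from \<open>p + e\<close>. Segments to points at distance at least \<open>\<rho>\<close>
  from a subspace of codimension three containing \<open>p + L\<close> stay away from \<open>p + L\<close>, so weak flatness makes
  the form small there.

  After extension to a torus, for each basis vector \<open>b\<close> the equation \<open>D\<^sup>*(a D u) + X (u - b) = 0\<close>, with a potential
  \<open>X\<close> vanishing near the ball, is solved by a lattice approximation. The maximum principle gives
  \<open>norm u \<le> 1\<close>. Multiplying \<open>b\<close> by a cutoff which vanishes near the subspace of codimension three gives a
  competitor of small energy: the neighbourhood has volume of order \<open>\<rho>\<^sup>3\<close>, the cutoff has squared gradient of
  order \<open>\<rho>\<^sup>-\<^sup>2\<close>. Hence \<open>u\<close> has small energy, and a Poincare inequality yields orthonormality on average.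
\<close>

text \<open>The set \<open>p + L\<close> has codimension four, but a frame radial about a point is
  controlled at \<open>x\<close> only if the whole segment from that point to \<open>x\<close> keeps
  away from \<open>p + L\<close>. Segments from \<open>p + e\<close> which come close end near the
  span of \<open>L\<close> and \<open>e\<close> through \<open>p\<close>; this subspace of
  codimension three is the true exceptional set. It is still negligible for the Dirichlet energy,
  since \<rho>^3 times \<rho>^-2 tends to zero. The form is not controlled near it, but the
  competitor vanishes there, and the maximum principle uses only skewness. So \<rho> and the
  admissible size \<sigma> of the form are fixed before \<delta>. A torus with a potential takes the
  place of boundary conditions: the potential makes the operator coercive and ties \<open>u\<close>
  to \<open>b\<close>; where it vanishes, \<open>u\<close> is harmonic. The lattice gives existence
  and smoothness together, as difference quotients of all orders are bounded uniformly in the mesh.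
  The radii are fixed: metric balls of radius 2 lie in radius 11/5, the potential rises up to 23/10,
  the coefficients are altered beyond 5/2, and the frame lives on 16/5.\<close>

abbreviation (input) sum_all :: "('i::finite => 'b) => 'b::comm_monoid_add" (binder "SUM " 10)
 where "sum_all f \<equiv> sum f UNIV"

abbreviation (input) ax :: "real => 'i => real^'i"
 where "ax t i \<equiv> t *\<^sub>R axis i 1"

abbreviation (input) "nsq v \<equiv> (norm v)^2"

abbreviation (input) "smooth \<equiv> smooth_on UNIV"

abbreviation (input) "kd i j \<equiv> if i = j then 1 else 0"

section \<open>Calculus of smooth functions\<close>

lemma pd_eq: "(f has_derivative f') (at x) ==> pd i f x = f' (axis i 1)"
 unfolding pd_def using frechet_derivative_at by metis

lemma differentiable_has_derivative_pd:
 assumes "f differentiable (at x)"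
 shows "(f has_derivative (%v. SUM i. (v $ i) *\<^sub>R pd i f x)) (at x)"
proof -
 have d: "(f has_derivative frechet_derivative f (at x)) (at x)"
  using assms frechet_derivative_works by blast
 then interpret bounded_linear "frechet_derivative f (at x)" by (rule has_derivative_bounded_linear)
 have "frechet_derivative f (at x) v = (SUM i. (v $ i) *\<^sub>R pd i f x)" for v
 proof -
  have "v = (SUM i. ax (v $ i) i)"
   by (simp add: basis_expansion flip: scalar_mult_eq_scaleR)
  then have "frechet_derivative f (at x) v = frechet_derivative f (at x) (SUM i. ax (v $ i) i)"
   by simp
  also have "... = (SUM i. (v $ i) *\<^sub>R pd i f x)"
   by (simp add: sum scaleR pd_def)
  finally show ?thesis .
 qed
 then have "frechet_derivative f (at x) = (%v. SUM i. (v $ i) *\<^sub>R pd i f x)" by blast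
 with d show ?thesis by simp
qed

lemma line_derivative_dir:
 fixes f :: "real^'n => real"
 assumes "f differentiable (at (x + t *\<^sub>R v))"
 shows "((%t. f (x + t *\<^sub>R v)) has_real_derivative (SUM l. v $ l * pd l f (x + t *\<^sub>R v))) (at t)"
proof -
 have "((%s. x + s *\<^sub>R v) has_derivative (%s. s *\<^sub>R v)) (at t)"
  by (auto intro!: derivative_eq_intros)
 from has_derivative_compose[OF this differentiable_has_derivative_pd[OF assms]] show ?thesis
  unfolding has_field_derivative_def
  by (rule arg_cong[where f = "%d. (_ has_derivative d) _", THEN iffD1, rotated])
   (rule ext, simp add: sum_distrib_left mult_ac)
qed

lemma line_derivative:
 fixes f :: "real^'n => real"
 assumes "f differentiable (at (y + ax t i))"
 shows "((%t. f (y + ax t i)) has_real_derivative pd i f (y + ax t i)) (at t)"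
proof -
 have "(SUM l. axis i 1 $ l * pd l f z) = pd i f z" for z
  by (simp add: axis_def if_distrib[of "%z. z * _"] cong: if_cong)
 then show ?thesis using line_derivative_dir[OF assms] by simp
qed

lemma pd_cong_open:
 assumes "open S" "x \<in> S" "!!y. y \<in> S ==> f y = g y"
 shows "pd i f x = pd i g x"
proof -
 have "(f has_derivative F) (at x) \<longleftrightarrow> (g has_derivative F) (at x)" for F
  using assms by (metis has_derivative_transform_within_open)
 then show ?thesis by (simp add: pd_def frechet_derivative_def)
qed

lemma differentiable_cong_open:
 assumes "open S" "x \<in> S" "!!y. y \<in> S ==> f y = g y" "f differentiable (at x)"
 shows "g differentiable (at x)"
 using assms has_derivative_transform_within_open unfolding differentiable_def by blast

lemma Ck_on_cong:
 assumes "open S" "!!y. y \<in> S ==> f y = g y" "Ck_on m S f"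
 shows "Ck_on m S g"
 using assms(2,3)
proof (induction m arbitrary: f g)
 case 0 then show ?case by (metis Ck_on.simps(1) continuous_on_cong)
next
 case (Suc m)
 have "\<forall>x\<in>S. g differentiable (at x)"
  using Suc.prems differentiable_cong_open[OF `open S`] by (metis Ck_on.simps(2))
 moreover have "Ck_on m S (pd i g)" for i
  by (rule Suc.IH[of "pd i f"], rule pd_cong_open[OF `open S`]) (use Suc.prems in auto)
 ultimately show ?case by simp
qed

lemma smooth_on_cong:
 "open S ==> (!!y. y \<in> S ==> f y = g y) ==> smooth_on S f ==> smooth_on S g"
 unfolding smooth_on_def using Ck_on_cong by blast

lemma Ck_on_subset: "Ck_on m S f ==> T \<subseteq> S ==> Ck_on m T f"
 by (induction m arbitrary: f) (auto intro: continuous_on_subset)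

lemma smooth_on_subset: "smooth_on S f ==> T \<subseteq> S ==> smooth_on T f"
 unfolding smooth_on_def using Ck_on_subset by blast

lemma Ck_on_continuous_on: "Ck_on m S f ==> continuous_on S f"
 by (cases m) (auto intro!: differentiable_imp_continuous_on simp: differentiable_on_def differentiable_at_withinI)

lemma Ck_on_SucD: "Ck_on (Suc m) S f ==> Ck_on m S f"
proof (induction m arbitrary: f)
 case 0 then show ?case using Ck_on_continuous_on by (metis Ck_on.simps(1))
next
 case (Suc m) then show ?case by (metis Ck_on.simps(2))
qed

lemma smooth_on_iff:
 "smooth_on S f \<longleftrightarrow> (\<forall>x\<in>S. f differentiable (at x)) & (ALL i. smooth_on S (pd i f))"
 unfolding smooth_on_def
 by (metis Ck_on.simps(2) Ck_on_SucD)

lemma smooth_on_pd: "smooth_on S f ==> smooth_on S (pd i f)"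
 using smooth_on_iff by blast

lemma smooth_on_differentiable: "smooth_on S f ==> x \<in> S ==> f differentiable (at x)"
 using smooth_on_iff by blast

lemma smooth_on_continuous_on: "smooth_on S f ==> continuous_on S f"
 using Ck_on_continuous_on smooth_on_def by blast

lemma smooth_on_isCont: "smooth_on S f ==> open S ==> x \<in> S ==> isCont f x"
 using smooth_on_continuous_on continuous_on_eq_continuous_at by blast

lemma Ck_on_local:
 assumes "!!x. x \<in> S ==> EX T. open T & x \<in> T & Ck_on m T f"
 shows "Ck_on m S f"
 using assms
proof (induction m arbitrary: f)
 case 0
 have "isCont f x" if "x \<in> S" for x
  using 0[OF that] by (metis Ck_on.simps(1) continuous_on_eq_continuous_at)
 then show ?case by (simp add: continuous_at_imp_continuous_on)
next
 case (Suc m)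
 have "\<forall>x\<in>S. f differentiable (at x)" using Suc.prems by fastforce
 moreover have "Ck_on m S (pd i f)" for i
  by (rule Suc.IH) (use Suc.prems in fastforce)
 ultimately show ?case by simp
qed

lemma smooth_on_local:
 assumes "!!x. x \<in> S ==> EX T. open T & x \<in> T & smooth_on T f"
 shows "smooth_on S f"
 unfolding smooth_on_def
proof
 fix m show "Ck_on m S f"
  by (rule Ck_on_local) (use assms in \<open>auto simp: smooth_on_def\<close>)
qed

lemma smooth_on_open_Un: 
 "open S ==> open T ==> smooth_on S f ==> smooth_on T f ==> smooth_on (S \<union> T) f"
 by (rule smooth_on_local) blast

section \<open>Rules of differentiation and closure of smoothness under algebraic operations\<close>

lemma pd_const [simp]: "pd i (%x. c) = (%x. 0)"
 by (rule ext, rule pd_eq[OF has_derivative_const, THEN trans]) simp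

lemma Ck_on_const [simp]: "Ck_on m S (%x. c)"
 by (induction m arbitrary: c) auto

lemma smooth_on_const [simp]: "smooth_on S (%x. c)"
 by (simp add: smooth_on_def)

lemma pd_add:
 assumes "f differentiable (at x)" "g differentiable (at x)"
 shows "pd i (%x. f x + g x) x = pd i f x + pd i g x"
 using pd_eq[OF has_derivative_add[OF assms[unfolded frechet_derivative_works]]] by (simp add: pd_def)

lemma Ck_on_add:
 "open S ==> Ck_on m S f ==> Ck_on m S g ==> Ck_on m S (%x. f x + g x)"
proof (induction m arbitrary: f g)
 case 0 then show ?case by (auto intro: continuous_on_add)
next
 case (Suc m)
 have "Ck_on m S (pd i (%x. f x + g x))" for i
  by (rule Ck_on_cong[OF `open S` _ Suc.IH[of "pd i f" "pd i g"]]) (use Suc.prems in \<open>auto simp: pd_add\<close>)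
 then show ?case using Suc.prems by auto
qed

lemma smooth_on_add:
 "open S ==> smooth_on S f ==> smooth_on S g ==> smooth_on S (%x. f x + g x)"
 by (simp add: smooth_on_def Ck_on_add)

lemma smooth_on_sum:
 assumes "open S" "!!k. k \<in> K ==> smooth_on S (f k)"
 shows "smooth_on S (%x. \<Sum>k\<in>K. f k x)"
 using assms(2) by (induction K rule: infinite_finite_induct) (auto intro!: smooth_on_add assms(1))

lemma pd_bounded_linear:
 assumes "bounded_linear L" "f differentiable (at x)"
 shows "pd i (%x. L (f x)) x = L (pd i f x)"
 using pd_eq[OF bounded_linear.has_derivative[OF assms(1) assms(2)[unfolded frechet_derivative_works]]]
 by (simp add: pd_def)

lemma Ck_on_bounded_linear:
 assumes "bounded_linear L"
 shows "open S ==> Ck_on m S f ==> Ck_on m S (%x. L (f x))"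
proof (induction m arbitrary: f)
 case 0 then show ?case using assms by (auto intro: bounded_linear.continuous_on)
next
 case (Suc m)
 have "Ck_on m S (pd i (%x. L (f x)))" for i
  by (rule Ck_on_cong[OF `open S` _ Suc.IH[of "pd i f"]])
    (use Suc.prems assms in \<open>auto simp: pd_bounded_linear\<close>)
 moreover have "(%x. L (f x)) differentiable (at x)" if "x \<in> S" for x
 proof -
  have "(f has_derivative frechet_derivative f (at x)) (at x)"
   using Suc.prems(2) that frechet_derivative_works by auto
  from bounded_linear.has_derivative[OF assms this] show ?thesis
   unfolding differentiable_def by blast
 qed
 ultimately show ?case by simp
qed

lemma smooth_on_bounded_linear:
 "bounded_linear L ==> open S ==> smooth_on S f ==> smooth_on S (%x. L (f x))"
 by (simp add: smooth_on_def Ck_on_bounded_linear)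

lemma pd_bilinear:
 assumes "bounded_bilinear P" "f differentiable (at x)" "g differentiable (at x)"
 shows "pd i (%x. P (f x) (g x)) x = P (pd i f x) (g x) + P (f x) (pd i g x)"
 using pd_eq[OF bounded_bilinear.FDERIV[OF assms(1) assms(2,3)[unfolded frechet_derivative_works]]]
 by (simp add: pd_def)

lemma bounded_bilinear_differentiable:
 assumes "bounded_bilinear P" "f differentiable (at x)" "g differentiable (at x)"
 shows "(%x. P (f x) (g x)) differentiable (at x)"
 using bounded_bilinear.FDERIV[OF assms(1)] assms(2,3) unfolding differentiable_def by blast

lemma Ck_on_bilinear:
 assumes "bounded_bilinear P"
 shows "open S ==> Ck_on m S f ==> Ck_on m S g ==> Ck_on m S (%x. P (f x) (g x))"
proof (induction m arbitrary: f g)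
 case 0 then show ?case using assms by (auto intro: bounded_bilinear.continuous_on)
next
 case (Suc m)
 have "Ck_on m S (pd i (%x. P (f x) (g x)))" for i
  by (rule Ck_on_cong[OF `open S` _ Ck_on_add[OF `open S` Suc.IH[of "pd i f" g] Suc.IH[of f "pd i g"]]])
    (use Suc.prems assms in \<open>auto simp: pd_bilinear intro: Ck_on_SucD\<close>)
 moreover have "(%x. P (f x) (g x)) differentiable (at x)" if "x \<in> S" for x
  using bounded_bilinear_differentiable[OF assms, of f x g] Suc.prems that by auto
 ultimately show ?case by simp
qed

lemma smooth_on_bilinear:
 "bounded_bilinear P ==> open S ==> smooth_on S f ==> smooth_on S g ==> smooth_on S (%x. P (f x) (g x))"
 by (simp add: smooth_on_def Ck_on_bilinear)

lemma smooth_on_mult: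
 fixes f g :: "real^'n => 'a::real_normed_algebra"
 shows "open S ==> smooth_on S f ==> smooth_on S g ==> smooth_on S (%x. f x * g x)"
 by (rule smooth_on_bilinear[OF bounded_bilinear_mult])

lemma smooth_on_scaleR:
 "open S ==> smooth_on S f ==> smooth_on S g ==> smooth_on S (%x. f x *\<^sub>R g x)"
 by (rule smooth_on_bilinear[OF bounded_bilinear_scaleR])

lemma smooth_on_inner:
 "open S ==> smooth_on S f ==> smooth_on S g ==> smooth_on S (%x. f x \<bullet> g x)"
 by (rule smooth_on_bilinear[OF bounded_bilinear_inner])

lemma smooth_on_minus: "open S ==> smooth_on S f ==> smooth_on S (%x. - f x)"
 by (rule smooth_on_bounded_linear[OF bounded_linear_minus[OF bounded_linear_ident]])

lemma smooth_on_diff: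
 "open S ==> smooth_on S f ==> smooth_on S g ==> smooth_on S (%x. f x - g x)"
 using smooth_on_add[OF _ _ smooth_on_minus, of S f g] by simp

lemma smooth_on_prod:
 fixes f :: "'k => real^'n => real"
 assumes "open S" "!!k. k \<in> K ==> smooth_on S (f k)"
 shows "smooth_on S (%x. \<Prod>k\<in>K. f k x)"
 using assms(2) by (induction K rule: infinite_finite_induct) (auto intro!: smooth_on_mult assms(1))

lemma smooth_on_ident [simp]: "smooth_on S (%x::real^'n. x)"
proof -
 have "pd i (%x::real^'n. x) = (%x. axis i 1)" for i
  by (rule ext, rule pd_eq[OF has_derivative_ident, THEN trans]) simp
 then show ?thesis by (subst smooth_on_iff) auto
qed

lemma smooth_on_nth: "open S ==> smooth_on S f ==> smooth_on S (%x. f x $ i)"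
 by (rule smooth_on_bounded_linear[OF bounded_linear_vec_nth])

lemma bounded_linear_axis: "bounded_linear (axis i :: 'b::euclidean_space => 'b^'m)"
 by (rule linear_conv_bounded_linear[THEN iffD1], rule linearI)
   (auto simp: axis_def vec_eq_iff)

lemma smooth_on_vec:
 fixes f :: "real^'n => 'b::euclidean_space^'m"
 assumes "open S" "!!i. smooth_on S (%x. f x $ i)"
 shows "smooth_on S f"
proof -
 have "f = (%x. SUM i. axis i (f x $ i))"
  by (auto simp: vec_eq_iff axis_def fun_eq_iff if_distrib cong: if_cong)
 then show ?thesis
  using smooth_on_sum[OF assms(1), of UNIV "%i x. axis i (f x $ i)"]
   smooth_on_bounded_linear[OF bounded_linear_axis assms(1) assms(2)] by auto
qed

lemma pd_nth: "f differentiable (at x) ==> pd i f x $ j = pd i (%x. f x $ j) x"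
 using pd_bounded_linear[OF bounded_linear_vec_nth] by metis

section \<open>Chain rules\<close>

lemma pd_compose:
 assumes "\<phi> differentiable (at x)" "f differentiable (at (\<phi> x))"
 shows "pd i (%x. f (\<phi> x)) x = (SUM j. (pd i \<phi> x $ j) *\<^sub>R pd j f (\<phi> x))"
proof -
 have "((%x. f (\<phi> x)) has_derivative (%v. SUM j. (frechet_derivative \<phi> (at x) v $ j) *\<^sub>R pd j f (\<phi> x))) (at x)"
  using has_derivative_compose[OF assms(1)[unfolded frechet_derivative_works] 
     differentiable_has_derivative_pd[OF assms(2)]] by simp
 from pd_eq[OF this] show ?thesis by (simp add: pd_def)
qed

lemma Ck_on_compose:
 fixes \<phi> :: "real^'n => real^'m"
 assumes "open S" "open T" "\<phi> ` S \<subseteq> T" "smooth_on S \<phi>"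
 shows "Ck_on m T f ==> Ck_on m S (%x. f (\<phi> x))"
proof (induction m arbitrary: f)
 case 0
 then show ?case using assms smooth_on_continuous_on
  by (metis Ck_on.simps(1) continuous_on_compose2)
next
 case (Suc m)
 have d: "\<phi> differentiable (at x)" "f differentiable (at (\<phi> x))" if "x \<in> S" for x
  using that assms Suc.prems smooth_on_differentiable by (auto simp: image_subset_iff)
 have "Ck_on m S (%x. \<Sum>j\<in>J. (pd i \<phi> x $ j) *\<^sub>R pd j f (\<phi> x))" if "finite J" for i J
  using that
 proof (induction J)
  case (insert j J)
  have "Ck_on m S (%x. (pd i \<phi> x $ j) *\<^sub>R pd j f (\<phi> x))"
   by (rule Ck_on_bilinear[OF bounded_bilinear_scaleR assms(1)])
     (use Suc smooth_on_nth[OF assms(1) smooth_on_pd[OF assms(4)]] in \<open>auto simp: smooth_on_def\<close>)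
  with insert show ?case by (simp add: Ck_on_add[OF assms(1)])
 qed simp
 from this[OF finite] have "Ck_on m S (pd i (%x. f (\<phi> x)))" for i
  by (rule Ck_on_cong[OF assms(1), rotated]) (simp add: pd_compose[OF d])
 moreover have "(%x. f (\<phi> x)) differentiable (at x)" if "x \<in> S" for x
  using d[OF that] differentiable_chain_at[of \<phi> x f] by (simp add: o_def)
 ultimately show ?case by simp
qed

lemma smooth_on_compose:
 fixes \<phi> :: "real^'n => real^'m"
 assumes "open S" "open T" "\<phi> ` S \<subseteq> T" "smooth_on S \<phi>" "smooth_on T f"
 shows "smooth_on S (%x. f (\<phi> x))"
 using assms Ck_on_compose unfolding smooth_on_def by (metis smooth_on_def)

lemma pd_compose_real:
 assumes "u differentiable (at x)" "(f has_real_derivative d) (at (u x))"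
 shows "pd i (%x. f (u x)) x = d * pd i u x"
proof -
 have "((%x. f (u x)) has_derivative (%v. d * frechet_derivative u (at x) v)) (at x)"
  using has_derivative_compose[OF assms(1)[unfolded frechet_derivative_works] 
     assms(2)[unfolded has_field_derivative_def]] by simp
 from pd_eq[OF this] show ?thesis by (simp add: pd_def)
qed

lemma differentiable_compose_real:
 fixes f :: "real => real"
 assumes "u differentiable (at x)" "(f has_real_derivative d) (at (u x))"
 shows "(%x. f (u x)) differentiable (at x)"
 using has_derivative_compose[OF assms(1)[unfolded frechet_derivative_works] 
   assms(2)[unfolded has_field_derivative_def]] unfolding differentiable_def by blast

text \<open>The outer function comes with the whole sequence \<open>F\<close> of its derivatives, so
  that the induction can pass from \<open>F k\<close> to \<open>F (Suc k)\<close>; functions of one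
  real variable thus need no smoothness notion of their own.\<close>

lemma Ck_on_compose_real:
 assumes "open S" "u ` S \<subseteq> T" "smooth_on S u"
  and F: "!!k t. t \<in> T ==> (F k has_real_derivative F (Suc k) t) (at t)"
 shows "Ck_on m S (%x. F k (u x))"
proof (induction m arbitrary: k)
 case 0
 have "continuous_on T (F k)" by (meson DERIV_atLeastAtMost_imp_continuous_on F DERIV_isCont continuous_at_imp_continuous_on)
 with assms show ?case using smooth_on_continuous_on by (metis Ck_on.simps(1) continuous_on_compose2)
next
 case (Suc m)
 have d: "u differentiable (at x)" "(F k has_real_derivative F (Suc k) (u x)) (at (u x))" if "x \<in> S" for x
  using that assms smooth_on_differentiable by (auto simp: image_subset_iff)
 have "Ck_on m S (pd i (%x. F k (u x)))" for i
  by (rule Ck_on_cong[OF assms(1) _ Ck_on_bilinear[OF bounded_bilinear_mult assms(1) Suc.IH[of "Suc k"], of "pd i u"]])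
    (use smooth_on_pd[OF assms(3)] in \<open>auto simp: pd_compose_real[OF d] smooth_on_def\<close>)
 then show ?case using differentiable_compose_real[OF d] by simp
qed

lemma smooth_on_compose_real:
 assumes "open S" "u ` S \<subseteq> T" "smooth_on S u"
  and "!!k t. t \<in> T ==> (F k has_real_derivative F (Suc k) t) (at t)"
 shows "smooth_on S (%x. F k (u x))"
 unfolding smooth_on_def using Ck_on_compose_real assms by blast

lemma smooth_on_inverse:
 fixes u :: "real^'n => real"
 assumes "open S" "smooth_on S u" "!!x. x \<in> S ==> u x ~= 0"
 shows "smooth_on S (%x. inverse (u x))"
proof -
 define F where "F k t = (-1)^k * fact k * inverse t ^ Suc k" for k and t :: real
 have "(F k has_real_derivative F (Suc k) t) (at t)" if "t \<in> - {0}" for k t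
 proof -
  have "((%t. inverse t ^ Suc k) has_real_derivative (1 + real k) * (- ((inverse t)^2) * inverse t ^ k)) (at t)"
   by (rule DERIV_power_Suc) (use DERIV_inverse[of t] that in \<open>auto simp: numeral_2_eq_2\<close>)
  from DERIV_cmult[OF this, of "(-1)^k * fact k"] show ?thesis
   unfolding F_def by (simp add: algebra_simps power2_eq_square)
 qed
 from smooth_on_compose_real[where F = F and k = 0 and T = "- {0}", OF assms(1) _ assms(2) this] show ?thesis
  using assms(3) by (force simp: F_def)
qed

lemma smooth_on_divide:
 fixes u v :: "real^'n => real"
 assumes "open S" "smooth_on S u" "smooth_on S v" "!!x. x \<in> S ==> v x ~= 0"
 shows "smooth_on S (%x. u x / v x)"
 using smooth_on_mult[OF assms(1,2) smooth_on_inverse[OF assms(1,3,4)]] by (simp add: divide_inverse)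

lemma smooth_on_sqrt:
 assumes "open S" "smooth_on S u" "!!x. x \<in> S ==> u x > 0"
 shows "smooth_on S (%x. sqrt (u x))"
proof -
 define F where "F k t = (\<Prod>l<k. 1/2 - real l) * t powr (1/2 - real k)" for k and t :: real
 have "(F k has_real_derivative F (Suc k) t) (at t)" if "t \<in> {0<..}" for k t
  unfolding F_def using that
  by (auto intro!: derivative_eq_intros simp: algebra_simps)
 from smooth_on_compose_real[where F = F and k = 0, OF assms(1) _ assms(2) this]
 have "smooth_on S (%x. F 0 (u x))" using assms(3) by auto
 then show ?thesis
  by (rule smooth_on_cong[OF assms(1), rotated]) (simp add: F_def powr_half_sqrt assms(3) less_imp_le)
qed

section \<open>Determinants and inverses of matrices\<close>

lemma smooth_on_det:
 fixes g :: "real^'n => real^'m^'m"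
 assumes "open S" "smooth_on S g"
 shows "smooth_on S (%x. det (g x))"
 unfolding det_def
 by (intro smooth_on_sum smooth_on_mult smooth_on_prod smooth_on_nth assms smooth_on_const)

text \<open>Cramer's rule for the right-hand side \<open>axis l 1\<close>: the entries of the
  inverse are quotients of determinants, which makes inversion visibly smooth in the
  entries.\<close>

lemma matrix_inv_nth:
 fixes A :: "real^'m^'m"
 assumes "det A ~= 0"
 shows "matrix_inv A $ k $ l = det (\<chi> i j. if j = k then axis l 1 $ i else A $ i $ j) / det A"
proof -
 have inv: "A ** matrix_inv A = mat 1"
  using assms invertible_det_nz[of A] unfolding invertible_def matrix_inv_def by (metis (mono_tags, lifting) someI_ex)
 have "A *v (matrix_inv A *v axis l 1) = axis l 1"
  by (simp add: matrix_vector_mul_assoc inv)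
 then have "matrix_inv A *v axis l 1 = (\<chi> k. det (\<chi> i j. if j = k then axis l 1 $ i else A $ i $ j) / det A)"
  using cramer[OF assms] by blast
 moreover have "(matrix_inv A *v axis l 1) $ k = matrix_inv A $ k $ l"
  by (simp add: matrix_vector_mult_basis column_def)
 ultimately show ?thesis by simp
qed

lemma smooth_on_matrix_inv:
 fixes g :: "real^'n => real^'m^'m"
 assumes "open S" "smooth_on S g" "!!x. x \<in> S ==> det (g x) ~= 0"
 shows "smooth_on S (%x. matrix_inv (g x))"
proof (intro smooth_on_vec assms)
 fix k l
 have "smooth_on S (%x. det (\<chi> i j. if j = k then axis l 1 $ i else g x $ i $ j) / det (g x))"
 proof (intro smooth_on_divide smooth_on_det smooth_on_vec assms)
  fix i j
  have "smooth_on S (%x. g x $ i $ j)" by (intro smooth_on_nth assms)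
  then show "smooth_on S (%x. (\<chi> i j. if j = k then axis l 1 $ i else g x $ i $ j) $ i $ j)"
   by (cases "j = k") auto
  show "smooth_on S (%x. g x $ i $ j)" by fact
 qed (use assms in auto)
 then show "smooth_on S (%x. matrix_inv (g x) $ k $ l)"
  by (rule smooth_on_cong[OF assms(1), rotated]) (simp add: matrix_inv_nth assms(3))
qed

subsection \<open>A smooth step\<close>

text \<open>With s = 1/t the claim is that exp(-s) beats every polynomial. An extra power of s is
  carried through the induction on the coefficients.\<close>

lemma poly_inverse_exp_tendsto_0:
 "((%t. poly p (1/t) * exp (- (1/t))) \<longlongrightarrow> 0) (at_right (0::real))"
proof -
 have "((%s. poly p s * exp (- s)) \<longlongrightarrow> 0) at_top"
 proof (induction p)
  case (pCons c p)
  have "((%s. poly q s * s ^ k * exp (- s)) \<longlongrightarrow> 0) at_top" for q :: "real poly" and k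
  proof (induction q arbitrary: k)
   case (pCons c q)
   have "((%s::real. c * (s ^ k / exp s) + poly q s * s ^ Suc k * exp (- s)) \<longlongrightarrow> c * 0 + 0) at_top"
    by (intro tendsto_intros tendsto_power_div_exp_0 pCons.IH)
   then show ?case by (simp add: algebra_simps exp_minus divide_inverse)
  qed simp
  from this[of "pCons c p" 0] show ?case by simp
 qed simp
 from filterlim_compose[OF this filterlim_inverse_at_top_right] show ?thesis
  by (simp add: inverse_eq_divide)
qed

text \<open>For positive \<open>t\<close> the \<open>k\<close>-th derivative of exp(-1/t) is
  \<open>poly (flat_poly k) (1/t) * exp (- (1/t))\<close>; the factor s^2 comes from differentiating
  1/t.\<close>

primrec flat_poly :: "nat => real poly" where
 "flat_poly 0 = 1"
| "flat_poly (Suc k) = [:0, 0, 1:] * (flat_poly k - pderiv (flat_poly k))"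

definition flat_fun :: "nat => real => real" where
 "flat_fun k t = (if t <= 0 then 0 else poly (flat_poly k) (1/t) * exp (- (1/t)))"

lemma flat_fun_deriv: "(flat_fun k has_real_derivative flat_fun (Suc k) t) (at t)"
proof -
 consider "t < 0" | "t = 0" | "t > 0" by linarith
 then show ?thesis
 proof cases
  case 1
  have "((%_. 0) has_real_derivative 0) (at t)" by simp
  then have "(flat_fun k has_real_derivative 0) (at t)"
   by (rule has_field_derivative_transform_within_open[of _ _ _ "{..<0}"]) (use 1 in \<open>auto simp: flat_fun_def\<close>)
  then show ?thesis using 1 by (simp add: flat_fun_def)
 next
  case 3
  have "((%t. poly (flat_poly k) (1/t) * exp (- (1/t))) has_real_derivative 
    poly (pderiv (flat_poly k)) (1/t) * (- (1/t^2)) * exp (- (1/t)) + poly (flat_poly k) (1/t) * (exp (-(1/t)) * (1/t^2))) (at t)"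
   using 3 by (auto intro!: derivative_eq_intros DERIV_chain2[OF poly_DERIV] simp: power2_eq_square field_simps)
  also have "poly (pderiv (flat_poly k)) (1/t) * (- (1/t^2)) * exp (- (1/t)) + poly (flat_poly k) (1/t) * (exp (-(1/t)) * (1/t^2))
    = flat_fun (Suc k) t"
   using 3 by (simp add: flat_fun_def field_simps power2_eq_square)
  finally show ?thesis
   by (rule has_field_derivative_transform_within_open[of _ _ _ "{0<..}"]) (use 3 in \<open>auto simp: flat_fun_def\<close>)
 next
  case 2
  \<comment> \<open>The right difference quotient at 0 has again the form of a polynomial in 1/h
    times exp(-1/h), the division by h multiplying the polynomial by its variable.\<close>
  have "((%h. (flat_fun k (0 + h) - flat_fun k 0) / h) \<longlongrightarrow> 0) (at_right 0)"
   by (rule Lim_transform_eventually[OF poly_inverse_exp_tendsto_0[of "[:0, 1:] * flat_poly k"]])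
     (auto simp: eventually_at_right_less flat_fun_def intro!: eventually_mono[OF eventually_at_right_less])
  moreover have "((%h. (flat_fun k (0 + h) - flat_fun k 0) / h) \<longlongrightarrow> 0) (at_left 0)"
   by (rule Lim_transform_eventually[OF tendsto_const])
     (auto simp: flat_fun_def eventually_at_left_field intro!: exI[of _ "-1"])
  ultimately show ?thesis using 2
   by (simp add: DERIV_def filterlim_at_split flat_fun_def)
 qed
qed

definition smooth_step :: "real => real" where
 "smooth_step t = flat_fun 0 t / (flat_fun 0 t + flat_fun 0 (1 - t))"

lemma flat_fun_0: "flat_fun 0 t >= 0" "t > 0 ==> flat_fun 0 t > 0" "t <= 0 ==> flat_fun 0 t = 0"
 by (auto simp: flat_fun_def)

lemma flat_fun_denom: "flat_fun 0 t + flat_fun 0 (1 - t) > 0"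
 using flat_fun_0[of t] flat_fun_0[of "1 - t"] by (cases "t > 0") auto

lemma smooth_step:
 "0 <= smooth_step t" "smooth_step t <= 1" "t <= 0 ==> smooth_step t = 0" "t >= 1 ==> smooth_step t = 1"
 using flat_fun_denom[of t] flat_fun_0[of t] flat_fun_0[of "1 - t"]
 by (auto simp: smooth_step_def divide_simps)

lemma smooth_on_smooth_step:
 assumes "open S" "smooth_on S u"
 shows "smooth_on S (%x. smooth_step (u x))"
proof -
 have f: "smooth_on S (%x. flat_fun 0 (w x))" if "smooth_on S w" for w
  using smooth_on_compose_real[where F = flat_fun and T = UNIV, OF assms(1) _ that flat_fun_deriv] by auto
 show ?thesis unfolding smooth_step_def
  by (intro smooth_on_divide smooth_on_add f smooth_on_diff assms smooth_on_const)
    (use flat_fun_denom in \<open>auto simp: less_le\<close>)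
qed

section \<open>Finite differences on a periodic lattice\<close>

text \<open>The mesh divides 5, so that both the period 10 and the half period 5, over which the
  potential is compared with itself, consist of whole lattice steps.\<close>

definition hstep :: "nat => real" where
 "hstep j = 5 / real (Suc j)"

lemma hstep_pos [simp]: "hstep j > 0" "hstep j >= 0" "hstep j ~= 0"
 by (auto simp: hstep_def)

definition nper :: "nat => nat" where
 "nper j = 2 * Suc j"

lemma nper_pos [simp]: "nper j > 0" by (simp add: nper_def)

lemma hstep_period: "real (nper j) * hstep j = 10" "real (Suc j) * hstep j = 5"
proof -
 show 1: "real (Suc j) * hstep j = 5" by (simp add: hstep_def del: of_nat_Suc)
 then show "real (nper j) * hstep j = 10" unfolding nper_def of_nat_mult by (simp add: mult.assoc del: of_nat_Suc)
qed

definition periodic :: "(real^'n => 'b) => bool" where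
 "periodic f \<longleftrightarrow> (ALL i x. f (x + ax 10 i) = f x)"

definition dq :: "nat => 'n::finite => (real^'n => 'b::real_vector) => real^'n => 'b" where
 "dq j i f x = (1 / hstep j) *\<^sub>R (f (x + ax (hstep j) i) - f x)"

definition line_avg :: "nat => 'n::finite => (real^'n => real) => real^'n => real" where
 "line_avg j i f x = (\<Sum>t<nper j. f (x + ax (real t * hstep j) i)) / real (nper j)"

definition coords :: "'n::finite list" where
 "coords = (SOME xs. set xs = UNIV & distinct xs)"

lemma coords: "set (coords :: 'n::finite list) = UNIV" "distinct (coords :: 'n list)"
 using someI_ex[OF finite_distinct_list[OF finite, of "UNIV :: 'n set"]] by (auto simp: coords_def)

lemma length_coords: "length (coords :: 'n::finite list) = CARD('n)"
 by (metis coords distinct_card)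

text \<open>Functions are kept on all of \<open>real^'n\<close>: the value at \<open>x\<close> is
  the average over the finitely many points, modulo the period, of the translated lattice through
  \<open>x\<close>. No separate space of lattice functions is introduced.\<close>

definition mean :: "nat => (real^'n => real) => real^'n => real" where
 "mean j f = foldr (line_avg j) coords f"

lemma periodic_shift: "periodic f ==> periodic (%y. f (y + v))"
 by (simp add: periodic_def) (metis add.assoc add.commute)

lemma periodicD: "periodic f ==> f (x + ax 10 i + v) = f (x + v)"
 unfolding periodic_def by (metis add.assoc add.commute)

lemma periodic_line_avg: "periodic f ==> periodic (line_avg j i f)"
 by (subst periodic_def) (simp add: line_avg_def periodicD)

lemma periodic_foldr: "periodic f ==> periodic (foldr (line_avg j) is f)"
 by (induction "is") (auto intro: periodic_line_avg)

lemma periodic_dq: "periodic f ==> periodic (dq j i f)"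
 by (subst periodic_def) (simp add: dq_def periodicD periodicD[where v = 0, simplified])

lemma line_avg_shift: "line_avg j i (%y. f (y + v)) x = line_avg j i f (x + v)"
 by (simp add: line_avg_def algebra_simps)

text \<open>The sum runs over exactly one period, so that a lattice step permutes its terms
  cyclically.\<close>

lemma line_avg_step:
 assumes "periodic f"
 shows "line_avg j i f (x + ax (hstep j) i) = line_avg j i f x"
proof -
 let ?F = "%t. f (x + ax (real t * hstep j) i)"
 have "(\<Sum>t<nper j. f (x + ax (hstep j) i + ax (real t * hstep j) i)) = (\<Sum>t<nper j. ?F (Suc t))"
  by (intro sum.cong) (auto simp: algebra_simps)
 also have "... = (\<Sum>t<nper j. ?F t) + ?F (nper j) - ?F 0"
  using sum.lessThan_Suc_shift[of ?F "nper j"] sum.lessThan_Suc[of ?F "nper j"] by simp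
 also have "?F (nper j) = ?F 0"
  using assms hstep_period(1)[of j] unfolding periodic_def by simp
 finally show ?thesis by (simp add: line_avg_def)
qed

lemma foldr_shift: "foldr (line_avg j) is (%y. f (y + v)) x = foldr (line_avg j) is f (x + v)"
proof (induction "is" arbitrary: x)
 case (Cons i "is")
 then have "foldr (line_avg j) is (%y. f (y + v)) = (%y. foldr (line_avg j) is f (y + v))" by blast
 then show ?case by (simp add: line_avg_shift)
qed simp

lemma foldr_step:
 assumes "periodic f" "i \<in> set is"
 shows "foldr (line_avg j) is f (x + ax (hstep j) i) = foldr (line_avg j) is f x"
 using assms(2)
proof (induction "is" arbitrary: x)
 case (Cons k "is")
 let ?g = "foldr (line_avg j) is f"
 show ?case
 proof (cases "k = i")
  case True
  then show ?thesis using line_avg_step[OF periodic_foldr[OF assms(1)]] by simp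
 next
  case False
  then have "(%y. ?g (y + ax (hstep j) i)) = ?g" using Cons by auto
  then show ?thesis by (simp add: line_avg_shift[symmetric])
 qed
qed simp

lemma mean_shift: "mean j (%y. f (y + v)) x = mean j f (x + v)"
 by (simp add: mean_def foldr_shift)

lemma mean_step: "periodic f ==> mean j f (x + ax (hstep j) i) = mean j f x"
 by (simp add: mean_def foldr_step coords)

lemma mean_shift_step: "periodic f ==> mean j (%y. f (y + ax (hstep j) i)) x = mean j f x"
 by (simp add: mean_shift mean_step)

lemma mean_shift_steps:
 "periodic f ==> mean j (%y. f (y + ax (real t * hstep j) i)) x = mean j f x"
proof (induction t)
 case (Suc t)
 have "mean j (%y. f (y + ax (real (Suc t) * hstep j) i)) x
   = mean j f ((x + ax (real t * hstep j) i) + ax (hstep j) i)"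
  by (simp add: mean_shift algebra_simps)
 also have "... = mean j f x"
  using Suc by (simp only: mean_step) (simp add: mean_shift)
 finally show ?case .
qed simp

lemma mean_shift_back: 
 assumes "periodic f"
 shows "mean j (%y. f (y - ax (hstep j) i)) x = mean j f x"
 using mean_step[OF assms, of j "x - ax (hstep j) i" i] 
  mean_shift[of j f "- ax (hstep j) i" x] by simp

lemma line_avg_mono: "(!!y. f y <= g y) ==> line_avg j i f x <= line_avg j i g x"
 unfolding line_avg_def by (intro divide_right_mono sum_mono) auto

lemma mean_mono: 
 fixes x :: "real^'n"
 shows "(!!y. f y <= g y) ==> mean j f x <= mean j g x"
proof -
 have "foldr (line_avg j) is f x <= foldr (line_avg j) is g x" if "!!y. f y <= g y" for "is" :: "'n list"
  using that by (induction "is" arbitrary: x) (auto intro: line_avg_mono)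
 then show "(!!y. f y <= g y) ==> mean j f x <= mean j g x" unfolding mean_def by blast
qed

lemma line_avg_linear:
 "line_avg j i (%y. a * f y + b * g y) x = a * line_avg j i f x + b * line_avg j i g x"
 by (simp add: line_avg_def sum.distrib sum_distrib_left[symmetric] add_divide_distrib)

lemma mean_linear: 
 fixes x :: "real^'n"
 shows "mean j (%y. a * f y + b * g y) x = a * mean j f x + b * mean j g x"
proof -
 have "foldr (line_avg j) is (%y. a * f y + b * g y) x = a * foldr (line_avg j) is f x + b * foldr (line_avg j) is g x" for "is" :: "'n list"
 proof (induction "is" arbitrary: x)
  case (Cons i "is")
  then have "foldr (line_avg j) is (%y. a * f y + b * g y) = (%x. a * foldr (line_avg j) is f x + b * foldr (line_avg j) is g x)" by blast
  then show ?case by (simp add: line_avg_linear)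
 qed simp
 then show ?thesis by (simp add: mean_def)
qed

lemma mean_add: "mean j (%y. f y + g y) x = mean j f x + mean j g x"
 using mean_linear[of j 1 f 1 g x] by simp

lemma mean_cmult: "mean j (%y. a * f y) x = a * mean j f x"
 using mean_linear[of j a f 0 f x] by simp

lemma mean_minus: "mean j (%y. - f y) x = - mean j f x"
 using mean_cmult[of j "-1" f x] by simp

lemma mean_diff: "mean j (%y. f y - g y) x = mean j f x - mean j g x"
 using mean_linear[of j 1 f "-1" g x] by simp

lemma mean_const [simp]:
 fixes x :: "real^'n"
 shows "mean j (%y. c) x = c"
proof -
 have "foldr (line_avg j) is (%y. c) = (%x. c)" for "is" :: "'n list"
  by (induction "is") (auto simp: line_avg_def fun_eq_iff)
 then show ?thesis by (simp add: mean_def fun_eq_iff)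
qed

lemma mean_sum: "mean j (%y. \<Sum>k\<in>K. f k y) x = (\<Sum>k\<in>K. mean j (f k) x)"
 by (induction K rule: infinite_finite_induct) (auto simp: mean_add)

lemma mean_nonneg: "(!!y. f y >= 0) ==> mean j f x >= 0"
 using mean_mono[of "%_. 0" f j x] by simp

lemma mean_abs_le: "\<bar>mean j f x\<bar> <= mean j (%y. \<bar>f y\<bar>) x"
proof -
 have "mean j f x <= mean j (%y. \<bar>f y\<bar>) x" "mean j (%y. - f y) x <= mean j (%y. \<bar>f y\<bar>) x"
  by (rule mean_mono, simp)+
 then show ?thesis by (simp add: mean_minus)
qed

text \<open>An average of nonnegative terms bounds each term up to the number of terms. The constant
  depends on the mesh, which is harmless where the mesh is fixed.\<close>

lemma point_le_mean:
 fixes f :: "real^'n => real"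
 assumes "!!y. f y >= 0"
 shows "f x <= real (nper j) ^ CARD('n) * mean j f x"
proof -
 have "f x <= real (nper j) ^ length is * foldr (line_avg j) is f x & foldr (line_avg j) is f x >= 0" for "is" :: "'n list"
 proof (induction "is" arbitrary: x)
  case (Cons i "is")
  let ?g = "foldr (line_avg j) is f"
  have "?g (x + ax (real 0 * hstep j) i) <= (\<Sum>t<nper j. ?g (x + ax (real t * hstep j) i))"
   by (rule member_le_sum) (use Cons in auto)
  then have "?g x <= real (nper j) * line_avg j i ?g x"
   by (simp add: line_avg_def)
  then have "real (nper j) ^ length is * ?g x <= real (nper j) ^ length is * (real (nper j) * line_avg j i ?g x)"
   by (intro mult_left_mono) auto
  then have "f x <= real (nper j) ^ length (i # is) * line_avg j i ?g x"
   using order_trans[OF conjunct1[OF Cons[of x]]] by (simp add: mult_ac)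
  moreover have "line_avg j i ?g x >= 0"
   by (subst line_avg_def) (intro divide_nonneg_nonneg sum_nonneg, use Cons in auto)
  ultimately show ?case by simp
 qed (use assms in auto)
 from this[of coords] show ?thesis by (simp add: mean_def length_coords)
qed

subsection \<open>Discrete Sobolev norms\<close>

text \<open>Square of a discrete Sobolev norm of order \<open>s\<close>. Lower differences occur
  with multiplicity, which affects constants only.\<close>

fun hn :: "nat => nat => (real^'n => 'b::real_inner) => real^'n => real" where
 "hn j 0 u x = mean j (%y. nsq (u y)) x"
| "hn j (Suc s) u x = hn j s u x + (SUM i. hn j s (dq j i u) x)"

lemma hn_nonneg [simp]: "hn j s u x >= 0"
 by (induction s arbitrary: u) (auto intro!: mean_nonneg add_nonneg_nonneg sum_nonneg)

lemma hn_le_Suc: "hn j s u x <= hn j (Suc s) u x"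
 by (simp add: sum_nonneg)

lemma hn_le: "s <= t ==> hn j s u x <= hn j t u x"
 by (induction t rule: dec_induct) (use hn_le_Suc order_trans in blast)+

lemma hn_dq_sum: "(SUM i. hn j s (dq j i u) x) <= hn j (Suc s) u x"
 by simp

lemma hn_dq: "hn j s (dq j i u) x <= hn j (Suc s) u x"
 using member_le_sum[of i UNIV "%i. hn j s (dq j i u) x"] hn_dq_sum[of j s u x]
 by (simp del: hn.simps)

lemma dq_add: "dq j i (%y. u y + v y) = (%y. dq j i u y + dq j i v y)"
 by (simp add: dq_def fun_eq_iff algebra_simps)

lemma dq_diff: "dq j i (%y. u y - v y) = (%y. dq j i u y - dq j i v y)"
 by (simp add: dq_def fun_eq_iff algebra_simps)

lemma dq_scaleR: "dq j i (%y. c *\<^sub>R u y) = (%y. c *\<^sub>R dq j i u y)"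
 by (simp add: dq_def fun_eq_iff algebra_simps)

lemma dq_const [simp]: "dq j i (%y. c) = (%y. 0)"
 by (simp add: dq_def fun_eq_iff)

lemma dq_shift: "dq j i (%y. u (y + v)) = (%y. dq j i u (y + v))"
 by (simp add: dq_def fun_eq_iff algebra_simps)

lemma dq_commute: "dq j i (dq j k u) = dq j k (dq j i u)"
 by (simp add: dq_def fun_eq_iff algebra_simps)

text \<open>Discrete product rule. One factor is taken at the shifted point, which is harmless
  because the norms of periodic functions are invariant under lattice steps.\<close>

lemma dq_bilinear:
 assumes "bounded_bilinear P"
 shows "dq j i (%y. P (c y) (u y)) = (%y. P (dq j i c y) (u (y + ax (hstep j) i)) + P (c y) (dq j i u y))"
proof -
 interpret bounded_bilinear P by fact
 show ?thesis by (simp add: dq_def fun_eq_iff scaleR_left scaleR_right diff_left diff_right flip: scaleR_add_right)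
qed

text \<open>Serves for the elliptic coefficients, for the metric and its inverse, and for the form
  induced on pairs of indices. The error matrix has entries at most \<eta>, and twice a scalar
  product is at most the sum of the squared norms.\<close>

lemma quadratic_close:
 fixes H :: "'m::finite => 'm => real" and w :: "'m => 'b::real_inner"
 assumes H: "!!i k. \<bar>H i k - (kd i k)\<bar> <= \<eta>"
 shows "\<bar>(SUM i k. H i k * (w i \<bullet> w k)) - (SUM i. nsq (w i))\<bar> <= \<eta> * real CARD('m) * (SUM i. nsq (w i))"
proof -
 let ?d = "%i k. if i = k then 1 else (0::real)"
 have \<eta>: "\<eta> >= 0" using H[of undefined undefined] by (simp add: order_trans[OF abs_ge_zero])
 have "(SUM i k. ?d i k * (w i \<bullet> w k)) = (SUM i. nsq (w i))"
  by (simp add: if_distrib[of "%z. z * _"] power2_norm_eq_inner cong: if_cong)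
 then have "(SUM i k. H i k * (w i \<bullet> w k)) - (SUM i. nsq (w i))
   = (SUM i k. (H i k - ?d i k) * (w i \<bullet> w k))"
  by (simp only: left_diff_distrib sum_subtractf)
 also have "\<bar>...\<bar> <= (SUM i k. \<eta> * ((nsq (w i) + nsq (w k)) / 2))"
 proof (rule order_trans[OF sum_abs sum_mono], rule order_trans[OF sum_abs sum_mono])
  fix i k
  have "\<bar>w i \<bullet> w k\<bar> <= norm (w i) * norm (w k)" by (rule Cauchy_Schwarz_ineq2)
  also have "... <= (nsq (w i) + nsq (w k)) / 2" using sum_squares_bound[of "norm (w i)" "norm (w k)"] by simp
  finally show "\<bar>(H i k - ?d i k) * (w i \<bullet> w k)\<bar> <= \<eta> * ((nsq (w i) + nsq (w k)) / 2)"
   unfolding abs_mult by (intro mult_mono H) (use \<eta> in auto)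
 qed
 also have "... = \<eta> * real CARD('m) * (SUM i. nsq (w i))"
  by (simp add: sum_distrib_left[symmetric] sum_divide_distrib[symmetric] sum.distrib)
 finally show ?thesis .
qed

lemma norm_add_sq_le: "nsq (a + b :: 'a::real_inner) <= 2 * (nsq a + nsq b)"
proof -
 have "0 <= nsq (a - b)" by simp
 then show ?thesis by (simp add: power2_norm_eq_inner inner_add_left inner_add_right inner_diff_left inner_diff_right inner_commute)
qed

lemma hn_add: "hn j s (%y. u y + v y) x <= 2 * (hn j s u x + hn j s v x)"
proof (induction s arbitrary: u v)
 case 0
 have "mean j (%y. nsq (u y + v y)) x <= mean j (%y. 2 * (nsq (u y) + nsq (v y))) x"
  by (intro mean_mono norm_add_sq_le)
 then show ?case by (simp add: mean_cmult mean_add)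
next
 case (Suc s)
 have "(SUM i. hn j s (dq j i (%y. u y + v y)) x) <= (SUM i. 2 * (hn j s (dq j i u) x + hn j s (dq j i v) x))"
  unfolding dq_add by (intro sum_mono Suc)
 with Suc[of u v] show ?case by (simp add: sum.distrib sum_distrib_left algebra_simps)
qed

lemma hn_scaleR: "hn j s (%y. c *\<^sub>R u y) x = c^2 * hn j s u x"
 by (induction s arbitrary: u) (auto simp: power_mult_distrib mean_cmult dq_scaleR sum_distrib_left algebra_simps)

lemma hn_minus: "hn j s (%y. - u y) x = hn j s u x"
 using hn_scaleR[of j s "-1" u x] by simp

lemma hn_diff: "hn j s (%y. u y - v y) x <= 2 * (hn j s u x + hn j s v x)"
 using hn_add[of j s u "%y. - v y" x] by (simp add: hn_minus)

lemma hn_shift: "hn j s (%y. u (y + v)) x = hn j s u (x + v)"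
 by (induction s arbitrary: u) (auto simp: mean_shift[of j "%y. nsq (u y)" for u] dq_shift)

lemma periodic_norm_sq: "periodic u ==> periodic (%y. nsq (u y))"
 by (simp add: periodic_def)

lemma hn_step: "periodic u ==> hn j s u (x + ax (hstep j) i) = hn j s u x"
 by (induction s arbitrary: u) (auto simp: mean_step[OF periodic_norm_sq] periodic_dq)

lemma hn_step_back: "periodic u ==> hn j s u (x - ax (hstep j) i) = hn j s u x"
 using hn_step[of u j s "x - ax (hstep j) i" i] by simp

lemma hn_zero [simp]: "hn j s (%y. 0) x = 0"
 by (induction s) simp_all

subsection \<open>Operators of finite order\<close>

fun bdd_coeff :: "nat => (nat => real^'n => 'b::real_normed_vector) => bool" where
 "bdd_coeff 0 c \<longleftrightarrow> (EX K. ALL j x. norm (c j x) <= K)"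
| "bdd_coeff (Suc s) c \<longleftrightarrow> bdd_coeff s c & (ALL i. bdd_coeff s (%j. dq j i (c j)))"

text \<open>Discrete counterpart of a smooth periodic function: the family is indexed by the mesh,
  and the bounds on its difference quotients of each order are uniform in the mesh.\<close>

definition lattice_coeff :: "(nat => real^'n => 'b::real_normed_vector) => bool" where
 "lattice_coeff c \<longleftrightarrow> (ALL j. periodic (c j)) & (ALL s. bdd_coeff s c)"

lemma lattice_coeff_dq: "lattice_coeff c ==> lattice_coeff (%j. dq j i (c j))"
 unfolding lattice_coeff_def using periodic_dq bdd_coeff.simps(2) by blast

lemma periodic_bilinear: "periodic c ==> periodic u ==> periodic (%y. P (c y) (u y))"
 by (simp add: periodic_def)

lemma hn_mult:
 fixes P :: "'c::real_normed_vector => 'b::real_inner => 'd::real_inner"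
 assumes "bounded_bilinear P" "lattice_coeff c"
 shows "EX K>=0. ALL j x u. periodic u --> hn j s (%y. P (c j y) (u y)) x <= K * hn j s u x"
 using assms(2)
proof (induction s arbitrary: c)
 case 0
 interpret bounded_bilinear P by fact
 obtain B where B: "!!a b. norm (P a b) <= norm a * norm b * B" "B > 0" using pos_bounded by blast
 obtain K where K: "norm (c j x) <= K" for j x 
  using 0 unfolding lattice_coeff_def by (metis bdd_coeff.simps(1))
 have "K >= 0" using K norm_ge_zero order_trans by blast
 have "nsq (P (c j y) (u y)) <= (K * B)^2 * nsq (u y)" for j y u
 proof -
  have "norm (P (c j y) (u y)) <= K * norm (u y) * B"
   using B(1)[of "c j y" "u y"] K[of j y] B(2) 
   by (meson mult_right_mono norm_ge_zero order_trans less_imp_le)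
  then have "norm (P (c j y) (u y)) <= (K * B) * norm (u y)" by (simp add: mult_ac)
  then show ?thesis by (metis norm_ge_zero power_mono power_mult_distrib)
 qed
 then have "hn j 0 (%y. P (c j y) (u y)) x <= (K * B)^2 * hn j 0 u x" for j x u
  using mean_mono[of "%y. nsq (P (c j y) (u y))" "%y. (K * B)^2 * nsq (u y)" j x] by (simp add: mean_cmult)
 then show ?case by (intro exI[of _ "(K * B)^2"]) auto
next
 case (Suc s)
 have c1: "lattice_coeff (%j. dq j i (c j))" for i
  using Suc.prems lattice_coeff_dq by blast
 obtain K where K: "K >= 0" "!!j x u. periodic u ==> hn j s (%y. P (c j y) (u y)) x <= K * hn j s u x"
  using Suc.IH[OF Suc.prems] by blast
 have "ALL i. EX K'>=0. ALL j x u. periodic u --> hn j s (%y. P (dq j i (c j) y) (u y)) x <= K' * hn j s u x"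
  using Suc.IH[OF c1] by blast
 then obtain K' where K': "!!i. K' i >= 0" 
  "!!i j x u. periodic u ==> hn j s (%y. P (dq j i (c j) y) (u y)) x <= K' i * hn j s u x" by metis
 let ?K = "2 * (SUM i. K' i) + 2 * K"
 have "hn j (Suc s) (%y. P (c j y) (u y)) x <= ?K * hn j (Suc s) u x" if u: "periodic u" for j x u
 proof -
  have "hn j s (dq j i (%y. P (c j y) (u y))) x <= 2 * (K' i * hn j s u x + K * hn j s (dq j i u) x)" for i
  proof -
   have "hn j s (%y. P (dq j i (c j) y) (u (y + ax (hstep j) i))) x <= K' i * hn j s (%y. u (y + ax (hstep j) i)) x"
    by (rule K'(2)[OF periodic_shift[OF u]])
   then have "hn j s (%y. P (dq j i (c j) y) (u (y + ax (hstep j) i))) x <= K' i * hn j s u x"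
    by (simp add: hn_shift hn_step u)
   moreover have "hn j s (%y. P (c j y) (dq j i u y)) x <= K * hn j s (dq j i u) x"
    by (rule K(2)[OF periodic_dq[OF u]])
   ultimately show ?thesis
    unfolding dq_bilinear[OF assms(1)] by (intro order_trans[OF hn_add]) auto
  qed
  then have "hn j (Suc s) (%y. P (c j y) (u y)) x <= K * hn j s u x + (SUM i. 2 * (K' i * hn j s u x + K * hn j s (dq j i u) x))"
   unfolding hn.simps by (intro add_mono sum_mono K(2)[OF u])
  also have "... = (K + 2 * (SUM i. K' i)) * hn j s u x + 2 * K * (SUM i. hn j s (dq j i u) x)"
   by (simp add: sum.distrib sum_distrib_left sum_distrib_right algebra_simps)
  also have "... <= ?K * hn j s u x + ?K * (SUM i. hn j s (dq j i u) x)"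
   using K(1) sum_nonneg[of UNIV K'] K'(1) by (intro add_mono[OF mult_right_mono mult_right_mono]) (auto intro!: sum_nonneg)
  finally show ?thesis by (simp add: algebra_simps)
 qed
 moreover have "?K >= 0" using K(1) K'(1) by (simp add: sum_nonneg)
 ultimately show ?case by blast
qed

text \<open>For a single mesh all difference quotients are bounded operators; the order becomes
  visible only because \<open>K\<close> is chosen before \<open>j\<close>.\<close>

definition bdd_op :: "nat => (nat => (real^'n => 'b::real_inner) => real^'n => 'b) => bool" where
 "bdd_op m T \<longleftrightarrow> (ALL s. EX K>=0. ALL j x u. periodic u --> hn j s (T j u) x <= K * hn j (s + m) u x)"

text \<open>Operators of order \<open>m\<close> whose commutators with difference quotients have order \<open>m\<close>, too.\<close>
definition dop :: "nat => (nat => (real^'n => 'b::real_inner) => real^'n => 'b) => bool" where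
 "dop m T \<longleftrightarrow> (ALL j u. periodic u --> periodic (T j u)) &
   (ALL j u v. T j (%x. u x - v x) = (%x. T j u x - T j v x)) &
   bdd_op m T & (ALL k. bdd_op m (%j u x. T j (dq j k u) x - dq j k (T j u) x))"

lemma bdd_op_add:
 assumes "bdd_op m S" "bdd_op m T"
 shows "bdd_op m (%j u x. S j u x + T j u x)"
 unfolding bdd_op_def
proof
 fix s
 obtain K K' where K: "K >= 0" "!!j x u. periodic u ==> hn j s (S j u) x <= K * hn j (s + m) u x"
  "K' >= 0" "!!j x u. periodic u ==> hn j s (T j u) x <= K' * hn j (s + m) u x"
  using assms unfolding bdd_op_def by meson
 have "hn j s (%x. S j u x + T j u x) x <= (2 * (K + K')) * hn j (s + m) u x" if "periodic u" for j x u
  using hn_add[of j s "S j u" "T j u" x] K(2,4)[OF that, of j x] by (simp add: algebra_simps)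
 then show "EX K>=0. ALL j x u. periodic u --> hn j s (%x. S j u x + T j u x) x <= K * hn j (s + m) u x"
  using K(1,3) by (intro exI[of _ "2 * (K + K')"]) auto
qed

lemma bdd_op_comp:
 assumes "bdd_op m S" "bdd_op l T" "!!j u. periodic u ==> periodic (T j u)"
 shows "bdd_op (m + l) (%j u. S j (T j u))"
 unfolding bdd_op_def
proof
 fix s
 obtain K where K: "K >= 0" "!!j x u. periodic u ==> hn j s (S j u) x <= K * hn j (s + m) u x"
  using assms(1) unfolding bdd_op_def by meson
 obtain K' where K': "K' >= 0" "!!j x u. periodic u ==> hn j (s + m) (T j u) x <= K' * hn j (s + m + l) u x"
  using assms(2) unfolding bdd_op_def by meson
 have "hn j s (S j (T j u)) x <= (K * K') * hn j (s + (m + l)) u x" if "periodic u" for j x u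
 proof -
  have "hn j s (S j (T j u)) x <= K * hn j (s + m) (T j u) x" using K(2) assms(3) that by blast
  also have "... <= K * (K' * hn j (s + m + l) u x)" using K'(2)[OF that] K(1) by (rule mult_left_mono)
  finally show ?thesis by (simp add: add.assoc mult.assoc)
 qed
 then show "EX K>=0. ALL j x u. periodic u --> hn j s (S j (T j u)) x <= K * hn j (s + (m + l)) u x"
  using K(1) K'(1) by (intro exI[of _ "K * K'"]) auto
qed

lemma bdd_op_raise:
 assumes "bdd_op m T" "m <= l"
 shows "bdd_op l T"
 unfolding bdd_op_def
proof
 fix s
 obtain K where K: "K >= 0" "!!j x u. periodic u ==> hn j s (T j u) x <= K * hn j (s + m) u x"
  using assms(1) unfolding bdd_op_def by meson
 then have "hn j s (T j u) x <= K * hn j (s + l) u x" if "periodic u" for j x u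
  using hn_le[of "s + m" "s + l" j u x] assms(2) that by (meson add_left_mono mult_left_mono order_trans)
 then show "EX K>=0. ALL j x u. periodic u --> hn j s (T j u) x <= K * hn j (s + l) u x" using K(1) by blast
qed

lemma bdd_op_zero: "bdd_op m (%j u x. 0)"
 unfolding bdd_op_def by (auto intro: exI[of _ 0])

lemma bdd_op_cong: "bdd_op m S ==> (!!j u x. S j u x = T j u x) ==> bdd_op m T"
 by (subgoal_tac "S = T") (auto intro!: ext)

lemma dop_raise: "dop m T ==> m <= l ==> dop l T"
 unfolding dop_def using bdd_op_raise by blast

lemma periodic_add: "periodic u ==> periodic v ==> periodic (%x. u x + v x)"
 by (simp add: periodic_def)

lemma dop_add:
 assumes "dop m S" "dop m T"
 shows "dop m (%j u x. S j u x + T j u x)"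
proof -
 have "bdd_op m (%j u x. S j (dq j k u) x + T j (dq j k u) x - dq j k (%x. S j u x + T j u x) x)" for k
  by (rule bdd_op_cong[OF bdd_op_add[of m "%j u x. S j (dq j k u) x - dq j k (S j u) x" "%j u x. T j (dq j k u) x - dq j k (T j u) x"]])
    (use assms in \<open>auto simp: dop_def dq_add\<close>)
 then show ?thesis using assms unfolding dop_def
  by (auto intro!: periodic_add bdd_op_add simp: algebra_simps)
qed

lemma dop_zero: "dop m (%j u x. 0)"
 unfolding dop_def using bdd_op_zero by (auto simp: periodic_def)

lemma dop_sum: "finite K ==> (!!k. k \<in> K ==> dop m (T k)) ==> dop m (%j u x. \<Sum>k\<in>K. T k j u x)"
proof (induction K rule: finite_induct)
 case (insert k K)
 have "dop m (%j u x. T k j u x + (\<Sum>k\<in>K. T k j u x))"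
  by (rule dop_add) (use insert in auto)
 with insert show ?case by simp
qed (simp add: dop_zero)

text \<open>With D a difference quotient, the commutator of the product with D is S [T, D] + [S, D]
  T. Additivity of \<open>S\<close> on differences splits off the first term.\<close>

lemma dop_comp:
 assumes "dop m S" "dop l T"
 shows "dop (m + l) (%j u. S j (T j u))"
proof -
 have S: "bdd_op m S" "bdd_op m (%j u x. S j (dq j k u) x - dq j k (S j u) x)"
  "S j (%x. u x - v x) = (%x. S j u x - S j v x)" for k j u v
  using assms(1) by (auto simp: dop_def)
 have T: "bdd_op l T" "bdd_op l (%j u x. T j (dq j k u) x - dq j k (T j u) x)"
  "periodic u ==> periodic (T j u)" for k j u
  using assms(2) by (auto simp: dop_def)
 have "bdd_op (m + l) (%j u x. S j (T j (dq j k u)) x - dq j k (S j (T j u)) x)" for k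
 proof (rule bdd_op_cong)
  show "bdd_op (m + l) (%j u x. S j (%x. T j (dq j k u) x - dq j k (T j u) x) x + (S j (dq j k (T j u)) x - dq j k (S j (T j u)) x))"
   by (intro bdd_op_add bdd_op_comp[OF S(1) T(2)] bdd_op_comp[OF S(2) T(1,3)])
     (auto intro!: periodic_bilinear[where P = minus] periodic_dq T)
 qed (simp add: S(3))
 moreover have "bdd_op (m + l) (%j u. S j (T j u))"
  by (rule bdd_op_comp) (use assms in \<open>auto simp: dop_def\<close>)
 ultimately show ?thesis using assms unfolding dop_def by auto
qed

lemma dop_dq: "dop 1 (%j. dq j i)"
proof -
 have "bdd_op 1 (%j. dq j i)"
  unfolding bdd_op_def using hn_dq by (auto intro!: exI[of _ 1])
 moreover have "bdd_op 1 (%j u x. dq j i (dq j k u) x - dq j k (dq j i u) x)" for k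
  by (rule bdd_op_cong[OF bdd_op_zero]) (simp add: dq_commute[of _ i k])
 ultimately show ?thesis unfolding dop_def by (auto simp: periodic_dq dq_diff)
qed

lemma dop_shift_back: 
 fixes i :: "'n::finite"
 shows "dop 0 (%j (u :: real^'n => 'b::real_inner) x. u (x - ax (hstep j) i))"
proof -
 have 1: "hn j s (%x. u (x - ax (hstep j) i)) x = hn j s u x" if "periodic u" for j s and u :: "real^'n => 'b" and x
  using hn_shift[of j s u "- ax (hstep j) i" x] hn_step_back[OF that] by simp
 have "bdd_op 0 (%j (u :: real^'n => 'b) x. u (x - ax (hstep j) i))"
  unfolding bdd_op_def by (auto intro!: exI[of _ 1] simp: 1)
 moreover have "bdd_op 0 (%j (u :: real^'n => 'b) x. dq j k u (x - ax (hstep j) i) - dq j k (%x. u (x - ax (hstep j) i)) x)" for k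
  by (rule bdd_op_cong[OF bdd_op_zero]) (use dq_shift[of _ k _ "- ax (hstep _) i"] in \<open>simp add: fun_eq_iff dq_def algebra_simps\<close>)
 moreover have "periodic (%x. u (x - v))" if "periodic u" for u :: "real^'n => 'b" and v
  using periodic_shift[OF that, of "- v"] by simp
 ultimately show ?thesis unfolding dop_def by auto
qed

text \<open>By the product rule the commutator with a difference quotient is, up to sign,
  multiplication by the difference quotient of \<open>c\<close> after a lattice shift, hence again
  of order zero.\<close>

lemma dop_mult:
 fixes P :: "'c::real_normed_vector => 'b::real_inner => 'b" and c :: "nat => real^'n => 'c"
 assumes P: "bounded_bilinear P" and c: "lattice_coeff c"
 shows "dop 0 (%j u x. P (c j x) (u x))"
proof -
 interpret bounded_bilinear P by fact
 have m: "bdd_op 0 (%j u x. P (c j x) (u x))" if "lattice_coeff c" for c :: "nat => real^'n => 'c"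
  using hn_mult[OF P that] unfolding bdd_op_def by auto
 have "bdd_op 0 (%j u x. P (c j x) (dq j k u x) - dq j k (%x. P (c j x) (u x)) x)" for k
 proof -
  have "lattice_coeff (%j x. - dq j k (c j) x)"
  proof -
   have "bdd_coeff s (%j x. - c j x)" if "bdd_coeff s c" for s and c :: "nat => real^'n => 'c"
   proof -
    have "dq j i (%x. - c j x) = (%x. - dq j i (c j) x)" for j i and c :: "nat => real^'n => 'c"
     using dq_scaleR[of j i "-1" "c j"] by simp
    then show ?thesis using that by (induction s arbitrary: c) auto
   qed
   then show ?thesis using lattice_coeff_dq[OF c, of k] unfolding lattice_coeff_def
    by (auto simp: periodic_def intro!: `!!s c. bdd_coeff s c ==> bdd_coeff s (%j x. - c j x)`)
  qed
  then have 1: "bdd_op 0 (%j u x. P (- dq j k (c j) x) (u x))" by (rule m)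
  have 2: "bdd_op 0 (%j (u :: real^'n => 'b) x. u (x + ax (hstep j) k))"
   unfolding bdd_op_def by (auto intro!: exI[of _ 1] simp: hn_shift hn_step)
  have "bdd_op (0 + 0) (%j u x. P (- dq j k (c j) x) (u (x + ax (hstep j) k)))"
   by (rule bdd_op_comp[OF 1 2]) (rule periodic_shift)
  then have 3: "bdd_op 0 (%j u x. P (- dq j k (c j) x) (u (x + ax (hstep j) k)))" by simp
  have "P (- dq j k (c j) x) (u (x + ax (hstep j) k)) = P (c j x) (dq j k u x) - dq j k (%x. P (c j x) (u x)) x" for j u x
   using fun_cong[OF dq_bilinear[OF P, of j k "c j" u], of x] by (simp add: minus_left)
  with 3 show ?thesis by (rule bdd_op_cong)
 qed
 moreover have "periodic (%x. P (c j x) (u x))" if "periodic u" for j u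
  using c that unfolding lattice_coeff_def by (auto intro: periodic_bilinear)
 ultimately show ?thesis using m[OF c] unfolding dop_def by (auto simp: diff_right)
qed

section \<open>A discrete elliptic boundary-free problem\<close>

lemma bounded_bilinear_matrix_vector: "bounded_bilinear ((*v) :: real^'n^'m => real^'n => real^'m)"
 by (rule bilinear_conv_bounded_bilinear[THEN iffD1])
   (auto simp: bilinear_def matrix_vector_mul_linear matrix_vector_mult_add_rdistrib
    scaleR_matrix_vector_assoc intro!: linearI)

lemma bounded_bilinear_transpose_vector:
 "bounded_bilinear (%(A :: real^'n^'m) v. transpose A *v v)"
proof (rule bilinear_conv_bounded_bilinear[THEN iffD1])
 have "transpose (A + B) = transpose A + transpose B" "transpose (c *\<^sub>R A) = c *\<^sub>R transpose A" for A B :: "real^'n^'m" and c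
  by (auto simp: transpose_def vec_eq_iff)
 then show "bilinear (%(A :: real^'n^'m) v. transpose A *v v)"
  by (auto simp: bilinear_def matrix_vector_mul_linear matrix_vector_mult_add_rdistrib
   scaleR_matrix_vector_assoc simp del: transpose_matrix_vector intro!: linearI)
qed

lemma inner_transpose_vector: "(transpose A *v v) \<bullet> w = v \<bullet> ((A :: real^'n^'m) *v w)"
 by (simp add: dot_lmul_matrix)

subsection \<open>Discrete Sobolev and Poincare inequalities\<close>

text \<open>Discrete Gronwall inequality along a line, squared by means of Cauchy-Schwarz. The
  growth factor depends only on the length \<open>hstep j * real T\<close> and not on the
  mesh.\<close>

lemma line_sum_le:
 fixes u :: "real^'n => 'b::real_inner"
 assumes "!!y. norm (u (y + ax (hstep j) i)) <= (1 + K * hstep j) * norm (u y) + hstep j * d y"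
  and "K >= 0" "!!y. d y >= 0" "t <= T"
 shows "nsq (u (y + ax (real t * hstep j) i))
  <= 2 * exp (K * hstep j * real T)^2 * (nsq (u y) + hstep j * hstep j * real T * (\<Sum>s<T. (d (y + ax (real s * hstep j) i))^2))"
proof -
 let ?p = "%t. y + ax (real t * hstep j) i"
 have e: "(1 + K * hstep j) ^ t >= 1" for t
  using assms(2) by (intro one_le_power) auto
 have 1: "norm (u (?p t)) <= (1 + K * hstep j) ^ t * (norm (u y) + (\<Sum>s<t. hstep j * d (?p s)))" for t
 proof (induction t)
  case (Suc t)
  have "norm (u (?p (Suc t))) <= (1 + K * hstep j) * norm (u (?p t)) + hstep j * d (?p t)"
   using assms(1)[of "?p t"] by (simp add: algebra_simps)
  also have "... <= (1 + K * hstep j) * ((1 + K * hstep j) ^ t * (norm (u y) + (\<Sum>s<t. hstep j * d (?p s)))) 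
    + (1 + K * hstep j) ^ Suc t * (hstep j * d (?p t))"
   using Suc e[of "Suc t"] mult_right_mono[of 1 "(1 + K * hstep j) ^ Suc t" "hstep j * d (?p t)"] assms(2,3)
   by (intro add_mono mult_left_mono) auto
  finally show ?case by (simp add: algebra_simps)
 qed simp
 have "(1 + K * hstep j) ^ t <= exp (K * hstep j) ^ t"
  using assms(2) by (intro power_mono exp_ge_add_one_self) (auto simp: add.commute)
 also have "... = exp (real t * (K * hstep j))" by (simp add: exp_of_nat_mult)
 also have "... <= exp (K * hstep j * real T)"
  using mult_right_mono[of "real t" "real T" "K * hstep j"] assms(2,4) by (simp add: mult.commute)
 finally have 2: "(1 + K * hstep j) ^ t <= exp (K * hstep j * real T)" .
 have 3: "(\<Sum>s<t. hstep j * d (?p s)) <= (\<Sum>s<T. hstep j * d (?p s))"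
  using assms(3,4) by (intro sum_mono2) auto
 have nn: "(\<Sum>s<t. hstep j * d (?p s)) >= 0" for t using assms(3) by (intro sum_nonneg) auto
 have "norm (u (?p t)) <= exp (K * hstep j * real T) * (norm (u y) + (\<Sum>s<T. hstep j * d (?p s)))"
  using 2 3 nn[of t] by (intro order_trans[OF 1] mult_mono add_mono) auto
 then have "nsq (u (?p t)) <= (exp (K * hstep j * real T) * (norm (u y) + (\<Sum>s<T. hstep j * d (?p s))))^2"
  by (intro power_mono) auto
 also have "... = exp (K * hstep j * real T)^2 * (norm (u y) + (\<Sum>s<T. hstep j * d (?p s)))^2"
  by (simp add: power_mult_distrib)
 also have "... <= exp (K * hstep j * real T)^2 * (2 * (nsq (u y) + hstep j * hstep j * real T * (\<Sum>s<T. (d (?p s))^2)))"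
 proof (intro mult_left_mono)
  have "(norm (u y) + (\<Sum>s<T. hstep j * d (?p s)))^2 <= 2 * (nsq (u y) + (\<Sum>s<T. hstep j * d (?p s))^2)"
   using norm_add_sq_le[of "norm (u y)" "\<Sum>s<T. hstep j * d (?p s)"] by simp
  also have "(\<Sum>s<T. hstep j * d (?p s))^2 <= (\<Sum>s<T. (hstep j * d (?p s))^2) * real T"
   using sum_squared_le_sum_of_squares[of "%s. hstep j * d (?p s)" "{..<T}"] by simp
  also have "... = hstep j * hstep j * real T * (\<Sum>s<T. (d (?p s))^2)"
   by (simp add: power_mult_distrib sum_distrib_left[symmetric] power2_eq_square mult_ac)
  finally show "(norm (u y) + (\<Sum>s<T. hstep j * d (?p s)))^2 <= 2 * (nsq (u y) + hstep j * hstep j * real T * (\<Sum>s<T. (d (?p s))^2))"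
   by simp
 qed simp
 finally show ?thesis by (simp add: mult_ac distrib_left)
qed

lemma shift_eq_dq: "u (y + ax (hstep j) i) = u y + hstep j *\<^sub>R dq j i u y"
 by (simp add: dq_def)

text \<open>Sobolev inequality on a circle: from each of the \<open>nper j\<close> points of the
  period one walks on until \<open>x\<close> is reached again, and averages the resulting bounds.
  The constant is twice the square of the period.\<close>

lemma sq_le_line_avg:
 fixes u :: "real^'n => 'b::real_inner"
 assumes "periodic u"
 shows "nsq (u x) <= 200 * line_avg j i (%y. nsq (u y) + nsq (dq j i u y)) x"
proof -
 let ?p = "%t. x + ax (real t * hstep j) i"
 let ?S = "%y. hstep j * 10 * (\<Sum>s<nper j. nsq (dq j i u (y + ax (real s * hstep j) i)))"
 have per: "u (?p (nper j)) = u x"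
  using assms hstep_period(1)[of j] by (simp add: periodic_def)
 have hh: "hstep j * hstep j * real (nper j) = hstep j * 10"
  using hstep_period(1)[of j] by (metis mult.assoc mult.commute)
 have pdq: "periodic (%y. nsq (dq j i u y))" by (intro periodic_norm_sq periodic_dq assms)
 have S: "?S (?p t) = ?S x" for t
 proof -
  have "line_avg j i (%y. nsq (dq j i u y)) (?p t) = line_avg j i (%y. nsq (dq j i u y)) x" for t
  proof (induction t)
   case (Suc t)
   have "?p (Suc t) = ?p t + ax (hstep j) i" by (simp add: algebra_simps)
   then show ?case using Suc line_avg_step[OF pdq] by metis
  qed simp
  from this[of t] show ?thesis using nper_pos[of j] by (simp add: line_avg_def)
 qed
 have "nsq (u x) <= 2 * (nsq (u (?p t)) + ?S x)" if t: "t < nper j" for t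
 proof -
  have "norm (u (y + ax (hstep j) i)) <= (1 + 0 * hstep j) * norm (u y) + hstep j * norm (dq j i u y)" for y
   unfolding shift_eq_dq by (rule order_trans[OF norm_triangle_ineq]) simp
  from line_sum_le[where u = u and d = "%y. norm (dq j i u y)" and j = j and i = i and K = 0, OF this, of "nper j - t" "nper j" "?p t"] 
  have "nsq (u (?p t + ax (real (nper j - t) * hstep j) i)) <= 2 * (nsq (u (?p t)) + ?S (?p t))"
   by (simp add: hh)
  moreover have "?p t + ax (real (nper j - t) * hstep j) i = ?p (nper j)"
   using t by (simp add: of_nat_diff algebra_simps)
  ultimately show ?thesis unfolding S using per by simp
 qed
 moreover define S0 where "S0 = ?S x"
 ultimately have "(\<Sum>t<nper j. nsq (u x)) <= (\<Sum>t<nper j. 2 * (nsq (u (?p t)) + S0))"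
  by (intro sum_mono) auto
 then have "real (nper j) * nsq (u x) <= 2 * (\<Sum>t<nper j. nsq (u (?p t))) + 2 * real (nper j) * S0"
  by (simp add: sum.distrib flip: sum_distrib_left)
 also have "... = real (nper j) * (2 * line_avg j i (%y. nsq (u y)) x + 200 * line_avg j i (%y. nsq (dq j i u y)) x)"
 proof -
  have "real (nper j) * (200 * (s / real (nper j))) = 2 * real (nper j) * (hstep j * 10 * s)" for s
   using hstep_period(1)[of j] nper_pos[of j] by (simp add: mult.assoc[symmetric] del: nper_pos)
  then show ?thesis unfolding S0_def by (simp add: line_avg_def distrib_left)
 qed
 finally have "nsq (u x) <= 2 * line_avg j i (%y. nsq (u y)) x + 200 * line_avg j i (%y. nsq (dq j i u y)) x"
  by (simp add: mult_le_cancel_left_pos)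
 moreover have "line_avg j i (%y. nsq (u y)) x >= 0"
  by (auto simp: line_avg_def intro!: divide_nonneg_nonneg sum_nonneg)
 ultimately show ?thesis
  using line_avg_linear[of j i 1 "%y. nsq (u y)" 1 "%y. nsq (dq j i u y)" x] by simp
qed

text \<open>Sum of the squares of all difference quotients with at most one difference in each listed direction.\<close>
fun mixed_sq :: "nat => 'n list => (real^'n => 'b::real_inner) => real^'n => real" where
 "mixed_sq j [] u x = nsq (u x)"
| "mixed_sq j (i # is) u x = mixed_sq j is u x + mixed_sq j is (dq j i u) x"

lemma mean_mixed_sq: "mean j (mixed_sq j is u) x <= hn j (length is) u x"
proof (induction "is" arbitrary: u)
 case (Cons i "is")
 have "mean j (mixed_sq j (i # is) u) x = mean j (mixed_sq j is u) x + mean j (mixed_sq j is (dq j i u)) x"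
  using mean_add[of j "mixed_sq j is u" "mixed_sq j is (dq j i u)" x] by (simp flip: mixed_sq.simps(2))
 also have "... <= hn j (length is) u x + hn j (length is) (dq j i u) x"
  by (intro add_mono Cons)
 also have "... <= hn j (length (i # is)) u x"
  using member_le_sum[of i UNIV "%i. hn j (length is) (dq j i u) x"] by simp
 finally show ?case .
next
 case Nil
 have "mixed_sq j [] u = (%y. nsq (u y))" by (simp add: fun_eq_iff)
 then show ?case by simp
qed

text \<open>The inequality on the circle is applied in each coordinate in turn and costs one
  difference per direction. The order \<open>CARD('n)\<close> is wasteful but suffices, as all
  orders will be bounded.\<close>

lemma discrete_sobolev:
 fixes u :: "real^'n => 'b::real_inner"
 assumes "periodic u"
 shows "nsq (u x) <= 200 ^ CARD('n) * hn j CARD('n) u x"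
proof -
 have "nsq (u x) <= 200 ^ length is * foldr (line_avg j) is (mixed_sq j is u) x" if "periodic u" for "is" and u :: "real^'n => 'b" and x
  using that
 proof (induction "is" arbitrary: u x)
  case (Cons i "is")
  let ?f = "%u. foldr (line_avg j) is (mixed_sq j is u)"
  have add: "foldr (line_avg j) is (mixed_sq j (i # is) u) = (%y. ?f u y + ?f (dq j i u) y)"
  proof -
   have "foldr (line_avg j) l (%y. f y + g y) = (%y. foldr (line_avg j) l f y + foldr (line_avg j) l g y)" for l and f g :: "real^'n => real"
   proof (induction l)
    case (Cons k l)
    have "foldr (line_avg j) (k # l) (%y. f y + g y) x = line_avg j k (%y. foldr (line_avg j) l f y + foldr (line_avg j) l g y) x" for x
     using Cons by simp
    then show ?case using line_avg_linear[of j k 1 "foldr (line_avg j) l f" 1 "foldr (line_avg j) l g"] by (simp add: fun_eq_iff)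
   qed simp
   moreover have "mixed_sq j (i # is) u = (%y. mixed_sq j is u y + mixed_sq j is (dq j i u) y)"
    by (simp add: fun_eq_iff)
   ultimately show ?thesis by simp
  qed
  have "nsq (u x) <= 200 * line_avg j i (%y. nsq (u y) + nsq (dq j i u y)) x"
   by (rule sq_le_line_avg[OF Cons.prems])
  also have "... <= 200 * line_avg j i (%y. 200 ^ length is * (?f u y + ?f (dq j i u) y)) x"
   using Cons.IH[OF Cons.prems] Cons.IH[OF periodic_dq[OF Cons.prems]]
   by (intro mult_left_mono line_avg_mono) (auto simp: distrib_left intro: add_mono)
  also have "... = 200 ^ length (i # is) * foldr (line_avg j) (i # is) (mixed_sq j (i # is) u) x"
   using line_avg_linear[of j i "200 ^ length is" _ 0] unfolding foldr.simps o_def add by simp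
  finally show ?case .
 qed (simp)
 from this[OF assms, of x coords]
 have "nsq (u x) <= 200 ^ CARD('n) * mean j (mixed_sq j coords u) x"
  by (simp add: mean_def length_coords)
 also have "... <= 200 ^ CARD('n) * hn j CARD('n) u x"
  using mean_mixed_sq[of j coords u x] by (simp add: length_coords)
 finally show ?thesis .
qed

lemma hn_dq_le: "periodic u ==> hn j s (dq j i u) x <= 4 / (hstep j)^2 * hn j s u x"
proof -
 assume u: "periodic u"
 have "dq j i u = (%y. (1 / hstep j) *\<^sub>R (u (y + ax (hstep j) i) - u y))" by (simp add: dq_def fun_eq_iff)
 then have "hn j s (dq j i u) x = (1 / hstep j)^2 * hn j s (%y. u (y + ax (hstep j) i) - u y) x"
  by (simp add: hn_scaleR)
 also have "... <= (1 / hstep j)^2 * (2 * (hn j s u x + hn j s u x))"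
  using hn_diff[of j s "%y. u (y + ax (hstep j) i)" u x] u by (intro mult_left_mono) (auto simp: hn_shift hn_step)
 finally show ?thesis by (simp add: power_divide)
qed

text \<open>The constant blows up as the mesh shrinks; the estimate makes the operator bounded for a
  fixed mesh, as the contraction argument requires.\<close>

lemma hn_le_fixed_step:
 fixes u :: "real^'n => 'b::real_inner"
 shows "periodic u ==> hn j s u x <= (1 + real CARD('n) * (4 / (hstep j)^2)) ^ s * hn j 0 u x"
proof (induction s)
 case (Suc s)
 have "hn j (Suc s) u x <= hn j s u x + (\<Sum>i\<in>(UNIV::'n set). 4 / (hstep j)^2 * hn j s u x)"
  unfolding hn.simps by (intro add_left_mono sum_mono hn_dq_le Suc.prems)
 also have "... = (1 + real CARD('n) * (4 / (hstep j)^2)) * hn j s u x" by (simp add: algebra_simps)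
 also have "... <= (1 + real CARD('n) * (4 / (hstep j)^2)) * ((1 + real CARD('n) * (4 / (hstep j)^2)) ^ s * hn j 0 u x)"
  by (rule mult_left_mono[OF Suc.IH[OF Suc.prems]]) simp
 finally show ?case by (simp only: power_Suc mult.assoc)
qed simp

lemma mean_divide: "mean j (%y. f y / c) x = mean j f x / c"
 using mean_cmult[of j "1 / c" f x] by simp

subsection \<open>The operator\<close>

text \<open>\<open>X_cover\<close> forbids the potential to be small at both of two points half a
  period apart. It stands in for strict positivity of \<open>X\<close>, which has to vanish near the
  ball.\<close>

locale lattice_operator =
 fixes a :: "'n::finite => 'n => nat => real^'n => real"
  and A :: "'n => nat => real^'n => real^'k^'k"
  and X :: "nat => real^'n => real"
 assumes a: "lattice_coeff (a i l)" and A: "lattice_coeff (A i)" and X: "lattice_coeff X"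
  and ellipticity: "\<bar>a i l j x - (kd i l)\<bar> <= 1 / (2 * real CARD('n))"
  and X_bounds: "0 <= X j x" "X j x <= 1"
  and X_cover: "1 <= X j x + X j (x + ax 5 i)"
begin

definition cdq :: "'n => nat => (real^'n => real^'k) => real^'n => real^'k" where
 "cdq i j u x = dq j i u x + A i j x *v u x"

definition cdq_adj :: "'n => nat => (real^'n => real^'k) => real^'n => real^'k" where
 "cdq_adj i j v x = transpose (A i j x) *v v x + (- 1) *\<^sub>R dq j i v (x - ax (hstep j) i)"

definition Lop :: "nat => (real^'n => real^'k) => real^'n => real^'k" where
 "Lop j u x = (SUM i. cdq_adj i j (%y. SUM l. a i l j y *\<^sub>R cdq l j u y) x) + X j x *\<^sub>R u x"

lemma dop_cdq: "dop 1 (cdq i)"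
proof -
 have "dop 1 (%j u x. dq j i u x + A i j x *v u x)"
  by (intro dop_add dop_dq dop_raise[OF dop_mult[OF bounded_bilinear_matrix_vector A]]) simp
 then show ?thesis by (simp add: cdq_def[abs_def])
qed

lemma lattice_coeff_const: "lattice_coeff (%j x. c)"
proof -
 have "bdd_coeff s (%j x. c)" for s by (induction s arbitrary: c) auto
 then show ?thesis by (auto simp: lattice_coeff_def periodic_def)
qed

lemma dop_cdq_adj: "dop 1 (cdq_adj i)"
proof -
 have "dop (0 + (0 + 1)) (%j (u :: real^'n => real^'k) x. (-1) *\<^sub>R dq j i u (x - ax (hstep j) i))"
  using dop_comp[OF dop_mult[OF bounded_bilinear_scaleR lattice_coeff_const[of "-1"]] 
    dop_comp[OF dop_shift_back[of i] dop_dq[of i]]]  by simp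
 then have "dop 1 (%j (u :: real^'n => real^'k) x. (-1) *\<^sub>R dq j i u (x - ax (hstep j) i))" by simp
 then have "dop 1 (%j u x. transpose (A i j x) *v u x + (-1) *\<^sub>R dq j i u (x - ax (hstep j) i))"
  by (intro dop_add dop_raise[OF dop_mult[OF bounded_bilinear_transpose_vector A]]) simp_all
 then show ?thesis by (simp add: cdq_adj_def[abs_def])
qed

lemma dop_flux: "dop 1 (%j u y. SUM l. a i l j y *\<^sub>R cdq l j u y)"
 using dop_comp[OF dop_mult[OF bounded_bilinear_scaleR a] dop_cdq] by (intro dop_sum) auto

lemma dop_Lop: "dop 2 Lop"
proof -
 have "dop 2 (%j u x. (SUM i. cdq_adj i j (%y. SUM l. a i l j y *\<^sub>R cdq l j u y) x) + X j x *\<^sub>R u x)"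
 proof (intro dop_add dop_sum)
  show "dop 2 (%j u x. X j x *\<^sub>R u x)"
   by (rule dop_raise[OF dop_mult[OF bounded_bilinear_scaleR X]]) simp
  show "dop 2 (%j u. cdq_adj i j (%y. SUM l. a i l j y *\<^sub>R cdq l j u y))" for i
   using dop_comp[OF dop_cdq_adj[of i] dop_flux[of i]] by (simp add: numeral_2_eq_2)
 qed simp
 then show ?thesis by (simp add: Lop_def[abs_def])
qed

lemma periodic_Lop: "periodic u ==> periodic (Lop j u)"
 using dop_Lop by (auto simp: dop_def)

lemma Lop_diff: "Lop j (%x. u x - v x) = (%x. Lop j u x - Lop j v x)"
 using dop_Lop by (auto simp: dop_def)

lemma periodic_cdq: "periodic u ==> periodic (cdq i j u)"
 using dop_cdq by (auto simp: dop_def)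

lemma mean_cdq_adj:
 assumes "periodic F" "periodic v"
 shows "mean j (%y. cdq_adj i j F y \<bullet> v y) x = mean j (%y. F y \<bullet> cdq i j v y) x"
proof -
 let ?e = "hstep j *\<^sub>R axis i (1::real)"
 have "mean j (%y. dq j i F (y - ?e) \<bullet> v y) x = mean j (%y. (1 / hstep j) * (F y \<bullet> v y) - (1 / hstep j) * (F (y - ?e) \<bullet> v (y - ?e + ?e))) x"
  by (simp add: dq_def inner_diff_left diff_divide_distrib)
 also have "... = (1 / hstep j) * (mean j (%y. F y \<bullet> v y) x - mean j (%y. F y \<bullet> v (y + ?e)) x)"
  using mean_shift_back[OF periodic_bilinear[OF assms(1) periodic_shift[OF assms(2), of ?e], of inner], of j i x]
  by (simp add: mean_diff mean_divide diff_divide_distrib)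
 also have "... = - mean j (%y. F y \<bullet> dq j i v y) x"
 proof -
  have "mean j (%y. F y \<bullet> dq j i v y) x = mean j (%y. (1 / hstep j) * (F y \<bullet> v (y + ?e)) - (1 / hstep j) * (F y \<bullet> v y)) x"
   by (simp add: dq_def inner_diff_right diff_divide_distrib)
  then show ?thesis by (simp add: mean_diff mean_divide diff_divide_distrib)
 qed
 finally have 1: "mean j (%y. dq j i F (y - ?e) \<bullet> v y) x = - mean j (%y. F y \<bullet> dq j i v y) x" .
 have "mean j (%y. cdq_adj i j F y \<bullet> v y) x = mean j (%y. F y \<bullet> (A i j y *v v y) - dq j i F (y - ?e) \<bullet> v y) x"
  by (simp add: cdq_adj_def inner_diff_left inner_transpose_vector del: transpose_matrix_vector)
 also have "... = mean j (%y. F y \<bullet> (A i j y *v v y) + F y \<bullet> dq j i v y) x"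
  by (simp add: mean_diff mean_add 1)
 finally show ?thesis by (simp add: cdq_def inner_add_right add.commute)
qed

lemma mean_Lop:
 assumes "periodic u" "periodic v"
 shows "mean j (%y. Lop j u y \<bullet> v y) x =
  mean j (%y. (SUM i l. a i l j y * (cdq l j u y \<bullet> cdq i j v y)) + X j y * (u y \<bullet> v y)) x"
proof -
 have "periodic (%y. SUM l. a i l j y *\<^sub>R cdq l j u y)" for i
  using dop_flux[of i] assms(1) by (auto simp: dop_def)
 then have "mean j (%y. cdq_adj i j (%y. SUM l. a i l j y *\<^sub>R cdq l j u y) y \<bullet> v y) x
  = mean j (%y. SUM l. a i l j y * (cdq l j u y \<bullet> cdq i j v y)) x" for i
  by (subst mean_cdq_adj[OF _ assms(2)]) (auto simp: inner_sum_left)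
 then show ?thesis
  by (simp add: Lop_def inner_add_left inner_sum_left mean_add mean_sum)
qed

lemma form_lower_bound:
 fixes p :: "'n => real^'k"
 shows "(SUM i l. a i l j y * (p l \<bullet> p i)) >= (1/2) * (SUM i. nsq (p i))"
proof -
 have "\<bar>z - N\<bar> <= 1 / (2 * c) * c * N ==> c > 0 ==> N <= 2 * z & 2 * z <= 3 * N" for z N c :: real
  by (auto simp: abs_if split: if_splits)
 from this[OF quadratic_close[where H = "%i l. a i l j y" and w = p, OF ellipticity]]
 show ?thesis by (simp_all add: inner_commute)
qed

lemma energy_lower_bound:
 assumes "periodic u"
 shows "mean j (%y. Lop j u y \<bullet> u y) x >= 
  (1/2) * (SUM i. mean j (%y. nsq (cdq i j u y)) x) + mean j (%y. X j y * nsq (u y)) x"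
proof -
 have "mean j (%y. (1/2) * (SUM i. nsq (cdq i j u y)) + X j y * nsq (u y)) x <=
  mean j (%y. (SUM i l. a i l j y * (cdq l j u y \<bullet> cdq i j u y)) + X j y * (u y \<bullet> u y)) x"
  by (intro mean_mono add_mono form_lower_bound) (simp add: power2_norm_eq_inner)
 then show ?thesis unfolding mean_Lop[OF assms assms] by (simp add: mean_add mean_divide mean_sum)
qed

text \<open>The energy controls the covariant differences; the plain ones differ from them by
  \<open>A\<close> applied to \<open>u\<close>, a term of order zero which goes into
  \<open>K\<close>. No smallness of \<open>A\<close> enters.\<close>

lemma garding:
 obtains K where "K >= 0" "!!j x u. periodic u ==> 
  (1/4) * (SUM i. hn j 0 (dq j i u) x) <= mean j (%y. Lop j u y \<bullet> u y) x + K * hn j 0 u x"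
proof -
 have "EX K>=0. ALL j x u. periodic u --> hn j 0 (%y. A i j y *v u y) x <= K * hn j 0 u x" for i
  using hn_mult[OF bounded_bilinear_matrix_vector A] .
 then obtain K where K: "!!i. K i >= 0" "!!i j x u. periodic u ==> hn j 0 (%y. A i j y *v u y) x <= K i * hn j 0 u x"
  using choice[of "%i K. K>=0 & (ALL j x u. periodic u --> hn j 0 (%y. A i j y *v u y) x <= K * hn j 0 u x)"] by blast
 show thesis
 proof
  show "(SUM i. K i) >= 0" using K by (simp add: sum_nonneg)
  fix j x and u :: "real^'n => real^'k" assume u: "periodic u"
  have "hn j 0 (dq j i u) x <= 2 * (mean j (%y. nsq (cdq i j u y)) x + K i * hn j 0 u x)" for i
  proof -
   have "dq j i u = (%y. cdq i j u y - A i j y *v u y)" by (simp add: cdq_def fun_eq_iff)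
   then have "hn j 0 (dq j i u) x = hn j 0 (%y. cdq i j u y - A i j y *v u y) x" by (rule arg_cong)
   then have "hn j 0 (dq j i u) x <= 2 * (hn j 0 (cdq i j u) x + hn j 0 (%y. A i j y *v u y) x)"
    using hn_diff[of j 0 "cdq i j u" "%y. A i j y *v u y" x] by linarith
   with K(2)[OF u, of j i x] show ?thesis by simp
  qed
  then have "(SUM i. hn j 0 (dq j i u) x) <= (SUM i. 2 * (mean j (%y. nsq (cdq i j u y)) x + K i * hn j 0 u x))"
   by (rule sum_mono)
  then have "(1/4) * (SUM i. hn j 0 (dq j i u) x) <= (1/2) * (SUM i. mean j (%y. nsq (cdq i j u y)) x) + (1/2) * ((SUM i. K i) * hn j 0 u x)"
   by (simp add: sum.distrib flip: sum_distrib_left sum_distrib_right)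
  moreover have "mean j (%y. X j y * nsq (u y)) x >= 0" using X_bounds by (intro mean_nonneg) auto
  moreover have "(SUM i. K i) * hn j 0 u x >= 0" using K(1) hn_nonneg[of j 0 u x] by (intro mult_nonneg_nonneg sum_nonneg) auto
  ultimately show "(1/4) * (SUM i. hn j 0 (dq j i u) x) <= mean j (%y. Lop j u y \<bullet> u y) x + (SUM i. K i) * hn j 0 u x"
   using energy_lower_bound[OF u, of j x] by linarith
 qed
qed

text \<open>The potential may vanish, but not at two opposite points. The square of \<open>u\<close>
  at the point opposite to \<open>y\<close> is charged partly to the potential there and partly to
  the potential at \<open>y\<close>, from where the value is carried along the \<open>Suc j\<close>
  steps of half a period by the Gronwall inequality.\<close>

lemma coercive:
 obtains K where "K > 0" "!!j x u. periodic u ==> hn j 0 u x <= K * mean j (%y. Lop j u y \<bullet> u y) x"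
proof -
 obtain i :: 'n where True by blast
 interpret mv: bounded_bilinear "(*v) :: real^'k^'k => real^'k => real^'k" by (rule bounded_bilinear_matrix_vector)
 obtain B where B: "B > 0" "!!M v. norm ((M :: real^'k^'k) *v v) <= norm M * norm v * B" using mv.pos_bounded by blast
 obtain K0 where K0: "!!j x. norm (A i j x) <= K0"
  using A[of i] unfolding lattice_coeff_def by (metis bdd_coeff.simps(1))
 define K where "K = K0 * B"
 have "K0 >= 0" using K0 norm_ge_zero order_trans by blast
 then have "K >= 0" using B by (simp add: K_def)
 have Au: "norm (A i j y *v v) <= K * norm v" for j y v
 proof -
  have "norm (A i j y) * norm v * B <= K0 * norm v * B"
   using K0 B(1) by (intro mult_right_mono) auto
  then show ?thesis using B(2)[of "A i j y" v] by (simp add: K_def mult_ac)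
 qed
 define E where "E = 2 * (exp (5 * K))^2"
 have "E >= 0" by (simp add: E_def)
 show thesis
 proof
  show "1 + E + 50 * E > 0" using `E >= 0` by simp
  fix j x and u :: "real^'n => real^'k" assume u: "periodic u"
  let ?p = "%y t. y + ax (real t * hstep j) i"
  let ?e = "5 *\<^sub>R axis i (1::real)"
  have step: "norm (u (y + ax (hstep j) i)) <= (1 + K * hstep j) * norm (u y) + hstep j * norm (cdq i j u y)" for y
  proof -
   have "u (y + ax (hstep j) i) = (u y - hstep j *\<^sub>R (A i j y *v u y)) + hstep j *\<^sub>R cdq i j u y"
    by (simp add: shift_eq_dq cdq_def algebra_simps)
   then have "norm (u (y + ax (hstep j) i)) <= norm (u y) + hstep j * norm (A i j y *v u y) + hstep j * norm (cdq i j u y)"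
    using norm_triangle_ineq[of "u y - hstep j *\<^sub>R (A i j y *v u y)" "hstep j *\<^sub>R cdq i j u y"] 
     norm_triangle_ineq4[of "u y" "hstep j *\<^sub>R (A i j y *v u y)"] by simp
   also have "... <= norm (u y) + hstep j * (K * norm (u y)) + hstep j * norm (cdq i j u y)"
    using Au by (intro add_mono mult_left_mono) auto
   finally show ?thesis by (simp add: algebra_simps)
  qed
  have e5: "?p y (Suc j) = y + ?e" for y using hstep_period(2)[of j] by simp
  have "nsq (u (y + ?e)) <= X j (y + ?e) * nsq (u (y + ?e)) + 
    E * (X j y * nsq (u y) + 5 * hstep j * (\<Sum>s<Suc j. nsq (cdq i j u (?p y s))))" for y
  proof -
   let ?S = "5 * hstep j * (\<Sum>s<Suc j. nsq (cdq i j u (?p y s)))"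
   have S: "?S >= 0" by (intro mult_nonneg_nonneg sum_nonneg) auto
   have "hstep j * hstep j * real (Suc j) = 5 * hstep j" "K * hstep j * real (Suc j) = 5 * K"
    using hstep_period(2)[of j] by (simp_all only: mult.commute mult.left_commute mult.assoc)
   with line_sum_le[where u = u and d = "%y. norm (cdq i j u y)" and j = j and i = i, OF step `K >= 0`, of "Suc j" "Suc j" y] 
   have *: "nsq (u (y + ?e)) <= E * (nsq (u y) + ?S)"
    unfolding e5 E_def by (simp only: norm_ge_zero order_refl simp_thms)
   \<comment> \<open>Only the share weighted by \<open>X j y\<close> is transported, so that it
     arrives with the potential at its starting point as a factor.\<close>
   have "1 * nsq (u (y + ?e)) <= (X j (y + ?e) + X j y) * nsq (u (y + ?e))"
    using X_cover[of j y i] by (intro mult_right_mono) auto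
   also have "... = X j (y + ?e) * nsq (u (y + ?e)) + X j y * nsq (u (y + ?e))" by (simp add: algebra_simps)
   also have "X j y * nsq (u (y + ?e)) <= X j y * (E * (nsq (u y) + ?S))"
    by (intro mult_left_mono * X_bounds)
   also have "... = E * (X j y * nsq (u y) + X j y * ?S)" by (simp add: algebra_simps)
   also have "... <= E * (X j y * nsq (u y) + ?S)"
    using mult_right_mono[OF X_bounds(2) S, of j y] `E >= 0` by (intro mult_left_mono) auto
   finally show ?thesis by simp
  qed
  then have "mean j (%y. nsq (u (y + ?e))) x <= mean j (%y. X j (y + ?e) * nsq (u (y + ?e)) + 
    E * (X j y * nsq (u y) + 5 * hstep j * (\<Sum>s<Suc j. nsq (cdq i j u (?p y s))))) x"
   by (rule mean_mono)
  moreover have pX: "periodic (%y. X j y * nsq (u y))"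
   using X u unfolding lattice_coeff_def by (auto simp: periodic_def)
  have "mean j (%y. nsq (u (y + ?e))) x = hn j 0 u x"
   using mean_shift_steps[OF periodic_norm_sq[OF u], of j "Suc j" i x] unfolding e5 by simp
  moreover have "mean j (%y. X j (y + ?e) * nsq (u (y + ?e))) x = mean j (%y. X j y * nsq (u y)) x"
   using mean_shift_steps[OF pX, of j "Suc j" i x] unfolding e5 by simp
  moreover have "mean j (%y. nsq (cdq i j u (?p y s))) x = mean j (%y. nsq (cdq i j u y)) x" for s
   using mean_shift_steps[OF periodic_norm_sq[OF periodic_cdq[OF u]], where t = s and i = i and x = x and j = j] by simp
  ultimately have "hn j 0 u x <= mean j (%y. X j y * nsq (u y)) x + E * (mean j (%y. X j y * nsq (u y)) x
     + 5 * hstep j * (real (Suc j) * mean j (%y. nsq (cdq i j u y)) x))"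
   by (simp add: mean_add mean_cmult mean_sum del: sum.lessThan_Suc of_nat_Suc)
  also have "5 * hstep j * (real (Suc j) * mean j (%y. nsq (cdq i j u y)) x) = 25 * mean j (%y. nsq (cdq i j u y)) x"
  proof -
   have "5 * hstep j * (real (Suc j) * q) = 5 * (real (Suc j) * hstep j) * q" for q by (simp only: mult_ac)
   then show ?thesis unfolding hstep_period(2) by simp
  qed
  finally have 1: "hn j 0 u x <= (1 + E) * mean j (%y. X j y * nsq (u y)) x + 25 * E * mean j (%y. nsq (cdq i j u y)) x"
   by (simp add: algebra_simps)
  define P Q R where "P = mean j (%y. X j y * nsq (u y)) x" and "Q = mean j (%y. nsq (cdq i j u y)) x"
   and "R = mean j (%y. Lop j u y \<bullet> u y) x"
  have "P >= 0" "Q >= 0" unfolding P_def Q_def using X_bounds by (auto intro!: mean_nonneg)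
  have "Q <= (SUM i. mean j (%y. nsq (cdq i j u y)) x)"
   unfolding Q_def by (rule member_le_sum[of i UNIV "%i. mean j (%y. nsq (cdq i j u y)) x"]) (auto intro: mean_nonneg)
  then have R: "(1/2) * Q + P <= R" using energy_lower_bound[OF u, of j x] unfolding P_def R_def by linarith
  have "hn j 0 u x <= (1 + E) * P + 25 * E * Q" using 1 unfolding P_def Q_def .
  also have "... <= (1 + E) * ((1/2) * Q + P) + 50 * E * ((1/2) * Q + P)"
   using `P >= 0` `Q >= 0` `E >= 0` by (simp add: algebra_simps)
  also have "... = (1 + E + 50 * E) * ((1/2) * Q + P)" by (simp only: distrib_right)
  also have "... <= (1 + E + 50 * E) * R" using R `E >= 0` by (intro mult_left_mono) auto
  finally show "hn j 0 u x <= (1 + E + 50 * E) * mean j (%y. Lop j u y \<bullet> u y) x" by (simp add: R_def)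
 qed
qed

end

subsection \<open>Uniform bounds for solutions\<close>

text \<open>In contrast to \<open>hn\<close>, only differences of order exactly \<open>s\<close>
  enter.\<close>

fun ip :: "nat => nat => (real^'n => 'b::real_inner) => (real^'n => 'b) => real^'n => real" where
 "ip j 0 u v x = mean j (%y. u y \<bullet> v y) x"
| "ip j (Suc s) u v x = (SUM i. ip j s (dq j i u) (dq j i v) x)"

lemma ip_add_left: "ip j s (%y. u y + w y) v x = ip j s u v x + ip j s w v x"
 by (induction s arbitrary: u v w) (auto simp: inner_add_left mean_add dq_add sum.distrib)

lemma ip_young:
 fixes u v :: "real^'n => 'b::real_inner"
 assumes "\<mu> > 0"
 shows "ip j s u v x <= \<mu> * hn j s u x + (1 / \<mu>) * hn j s v x"
proof (induction s arbitrary: u v)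
 case 0
 have "u y \<bullet> v y <= \<mu> * nsq (u y) + (1 / \<mu>) * nsq (v y)" for y
 proof -
  have "0 <= nsq (\<mu> *\<^sub>R u y - v y)" by simp
  also have "... = \<mu> * (\<mu> * (u y \<bullet> u y)) + v y \<bullet> v y - 2 * \<mu> * (u y \<bullet> v y)"
   by (simp add: power2_norm_eq_inner inner_diff_left inner_diff_right inner_commute)
  finally have "2 * (u y \<bullet> v y) <= \<mu> * nsq (u y) + (1 / \<mu>) * nsq (v y)"
   using assms by (simp add: power2_norm_eq_inner field_simps)
  moreover have "\<mu> * nsq (u y) + (1 / \<mu>) * nsq (v y) >= 0" using assms by (intro add_nonneg_nonneg) auto
  ultimately show ?thesis by linarith
 qed
 then have "mean j (%y. u y \<bullet> v y) x <= mean j (%y. \<mu> * nsq (u y) + (1 / \<mu>) * nsq (v y)) x" by (rule mean_mono)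
 then show ?case unfolding mean_linear by simp
next
 case (Suc s)
 have "ip j (Suc s) u v x <= (SUM i. \<mu> * hn j s (dq j i u) x + (1 / \<mu>) * hn j s (dq j i v) x)"
  unfolding ip.simps by (intro sum_mono Suc)
 also have "... = \<mu> * (SUM i. hn j s (dq j i u) x) + (1 / \<mu>) * (SUM i. hn j s (dq j i v) x)"
  by (simp only: sum.distrib sum_distrib_left)
 also have "... <= \<mu> * hn j (Suc s) u x + (1 / \<mu>) * hn j (Suc s) v x"
  using assms by (intro add_mono mult_left_mono hn_dq_sum) auto
 finally show ?case .
qed

text \<open>A norm of order \<open>Suc s\<close> is the norm of order \<open>s\<close> plus the part
  of top order; the constant accounts for the multiplicities in the recursion of
  \<open>hn\<close>.\<close>

lemma hn_Suc_le_ip: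
 "hn j (Suc s) u x <= (1 + real CARD('n)) ^ s * (hn j s u x + ip j (Suc s) u u x)"
 for u :: "real^'n => 'b::real_inner"
proof (induction s arbitrary: u)
 case 0 then show ?case by (simp add: power2_norm_eq_inner)
next
 case (Suc s)
 let ?c = "(1 + real CARD('n)) ^ s" and ?N = "1 + real CARD('n)"
 have c: "?c >= 1" "?c >= 0" by (simp_all add: one_le_power)
 have ip: "ip j (Suc (Suc s)) u u x = (SUM i. ip j (Suc s) (dq j i u) (dq j i u) x)" by (rule ip.simps(2))
 have "(SUM i. hn j (Suc s) (dq j i u) x) <= (SUM i. ?c * (hn j s (dq j i u) x + ip j (Suc s) (dq j i u) (dq j i u) x))"
  by (intro sum_mono Suc)
 also have "... = ?c * (SUM i. hn j s (dq j i u) x) + ?c * ip j (Suc (Suc s)) u u x"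
  unfolding ip by (simp only: distrib_left sum.distrib sum_distrib_left)
 also have "... <= ?c * hn j (Suc s) u x + ?c * ip j (Suc (Suc s)) u u x"
  using c by (intro add_right_mono mult_left_mono hn_dq_sum)
 finally have 1: "hn j (Suc (Suc s)) u x <= (1 + ?c) * hn j (Suc s) u x + ?c * ip j (Suc (Suc s)) u u x"
  by (simp only: hn.simps(2)[of j "Suc s"]) (simp only: distrib_right mult_1)
 have "ip j t u u x >= 0" for t
  by (induction t arbitrary: u) (auto intro!: mean_nonneg sum_nonneg)
 moreover have "1 + ?c <= ?N * ?c" "?c <= ?N * ?c"
 proof -
  have "1 * ?c <= real CARD('n) * ?c" using c by (intro mult_right_mono) (simp_all add: Suc_leI)
  moreover have "?N * ?c = ?c + real CARD('n) * ?c" by (simp add: distrib_right)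
  ultimately show "1 + ?c <= ?N * ?c" "?c <= ?N * ?c" using c by linarith+
 qed
 ultimately have "(1 + ?c) * hn j (Suc s) u x + ?c * ip j (Suc (Suc s)) u u x <= (?N * ?c) * hn j (Suc s) u x + (?N * ?c) * ip j (Suc (Suc s)) u u x"
  by (intro add_mono mult_right_mono hn_nonneg)
 with 1 show ?case by (simp only: power_Suc distrib_left)
qed

lemma hn_bdd_coeff:
 "bdd_coeff s f ==> EX K. ALL j x. hn j s (f j) x <= K"
proof (induction s arbitrary: f)
 case 0
 then obtain K where K: "!!j x. norm (f j x) <= K" by auto
 have "hn j 0 (f j) x <= K^2" for j x
  using mean_mono[of "%y. nsq (f j y)" "%y. K\<^sup>2" j x] K by (simp add: power_mono)
 then show ?case by blast
next
 case (Suc s)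
 then obtain K where K: "!!j x. hn j s (f j) x <= K" by (meson bdd_coeff.simps(2))
 have "ALL i. EX K. ALL j x. hn j s (dq j i (f j)) x <= K"
  using Suc.IH Suc.prems by (metis bdd_coeff.simps(2))
 then obtain K' where K': "!!i j x. hn j s (dq j i (f j)) x <= K' i" by metis
 have "hn j (Suc s) (f j) x <= K + (SUM i. K' i)" for j x
  unfolding hn.simps by (intro add_mono sum_mono K K')
 then show ?case by blast
qed

text \<open>Energy bounds of all orders become pointwise bounds of all orders, since the discrete
  Sobolev inequality costs a fixed number of differences.\<close>

lemma bdd_coeff_hn:
 fixes w :: "nat => real^'n => 'b::real_inner"
 assumes "!!j. periodic (w j)" "!!s. EX K. ALL j x. hn j s (w j) x <= K"
 shows "bdd_coeff s w"
 using assms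
proof (induction s arbitrary: w)
 case 0
 obtain K where K: "!!j x. hn j CARD('n) (w j) x <= K" using 0(2) by meson
 have "norm (w j x) <= sqrt (200 ^ CARD('n) * K)" for j x
  by (intro real_le_rsqrt order_trans[OF discrete_sobolev[OF 0(1)[of j], of x j] mult_left_mono[OF K[of j x]]]) simp
 then show ?case by auto
next
 case (Suc s)
 have "bdd_coeff s (%j. dq j i (w j))" for i
 proof (rule Suc.IH)
  show "EX K. ALL j x. hn j t (dq j i (w j)) x <= K" for t
   using Suc.prems(2)[of "Suc t"] hn_dq order_trans by meson
 qed (use Suc.prems periodic_dq in blast)
 then show ?case using Suc by simp
qed

context lattice_operator begin

text \<open>The estimate is applied to the difference quotients of \<open>u\<close>. The commutator
  with \<open>Lop\<close> has order two rather than three, so that, paired with a first difference,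
  it costs only a small multiple of the next norm plus lower terms.\<close>

lemma garding_higher:
 assumes "\<mu> > 0"
 shows "EX K>=0. ALL j x u. periodic u -->
   (1/4) * ip j (Suc s) u u x <= ip j s (Lop j u) u x + \<mu> * hn j (Suc s) u x + K * hn j s u x"
 using assms
proof (induction s arbitrary: \<mu>)
 case 0
 obtain K where K: "K >= 0" "!!j x u. periodic u ==> 
  (1/4) * (SUM i. hn j 0 (dq j i u) x) <= mean j (%y. Lop j u y \<bullet> u y) x + K * hn j 0 u x"
  using garding by blast
 show ?case
 proof (intro exI[of _ K] conjI allI impI K)
  fix j x and u :: "real^'n => real^'k" assume u: "periodic u"
  have "ip j (Suc 0) u u x = (SUM i. hn j 0 (dq j i u) x)" by (simp add: power2_norm_eq_inner)
  moreover have "\<mu> * hn j (Suc 0) u x >= 0" using 0 by (intro mult_nonneg_nonneg) (auto simp del: hn.simps)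
  ultimately show "(1/4) * ip j (Suc 0) u u x <= ip j 0 (Lop j u) u x + \<mu> * hn j (Suc 0) u x + K * hn j 0 u x"
   using K(2)[OF u, of j x] by simp
 qed
next
 case (Suc s)
 let ?n = "real CARD('n)"
 let ?C = "%k j u x. Lop j (dq j k u) x - dq j k (Lop j u) x"
 have "bdd_op 2 (?C k)" for k using dop_Lop by (simp add: dop_def)
 then have "ALL k. EX K>=0. ALL j x u. periodic u --> hn j s (?C k j u) x <= K * hn j (s + 2) u x"
  unfolding bdd_op_def by blast
 from choice[OF this] obtain M where M: "!!k. M k >= 0" 
  "!!k j x u. periodic u ==> hn j s (?C k j u) x <= M k * hn j (s + 2) u x"
  by blast
 define M' where "M' = 1 + (SUM k. M k)"
 have M'pos: "M' > 0" using M(1) by (simp add: M'_def add_pos_nonneg sum_nonneg)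
 \<comment> \<open>Half of \<mu> pays for the commutators in all directions together; the other half
   is the loss in the induction hypothesis.\<close>
 define \<nu> where "\<nu> = \<mu> / (2 * M')"
 have \<nu>: "\<nu> > 0" using Suc.prems M'pos by (simp add: \<nu>_def)
 have "\<mu> / 2 > 0" using Suc.prems by simp
 from Suc.IH[OF this] obtain K where K: "K >= 0" "!!j x u. periodic u ==>
   (1/4) * ip j (Suc s) u u x <= ip j s (Lop j u) u x + (\<mu> / 2) * hn j (Suc s) u x + K * hn j s u x" by blast
 show ?case
 proof (intro exI[of _ "1 / \<nu> + K"] conjI allI impI)
  show "1 / \<nu> + K >= 0" using \<nu> K by simp
  fix j x and u :: "real^'n => real^'k" assume u: "periodic u"
  have "(1/4) * ip j (Suc s) (dq j k u) (dq j k u) x <= ip j s (dq j k (Lop j u)) (dq j k u) x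
    + (\<nu> * (M k * hn j (s + 2) u x) + (1 / \<nu> + K) * hn j s (dq j k u) x) + (\<mu> / 2) * hn j (Suc s) (dq j k u) x" for k
  proof -
   have "Lop j (dq j k u) = (%y. dq j k (Lop j u) y + ?C k j u y)" by simp
   then have "ip j s (Lop j (dq j k u)) (dq j k u) x = ip j s (%y. dq j k (Lop j u) y + ?C k j u y) (dq j k u) x"
    by (rule arg_cong[where f = "%w. ip j s w (dq j k u) x"])
   also have "... = ip j s (dq j k (Lop j u)) (dq j k u) x + ip j s (?C k j u) (dq j k u) x"
    by (rule ip_add_left)
   finally have 1: "ip j s (Lop j (dq j k u)) (dq j k u) x = ip j s (dq j k (Lop j u)) (dq j k u) x + ip j s (?C k j u) (dq j k u) x" .
   have "ip j s (?C k j u) (dq j k u) x <= \<nu> * hn j s (?C k j u) x + (1 / \<nu>) * hn j s (dq j k u) x"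
    by (rule ip_young[OF \<nu>])
   moreover have "\<nu> * hn j s (?C k j u) x <= \<nu> * (M k * hn j (s + 2) u x)"
    using M(2)[OF u] \<nu> by (intro mult_left_mono) auto
   ultimately show ?thesis
    using K(2)[OF periodic_dq[OF u, of j k], of j x] 1 unfolding distrib_right by linarith
  qed
  then have "(SUM k. (1/4) * ip j (Suc s) (dq j k u) (dq j k u) x) <= (SUM k. ip j s (dq j k (Lop j u)) (dq j k u) x
    + (\<nu> * (M k * hn j (s + 2) u x) + (1 / \<nu> + K) * hn j s (dq j k u) x) + (\<mu> / 2) * hn j (Suc s) (dq j k u) x)"
   by (rule sum_mono)
  then have "(1/4) * ip j (Suc (Suc s)) u u x <= ip j (Suc s) (Lop j u) u x 
    + \<nu> * ((SUM k. M k) * hn j (s + 2) u x) + (1 / \<nu> + K) * (SUM k. hn j s (dq j k u) x) + (\<mu> / 2) * (SUM k. hn j (Suc s) (dq j k u) x)"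
   by (simp only: sum.distrib flip: sum_distrib_left sum_distrib_right ip.simps(2))
  also have "... <= ip j (Suc s) (Lop j u) u x + \<nu> * (M' * hn j (Suc (Suc s)) u x) + (1 / \<nu> + K) * hn j (Suc s) u x + (\<mu> / 2) * hn j (Suc (Suc s)) u x"
  proof (intro add_mono mult_left_mono hn_dq_sum order_refl)
   show "(SUM k. M k) * hn j (s + 2) u x <= M' * hn j (Suc (Suc s)) u x"
    unfolding M'_def add_2_eq_Suc' by (intro mult_right_mono hn_nonneg) simp
  qed (use \<nu> K Suc.prems in auto)
  also have "\<nu> * (M' * hn j (Suc (Suc s)) u x) = (\<mu> / 2) * hn j (Suc (Suc s)) u x"
   using M'pos unfolding \<nu>_def by (simp del: hn.simps)
  finally show "(1/4) * ip j (Suc (Suc s)) u u x <= ip j (Suc s) (Lop j u) u x + \<mu> * hn j (Suc (Suc s)) u x + (1 / \<nu> + K) * hn j (Suc s) u x"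
   by (simp del: hn.simps ip.simps)
 qed
qed

lemma regularity:
 "EX K>=0. ALL j x u. periodic u --> hn j (Suc s) u x <= K * (hn j s u x + hn j s (Lop j u) x)"
proof -
 define c where "c = (1 + real CARD('n)) ^ s"
 have c: "c >= 1" by (simp add: c_def one_le_power)
 \<comment> \<open>Then \<open>4 * c * \<mu>\<close> is 1/2, so that the norm of order
   \<open>Suc s\<close> on the right is absorbed by the left-hand side.\<close>
 define \<mu> where "\<mu> = 1 / (8 * c)"
 have "\<mu> > 0" using c by (simp add: \<mu>_def)
 from garding_higher[OF this, of s] obtain K where K: "K >= 0" "!!j x u. periodic u ==>
   (1/4) * ip j (Suc s) u u x <= ip j s (Lop j u) u x + \<mu> * hn j (Suc s) u x + K * hn j s u x" by blast
 show ?thesis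
 proof (intro exI[of _ "2 * c * (5 + 4 * K)"] conjI allI impI)
  show "2 * c * (5 + 4 * K) >= 0" using c K by simp
  fix j x and u :: "real^'n => real^'k" assume u: "periodic u"
  define P Q R I W where "P = hn j (Suc s) u x" and "Q = hn j s u x" and "R = hn j s (Lop j u) x"
   and "I = ip j (Suc s) u u x" and "W = ip j s (Lop j u) u x"
  have nn: "Q >= 0" "R >= 0" by (simp_all add: Q_def R_def)
  have "W <= R + Q"
   using ip_young[of 1 j s "Lop j u" u x] by (simp add: R_def Q_def W_def)
  moreover have "(1/4) * I <= W + \<mu> * P + K * Q"
   using K(2)[OF u, of j x] by (simp only: P_def Q_def W_def I_def)
  ultimately have "(1/4) * I <= R + Q + \<mu> * P + K * Q" by linarith
  then have "I <= 4 * (R + Q + \<mu> * P + K * Q)" by simp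
  then have "c * (Q + I) <= c * (Q + 4 * (R + Q + \<mu> * P + K * Q))"
   using c by (intro mult_left_mono add_left_mono) auto
  moreover have "P <= c * (Q + I)"
   using hn_Suc_le_ip[of j s u x] by (simp only: P_def Q_def I_def c_def)
  ultimately have "P <= c * (Q + 4 * (R + Q + \<mu> * P + K * Q))" by linarith
  also have "... = c * (4 * R + (5 + 4 * K) * Q) + (4 * c * \<mu>) * P" by (simp add: algebra_simps)
  also have "4 * c * \<mu> = 1/2" using c by (simp add: \<mu>_def)
  finally have "P <= 2 * c * (4 * R + (5 + 4 * K) * Q)" by simp
  also have "... <= 2 * c * ((5 + 4 * K) * R + (5 + 4 * K) * Q)"
   using c K nn by (intro mult_left_mono add_right_mono mult_right_mono) auto
  finally show "hn j (Suc s) u x <= 2 * c * (5 + 4 * K) * (hn j s u x + hn j s (Lop j u) x)"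
   unfolding P_def Q_def R_def by (simp add: algebra_simps del: hn.simps)
 qed
qed

lemma apriori_0: "EX K>=0. ALL j x u. periodic u --> hn j 0 u x <= K * hn j 0 (Lop j u) x"
proof -
 obtain K where K: "K > 0" "!!j x u. periodic u ==> hn j 0 u x <= K * mean j (%y. Lop j u y \<bullet> u y) x"
  using coercive by blast
 have "hn j 0 u x <= (4 * K^2) * hn j 0 (Lop j u) x" if "periodic u" for j x u
 proof -
  have "hn j 0 u x <= K * (2 * K * hn j 0 (Lop j u) x + 1 / (2 * K) * hn j 0 u x)"
  proof (rule order_trans[OF K(2)[OF that] mult_left_mono])
   show "mean j (%y. Lop j u y \<bullet> u y) x <= 2 * K * hn j 0 (Lop j u) x + 1 / (2 * K) * hn j 0 u x"
    using ip_young[of "2 * K" j 0 "Lop j u" u x] K(1) by simp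
  qed (use K in simp)
  also have "... = 2 * K^2 * hn j 0 (Lop j u) x + 1/2 * hn j 0 u x"
   using K(1) by (simp add: distrib_left power2_eq_square del: hn.simps)
  finally show ?thesis by simp
 qed
 then show ?thesis by (intro exI[of _ "4 * K^2"]) simp
qed

text \<open>Coercivity starts the induction, and \<open>regularity\<close> gains one order at a
  time; all constants are independent of the mesh.\<close>

lemma apriori:
 "EX K>=0. ALL j x u. periodic u --> hn j s u x <= K * hn j s (Lop j u) x"
proof (induction s)
 case 0 show ?case by (rule apriori_0)
next
 case (Suc s)
 then obtain K where K: "K >= 0" "!!j x u. periodic u ==> hn j s u x <= K * hn j s (Lop j u) x" by blast
 obtain M where M: "M >= 0" "!!j x u. periodic u ==> hn j (Suc s) u x <= M * (hn j s u x + hn j s (Lop j u) x)"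
  using regularity by blast
 show ?case
 proof (intro exI[of _ "M * (K + 1)"] conjI allI impI)
  show "M * (K + 1) >= 0" using K M by simp
  fix j x and u :: "real^'n => real^'k" assume u: "periodic u"
  have "hn j (Suc s) u x <= M * (K * hn j s (Lop j u) x + hn j s (Lop j u) x)"
   using M(1) K(2)[OF u, of j x] by (intro order_trans[OF M(2)[OF u]] mult_left_mono add_right_mono)
  also have "... <= M * (K * hn j (Suc s) (Lop j u) x + hn j (Suc s) (Lop j u) x)"
   using M(1) K(1) by (intro mult_left_mono add_mono hn_le_Suc)
  finally show "hn j (Suc s) u x <= M * (K + 1) * hn j (Suc s) (Lop j u) x"
   by (simp add: algebra_simps del: hn.simps)
 qed
qed

lemma Lop_tendsto:
 assumes "!!y. (%m. w m y) \<longlonglongrightarrow> u y"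
 shows "(%m. Lop j (w m) x) \<longlonglongrightarrow> Lop j u x"
proof -
 have c: "(%m. cdq i j (w m) y) \<longlonglongrightarrow> cdq i j u y" for i y
  unfolding cdq_def dq_def
  by (intro tendsto_intros assms bounded_linear.tendsto[OF matrix_vector_mul_bounded_linear])
 have f: "(%m. SUM l. a i l j y *\<^sub>R cdq l j (w m) y) \<longlonglongrightarrow> (SUM l. a i l j y *\<^sub>R cdq l j u y)" for i y
  by (intro tendsto_intros c)
 show ?thesis
  unfolding Lop_def cdq_adj_def dq_def
  by (intro tendsto_intros assms f bounded_linear.tendsto[OF matrix_vector_mul_bounded_linear])
qed

text \<open>Since \<open>L\<close> is bounded and coercive, \<open>u \<mapsto> u - s (L u - f)\<close> is a contraction for small \<open>s\<close>.\<close>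
lemma solvable:
 assumes f: "periodic f"
 shows "EX u. periodic u & Lop j u = f"
proof -
 obtain K where K: "K > 0" "!!j x u. periodic u ==> hn j 0 u x <= K * mean j (%y. Lop j u y \<bullet> u y) x"
  using coercive by blast
 obtain B0 where B0: "B0 >= 0" "!!j x u. periodic u ==> hn j 0 (Lop j u) x <= B0 * hn j (0 + 2) u x"
  using dop_Lop unfolding dop_def bdd_op_def by blast
 define B where "B = B0 * (1 + real CARD('n) * (4 / (hstep j)^2)) ^ 2"
 have B: "hn j 0 (Lop j u) x <= B * hn j 0 u x" if "periodic u" for u x
  using order_trans[OF B0(2)[OF that] mult_left_mono[OF hn_le_fixed_step[OF that] B0(1)], of j x]
  by (simp only: B_def mult.assoc add_0)
 have "B >= 0" unfolding B_def using B0(1) by simp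
 define c where "c = 1 / K"
 have c: "c > 0" using K by (simp add: c_def)
 \<comment> \<open>Here \<open>c\<close> is the coercivity constant and \<open>B\<close> bounds the
   operator for this mesh. The choice ensures \<open>s * c <= 1\<close> and
   \<open>s * B <= c\<close>, so that the factor 1 - 2 s c + s^2 B is at most 1 - s c.\<close>
 define s where "s = c / (B + 1 + c^2)"
 have den: "B + 1 + c^2 > 0" using `B >= 0` by (simp add: add_nonneg_pos add_pos_nonneg)
 have s: "s > 0" using c den by (simp add: s_def)
 define q where "q = 1 - s * c"
 have "s * c = c^2 / (B + 1 + c^2)" by (simp add: s_def power2_eq_square)
 then have "s * c <= 1" using den `B >= 0` by (simp add: divide_le_eq_1)
 then have q: "q >= 0" "q < 1" using c s by (auto simp: q_def)
 have sB: "s\<^sup>2 * B <= s * c"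
 proof -
  have "s * B <= c" using den c `B >= 0` by (simp add: s_def divide_simps)
  then have "s * (s * B) <= s * c" using s by (intro mult_left_mono) auto
  then show ?thesis by (simp add: power2_eq_square)
 qed
 have contr: "hn j 0 (%y. u y - s *\<^sub>R Lop j u y) x <= q * hn j 0 u x" if u: "periodic u" for u x
 proof -
  have "hn j 0 (%y. u y - s *\<^sub>R Lop j u y) x = mean j (%y. nsq (u y) + (- 2 * s) * (Lop j u y \<bullet> u y) + s^2 * nsq (Lop j u y)) x"
  proof -
   have "nsq (p - s *\<^sub>R q) = nsq p + (- 2 * s) * (q \<bullet> p) + s^2 * nsq q" for p q :: "real^'k"
    by (simp add: power2_norm_eq_inner inner_diff_left inner_diff_right inner_commute) (simp add: power2_eq_square)
   then show ?thesis by simp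
  qed
  also have "... = hn j 0 u x - 2 * s * mean j (%y. Lop j u y \<bullet> u y) x + s^2 * hn j 0 (Lop j u) x"
   by (simp only: mean_add mean_cmult hn.simps)
  also have "... <= hn j 0 u x - 2 * s * (c * hn j 0 u x) + s^2 * (B * hn j 0 u x)"
  proof -
   have "c * hn j 0 u x <= mean j (%y. Lop j u y \<bullet> u y) x"
    using K(2)[OF u, of j x] K(1) by (simp add: c_def divide_simps mult.commute)
   then have "2 * s * (c * hn j 0 u x) <= 2 * s * mean j (%y. Lop j u y \<bullet> u y) x"
    using s by (intro mult_left_mono) auto
   moreover have "s\<^sup>2 * hn j 0 (Lop j u) x <= s^2 * (B * hn j 0 u x)"
    by (intro mult_left_mono B u) simp
   ultimately show ?thesis by linarith
  qed
  also have "... = (1 - 2 * (s * c) + s^2 * B) * hn j 0 u x" by (simp add: algebra_simps)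
  also have "... <= q * hn j 0 u x"
   using sB by (intro mult_right_mono hn_nonneg) (simp add: q_def mult.commute)
  finally show ?thesis .
 qed
 define w where "w m = ((%u y. u y - s *\<^sub>R (Lop j u y - f y)) ^^ m) (%y. 0)" for m
 have w_Suc: "w (Suc m) = (%y. w m y - s *\<^sub>R (Lop j (w m) y - f y))" for m by (simp add: w_def)
 have pw: "periodic (w m)" for m
 proof (induction m)
  case (Suc m)
  then show ?case unfolding w_Suc using f periodic_Lop[OF Suc] by (simp add: periodic_def)
 qed (simp add: w_def periodic_def)
 define d where "d m = (%y. w (Suc m) y - w m y)" for m
 have pd: "periodic (d m)" for m using pw[of m] pw[of "Suc m"] by (simp add: d_def periodic_def)
 have d_eq: "d m = (%y. - (s *\<^sub>R (Lop j (w m) y - f y)))" for m by (simp add: d_def w_Suc)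
 have "d (Suc m) = (%y. d m y - s *\<^sub>R Lop j (d m) y)" for m
 proof -
  have L: "Lop j (d m) = (%y. Lop j (w (Suc m)) y - Lop j (w m) y)" unfolding d_def by (rule Lop_diff)
  have "d (Suc m) y = d m y - s *\<^sub>R (Lop j (w (Suc m)) y - Lop j (w m) y)" for y
   using fun_cong[OF d_eq[of m], of y] fun_cong[OF d_eq[of "Suc m"], of y] by (simp add: scaleR_diff_right)
  then show ?thesis unfolding L by blast
 qed
 then have dn: "hn j 0 (d m) x <= q ^ m * hn j 0 (d 0) x" for m x
 proof (induction m)
  case (Suc m)
  have "hn j 0 (d (Suc m)) x <= q * hn j 0 (d m) x" using contr[OF pd[of m], of x] Suc.prems by simp
  also have "... <= q * (q ^ m * hn j 0 (d 0) x)" using Suc q(1) by (intro mult_left_mono) auto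
  finally show ?case by (simp only: power_Suc mult.assoc)
 qed simp
 define N where "N = real (nper j) ^ CARD('n)"
 have N: "N >= 0" by (simp add: N_def)
 have db: "norm (d m x) <= sqrt (N * hn j 0 (d 0) x) * sqrt q ^ m" for m x
 proof -
  have "nsq (d m x) <= N * hn j 0 (d m) x"
   using point_le_mean[of "%y. nsq (d m y)" x j] by (simp add: N_def)
  also have "... <= N * (q ^ m * hn j 0 (d 0) x)" by (intro mult_left_mono dn N)
  also have "... = N * hn j 0 (d 0) x * q ^ m" by simp
  finally have "norm (d m x) <= sqrt (N * hn j 0 (d 0) x * q ^ m)" by (rule real_le_rsqrt)
  then show ?thesis by (simp only: real_sqrt_mult real_sqrt_power)
 qed
 have "summable (%m. d m x)" for x
 proof (rule summable_comparison_test[OF _ summable_mult[OF summable_geometric]])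
  show "norm (sqrt q) < 1" using q by simp
  show "EX n0. ALL m>=n0. norm (d m x) <= sqrt (N * hn j 0 (d 0) x) * sqrt q ^ m" using db by blast
 qed
 then have "(%m. \<Sum>k<m. d k x) \<longlonglongrightarrow> (\<Sum>k. d k x)" for x by (rule summable_LIMSEQ)
 moreover have "(\<Sum>k<m. d k x) = w m x" for m x
  unfolding d_def by (subst sum_lessThan_telescope) (simp add: w_def)
 ultimately have lim: "(%m. w m x) \<longlonglongrightarrow> (\<Sum>k. d k x)" for x by simp
 define u where "u x = (\<Sum>k. d k x)" for x
 have lim: "(%m. w m x) \<longlonglongrightarrow> u x" for x using lim by (simp add: u_def)
 have "periodic u" using pd unfolding u_def periodic_def by simp
 moreover have "Lop j u x = f x" for x
 proof -
  have "(%m. w m x - s *\<^sub>R (Lop j (w m) x - f x)) \<longlonglongrightarrow> u x - s *\<^sub>R (Lop j u x - f x)"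
   by (intro tendsto_intros lim Lop_tendsto)
  then have "(%m. w (Suc m) x) \<longlonglongrightarrow> u x - s *\<^sub>R (Lop j u x - f x)" by (simp add: w_Suc)
  moreover have "(%m. w (Suc m) x) \<longlonglongrightarrow> u x" using lim[of x] by (rule LIMSEQ_Suc)
  ultimately have "u x - s *\<^sub>R (Lop j u x - f x) = u x" by (rule LIMSEQ_unique)
  then show ?thesis using s by simp
 qed
 ultimately show ?thesis by blast
qed

theorem bounded_solutions:
 assumes f: "lattice_coeff f"
 obtains u where "lattice_coeff u" "!!j. Lop j (u j) = f j"
proof -
 have "ALL j. EX u. periodic u & Lop j u = f j" using solvable f unfolding lattice_coeff_def by blast
 from choice[OF this] obtain u where u: "!!j. periodic (u j)" "!!j. Lop j (u j) = f j" by blast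
 have "EX K. ALL j x. hn j s (u j) x <= K" for s
 proof -
  obtain K where K: "K >= 0" "!!j x u. periodic u ==> hn j s u x <= K * hn j s (Lop j u) x" using apriori by blast
  obtain M where M: "!!j x. hn j s (f j) x <= M" using hn_bdd_coeff f unfolding lattice_coeff_def by blast
  have "hn j s (u j) x <= K * M" for j x
   using K(2)[OF u(1), of j j x] mult_left_mono[OF M[of j x] K(1)] unfolding u(2) by linarith
  then show ?thesis by blast
 qed
 then have "lattice_coeff u" using bdd_coeff_hn u(1) unfolding lattice_coeff_def by blast
 with u that show thesis by blast
qed

end

subsection \<open>Passing to the limit\<close>

definition lfloor :: "nat => real^'n => real^'n" where
 "lfloor j x = (\<chi> i. hstep j * of_int \<lfloor>x $ i / hstep j\<rfloor>)"

lemma lfloor_bounds: "lfloor j x $ i <= x $ i" "x $ i < lfloor j x $ i + hstep j"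
 using floor_divide_lower[of "hstep j" "x $ i"] floor_divide_upper[of "hstep j" "x $ i"]
 by (simp_all add: lfloor_def algebra_simps)

lemma lfloor_step_int: "lfloor j (x + ax (of_int m * hstep j) i) = lfloor j x + ax (of_int m * hstep j) i"
 by (simp add: lfloor_def vec_eq_iff axis_def add_divide_distrib algebra_simps)

lemma lfloor_step: "lfloor j (x + ax (hstep j) i) = lfloor j x + ax (hstep j) i"
 using lfloor_step_int[of j x 1 i] by simp

lemma lfloor_period: "lfloor j (x + ax 10 i) = lfloor j x + ax 10 i"
 using lfloor_step_int[of j x "int (nper j)" i] hstep_period(1)[of j] by simp

lemma lfloor_idem [simp]: "lfloor j (lfloor j x) = lfloor j x"
 by (simp add: lfloor_def vec_eq_iff)

lemma dq_lfloor: "dq j i (%x. c (lfloor j x)) = (%x. dq j i c (lfloor j x))"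
 by (simp add: dq_def fun_eq_iff lfloor_step)

lemma periodic_lfloor: "periodic c ==> periodic (%x. c (lfloor j x))"
 by (simp add: periodic_def lfloor_period)

text \<open>Solutions on different translates of the lattice are unrelated. Constancy on mesh cells
  singles out one translate and makes values at nearby points comparable up to the mesh
  width.\<close>

definition step_family :: "(nat => real^'n => 'b::real_normed_vector) => bool" where
 "step_family u \<longleftrightarrow> lattice_coeff u & (ALL j x. u j (lfloor j x) = u j x)"

lemma step_family_dq: 
 assumes "step_family u" shows "step_family (%j. dq j i (u j))"
proof -
 have "(%x. u j (lfloor j x)) = u j" for j using assms by (auto simp: step_family_def)
 then have "dq j i (u j) (lfloor j x) = dq j i (u j) x" for j x
  using dq_lfloor[of j i "u j"] by metis
 then show ?thesis using assms lattice_coeff_dq unfolding step_family_def by blast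
qed

lemma step_family_bounded: "step_family u ==> EX K>=0. ALL j x. norm (u j x) <= K"
 unfolding step_family_def lattice_coeff_def by (metis bdd_coeff.simps(1) norm_ge_zero order_trans)

lemma norm_diff_le_pd:
 fixes c :: "real^'n => 'b::real_normed_vector"
 assumes "!!x. c differentiable (at x)" "!!x. norm (pd i c x) <= K" "t >= 0"
 shows "norm (c (x + ax t i) - c x) <= t * K"
proof -
 have d: "((%s. c (x + ax s i)) has_derivative (%s. s *\<^sub>R pd i c (x + ax r i))) (at r within {0..t})" for r
 proof -
  let ?y = "x + ax r i"
  have "((%s. x + ax s i) has_derivative (%s. ax s i)) (at r)"
   by (auto intro!: derivative_eq_intros)
  from has_derivative_compose[OF this assms(1)[of ?y, unfolded frechet_derivative_works]]
  have "((%s. c (x + ax s i)) has_derivative (%s. frechet_derivative c (at ?y) (ax s i))) (at r)" .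
  moreover have "frechet_derivative c (at ?y) (ax s i) = s *\<^sub>R pd i c ?y" for s
   using assms(1)[of ?y] linear_frechet_derivative linear_scale by (fastforce simp: pd_def)
  ultimately show ?thesis by (simp add: has_derivative_at_withinI)
 qed
 have "norm (c (x + ax t i) - c (x + ax 0 i)) <= K * norm (t - 0)"
 proof (rule differentiable_bound[OF _ d])
  show "onorm (%s. s *\<^sub>R pd i c (x + ax r i)) <= K" for r
   by (rule onorm_bound) (use assms(2) in \<open>auto intro: order_trans[OF norm_ge_zero assms(2)] simp: mult.commute[of K] mult_left_mono\<close>)
 qed (use assms in auto)
 then show ?thesis using assms(3) by (simp add: mult.commute)
qed

lemma pd_shift:
 assumes "c differentiable (at (x + v))"
 shows "(%x. c (x + v)) differentiable (at x)" "pd i (%x. c (x + v)) x = pd i c (x + v)"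
proof -
 have "((%x. x + v) has_derivative (%x. x)) (at x)" by (auto intro!: derivative_eq_intros)
 from has_derivative_compose[OF this assms[unfolded frechet_derivative_works]]
 have d: "((%x. c (x + v)) has_derivative frechet_derivative c (at (x + v))) (at x)" .
 show "(%x. c (x + v)) differentiable (at x)" using d unfolding differentiable_def by blast
 show "pd i (%x. c (x + v)) x = pd i c (x + v)" using pd_eq[OF d] by (simp add: pd_def)
qed

lemma pd_dq:
 assumes "!!x. c differentiable (at x)"
 shows "dq j i c differentiable (at x)" "pd k (dq j i c) x = dq j i (pd k c) x"
proof -
 let ?s = "%x. c (x + ax (hstep j) i)"
 have eq: "dq j i c = (%x. (1 / hstep j) *\<^sub>R (?s x - c x))"
  by (simp add: dq_def fun_eq_iff)
 have "(?s has_derivative frechet_derivative ?s (at x)) (at x)" "(c has_derivative frechet_derivative c (at x)) (at x)"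
  using assms pd_shift(1) frechet_derivative_works by blast+
 from has_derivative_scaleR_right[OF has_derivative_diff[OF this]]
 have d: "(dq j i c has_derivative (%v. (1 / hstep j) *\<^sub>R (frechet_derivative ?s (at x) v - frechet_derivative c (at x) v))) (at x)"
  unfolding eq .
 show "dq j i c differentiable (at x)" using d unfolding differentiable_def by blast
 show "pd k (dq j i c) x = dq j i (pd k c) x"
  unfolding pd_eq[OF d, of k] using pd_shift(2)[where c = c and x = x and v = "ax (hstep j) i" and i = k, OF assms]
  by (simp only: pd_def dq_def)
qed

fun bdd_diff :: "nat => (nat => real^'n => 'b::real_normed_vector) => bool" where
 "bdd_diff 0 c \<longleftrightarrow> (EX K. ALL j x. norm (c j x) <= K)"
| "bdd_diff (Suc s) c \<longleftrightarrow> (EX K. ALL j x. norm (c j x) <= K) & (ALL j x. c j differentiable (at x)) & (ALL i. bdd_diff s (%j. pd i (c j)))"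

lemma bdd_diff_dq: "bdd_diff (Suc s) c ==> bdd_diff s (%j. dq j i (c j))"
proof (induction s arbitrary: c)
 case 0
 then have "EX K. ALL j x. norm (pd i (c j) x) <= K" by simp
 then obtain K where K: "!!j x. norm (pd i (c j) x) <= K" by blast
 have "norm (dq j i (c j) x) <= K" for j x
  using norm_diff_le_pd[of "c j" i K "hstep j" x] 0 K by (simp add: dq_def divide_simps mult.commute)
 then show ?case by auto
next
 case (Suc s)
 then have "EX K. ALL j x. norm (pd i (c j) x) <= K" by simp
 then obtain K where K: "!!j x. norm (pd i (c j) x) <= K" by blast
 have "norm (dq j i (c j) x) <= K" for j x
  using norm_diff_le_pd[of "c j" i K "hstep j" x] Suc.prems K by (simp add: dq_def divide_simps mult.commute)
 moreover have "pd k (dq j i (c j)) = dq j i (pd k (c j))" for j k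
  using pd_dq(2)[of "c j"] Suc.prems by (auto simp: fun_eq_iff)
 then have "bdd_diff s (%j. pd k (dq j i (c j)))" for k
  using Suc.IH[of "%j. pd k (c j)"] Suc.prems by simp
 moreover have "dq j i (c j) differentiable (at x)" for j x
  using pd_dq(1)[of "c j"] Suc.prems by simp
 ultimately show ?case unfolding bdd_diff.simps(2) by blast
qed

lemma bdd_diff_mono: "bdd_diff (Suc s) c ==> bdd_diff s c"
proof (induction s arbitrary: c)
 case (Suc s)
 have "bdd_diff s (%j. pd i (c j))" for i
  by (rule Suc.IH) (use Suc.prems in simp)
 with Suc.prems show ?case by simp
qed auto

lemma bdd_diff_step: "bdd_diff s c ==> bdd_coeff s (%j x. c j (lfloor j x))"
proof (induction s arbitrary: c)
 case (Suc s)
 have "bdd_coeff s (%j. dq j i (%x. c j (lfloor j x)))" for i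
  unfolding dq_lfloor using Suc.IH[OF bdd_diff_dq[OF Suc.prems]] .
 with Suc bdd_diff_mono show ?case by auto
qed auto

section \<open>Representatives modulo the period and bounds for periodic functions\<close>

definition wrap :: "real^'n => real^'n => real^'n" where
 "wrap p x = (\<chi> i. x $ i - 10 * of_int \<lfloor>(x $ i - p $ i + 5) / 10\<rfloor>)"

lemma wrap_bounds: "p $ i - 5 <= wrap p x $ i" "wrap p x $ i < p $ i + 5"
 using floor_divide_lower[of 10 "x $ i - p $ i + 5"] floor_divide_upper[of 10 "x $ i - p $ i + 5"]
 by (simp_all add: wrap_def algebra_simps)

lemma periodic_int:
 assumes "periodic f"
 shows "f (x + ax (10 * of_int m) i) = f x"
proof -
 have n: "f (x + ax (10 * real n) i) = f x" for n x
 proof (induction n)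
  case (Suc n)
  have "x + ax (10 * real (Suc n)) i = (x + ax (10 * real n) i) + ax 10 i" by (simp add: algebra_simps)
  then show ?case using Suc assms unfolding periodic_def by metis
 qed simp
 show ?thesis
 proof (cases "m >= 0")
  case True then show ?thesis using n[of x "nat m"] by simp
 next
  case False then show ?thesis using n[of "x + ax (10 * of_int m) i" "nat (- m)"] by simp
 qed
qed

lemma sum_axis: "(SUM i. c i *\<^sub>R axis i (1::real)) = (\<chi> i. c i)"
 by (simp add: vec_eq_iff axis_def if_distrib cong: if_cong)

lemma axis_shifts_invariant:
 fixes f :: "real^'n => 'b"
 assumes "!!i x. f (x + ax (c i) i) = f x"
 shows "f (x + (\<chi> i. c i)) = f x"
proof -
 have "f (x + (\<Sum>i\<in>I. ax (c i) i)) = f x" if "finite I" for I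
  using that
 proof (induction I)
  case (insert i I)
  then have "f (x + (\<Sum>i\<in>insert i I. ax (c i) i)) = f (x + (\<Sum>i\<in>I. ax (c i) i) + ax (c i) i)"
   by (simp add: add_ac)
  also have "... = f x" unfolding assms by (rule insert.IH)
  finally show ?case .
 qed simp
 from this[of UNIV] show ?thesis by (simp add: sum_axis)
qed

lemma periodic_ints: "periodic f ==> f (x + (\<chi> i. 10 * of_int (m i))) = f x"
 by (rule axis_shifts_invariant) (rule periodic_int)

lemma periodic_wrap: "periodic f ==> f (wrap p x) = f x"
 using periodic_ints[of f "wrap p x" "%i. \<lfloor>(x $ i - p $ i + 5) / 10\<rfloor>"]
 by (simp add: wrap_def plus_vec_def)

lemma wrap_cball: "wrap p x \<in> cball p (5 * real CARD('n))" for x :: "real^'n"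
proof -
 have "norm (wrap p x - p) <= (SUM i. \<bar>(wrap p x - p) $ i\<bar>)" by (rule norm_le_l1_cart)
 also have "... <= (\<Sum>i\<in>(UNIV::'n set). 5)"
 proof (rule sum_mono)
  show "\<bar>(wrap p x - p) $ i\<bar> <= 5" for i
   using wrap_bounds(1)[of p i x] wrap_bounds(2)[of p x i] by simp
 qed
 finally show ?thesis by (simp add: dist_norm norm_minus_commute)
qed

lemma periodic_continuous_bounded:
 fixes c :: "real^'n => 'b::real_normed_vector"
 assumes "periodic c" "continuous_on UNIV c"
 obtains K where "!!x. norm (c x) <= K"
proof -
 have "compact (c ` cball 0 (5 * real CARD('n)))"
  by (rule compact_continuous_image[OF continuous_on_subset[OF assms(2)] compact_cball]) simp
 then have "bounded (c ` cball 0 (5 * real CARD('n)))" by (rule compact_imp_bounded)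
 then obtain K where K: "\<forall>z \<in> c ` cball 0 (5 * real CARD('n)). norm z <= K"
  unfolding bounded_iff by blast
 have "norm (c x) <= K" for x
 proof -
  have "c (wrap 0 x) \<in> c ` cball 0 (5 * real CARD('n))" by (rule imageI) (rule wrap_cball)
  then have "norm (c (wrap 0 x)) <= K" using K by (rule bspec[rotated])
  then show ?thesis by (simp only: periodic_wrap[OF assms(1)])
 qed
 with that show thesis by blast
qed

lemma periodic_pd:
 assumes "periodic c" "!!x. c differentiable (at x)"
 shows "periodic (pd i c)"
 unfolding periodic_def
proof (intro allI)
 fix k x
 have "(%x. c (x + ax 10 k)) = c" using assms(1) by (auto simp: periodic_def)
 then show "pd i c (x + ax 10 k) = pd i c x"
  using pd_shift(2)[where c = c and i = i and x = x and v = "ax 10 k", OF assms(2)] by (simp only:)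
qed

lemma smooth_step_family:
 fixes c :: "real^'n => 'b::real_normed_vector"
 assumes "smooth c" "periodic c"
 shows "step_family (%j x. c (lfloor j x))"
proof -
 have "bdd_diff s (%j. c)" for s
  using assms
 proof (induction s arbitrary: c)
  case 0
  then show ?case using periodic_continuous_bounded smooth_on_continuous_on unfolding bdd_diff.simps(1) by blast
 next
  case (Suc s)
  have "c differentiable (at x)" for x using Suc.prems smooth_on_differentiable by blast
  moreover obtain K where "!!x. norm (c x) <= K"
   using periodic_continuous_bounded Suc.prems smooth_on_continuous_on by metis
  moreover have "bdd_diff s (%j. pd i c)" for i
   using Suc.IH Suc.prems periodic_pd smooth_on_pd calculation(1) by blast
  ultimately show ?case unfolding bdd_diff.simps(2) by blast
 qed
 then show ?thesis
  using bdd_diff_step[of _ "%j. c"] periodic_lfloor assms(2) unfolding step_family_def lattice_coeff_def by auto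
qed

lemma bdd_coeff_shift: "bdd_coeff s u ==> bdd_coeff s (%j y. u j (y + v j))"
proof (induction s arbitrary: u)
 case (Suc s)
 have "bdd_coeff s (%j y. dq j i (u j) (y + v j))" for i
  using Suc.IH[of "%j. dq j i (u j)"] Suc.prems by simp
 with Suc show ?case by (simp add: dq_shift)
qed auto

lemma bdd_coeff_add: "bdd_coeff s u ==> bdd_coeff s w ==> bdd_coeff s (%j y. u j y + w j y)"
proof (induction s arbitrary: u w)
 case 0
 then obtain K L where "!!j x. norm (u j x) <= K" "!!j x. norm (w j x) <= L" by auto
 then have "norm (u j x + w j x) <= K + L" for j x by (meson add_mono norm_triangle_le)
 then show ?case by auto
qed (simp add: dq_add)

lemma bdd_coeff_bilinear:
 assumes "bounded_bilinear P"
 shows "bdd_coeff s c ==> bdd_coeff s u ==> bdd_coeff s (%j y. P (c j y) (u j y))"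
proof (induction s arbitrary: c u)
 case 0
 interpret bounded_bilinear P by fact
 obtain K L where KL: "!!j x. norm (c j x) <= K" "!!j x. norm (u j x) <= L" using 0 by auto
 obtain B where B: "!!a b. norm (P a b) <= norm a * norm b * B" "B > 0" using pos_bounded by blast
 have "norm (P (c j x) (u j x)) <= K * L * B" for j x
  using KL[of j x] B(2) by (intro order_trans[OF B(1)] mult_right_mono mult_mono) (auto intro: order_trans[OF norm_ge_zero])
 then show ?case by auto
next
 case (Suc s)
 have "bdd_coeff s (%j. dq j i (%y. P (c j y) (u j y)))" for i
  unfolding dq_bilinear[OF assms]
  by (intro bdd_coeff_add Suc.IH bdd_coeff_shift) (use Suc.prems in auto)
 with Suc show ?case by auto
qed

lemma step_family_add: "step_family u ==> step_family w ==> step_family (%j y. u j y + w j y)"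
 unfolding step_family_def lattice_coeff_def using bdd_coeff_add periodic_add by fastforce

lemma step_family_sum: 
 fixes u :: "'i => nat => real^'n => 'b::real_normed_vector"
 shows "finite K ==> (!!k. k \<in> K ==> step_family (u k)) ==> step_family (%j y. \<Sum>k\<in>K. u k j y)"
proof (induction K rule: finite_induct)
 case empty
 have "bdd_coeff s (%j (y :: real^'n). 0 :: 'b)" for s by (induction s) auto
 then show ?case by (simp add: step_family_def lattice_coeff_def periodic_def)
qed (simp add: step_family_add)

lemma step_family_bilinear:
 assumes "bounded_bilinear P"
 shows "step_family u ==> step_family w ==> step_family (%j y. P (u j y) (w j y))"
 unfolding step_family_def lattice_coeff_def using bdd_coeff_bilinear[OF assms] periodic_bilinear by fastforce

section \<open>Continuity of lattice functions up to the mesh width\<close>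

lemma lattice_lipschitz_nat:
 assumes "!!y. norm (dq j i f y) <= K"
 shows "norm (f (x + ax (real m * hstep j) i) - f x) <= real m * hstep j * K"
proof (induction m)
 case (Suc m)
 let ?y = "x + ax (real m * hstep j) i"
 have "norm (f (?y + ax (hstep j) i) - f ?y) <= hstep j * K"
  using assms[of ?y] by (simp add: dq_def divide_simps mult.commute)
 moreover have "?y + ax (hstep j) i = x + ax (real (Suc m) * hstep j) i" by (simp add: algebra_simps)
 ultimately show ?case using Suc norm_diff_triangle_le by (fastforce simp: algebra_simps)
qed simp

lemma lattice_lipschitz_int:
 assumes "!!y. norm (dq j i f y) <= K"
 shows "norm (f (x + ax (of_int m * hstep j) i) - f x) <= of_int \<bar>m\<bar> * hstep j * K"
proof (cases "m >= 0")
 case True then show ?thesis using lattice_lipschitz_nat[OF assms, where m = "nat m" and x = x] by simp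
next
 case False then show ?thesis 
  using lattice_lipschitz_nat[OF assms, where m = "nat (- m)" and x = "x + ax (of_int m * hstep j) i"]
  by (simp add: norm_minus_commute)
qed

text \<open>One walks from the cell of \<open>y\<close> to the cell of \<open>x\<close> along the
  coordinate directions. In each direction rounding lengthens the walk by at most one mesh
  width.\<close>

lemma step_lipschitz:
 fixes f :: "real^'n => 'b::real_normed_vector"
 assumes "!!i y. norm (dq j i f y) <= K" "!!y. f (lfloor j y) = f y"
 shows "norm (f x - f y) <= K * (SUM i. \<bar>x $ i - y $ i\<bar> + hstep j)"
proof -
 define m where "m i = \<lfloor>x $ i / hstep j\<rfloor> - \<lfloor>y $ i / hstep j\<rfloor>" for i
 have K: "K >= 0" using assms(1) norm_ge_zero order_trans by blast
 have "norm (f (lfloor j y + (\<Sum>i\<in>I. ax (of_int (m i) * hstep j) i)) - f (lfloor j y)) <= (\<Sum>i\<in>I. of_int \<bar>m i\<bar> * hstep j * K)" if "finite I" for I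
  using that
 proof (induction I)
  case (insert i I)
  let ?z = "lfloor j y + (\<Sum>i\<in>I. ax (of_int (m i) * hstep j) i)"
  have step: "norm (f (?z + ax (of_int (m i) * hstep j) i) - f ?z) <= of_int \<bar>m i\<bar> * hstep j * K"
   by (rule lattice_lipschitz_int[OF assms(1)])
  have eq: "lfloor j y + (\<Sum>i\<in>insert i I. ax (of_int (m i) * hstep j) i) = ?z + ax (of_int (m i) * hstep j) i"
   using insert by (simp add: add_ac)
  show ?case by (subst eq, subst sum.insert[OF insert.hyps]) (rule norm_diff_triangle_le[OF step insert.IH])
 qed simp
 from this[of UNIV] have "norm (f (lfloor j y + (SUM i. ax (of_int (m i) * hstep j) i)) - f (lfloor j y)) <= (SUM i. of_int \<bar>m i\<bar> * hstep j * K)"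
  by simp
 moreover have "lfloor j y + (SUM i. ax (of_int (m i) * hstep j) i) = lfloor j x"
  unfolding sum_axis by (simp add: vec_eq_iff lfloor_def m_def algebra_simps)
 moreover have "of_int \<bar>m i\<bar> * hstep j * K <= K * (\<bar>x $ i - y $ i\<bar> + hstep j)" for i
 proof -
  have "hstep j * of_int (m i) = lfloor j x $ i - lfloor j y $ i" by (simp add: m_def lfloor_def algebra_simps)
  then have "\<bar>hstep j * of_int (m i)\<bar> <= \<bar>x $ i - y $ i\<bar> + hstep j"
   using lfloor_bounds(1)[of j x i] lfloor_bounds(1)[of j y i] lfloor_bounds(2)[of x i j] lfloor_bounds(2)[of y i j]
   by linarith
  then have "of_int \<bar>m i\<bar> * hstep j <= \<bar>x $ i - y $ i\<bar> + hstep j" by (simp add: abs_mult mult.commute)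
  from mult_left_mono[OF this K] show ?thesis by (simp add: mult_ac)
 qed
 ultimately have "norm (f (lfloor j x) - f (lfloor j y)) <= (SUM i. K * (\<bar>x $ i - y $ i\<bar> + hstep j))"
  using sum_mono[of UNIV "%i. of_int \<bar>m i\<bar> * hstep j * K"] by (metis (no_types, lifting) order_trans)
 then show ?thesis by (simp add: assms(2) sum_distrib_left)
qed

lemma lattice_taylor:
 assumes "!!y. norm (dq j i (dq j i f) y) <= K"
 shows "norm (f (x + ax (real m * hstep j) i) - f x - (real m * hstep j) *\<^sub>R dq j i f x) <= K * (real m * hstep j)^2"
proof (induction m)
 case (Suc m)
 let ?y = "x + ax (real m * hstep j) i" and ?h = "hstep j"
 have K: "K >= 0" using assms norm_ge_zero order_trans by blast
 have "?y + ax ?h i = x + ax (real (Suc m) * ?h) i" by (simp add: algebra_simps)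
 then have eq: "f (x + ax (real (Suc m) * ?h) i) = f ?y + ?h *\<^sub>R dq j i f ?y"
  using shift_eq_dq[of f ?y j i] by (simp only:)
 have "f (x + ax (real (Suc m) * ?h) i) - f x - (real (Suc m) * ?h) *\<^sub>R dq j i f x
  = (f ?y - f x - (real m * ?h) *\<^sub>R dq j i f x) + ?h *\<^sub>R (dq j i f ?y - dq j i f x)"
  unfolding eq by (simp add: algebra_simps)
 moreover have "norm (?h *\<^sub>R (dq j i f ?y - dq j i f x)) <= ?h * (real m * ?h * K)"
  using lattice_lipschitz_nat[OF assms, where x = x and m = m] by simp
 ultimately have "norm (f (x + ax (real (Suc m) * ?h) i) - f x - (real (Suc m) * ?h) *\<^sub>R dq j i f x)
  <= K * (real m * ?h)^2 + ?h * (real m * ?h * K)"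
  using Suc by (metis (no_types, lifting) add_mono norm_triangle_le)
 also have "... <= K * (real (Suc m) * ?h)^2"
  using K by (simp add: power2_eq_square algebra_simps)
 finally show ?case .
qed simp

lemma hstep_tendsto: "hstep \<longlonglongrightarrow> 0"
proof -
 have "(%j. 5 * (1 / real (Suc j))) \<longlonglongrightarrow> 5 * 0"
  by (intro tendsto_intros LIMSEQ_Suc[OF lim_1_over_n])
 then show ?thesis by (simp add: hstep_def[abs_def])
qed

text \<open>Equicontinuity up to the mesh width upgrades convergence at a point to convergence along
  moving points. This is needed for the backward shift in the adjoint operator and for step counts
  that only approximate a given length.\<close>

lemma step_family_converges_continuously:
 fixes f :: "nat => real^'n => 'b::real_normed_vector"
 assumes "step_family f" "G <= sequentially" "((%j. f j x) \<longlongrightarrow> F) G" "(y \<longlongrightarrow> x) G"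
 shows "((%j. f j (y j)) \<longlongrightarrow> F) G"
proof -
 have "ALL i. EX K. K >= 0 & (ALL j x. norm (dq j i (f j) x) <= K)" using step_family_bounded[OF step_family_dq[OF assms(1)]] by blast
 from choice[OF this] obtain K where K: "!!i. K i >= 0" "!!i j x. norm (dq j i (f j) x) <= K i" by blast
 define L where "L = (SUM i. K i)"
 have L: "norm (dq j i (f j) x) <= L" for i j x
  using K(2)[of j i x] member_le_sum[of i UNIV K] K(1) unfolding L_def by (meson UNIV_I finite order_trans)
 have "((%j. L * (SUM i. \<bar>y j $ i - x $ i\<bar> + hstep j)) \<longlongrightarrow> L * (\<Sum>i\<in>(UNIV::'n set). \<bar>x $ i - x $ i\<bar> + 0)) G"
  by (intro tendsto_intros assms(4) tendsto_mono[OF assms(2) hstep_tendsto])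
 then have "((%j. L * (SUM i. \<bar>y j $ i - x $ i\<bar> + hstep j)) \<longlongrightarrow> 0) G" by simp
 then have "((%j. f j (y j) - f j x) \<longlongrightarrow> 0) G"
  by (rule Lim_null_comparison[rotated])
    (use step_lipschitz[OF L] assms(1) in \<open>auto simp: step_family_def\<close>)
 from tendsto_add[OF this assms(3)] show ?thesis by simp
qed

lemma step_approx:
 assumes "t >= 0" "G <= sequentially"
 shows "((%j. real (nat \<lfloor>t / hstep j\<rfloor>) * hstep j) \<longlongrightarrow> t) G"
proof -
 have b: "\<bar>real (nat \<lfloor>t / hstep j\<rfloor>) * hstep j - t\<bar> <= hstep j" for j
 proof -
  have "real (nat \<lfloor>t / hstep j\<rfloor>) = of_int \<lfloor>t / hstep j\<rfloor>" using assms(1) by simp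
  then show ?thesis using floor_divide_lower[of "hstep j" t] floor_divide_upper[of "hstep j" t]
   by (simp add: abs_le_iff distrib_right del: of_nat_nat)
 qed
 have "((%j. real (nat \<lfloor>t / hstep j\<rfloor>) * hstep j - t) \<longlongrightarrow> 0) G"
  by (rule Lim_null_comparison[OF _ tendsto_mono[OF assms(2) hstep_tendsto]]) (use b in auto)
 from tendsto_add[OF this tendsto_const[of t]] show ?thesis by simp
qed

text \<open>The limit is expanded with a difference quotient of the approximants in the place of its
  derivative. In this form it serves in both directions: to differentiate the limit when the
  quotients converge, and to make the quotients converge when the limit is differentiable.\<close>

lemma limit_taylor:
 fixes f :: "nat => real^'n => 'b::real_normed_vector"
 assumes f: "step_family f" and G: "G <= sequentially" "G ~= bot"
  and F: "!!x. ((%j. f j x) \<longlongrightarrow> F x) G" 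
 shows "EX K>=0. ALL t>=0. \<forall>\<epsilon>>0. ALL x. 
  \<forall>\<^sub>F j in G. norm (F (x + ax t i) - F x - t *\<^sub>R dq j i (f j) x) <= K * t^2 + \<epsilon>"
proof -
 obtain K where K: "K >= 0" "!!j x. norm (dq j i (dq j i (f j)) x) <= K"
  using step_family_bounded[OF step_family_dq[OF step_family_dq[OF f]]] by blast
 obtain M where M: "M >= 0" "!!j x. norm (dq j i (f j) x) <= M"
  using step_family_bounded[OF step_family_dq[OF f]] by blast
 have "\<forall>\<^sub>F j in G. norm (F (x + ax t i) - F x - t *\<^sub>R dq j i (f j) x) <= K * t^2 + \<epsilon>" if t: "t >= 0" and e: "\<epsilon> > 0" for t x \<epsilon>
 proof -
  define s where "s j = real (nat \<lfloor>t / hstep j\<rfloor>) * hstep j" for j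
  have s: "(s \<longlongrightarrow> t) G" unfolding s_def[abs_def] by (rule step_approx[OF t G(1)])
  have "((%j. f j (x + ax (s j) i)) \<longlongrightarrow> F (x + ax t i)) G"
   by (rule step_family_converges_continuously[OF f G(1) F]) (intro tendsto_intros s)
  then have "((%j. norm (F (x + ax t i) - f j (x + ax (s j) i)) + norm (f j x - F x) + \<bar>s j - t\<bar> * M + K * (s j)^2) 
    \<longlongrightarrow> norm (F (x + ax t i) - F (x + ax t i)) + norm (F x - F x) + \<bar>t - t\<bar> * M + K * t^2) G"
   by (intro tendsto_intros F s)
  then have "\<forall>\<^sub>F j in G. norm (F (x + ax t i) - f j (x + ax (s j) i)) + norm (f j x - F x) + \<bar>s j - t\<bar> * M + K * (s j)^2 < K * t^2 + \<epsilon>"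
   by (rule order_tendstoD(2)) (use e in simp)
  then show ?thesis
  proof (rule eventually_mono)
   fix j assume j: "norm (F (x + ax t i) - f j (x + ax (s j) i)) + norm (f j x - F x) + \<bar>s j - t\<bar> * M + K * (s j)^2 < K * t^2 + \<epsilon>"
   have "F (x + ax t i) - F x - t *\<^sub>R dq j i (f j) x
    = (F (x + ax t i) - f j (x + ax (s j) i)) + (f j x - F x) + (s j - t) *\<^sub>R dq j i (f j) x
     + (f j (x + ax (s j) i) - f j x - s j *\<^sub>R dq j i (f j) x)"
    by (simp add: algebra_simps)
   moreover have "norm (f j (x + ax (s j) i) - f j x - s j *\<^sub>R dq j i (f j) x) <= K * (s j)^2"
    unfolding s_def by (rule lattice_taylor[OF K(2)])
   moreover have "norm ((s j - t) *\<^sub>R dq j i (f j) x) <= \<bar>s j - t\<bar> * M"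
    using M(2)[of j x] by (simp add: mult_left_mono)
   ultimately show "norm (F (x + ax t i) - F x - t *\<^sub>R dq j i (f j) x) <= K * t^2 + \<epsilon>"
    using j by (smt (verit) norm_triangle_ineq)
  qed
 qed
 with K(1) show ?thesis by blast
qed

text \<open>The expansion is given for nonnegative \<open>t\<close>. For negative \<open>t\<close>
  it is taken from the other endpoint, and the Lipschitz bound moves \<open>D\<close> back; a
  general increment is split into coordinate steps.\<close>

lemma has_derivative_from_taylor:
 fixes F :: "real^'n => 'b::real_normed_vector"
 assumes T: "!!i t x. t >= 0 ==> norm (F (x + ax t i) - F x - t *\<^sub>R D i x) <= K * t^2"
  and L: "!!i x y. norm (D i x - D i y) <= L * norm (x - y)"
 shows "(F has_derivative (%v. SUM i. (v $ i) *\<^sub>R D i x)) (at x)"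
proof -
 define M where "M = \<bar>K\<bar> + \<bar>L\<bar>"
 have M: "M >= 0" by (simp add: M_def)
 have T': "norm (F (x + ax t i) - F x - t *\<^sub>R D i x) <= M * t^2" for i t x
 proof (cases "t >= 0")
  case True
  have "K * t^2 <= M * t^2" by (intro mult_right_mono) (auto simp: M_def)
  with T[OF True, of x i] show ?thesis by linarith
 next
  case False
  let ?y = "x + ax t i"
  have "norm (F (?y + ax (-t) i) - F ?y - (-t) *\<^sub>R D i ?y) <= K * (-t)^2"
   by (rule T) (use False in simp)
  then have 1: "norm (F x - F ?y + t *\<^sub>R D i ?y) <= K * t^2" by simp
  have "norm (D i ?y - D i x) <= L * \<bar>t\<bar>" using L[of i ?y x] by simp
  then have 2: "norm (t *\<^sub>R (D i ?y - D i x)) <= \<bar>t\<bar> * (L * \<bar>t\<bar>)" by (simp add: mult_left_mono)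
  have eq: "F ?y - F x - t *\<^sub>R D i x = t *\<^sub>R (D i ?y - D i x) - (F x - F ?y + t *\<^sub>R D i ?y)"
   by (simp add: algebra_simps)
  have "norm (F ?y - F x - t *\<^sub>R D i x) <= \<bar>t\<bar> * (L * \<bar>t\<bar>) + K * t^2"
   unfolding eq by (intro order_trans[OF norm_triangle_ineq4] add_mono 1 2)
  also have "... = (L + K) * t^2" by (simp add: algebra_simps power2_eq_square)
  also have "... <= M * t^2" by (intro mult_right_mono) (auto simp: M_def)
  finally show ?thesis .
 qed
 let ?n = "real CARD('n)"
 have est: "norm (F (x + v) - F x - (SUM i. (v $ i) *\<^sub>R D i x)) <= ?n * (M * (1 + ?n)) * nsq v" for v
 proof -
  have "norm (F (x + (\<Sum>i\<in>I. ax (v $ i) i)) - F x - (\<Sum>i\<in>I. (v $ i) *\<^sub>R D i x)) <= real (card I) * ((M * (1 + ?n)) * nsq v)"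
   if "finite I" for I
   using that
  proof (induction I)
   case (insert k I)
   let ?s = "\<Sum>i\<in>I. (v $ i) *\<^sub>R axis i (1::real)"
   let ?z = "x + ?s"
   have vk: "\<bar>v $ i\<bar> <= norm v" for i by (rule component_le_norm_cart)
   have "norm ?s <= (\<Sum>i\<in>I. norm v)" by (rule sum_norm_le) (use vk in auto)
   also have "... <= ?n * norm v"
    using card_mono[of UNIV I] by (simp add: mult_right_mono)
   finally have s: "norm ?s <= ?n * norm v" .
   have "norm (D k ?z - D k x) <= M * (?n * norm v)"
   proof -
    have "norm (D k ?z - D k x) <= L * norm ?s" using L[of k ?z x] by simp
    also have "... <= M * norm ?s" by (intro mult_right_mono) (auto simp: M_def)
    also have "... <= M * (?n * norm v)" by (intro mult_left_mono s M)
    finally show ?thesis .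
   qed
   then have 1: "norm ((v $ k) *\<^sub>R (D k ?z - D k x)) <= norm v * (M * (?n * norm v))"
    using vk[of k] by (simp add: mult_mono)
   have "norm (F (?z + ax (v $ k) k) - F ?z - (v $ k) *\<^sub>R D k ?z) <= M * (v $ k)^2" by (rule T')
   also have "... <= M * nsq v" using vk[of k] M by (intro mult_left_mono) (auto simp: abs_le_square_iff[symmetric])
   finally have 2: "norm (F (?z + ax (v $ k) k) - F ?z - (v $ k) *\<^sub>R D k ?z) <= M * nsq v" .
   have eq: "F (x + (\<Sum>i\<in>insert k I. ax (v $ i) i)) - F x - (\<Sum>i\<in>insert k I. (v $ i) *\<^sub>R D i x)
    = (F ?z - F x - (\<Sum>i\<in>I. (v $ i) *\<^sub>R D i x)) + (v $ k) *\<^sub>R (D k ?z - D k x) + (F (?z + ax (v $ k) k) - F ?z - (v $ k) *\<^sub>R D k ?z)"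
    using insert by (simp add: algebra_simps)
   have "norm (F (x + (\<Sum>i\<in>insert k I. ax (v $ i) i)) - F x - (\<Sum>i\<in>insert k I. (v $ i) *\<^sub>R D i x))
    <= real (card I) * ((M * (1 + ?n)) * nsq v) + norm v * (M * (?n * norm v)) + M * nsq v"
    unfolding eq by (intro norm_triangle_le add_mono insert.IH 1 2)
   also have "... = (real (card I) + 1) * ((M * (1 + ?n)) * nsq v)"
    by (simp add: algebra_simps power2_eq_square)
   finally show ?case using insert by (simp add: add.commute)
  qed simp
  from this[of UNIV] show ?thesis by (simp add: sum_axis mult.assoc)
 qed
 define B where "B = ?n * (M * (1 + ?n))"
 have B: "B >= 0" using M by (simp add: B_def)
 show ?thesis
  unfolding has_derivative_at_alt
 proof (intro conjI allI impI)
  show "bounded_linear (%v. SUM i. (v $ i) *\<^sub>R D i x)"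
   by (intro bounded_linear_sum bounded_linear_scaleR_const bounded_linear_vec_nth)
  fix e :: real assume e: "e > 0"
  show "\<exists>d>0. ALL y. norm (y - x) < d --> norm (F y - F x - (SUM i. ((y - x) $ i) *\<^sub>R D i x)) <= e * norm (y - x)"
  proof (intro exI[of _ "e / (B + 1)"] conjI allI impI)
   show "e / (B + 1) > 0" using e B by simp
   fix y assume y: "norm (y - x) < e / (B + 1)"
   have "norm (F y - F x - (SUM i. ((y - x) $ i) *\<^sub>R D i x)) <= B * nsq (y - x)"
    using est[of "y - x"] unfolding B_def by simp
   also have "... = (B * norm (y - x)) * norm (y - x)" by (simp add: power2_eq_square)
   also have "... <= e * norm (y - x)"
   proof (intro mult_right_mono)
    have "B * norm (y - x) <= (B + 1) * norm (y - x)" by (intro mult_right_mono) auto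
    also have "... <= e" using y B by (simp add: field_simps)
    finally show "B * norm (y - x) <= e" .
   qed simp
   finally show "norm (F y - F x - (SUM i. ((y - x) $ i) *\<^sub>R D i x)) <= e * norm (y - x)" .
  qed
 qed
qed

primrec dqs :: "nat => 'n::finite list => (real^'n => 'b::real_vector) => real^'n => 'b" where
 "dqs j [] f = f"
| "dqs j (i # w) f = dq j i (dqs j w f)"

lemma step_family_dqs: "step_family u ==> step_family (%j. dqs j w (u j))"
 by (induction w) (auto intro: step_family_dq)

text \<open>By Tychonoff's theorem there is a filter along which all iterated difference quotients
 converge at all points.\<close>
lemma convergence_filter:
 fixes u :: "nat => real^'n => 'b::euclidean_space"
 assumes "step_family u"
 obtains G U where "G ~= bot" "G <= sequentially" "!!w x. ((%j. dqs j w (u j) x) \<longlongrightarrow> U w x) G"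
proof -
 have "ALL w. EX K. ALL j x. norm (dqs j w (u j) x) <= K"
  using step_family_bounded[OF step_family_dqs[OF assms]] by blast
 from choice[OF this] obtain K where K: "!!w j x. norm (dqs j w (u j) x) <= K w" by blast
 let ?S = "PiE UNIV (%(w :: 'n list, x :: real^'n). cball (0::'b) (K w))"
 have "compactin (product_topology (%_. euclidean) UNIV) ?S"
  unfolding compactin_PiE by auto
 then have comp: "compact ?S" by (simp add: euclidean_product_topology)
 define E where "E j = (%(w, x). dqs j w (u j) x)" for j
 have "\<forall>\<^sub>F f in filtermap E sequentially. f \<in> ?S"
  unfolding eventually_filtermap by (intro always_eventually allI) (auto simp: E_def K)
 then obtain U0 where U0: "inf (nhds U0) (filtermap E sequentially) ~= bot"
  using comp unfolding compact_filter by (metis filtermap_bot_iff trivial_limit_sequentially)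
 \<comment> \<open>The neighbourhoods of the cluster point are pulled back to indices and
   intersected with the tails; that this filter is proper is precisely the cluster property. A
   filter avoids a diagonal argument over a dense set of points.\<close>
 define G where "G = inf (filtercomap E (nhds U0)) sequentially"
 have "G ~= bot"
 proof
  assume "G = bot"
  then have "\<forall>\<^sub>F j in G. False" by simp
  then obtain P Q where PQ: "eventually P (filtercomap E (nhds U0))" "eventually Q sequentially" "!!j. P j ==> Q j ==> False"
   unfolding G_def eventually_inf by blast
  from PQ(1) obtain R where R: "eventually R (nhds U0)" "!!j. R (E j) ==> P j"
   unfolding eventually_filtercomap by blast
  have "\<forall>\<^sub>F f in filtermap E sequentially. \<not> R f"
   unfolding eventually_filtermap by (rule eventually_mono[OF PQ(2)]) (use PQ(3) R(2) in blast)
  then have "\<forall>\<^sub>F f in inf (nhds U0) (filtermap E sequentially). False"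
   unfolding eventually_inf using R(1) by blast
  with U0 show False by (simp add: eventually_False)
 qed
 moreover have "G <= sequentially" by (simp add: G_def)
 moreover have "((%j. dqs j w (u j) x) \<longlongrightarrow> U0 (w, x)) G" for w x
 proof -
  have "filterlim E (nhds U0) G"
   unfolding G_def by (rule filterlim_mono[OF filterlim_filtercomap order_refl inf_le1])
  moreover have "((%f. f (w, x)) \<longlongrightarrow> U0 (w, x)) (nhds U0)"
  proof (rule topological_tendstoI)
   fix S assume S: "open S" "U0 (w, x) \<in> S"
   have "open ((%f. f (w, x)) -` S :: ('n list \<times> (real, 'n) vec => 'b) set)"
    using continuous_on_product_coordinates[of "(w, x)"] S(1) by (rule open_vimage[rotated])
   then show "\<forall>\<^sub>F f in nhds U0. f (w, x) \<in> S" using S(2) unfolding eventually_nhds by blast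
  qed
  ultimately have "((%j. E j (w, x)) \<longlongrightarrow> U0 (w, x)) G" by (rule filterlim_compose[rotated])
  then show ?thesis by (simp add: E_def)
 qed
 ultimately show thesis using that[of G "%w x. U0 (w, x)"] by blast
qed

lemma limit_has_derivative:
 fixes f :: "nat => real^'n => 'b::real_normed_vector"
 assumes f: "step_family f" and G: "G <= sequentially" "G ~= bot"
  and F: "!!x. ((%j. f j x) \<longlongrightarrow> F x) G" and D: "!!i x. ((%j. dq j i (f j) x) \<longlongrightarrow> D i x) G"
 shows "(F has_derivative (%v. SUM i. (v $ i) *\<^sub>R D i x)) (at x)"
proof -
 have "ALL i. EX K. K >= 0 & (ALL t>=0. \<forall>\<epsilon>>0. ALL x. 
  \<forall>\<^sub>F j in G. norm (F (x + ax t i) - F x - t *\<^sub>R dq j i (f j) x) <= K * t^2 + \<epsilon>)"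
  using limit_taylor[OF f G F] by blast
 from choice[OF this] obtain K where K: "!!i. K i >= 0" "!!i t \<epsilon> x. t >= 0 ==> \<epsilon> > 0 ==> 
  \<forall>\<^sub>F j in G. norm (F (x + ax t i) - F x - t *\<^sub>R dq j i (f j) x) <= K i * t^2 + \<epsilon>" by blast
 have 1: "norm (F (x + ax t i) - F x - t *\<^sub>R D i x) <= (SUM i. K i) * t^2" if t: "t >= 0" for i t x
 proof -
  have "norm (F (x + ax t i) - F x - t *\<^sub>R D i x) <= K i * t^2 + \<epsilon>" if "\<epsilon> > 0" for \<epsilon>
  proof (rule tendsto_upperbound[OF _ K(2)[OF t that, of x i] G(2)])
   show "((%j. norm (F (x + ax t i) - F x - t *\<^sub>R dq j i (f j) x)) \<longlongrightarrow> norm (F (x + ax t i) - F x - t *\<^sub>R D i x)) G"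
    by (intro tendsto_intros D)
  qed
  then have "norm (F (x + ax t i) - F x - t *\<^sub>R D i x) <= K i * t^2" by (rule field_le_epsilon)
  also have "... <= (SUM i. K i) * t^2"
   using member_le_sum[of i UNIV K] K(1) by (intro mult_right_mono) auto
  finally show ?thesis .
 qed
 have "ALL p. EX K. K >= 0 & (ALL j x. norm (dq j (fst p) (dq j (snd p) (f j)) x) <= K)"
  using step_family_bounded[OF step_family_dq[OF step_family_dq[OF f]]] by blast
 from choice[OF this] obtain B where B0: "ALL p. B p >= 0 & (ALL j x. norm (dq j (fst p) (dq j (snd p) (f j)) x) <= B p)" by blast
 have B: "B (i, k) >= 0" "norm (dq j i (dq j k (f j)) x) <= B (i, k)" for i j k x
  using B0[rule_format, of "(i, k)"] by auto
 define L where "L = (SUM p. B p)"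
 have L: "norm (dq j i (dq j k (f j)) x) <= L" for i j k x
  using B(2)[of j i k x] member_le_sum[of "(i, k)" UNIV B] B(1) unfolding L_def by (auto simp: split_paired_all intro: order_trans)
 have "L >= 0" using L norm_ge_zero order_trans by blast
 have 2: "norm (D i x - D i y) <= (L * real CARD('n)) * norm (x - y)" for i x y
 proof (rule tendsto_le[OF G(2)])
  show "((%j. norm (dq j i (f j) x - dq j i (f j) y)) \<longlongrightarrow> norm (D i x - D i y)) G" by (intro tendsto_intros D)
  have "((%j. L * (\<Sum>k\<in>(UNIV :: 'n set). norm (x - y) + hstep j)) \<longlongrightarrow> L * (\<Sum>k\<in>(UNIV :: 'n set). norm (x - y) + 0)) G"
   by (intro tendsto_intros tendsto_mono[OF G(1) hstep_tendsto])
  then show "((%j. L * (\<Sum>k\<in>(UNIV::'n set). norm (x - y) + hstep j)) \<longlongrightarrow> L * real CARD('n) * norm (x - y)) G" by (simp add: mult.assoc)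
  have "norm (dq j i (f j) x - dq j i (f j) y) <= L * (\<Sum>k\<in>(UNIV::'n set). norm (x - y) + hstep j)" for j
  proof -
   have "norm (dq j i (f j) x - dq j i (f j) y) <= L * (SUM k. \<bar>x $ k - y $ k\<bar> + hstep j)"
    by (rule step_lipschitz[OF L]) (use step_family_dq[OF f] in \<open>auto simp: step_family_def\<close>)
   also have "... <= L * (\<Sum>k\<in>(UNIV::'n set). norm (x - y) + hstep j)"
    using `L >= 0` component_le_norm_cart[of "x - y"] by (intro mult_left_mono sum_mono add_right_mono) auto
   finally show ?thesis .
  qed
  then show "\<forall>\<^sub>F j in G. norm (dq j i (f j) x - dq j i (f j) y) <= L * (\<Sum>k\<in>(UNIV::'n set). norm (x - y) + hstep j)" by simp
 qed
 show ?thesis by (rule has_derivative_from_taylor[OF 1 2])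
qed

lemma limit_smooth:
 fixes u :: "nat => real^'n => 'b::euclidean_space"
 assumes "step_family u" "G ~= bot" "G <= sequentially" "!!w x. ((%j. dqs j w (u j) x) \<longlongrightarrow> U w x) G"
 shows "smooth (U w)" "pd i (U w) = U (i # w)"
proof -
 have d: "(U w has_derivative (%v. SUM i. (v $ i) *\<^sub>R U (i # w) x)) (at x)" for w x
  by (rule limit_has_derivative[OF step_family_dqs[OF assms(1), of w] assms(3,2)]) (use assms(4)[of w] assms(4)[of "_ # w"] in auto)
 have pd: "pd i (U w) = U (i # w)" for i w
 proof
  fix x
  have "pd i (U w) x = (SUM k. (axis i 1 $ k) *\<^sub>R U (k # w) x)" by (rule pd_eq[OF d])
  also have "... = (SUM k. if k = i then U (k # w) x else 0)" by (rule sum.cong) (auto simp: axis_def)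
  finally show "pd i (U w) x = U (i # w) x" by simp
 qed
 show "pd i (U w) = U (i # w)" by (rule pd)
 have df: "U w differentiable (at x)" for w x using d differentiable_def by blast
 have "Ck_on m UNIV (U w)" for m w
 proof (induction m arbitrary: w)
  case 0 then show ?case using df by (auto intro!: differentiable_imp_continuous_on simp: differentiable_on_def)
 next
  case (Suc m) then show ?case using df pd by simp
 qed
 then show "smooth (U w)" by (simp add: smooth_on_def)
qed

text \<open>For the discrete flux, convergence is known for the values only, together with
  smoothness of the limit. The uniform bound on second differences gives convergence of the first
  difference quotients.\<close>

lemma limit_dq_eq_pd:
 fixes f :: "nat => real^'n => 'b::real_normed_vector"
 assumes f: "step_family f" and G: "G <= sequentially" "G ~= bot"
  and F: "!!x. ((%j. f j x) \<longlongrightarrow> F x) G" and d: "F differentiable (at x)"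
 shows "((%j. dq j i (f j) x) \<longlongrightarrow> pd i F x) G"
proof (rule tendstoI)
 fix e :: real assume e: "e > 0"
 obtain K where K: "K >= 0" "!!t \<epsilon>. t >= 0 ==> \<epsilon> > 0 ==> 
  \<forall>\<^sub>F j in G. norm (F (x + ax t i) - F x - t *\<^sub>R dq j i (f j) x) <= K * t^2 + \<epsilon>"
  using limit_taylor[OF f G F, of i] by blast
 have "(F has_derivative frechet_derivative F (at x)) (at x)" using d frechet_derivative_works by blast
 then obtain r where r: "r > 0" "!!y. norm (y - x) < r ==> norm (F y - F x - frechet_derivative F (at x) (y - x)) <= (e/4) * norm (y - x)"
  unfolding has_derivative_at_alt using e by (meson divide_pos_pos zero_less_numeral)
 \<comment> \<open>Relative to \<open>t\<close>, the error from the second differences and that from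
   the derivative of \<open>F\<close> are both at most \<open>e / 4\<close>; the slack in the Taylor
   estimate takes another quarter.\<close>
 define t where "t = min (r / 2) (e / (4 * (K + 1)))"
 have t: "t > 0" "t < r" using r(1) e K(1) by (auto simp: t_def)
 have "K * t <= (K + 1) * (e / (4 * (K + 1)))" using K(1) t by (intro mult_mono) (auto simp: t_def)
 moreover have "(K + 1) * (e / (4 * (K + 1))) = e / 4" using K(1) by (simp add: divide_simps)
 ultimately have Kt: "K * t <= e / 4" by (simp only:)
 have "linear (frechet_derivative F (at x))" using d linear_frechet_derivative by blast
 then have "frechet_derivative F (at x) (ax t i) = t *\<^sub>R pd i F x" by (simp add: linear_scale pd_def)
 then have 1: "norm (F (x + ax t i) - F x - t *\<^sub>R pd i F x) <= (e/4) * t"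
  using r(2)[of "x + ax t i"] t by simp
 have "e / 4 * t > 0" using e t by simp
 from K(2)[OF less_imp_le[OF t(1)] this]
 show "\<forall>\<^sub>F j in G. dist (dq j i (f j) x) (pd i F x) < e"
 proof (rule eventually_mono)
  fix j assume j: "norm (F (x + ax t i) - F x - t *\<^sub>R dq j i (f j) x) <= K * t^2 + e / 4 * t"
  have eq: "t *\<^sub>R (dq j i (f j) x - pd i F x) = (F (x + ax t i) - F x - t *\<^sub>R pd i F x) - (F (x + ax t i) - F x - t *\<^sub>R dq j i (f j) x)"
   by (simp add: algebra_simps)
  have "t * norm (dq j i (f j) x - pd i F x) = norm (t *\<^sub>R (dq j i (f j) x - pd i F x))" using t by simp
  also have "... <= (e/4) * t + (K * t^2 + e / 4 * t)"
   unfolding eq by (intro order_trans[OF norm_triangle_ineq4] add_mono 1 j)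
  also have "... = t * (e/4 + K * t + e/4)" by (simp add: power2_eq_square algebra_simps)
  finally have "norm (dq j i (f j) x - pd i F x) <= e/4 + K * t + e/4" using t by simp
  with Kt e show "dist (dq j i (f j) x) (pd i F x) < e" by (simp add: dist_norm)
 qed
qed

lemma lfloor_tendsto: "G <= sequentially ==> ((%j. lfloor j x) \<longlongrightarrow> x) G"
proof (rule vec_tendstoI)
 fix i assume G: "G <= sequentially"
 have "((%j. lfloor j x $ i - x $ i) \<longlongrightarrow> 0) G"
 proof (rule Lim_null_comparison[OF always_eventually tendsto_mono[OF G hstep_tendsto]], rule allI)
  show "norm (lfloor j x $ i - x $ i) <= hstep j" for j
   using lfloor_bounds(1)[of j x i] lfloor_bounds(2)[of x i j] by simp
 qed
 from tendsto_add[OF this tendsto_const[of "x $ i"]] show "((%j. lfloor j x $ i) \<longlongrightarrow> x $ i) G" by simp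
qed

lemma smooth_lfloor_tendsto:
 "smooth c ==> G <= sequentially ==> ((%j. c (lfloor j x)) \<longlongrightarrow> c x) G"
 by (rule isCont_tendsto_compose[OF smooth_on_isCont lfloor_tendsto]) auto

text \<open>The discrete problem with the right-hand side \<open>f\<close> is solved for all meshes; its solutions
 converge along a filter to a solution of the differential equation.\<close>
theorem torus_solution:
 fixes a :: "'n::finite => 'n => real^'n => real" and A :: "'n => real^'n => real^'k^'k"
  and X :: "real^'n => real" and f :: "real^'n => real^'k"
 assumes sa: "!!i l. smooth (a i l)" "!!i l. periodic (a i l)"
  and sA: "!!i. smooth (A i)" "!!i. periodic (A i)"
  and sX: "smooth X" "periodic X" and f: "smooth f" "periodic f"
  and ellipticity: "!!i l x. \<bar>a i l x - (kd i l)\<bar> <= 1 / (2 * real CARD('n))"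
  and X_bounds: "!!x. 0 <= X x" "!!x. X x <= 1"
  and X_cover: "!!i x. 1 <= X x + X (x + ax 5 i)"
 defines "W \<equiv> %u i x. SUM l. a i l x *\<^sub>R (pd l u x + A l x *v u x)"
 obtains u :: "real^'n => real^'k" where "smooth u" "periodic u"
  "!!x. (SUM i. transpose (A i x) *v W u i x - pd i (W u i) x) + X x *\<^sub>R u x = f x"
proof -
 define a' where "a' i l j x = a i l (lfloor j x)" for i l j x
 define A' where "A' i j x = A i (lfloor j x)" for i j x
 define X' where "X' j x = X (lfloor j x)" for j x
 define f' where "f' j x = f (lfloor j x)" for j x
 have sf: "step_family (a' i l)" "step_family (A' i)" "step_family X'" "step_family f'" for i l
  unfolding a'_def[abs_def] A'_def[abs_def] X'_def[abs_def] f'_def[abs_def]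
  by (intro smooth_step_family sa sA sX f)+
 have five: "lfloor j (x + ax 5 i) = lfloor j x + ax 5 i" for j i and x :: "real^'n"
  using lfloor_step_int[of j x "int (Suc j)" i] hstep_period(2)[of j] by simp
 interpret lattice_operator a' A' X'
 proof unfold_locales
  fix i l j x
  show "lattice_coeff (a' i l)" "lattice_coeff (A' i)" "lattice_coeff X'"
   using sf by (auto simp: step_family_def)
  show "\<bar>a' i l j x - (kd i l)\<bar> <= 1 / (2 * real CARD('n))" unfolding a'_def by (rule ellipticity)
  show "0 <= X' j x" "X' j x <= 1" by (simp_all add: X'_def X_bounds)
  show "1 <= X' j x + X' j (x + ax 5 i)" unfolding X'_def five by (rule X_cover)
 qed
 have "lattice_coeff f'" using sf by (auto simp: step_family_def)
 then obtain u0 where u0: "lattice_coeff u0" "!!j. Lop j (u0 j) = f' j" using bounded_solutions by blast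
 \<comment> \<open>The solution on the lattice through the origin is extended by constants over mesh
   cells. The coefficients have been sampled in the same way, so that the discrete equation persists
   at all points.\<close>
 define v where "v j x = u0 j (lfloor j x)" for j x
 have cdq_v: "cdq l j (v j) x = cdq l j (u0 j) (lfloor j x)" for l j x
  using fun_cong[OF dq_lfloor[of j l "u0 j"], of x] by (simp add: cdq_def v_def[abs_def] A'_def)
 define w where "w i j y = (SUM l. a' i l j y *\<^sub>R cdq l j (v j) y)" for i j y
 have eq: "(SUM i. transpose (A' i j x) *v w i j x + (- 1) *\<^sub>R dq j i (w i j) (x - ax (hstep j) i)) + X' j x *\<^sub>R v j x = f' j x" for j x
 proof -
  have w_fl: "w i j y = (SUM l. a' i l j (lfloor j y) *\<^sub>R cdq l j (u0 j) (lfloor j y))" for i y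
   by (simp add: w_def cdq_v a'_def)
  have "dq j i (w i j) y = dq j i (%y. SUM l. a' i l j y *\<^sub>R cdq l j (u0 j) y) (lfloor j y)" for i y
   using fun_cong[OF dq_lfloor[of j i "%y. SUM l. a' i l j y *\<^sub>R cdq l j (u0 j) y"], of y]
   unfolding w_fl[abs_def] .
  moreover have "lfloor j (x - ax (hstep j) i) = lfloor j x - ax (hstep j) i" for i
   using lfloor_step_int[of j x "-1" i] by simp
  ultimately have "(SUM i. transpose (A' i j x) *v w i j x + (- 1) *\<^sub>R dq j i (w i j) (x - ax (hstep j) i)) + X' j x *\<^sub>R v j x
    = Lop j (u0 j) (lfloor j x)"
   unfolding Lop_def cdq_adj_def by (simp only: w_fl) (simp add: A'_def X'_def v_def)
  then show ?thesis by (simp add: u0(2) f'_def)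
 qed
 have bdv: "bdd_coeff s c ==> bdd_coeff s (%j x. c j (lfloor j x))" for s and c :: "nat => real^'n => real^'k"
 proof (induction s arbitrary: c)
  case (Suc s)
  have "bdd_coeff s (%j. dq j i (%x. c j (lfloor j x)))" for i
   unfolding dq_lfloor by (rule Suc.IH) (use Suc.prems in simp)
  with Suc show ?case by simp
 qed auto
 have v: "step_family v"
  using u0(1) bdv periodic_lfloor[of "u0 _"] unfolding step_family_def lattice_coeff_def v_def[abs_def] by auto
 obtain G U where G: "G ~= bot" "G <= sequentially" and U: "!!w x. ((%j. dqs j w (v j) x) \<longlongrightarrow> U w x) G"
  using convergence_filter[OF v] by blast
 define u where "u = U []"
 have u: "smooth u" "!!i. pd i u = U [i]"
  using limit_smooth[OF v G U] by (auto simp: u_def)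
 have vlim: "((%j. v j x) \<longlongrightarrow> u x) G" for x using U[of "[]" x] by (simp add: u_def)
 have dvlim: "((%j. dq j l (v j) x) \<longlongrightarrow> pd l u x) G" for l x using U[of "[l]" x] by (simp add: u(2))
 have wf: "step_family (w i)" for i
  unfolding w_def[abs_def] cdq_def
  by (intro step_family_sum step_family_bilinear[OF bounded_bilinear_scaleR] step_family_add step_family_dq
    step_family_bilinear[OF bounded_bilinear_matrix_vector] sf v finite)
 have wlim: "((%j. w i j x) \<longlongrightarrow> W u i x) G" for i x
  unfolding w_def cdq_def W_def a'_def A'_def
  by (intro tendsto_intros bounded_bilinear.tendsto[OF bounded_bilinear_matrix_vector] smooth_lfloor_tendsto sa sA G dvlim vlim)
 have Wsm: "smooth (W u i)" for i
  unfolding W_def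
  by (intro smooth_on_sum smooth_on_scaleR smooth_on_add smooth_on_pd u sa(1) smooth_on_bilinear[OF bounded_bilinear_matrix_vector] sA(1) open_UNIV)
 have dw: "((%j. dq j i (w i j) (x - ax (hstep j) i)) \<longlongrightarrow> pd i (W u i) x) G" for i x
 proof (rule step_family_converges_continuously[OF step_family_dq[OF wf] G(2)])
  show "((%j. dq j i (w i j) x) \<longlongrightarrow> pd i (W u i) x) G"
   by (rule limit_dq_eq_pd[OF wf G(2,1) wlim]) (use Wsm smooth_on_differentiable in blast)
  have "((%j. x - ax (hstep j) i) \<longlongrightarrow> x - ax 0 i) G"
   by (intro tendsto_intros tendsto_mono[OF G(2) hstep_tendsto])
  then show "((%j. x - ax (hstep j) i) \<longlongrightarrow> x) G" by simp
 qed
 have pde: "(SUM i. transpose (A i x) *v W u i x - pd i (W u i) x) + X x *\<^sub>R u x = f x" for x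
 proof (rule tendsto_unique[OF G(1)])
  show "((%j. f' j x) \<longlongrightarrow> f x) G" unfolding f'_def by (intro smooth_lfloor_tendsto f G)
  have "((%j. (SUM i. transpose (A' i j x) *v w i j x + (- 1) *\<^sub>R dq j i (w i j) (x - ax (hstep j) i)) + X' j x *\<^sub>R v j x)
   \<longlongrightarrow> (SUM i. transpose (A i x) *v W u i x + (- 1) *\<^sub>R pd i (W u i) x) + X x *\<^sub>R u x) G"
   unfolding A'_def X'_def
   by (intro tendsto_intros bounded_bilinear.tendsto[OF bounded_bilinear_transpose_vector] smooth_lfloor_tendsto sA sX G wlim dw vlim)
  then show "((%j. f' j x) \<longlongrightarrow> (SUM i. transpose (A i x) *v W u i x - pd i (W u i) x) + X x *\<^sub>R u x) G"
   unfolding eq by simp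
 qed
 have "periodic u"
  unfolding periodic_def
 proof (intro allI)
  fix i x
  have "(%j. v j (x + ax 10 i)) = (%j. v j x)"
   using v unfolding step_family_def lattice_coeff_def periodic_def by auto
  then show "u (x + ax 10 i) = u x" using vlim[of x] vlim[of "x + ax 10 i"] tendsto_unique[OF G(1)] by simp
 qed
 with u(1) pde that show thesis by blast
qed

section \<open>Integrals of periodic functions\<close>

definition cell :: "real^'n => (real^'n) set" where
 "cell p = cbox (p - (\<chi> i. 5)) (p + (\<chi> i. 5))"

abbreviation (input) "intc p \<equiv> integral (cell p)"

lemma mem_cell: "x \<in> cell p \<longleftrightarrow> (ALL i. \<bar>x $ i - p $ i\<bar> <= 5)"
 by (simp add: cell_def mem_box_cart abs_le_iff) (smt (verit))

lemma wrap_cell: "wrap p x \<in> cell p"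
 using wrap_bounds(1)[of p _ x] wrap_bounds(2)[of p x] by (auto simp: mem_cell abs_le_iff) (smt (verit))+

lemma integral_translate:
 fixes F :: "real^'n => real"
 assumes "continuous_on UNIV F"
 shows "integral (cbox a b) (%x. F (x + c)) = integral (cbox (a + c) (b + c)) F"
proof -
 have "F integrable_on cbox (a + c) (b + c)"
  by (rule integrable_continuous[OF continuous_on_subset[OF assms]]) simp
 then have "(F has_integral integral (cbox (a + c) (b + c)) F) (cbox (a + c) (b + c))" by (rule integrable_integral)
 from has_integral_affinity'[OF this, of 1 c] show ?thesis by (simp add: integral_unique)
qed

text \<open>The shifted cube is cut along the face of the original one, and the protruding slab is
  moved back by one period.\<close>

lemma integral_periodic_shift_axis:
 fixes F :: "real^'n => real"
 assumes F: "continuous_on UNIV F" "periodic F" and t: "0 <= t" "t <= 10"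
 shows "intc p (%x. F (x + ax t i)) = intc p F"
proof -
 let ?e = "axis i (1::real) :: real^'n"
 define a b where "a = p - (\<chi> i. 5)" and "b = p + (\<chi> i. 5)"
 have ab: "b $ j = a $ j + 10" for j by (simp add: a_def b_def)
 have int: "F integrable_on cbox c d" for c d
  by (rule integrable_continuous[OF continuous_on_subset[OF F(1)]]) simp
 have hi: "(F has_integral integral (cbox c d) F) (cbox c d)" for c d by (rule integrable_integral[OF int])
 have eB: "?e \<in> Basis" by (simp add: axis_in_Basis_iff)
 have mem: "x \<in> cbox (a + s *\<^sub>R ?e) (b + r *\<^sub>R ?e) \<longleftrightarrow> (ALL j. j ~= i --> a $ j <= x $ j & x $ j <= b $ j) & a $ i + s <= x $ i & x $ i <= b $ i + r" for x s r
  by (auto simp: mem_box_cart axis_def)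
 have s1: "cbox a b \<inter> {x. x \<bullet> ?e <= a $ i + t} = cbox a (b + (t - 10) *\<^sub>R ?e)"
  "cbox a b \<inter> {x. x \<bullet> ?e >= a $ i + t} = cbox (a + t *\<^sub>R ?e) b"
  "cbox (a + t *\<^sub>R ?e) (b + t *\<^sub>R ?e) \<inter> {x. x \<bullet> ?e <= b $ i} = cbox (a + t *\<^sub>R ?e) b"
  "cbox (a + t *\<^sub>R ?e) (b + t *\<^sub>R ?e) \<inter> {x. x \<bullet> ?e >= b $ i} = cbox (a + 10 *\<^sub>R ?e) (b + t *\<^sub>R ?e)"
  using t mem[where s = 0] mem[where r = 0] mem[where s = 0 and r = 0] mem
  by (auto simp: inner_axis ab simp del: mem_box_cart)
 have "integral (cbox (a + 10 *\<^sub>R ?e) (b + t *\<^sub>R ?e)) F = integral (cbox a (b + (t - 10) *\<^sub>R ?e)) (%x. F (x + 10 *\<^sub>R ?e))"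
  unfolding integral_translate[OF F(1)] by (simp add: algebra_simps)
 also have "... = integral (cbox a (b + (t - 10) *\<^sub>R ?e)) F"
  using F(2) by (simp add: periodic_def)
 finally have per: "integral (cbox (a + 10 *\<^sub>R ?e) (b + t *\<^sub>R ?e)) F = integral (cbox a (b + (t - 10) *\<^sub>R ?e)) F" .
 have "integral (cbox a b) F = integral (cbox a (b + (t - 10) *\<^sub>R ?e)) F + integral (cbox (a + t *\<^sub>R ?e) b) F"
  by (rule integral_unique, rule has_integral_split[OF _ _ eB, where c = "a $ i + t"]) (simp_all only: s1 hi)
 moreover have "integral (cbox (a + t *\<^sub>R ?e) (b + t *\<^sub>R ?e)) F = integral (cbox (a + t *\<^sub>R ?e) b) F + integral (cbox (a + 10 *\<^sub>R ?e) (b + t *\<^sub>R ?e)) F"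
  by (rule integral_unique, rule has_integral_split[OF _ _ eB, where c = "b $ i"]) (simp_all only: s1 hi)
 ultimately show ?thesis
  unfolding cell_def integral_translate[OF F(1)] a_def[symmetric] b_def[symmetric] per by simp
qed

lemma continuous_on_shift: "continuous_on UNIV F ==> continuous_on UNIV (%x :: 'a::real_normed_vector. F (x + v))"
 by (rule continuous_on_compose2[of UNIV F]) (auto intro: continuous_intros)

lemma integrable_cell: "continuous_on UNIV F ==> F integrable_on cell p" for F :: "real^'n => real"
 unfolding cell_def by (rule integrable_continuous[OF continuous_on_subset]) auto

lemma continuous_on_line_avg: "continuous_on UNIV F ==> continuous_on UNIV (line_avg j i F)"
 unfolding line_avg_def by (intro continuous_intros continuous_on_shift) auto

lemma integral_line_avg:
 assumes F: "continuous_on UNIV F" "periodic F"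
 shows "intc p (line_avg j i F) = intc p F"
proof -
 have "intc p (%x. F (x + ax (real t * hstep j) i)) = intc p F" if "t < nper j" for t
 proof (rule integral_periodic_shift_axis[OF F])
  have "real t * hstep j <= real (nper j) * hstep j" using that by (intro mult_right_mono) auto
  then show "real t * hstep j <= 10" using hstep_period(1)[of j] by simp
 qed simp
 then have "intc p (%x. \<Sum>t<nper j. F (x + ax (real t * hstep j) i)) = real (nper j) * intc p F"
  by (subst integral_sum) (auto intro!: integrable_cell continuous_on_shift F)
 then show ?thesis unfolding line_avg_def by (simp add: integral_divide)
qed

lemma integral_mean:
 fixes F :: "real^'n => real"
 assumes "continuous_on UNIV F" "periodic F"
 shows "continuous_on UNIV (mean j F)" "intc p (mean j F) = intc p F"
proof -
 have "continuous_on UNIV (foldr (line_avg j) is F) & intc p (foldr (line_avg j) is F) = intc p F" for "is"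
  using assms(2) by (induction "is") (auto simp: assms(1) continuous_on_line_avg integral_line_avg periodic_foldr)
 then show "continuous_on UNIV (mean j F)" "intc p (mean j F) = intc p F" by (simp_all add: mean_def)
qed

lemma mean_steps: 
 assumes "periodic F" 
 shows "mean j F (x + (\<chi> i. of_int (m i) * hstep j)) = mean j F x"
proof (rule axis_shifts_invariant)
 fix x i
 have n: "mean j F (x + ax (real n * hstep j) i) = mean j F x" for n x
  using mean_shift_steps[OF assms, of j n i x] by (simp add: mean_shift)
 show "mean j F (x + ax (of_int (m i) * hstep j) i) = mean j F x"
 proof (cases "m i >= 0")
  case True then show ?thesis using n[of x "nat (m i)"] by simp
 next
  case False then show ?thesis using n[of "x + ax (of_int (m i) * hstep j) i" "nat (- m i)"] by simp
 qed
qed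

lemma periodic_uniformly_continuous:
 fixes F :: "real^'n => real"
 assumes "continuous_on UNIV F" "periodic F" "e > 0"
 obtains d where "d > 0" "!!x y. dist x y < d ==> dist (F x) (F y) < e"
proof -
 let ?C = "cball (0::real^'n) (5 * real CARD('n) + 1)"
 have "uniformly_continuous_on ?C F"
  by (rule compact_uniformly_continuous[OF continuous_on_subset[OF assms(1)] compact_cball]) simp
 then obtain d where d: "d > 0" "!!x y. x \<in> ?C ==> y \<in> ?C ==> dist x y < d ==> dist (F x) (F y) < e"
  unfolding uniformly_continuous_on_def using assms(3) by meson
 have "dist (F x) (F y) < e" if xy: "dist x y < min d 1" for x y
 proof -
  define v where "v = wrap 0 x - x"
  have w: "F (z + v) = F z" for z
  proof -
   have "v = (\<chi> i. 10 * of_int (- \<lfloor>(x $ i - 0 $ i + 5) / 10\<rfloor>))" by (simp add: v_def wrap_def vec_eq_iff)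
   then show ?thesis using periodic_ints[OF assms(2), of z "%i. - \<lfloor>(x $ i - 0 $ i + 5) / 10\<rfloor>"] by (simp only:)
  qed
  have 1: "norm (x + v) <= 5 * real CARD('n)" using wrap_cball[of 0 x] by (simp add: v_def)
  have 2: "dist (x + v) (y + v) = dist x y" by (simp add: dist_norm)
  have "norm (y + v) <= norm (x + v) + dist (x + v) (y + v)"
   using norm_triangle_sub[of "y + v" "x + v"] by (simp add: dist_norm norm_minus_commute)
  then have "dist (F (x + v)) (F (y + v)) < e" using 1 2 xy by (intro d(2)) auto
  then show ?thesis by (simp only: w)
 qed
 with d(1) that[of "min d 1"] show thesis by auto
qed

lemma content_cell: "measure lborel (cell p) = 10 ^ CARD('n)" for p :: "real^'n"
 unfolding cell_def by (subst content_cbox_cart) (auto simp: interval_ne_empty_cart(1))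

text \<open>The lattice mean has the same integral as \<open>F\<close>, and for a fine mesh it is
  almost constant: it is invariant under lattice steps, and within one mesh cell uniform continuity
  applies.\<close>

lemma mean_tendsto_integral:
 fixes F :: "real^'n => real"
 assumes F: "continuous_on UNIV F" "periodic F"
 shows "(%j. mean j F x) \<longlonglongrightarrow> intc p F / 10 ^ CARD('n)"
proof (rule LIMSEQ_I)
 fix e :: real assume e: "e > 0"
 obtain d where d: "d > 0" "!!x y. dist x y < d ==> dist (F x) (F y) < e / 2"
  using periodic_uniformly_continuous[OF F, of "e / 2"] e by auto
 let ?n = "real CARD('n)"
 have "(%j. ?n * hstep j) \<longlonglongrightarrow> ?n * 0" by (intro tendsto_intros hstep_tendsto)
 then have "\<forall>\<^sub>F j in sequentially. ?n * hstep j < d" using d(1) by (intro order_tendstoD) auto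
 then obtain j0 where j0: "!!j. j >= j0 ==> ?n * hstep j < d" unfolding eventually_sequentially by blast
 show "EX no. ALL j>=no. norm (mean j F x - intc p F / 10 ^ CARD('n)) < e"
 proof (intro exI allI impI)
  fix j assume j: "j >= j0"
  have close: "\<bar>mean j F y - mean j F x\<bar> <= e / 2" for y
  proof -
   define v where "v = (y - x) - lfloor j (y - x)"
   have "norm v <= (SUM i. \<bar>v $ i\<bar>)" by (rule norm_le_l1_cart)
   also have "... <= (\<Sum>i\<in>(UNIV::'n set). hstep j)"
   proof (rule sum_mono)
    show "\<bar>v $ i\<bar> <= hstep j" for i
     using lfloor_bounds(1)[of j "y - x" i] lfloor_bounds(2)[of "y - x" i j] by (simp add: v_def)
   qed
   finally have v: "norm v < d" using j0[OF j] by simp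
   have "y = (x + v) + (\<chi> i. of_int \<lfloor>(y - x) $ i / hstep j\<rfloor> * hstep j)"
    by (simp add: v_def lfloor_def vec_eq_iff mult.commute)
   then have "mean j F y = mean j F (x + v)" using mean_steps[OF F(2), of j "x + v" "%i. \<lfloor>(y - x) $ i / hstep j\<rfloor>"] by simp
   also have "... = mean j (%z. F (z + v)) x" by (simp add: mean_shift)
   finally have "mean j F y - mean j F x = mean j (%z. F (z + v) - F z) x" by (simp add: mean_diff)
   moreover have "\<bar>mean j (%z. F (z + v) - F z) x\<bar> <= mean j (%z. e / 2) x"
    using d(2)[of "_ + v"] v by (intro order_trans[OF mean_abs_le] mean_mono) (auto simp: dist_norm intro: less_imp_le)
   ultimately show ?thesis by simp
  qed
  have ci: "(%y. mean j F x) integrable_on cell p" "mean j F integrable_on cell p"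
   by (auto intro!: integrable_cell integral_mean F)
  have "\<bar>intc p (%y. mean j F y - mean j F x)\<bar> <= intc p (%y. e / 2)"
   using integral_norm_bound_integral[of "%y. mean j F y - mean j F x" "cell p" "%y. e / 2"] close
   by (simp add: integrable_diff[OF ci(2,1)] integrable_cell)
  moreover have "intc p (%y. mean j F y - mean j F x) = intc p F - 10 ^ CARD('n) * mean j F x"
   using integral_diff[OF ci(2,1)] integral_mean(2)[OF F, of p j] content_cell[of p] by (simp add: cell_def)
  moreover have "intc p (%y. e / 2) = 10 ^ CARD('n) * (e / 2)"
   using content_cell[of p] by (simp add: cell_def)
  ultimately have "\<bar>intc p F / 10 ^ CARD('n) - mean j F x\<bar> <= e / 2"
   by (simp add: abs_le_iff field_simps)
  then show "norm (mean j F x - intc p F / 10 ^ CARD('n)) < e" using e by (simp add: abs_minus_commute)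
 qed
qed

lemma integral_cell_mono:
 fixes F :: "real^'n => real"
 assumes "continuous_on UNIV F" "continuous_on UNIV H" "!!x. F x <= H x"
 shows "intc p F <= intc p H"
 by (intro integral_le integrable_cell assms)

lemma smooth_periodic_pd:
 fixes f :: "real^'n => real"
 assumes f: "smooth f" "periodic f"
 shows "continuous_on UNIV (pd i f)" "periodic (pd i f)"
 by (rule smooth_on_continuous_on[OF smooth_on_pd[OF f(1)]])
   (rule periodic_pd[OF f(2) smooth_on_differentiable[OF f(1) UNIV_I]])

lemma dq_close_pd:
 fixes f :: "real^'n => real"
 assumes f: "smooth f" "periodic f" and e: "e > 0"
 shows "\<forall>\<^sub>F j in sequentially. ALL x. \<bar>dq j i f x - pd i f x\<bar> <= e"
proof -
 have d: "f differentiable (at x)" for x using f smooth_on_differentiable by blast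
 obtain r where r: "r > 0" "!!x y. dist x y < r ==> dist (pd i f x) (pd i f y) < e"
  using periodic_uniformly_continuous[OF smooth_periodic_pd[OF f] e] by blast
 have close: "\<bar>dq j i f x - pd i f x\<bar> <= e" if "hstep j < r" for j x
 proof -
  have "EX s. 0 < s & s < hstep j & f (x + ax (hstep j) i) - f (x + ax 0 i) = (hstep j - 0) * pd i f (x + ax s i)"
  proof (rule MVT2)
   show "((%s. f (x + ax s i)) has_real_derivative pd i f (x + ax s i)) (at s)" for s by (rule line_derivative[OF d])
  qed simp
  then obtain s where s: "0 < s" "s < hstep j" "f (x + ax (hstep j) i) - f x = hstep j * pd i f (x + ax s i)" by auto
  then have "dq j i f x = pd i f (x + ax s i)" by (simp add: dq_def)
  then show ?thesis using r(2)[of "x + ax s i" x] s that by (simp add: dist_norm)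
 qed
 show ?thesis by (rule eventually_mono[OF order_tendstoD(2)[OF hstep_tendsto r(1)]]) (intro allI close)
qed

text \<open>Differences of the form \<open>f (x + h e) - f x\<close> have mean zero; divide by \<open>h\<close> and let \<open>h\<close> tend to zero.\<close>
lemma integral_cell_pd:
 fixes f :: "real^'n => real"
 assumes f: "smooth f" "periodic f"
 shows "intc p (pd i f) = 0"
proof -
 have "\<bar>intc p (pd i f) / 10 ^ CARD('n)\<bar> <= 0 + e" if e: "e > 0" for e
 proof -
  have z: "mean j (dq j i f) 0 = 0" for j
  proof -
   have "mean j (dq j i f) 0 = mean j (%y. (f (y + ax (hstep j) i) - f y) / hstep j) 0"
    by (simp add: dq_def[abs_def])
   then show ?thesis by (simp add: mean_divide mean_diff mean_shift_step[OF f(2)])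
  qed
  have "\<forall>\<^sub>F j in sequentially. \<bar>mean j (pd i f) 0\<bar> <= e"
  proof (rule eventually_mono[OF dq_close_pd[OF f e]])
   fix j assume "ALL x. \<bar>dq j i f x - pd i f x\<bar> <= e"
   then have "\<bar>mean j (%y. dq j i f y - pd i f y) 0\<bar> <= mean j (%y. e) (0 :: real^'n)"
    by (intro order_trans[OF mean_abs_le] mean_mono) blast
   then show "\<bar>mean j (pd i f) 0\<bar> <= e" using z[of j] by (simp add: mean_diff)
  qed
  then show ?thesis
   using tendsto_upperbound[OF tendsto_rabs[OF mean_tendsto_integral[OF smooth_periodic_pd[OF f]]]] by fastforce
 qed
 then have "\<bar>intc p (pd i f) / 10 ^ CARD('n)\<bar> <= 0" by (rule field_le_epsilon)
 then show ?thesis by (simp only: abs_le_zero_iff divide_eq_0_iff) simp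
qed

text \<open>Poincare: compare the value at \<open>x\<close> with the value at the opposite point of the cell.\<close>
lemma integral_cell_poincare:
 fixes w X :: "real^'n => real"
 assumes w: "smooth w" "periodic w" and X: "continuous_on UNIV X" "periodic X"
  and X_cover: "!!x. 1 <= X x + X (x + ax 5 i)" and X_bounds: "!!x. X x >= 0" "!!x. X x <= 1"
 shows "intc p (%x. \<bar>w x\<bar>) <= 2 * intc p (%x. X x * \<bar>w x\<bar>) + 5 * intc p (%x. \<bar>pd i w x\<bar>)"
proof -
 have d: "w differentiable (at x)" for x using w smooth_on_differentiable by blast
 have cw: "continuous_on UNIV (%x. \<bar>w x\<bar>)" "periodic (%x. \<bar>w x\<bar>)" 
  using w continuous_on_rabs[OF smooth_on_continuous_on[OF w(1)]] by (auto simp: periodic_def)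
 have cX: "continuous_on UNIV (%x. X x * \<bar>w x\<bar>)" "periodic (%x. X x * \<bar>w x\<bar>)"
  using cw X by (auto intro: continuous_on_mult simp: periodic_def)
 have "periodic (pd i w)" by (rule periodic_pd[OF w(2) d])
 then have cp: "continuous_on UNIV (%x. \<bar>pd i w x\<bar>)" "periodic (%x. \<bar>pd i w x\<bar>)"
  using continuous_on_rabs[OF smooth_on_continuous_on[OF smooth_on_pd[OF w(1)]]] by (auto simp: periodic_def)
 let ?e = "5 *\<^sub>R axis i (1::real) :: real^'n"
 have "mean j (%x. \<bar>w x\<bar>) 0 <= 2 * mean j (%x. X x * \<bar>w x\<bar>) 0 + 5 * mean j (%x. \<bar>dq j i w x\<bar>) 0" for j
 proof -
  let ?p = "%y t. y + ax (real t * hstep j) i"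
  have e5: "?p y (Suc j) = y + ?e" for y using hstep_period(2)[of j] by simp
  have tel: "w (?p x m) - w x = (\<Sum>t<m. hstep j * dq j i w (?p x t))" for x m
  proof (induction m)
   case (Suc m)
   have "?p x (Suc m) = ?p x m + ax (hstep j) i" by (simp add: algebra_simps)
   then have "w (?p x (Suc m)) = w (?p x m) + hstep j * dq j i w (?p x m)" using shift_eq_dq[of w "?p x m" j i] by (simp only: real_scaleR_def)
   with Suc show ?case by simp
  qed simp
  have "\<bar>w x\<bar> <= X x * \<bar>w x\<bar> + (X (x + ?e) * \<bar>w (x + ?e)\<bar> + (\<Sum>t<Suc j. hstep j * \<bar>dq j i w (?p x t)\<bar>))" for x
  proof -
   let ?S = "\<Sum>t<Suc j. hstep j * \<bar>dq j i w (?p x t)\<bar>"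
   have "\<bar>w (x + ?e) - w x\<bar> <= ?S"
    unfolding e5[symmetric] tel by (rule order_trans[OF sum_abs]) (simp add: abs_mult del: sum.lessThan_Suc)
   then have 1: "\<bar>w x\<bar> <= \<bar>w (x + ?e)\<bar> + ?S" by linarith
   have S: "?S >= 0" by (intro sum_nonneg) auto
   have "1 * \<bar>w x\<bar> <= (X x + X (x + ?e)) * \<bar>w x\<bar>" by (intro mult_right_mono X_cover) simp
   also have "... <= X x * \<bar>w x\<bar> + X (x + ?e) * (\<bar>w (x + ?e)\<bar> + ?S)"
    using mult_left_mono[OF 1 X_bounds(1)[of "x + ?e"]] by (simp only: distrib_right)
   also have "... <= X x * \<bar>w x\<bar> + (X (x + ?e) * \<bar>w (x + ?e)\<bar> + ?S)"
    using mult_right_mono[OF X_bounds(2)[of "x + ?e"] S] by (simp only: distrib_left)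
   finally show ?thesis by simp
  qed
  from mean_mono[where j = j and x = 0, OF this]
  have "mean j (%x. \<bar>w x\<bar>) 0 <= mean j (%x. X x * \<bar>w x\<bar>) 0 + (mean j (%x. X (x + ?e) * \<bar>w (x + ?e)\<bar>) 0 
    + (\<Sum>t<Suc j. hstep j * mean j (%x. \<bar>dq j i w (?p x t)\<bar>) 0))"
   by (simp only: mean_add mean_sum mean_cmult)
  moreover have "mean j (%x. X (x + ?e) * \<bar>w (x + ?e)\<bar>) 0 = mean j (%x. X x * \<bar>w x\<bar>) 0"
   using mean_shift_steps[OF cX(2), of j "Suc j" i 0] unfolding e5 .
  moreover have "mean j (%x. \<bar>dq j i w (?p x t)\<bar>) 0 = mean j (%x. \<bar>dq j i w x\<bar>) 0" for t
  proof (rule mean_shift_steps)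
   show "periodic (%x. \<bar>dq j i w x\<bar>)" using periodic_dq[OF w(2), of j i] by (simp add: periodic_def)
  qed
  moreover have "(\<Sum>t<Suc j. hstep j * q) = 5 * q" for q
  proof -
   have "(\<Sum>t<Suc j. hstep j * q) = (real (Suc j) * hstep j) * q" by (simp only: sum_constant card_lessThan mult.assoc)
   then show ?thesis by (simp only: hstep_period)
  qed
  ultimately show ?thesis by (simp only:)
 qed
 then have A: "mean j (%x. \<bar>w x\<bar>) 0 <= 2 * mean j (%x. X x * \<bar>w x\<bar>) 0 + 5 * mean j (%x. \<bar>dq j i w x\<bar>) 0" for j .
 have "intc p (%x. \<bar>w x\<bar>) / 10 ^ CARD('n) <= 2 * (intc p (%x. X x * \<bar>w x\<bar>) / 10 ^ CARD('n)) 
  + 5 * (intc p (%x. \<bar>pd i w x\<bar>) / 10 ^ CARD('n) + e)" if e: "e > 0" for e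
 proof (rule tendsto_le[OF sequentially_bot _ mean_tendsto_integral[OF cw]])
  show "(%j. 2 * mean j (%x. X x * \<bar>w x\<bar>) 0 + 5 * (mean j (%x. \<bar>pd i w x\<bar>) 0 + e)) \<longlonglongrightarrow>
   2 * (intc p (%x. X x * \<bar>w x\<bar>) / 10 ^ CARD('n)) + 5 * (intc p (%x. \<bar>pd i w x\<bar>) / 10 ^ CARD('n) + e)"
   by (intro tendsto_intros mean_tendsto_integral cX cp)
  show "\<forall>\<^sub>F j in sequentially. mean j (%x. \<bar>w x\<bar>) 0 <= 2 * mean j (%x. X x * \<bar>w x\<bar>) 0 + 5 * (mean j (%x. \<bar>pd i w x\<bar>) 0 + e)"
  proof (rule eventually_mono[OF dq_close_pd[OF w e, of i]])
   fix j assume c: "ALL x. \<bar>dq j i w x - pd i w x\<bar> <= e"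
   have "mean j (%x. \<bar>dq j i w x\<bar>) 0 <= mean j (%x. \<bar>pd i w x\<bar> + e) 0"
   proof (rule mean_mono)
    show "\<bar>dq j i w y\<bar> <= \<bar>pd i w y\<bar> + e" for y using c[rule_format, of y] by linarith
   qed
   then show "mean j (%x. \<bar>w x\<bar>) 0 <= 2 * mean j (%x. X x * \<bar>w x\<bar>) 0 + 5 * (mean j (%x. \<bar>pd i w x\<bar>) 0 + e)"
    using A[of j] by (simp add: mean_add)
  qed
 qed
 then have "intc p (%x. \<bar>w x\<bar>) / 10 ^ CARD('n) <= (2 * (intc p (%x. X x * \<bar>w x\<bar>) / 10 ^ CARD('n)) 
  + 5 * (intc p (%x. \<bar>pd i w x\<bar>) / 10 ^ CARD('n))) + e" if e: "e > 0" for e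
  using that[THEN divide_pos_pos, of 5] by (fastforce simp: algebra_simps)
 then have "intc p (%x. \<bar>w x\<bar>) / 10 ^ CARD('n) <= 2 * (intc p (%x. X x * \<bar>w x\<bar>) / 10 ^ CARD('n)) 
  + 5 * (intc p (%x. \<bar>pd i w x\<bar>) / 10 ^ CARD('n))" by (rule field_le_epsilon)
 then show ?thesis by (simp add: field_simps)
qed

section \<open>The harmonic sections on the torus\<close>

lemma second_derivative_test:
 fixes f :: "real^'n => real"
 assumes S: "open S" "x \<in> S" and f: "smooth_on S f" and max: "!!y. y \<in> S ==> f y <= f x"
 shows "pd i f x = 0" "(SUM i l. v $ i * v $ l * pd i (pd l f) x) <= 0"
proof -
 have d: "f differentiable (at y)" if "y \<in> S" for y using f that smooth_on_differentiable by blast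
 have z: "pd l f x = 0" for l
  using differential_zero_maxmin[OF S(2,1) differentiable_has_derivative_pd[OF d[OF S(2)]]] max
   pd_eq[OF differentiable_has_derivative_pd[OF d[OF S(2)]], of l] by metis
 then show "pd i f x = 0" by blast
 define \<phi> where "\<phi> t = f (x + t *\<^sub>R v)" for t
 define \<psi> where "\<psi> t = (SUM l. v $ l * pd l f (x + t *\<^sub>R v))" for t
 have "((%t. v $ l * pd l f (x + t *\<^sub>R v)) has_real_derivative v $ l * (SUM i. v $ i * pd i (pd l f) (x + 0 *\<^sub>R v))) (at 0)" for l
  by (rule DERIV_cmult[OF line_derivative_dir]) (use smooth_on_pd[OF f] smooth_on_differentiable S(2) in auto)
 then have "(\<psi> has_real_derivative (SUM l. v $ l * (SUM i. v $ i * pd i (pd l f) (x + 0 *\<^sub>R v)))) (at 0)"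
  unfolding \<psi>_def[abs_def] by (rule DERIV_sum)
 moreover have "(SUM l. v $ l * (SUM i. v $ i * pd i (pd l f) (x + 0 *\<^sub>R v))) = (SUM i l. v $ i * v $ l * pd i (pd l f) x)"
  unfolding sum_distrib_left by (subst sum.swap) (simp add: mult_ac)
 ultimately have \<psi>': "(\<psi> has_real_derivative (SUM i l. v $ i * v $ l * pd i (pd l f) x)) (at 0)" by simp
 show "(SUM i l. v $ i * v $ l * pd i (pd l f) x) <= 0"
 proof (rule ccontr)
  assume "\<not> ?thesis"
  then have "(SUM i l. v $ i * v $ l * pd i (pd l f) x) > 0" by simp
  from DERIV_pos_inc_right[OF \<psi>' this] obtain r where r: "r > 0" "!!h. h > 0 ==> h < r ==> \<psi> 0 < \<psi> h" by auto
  have \<psi>0: "\<psi> 0 = 0" by (simp add: \<psi>_def z)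
  have "((%t. x + t *\<^sub>R v) \<longlongrightarrow> x + 0 *\<^sub>R v) (at 0)" by (intro tendsto_intros)
  then have "\<forall>\<^sub>F t in at 0. x + t *\<^sub>R v \<in> S" using S by (auto dest: topological_tendstoD)
  then obtain q where q: "q > 0" "!!t. t ~= 0 ==> \<bar>t\<bar> < q ==> x + t *\<^sub>R v \<in> S"
   unfolding eventually_at by (auto simp: dist_norm)
  define t where "t = min r q / 2"
  have t: "t > 0" "t < r" "t < q" using r q by (auto simp: t_def)
  have inS: "x + s *\<^sub>R v \<in> S" if "0 <= s" "s <= t" for s using q(2)[of s] S(2) that t by (cases "s = 0") auto
  have "EX s. 0 < s & s < t & \<phi> t - \<phi> 0 = (t - 0) * \<psi> s"
   by (rule MVT2[OF t(1)]) (unfold \<phi>_def \<psi>_def, rule line_derivative_dir, rule d, rule inS)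
  then obtain s where s: "0 < s" "s < t" "\<phi> t - \<phi> 0 = t * \<psi> s" by auto
  have "\<psi> s > 0" using r(2)[of s] s t \<psi>0 by simp
  then have "\<phi> t > \<phi> 0" using s(3) t(1) by (metis diff_gt_0_iff_gt mult_pos_pos)
  moreover have "\<phi> t <= \<phi> 0" unfolding \<phi>_def using max[OF inS[of t]] t by simp
  ultimately show False by simp
 qed
qed

text \<open>Avoids diagonalisation. Testing \<open>H\<close> with sums and differences of two basis
  vectors bounds its symmetrised off-diagonal entries by the diagonal ones; since \<open>a\<close>
  is within 1/(2n) of the identity, the errors consume at most half of the trace.\<close>

lemma contract_nonpos:
 fixes a H :: "'n::finite => 'n => real"
 assumes sym: "!!i l. a i l = a l i" and ell: "!!i l. \<bar>a i l - (kd i l)\<bar> <= 1 / (2 * real CARD('n))"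
  and H: "!!v :: real^'n. (SUM i l. v $ i * v $ l * H i l) <= 0"
 shows "(SUM i l. a i l * H i l) <= 0"
proof -
 let ?n = "real CARD('n)" and ?d = "%i l. if i = l then 1 else (0::real)"
 have delta: "(SUM l. ((if l = k then s else 0) + (if l = m then t else 0)) * G l) = s * G k + t * G m" for k m :: 'n and s t :: real and G
  by (simp add: distrib_right sum.distrib if_distrib[of "%z. z * _"] cong: if_cong)
 have quad: "(SUM i l. (axis k s + axis m t :: real^'n) $ i * (axis k s + axis m t) $ l * H i l)
   = s * s * H k k + s * t * H k m + t * s * H m k + t * t * H m m" for k m s t
 proof -
  have "(SUM i l. (axis k s + axis m t :: real^'n) $ i * (axis k s + axis m t) $ l * H i l)
   = (SUM i l. ((if i = k then s else 0) + (if i = m then t else 0)) * (((if l = k then s else 0) + (if l = m then t else 0)) * H i l))"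
   by (simp add: axis_def mult.assoc)
  also have "... = (SUM i. ((if i = k then s else 0) + (if i = m then t else 0)) * (SUM l. ((if l = k then s else 0) + (if l = m then t else 0)) * H i l))"
   by (simp only: sum_distrib_left)
  also have "... = s * (s * H k k + t * H k m) + t * (s * H m k + t * H m m)"
   by (simp only: delta)
  also have "... = s * s * H k k + s * t * H k m + t * s * H m k + t * t * H m m" by (simp add: algebra_simps)
  finally show ?thesis .
 qed
 have Hd: "H k k <= 0" for k using H[of "axis k 1 + axis k 0"] unfolding quad by simp
 have off: "\<bar>H k m + H m k\<bar> <= - (H k k + H m m)" for k m
  using H[of "axis k 1 + axis m 1"] H[of "axis k 1 + axis m (-1)"] unfolding quad by (simp add: abs_le_iff)
 have "(SUM i l. a i l * H i l) = (SUM i l. a i l * H l i)"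
  by (subst sum.swap) (simp add: sym)
 then have "2 * (SUM i l. a i l * H i l) = (SUM i l. a i l * (H i l + H l i))"
  by (simp add: distrib_left sum.distrib)
 also have "... <= (SUM i l. ?d i l * (2 * H i i) + 1 / (2 * ?n) * (- (H i i + H l l)))"
 proof (intro sum_mono)
  fix i l
  have "(a i l - ?d i l) * (H i l + H l i) <= \<bar>a i l - ?d i l\<bar> * \<bar>H i l + H l i\<bar>" by (metis abs_ge_self abs_mult)
  also have "... <= 1 / (2 * ?n) * (- (H i i + H l l))" by (intro mult_mono ell off) auto
  finally have "(a i l - ?d i l) * (H i l + H l i) <= 1 / (2 * ?n) * (- (H i i + H l l))" .
  moreover have "?d i l * (H i l + H l i) = ?d i l * (2 * H i i)" by auto
  ultimately show "a i l * (H i l + H l i) <= ?d i l * (2 * H i i) + 1 / (2 * ?n) * (- (H i i + H l l))"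
   by (simp only: left_diff_distrib)
 qed
 also have "... = (SUM i. 2 * H i i) + 1 / (2 * ?n) * (- (2 * ?n * (SUM i. H i i)))"
 proof -
  have "(SUM i l. - (H i i + H l l)) = - (2 * ?n * (SUM i. H i i))"
   by (simp add: sum_negf sum_subtractf sum.distrib flip: sum_distrib_left)
  moreover have "(SUM i l. ?d i l * (2 * H i i)) = (SUM i. 2 * H i i)"
   by (simp add: if_distrib[of "%z. z * _"] cong: if_cong)
  ultimately show ?thesis by (simp only: sum.distrib flip: sum_distrib_left)
 qed
 also have "... = (SUM i. H i i)" by (simp flip: sum_distrib_left)
 also have "... <= 0" by (intro sum_nonpos Hd)
 finally show ?thesis by simp
qed

lemma wrap_eq: "(!!i. \<bar>y $ i - p $ i\<bar> < 5) ==> wrap p y = y"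
proof -
 assume y: "!!i. \<bar>y $ i - p $ i\<bar> < 5"
 have "\<lfloor>(y $ i - p $ i + 5) / 10\<rfloor> = 0" for i using y[of i] by (simp add: floor_eq_iff abs_less_iff)
 then show ?thesis by (simp add: wrap_def)
qed

lemma matrix_vector_minus_left: "(- B) *v v = - (B *v v)" for B :: "real^'n^'m"
 using matrix_vector_mult_diff_rdistrib[of 0 B v] by simp

text \<open>\<open>X_zero\<close> confines the zeros of the potential, modulo the period, to a ball
  about \<open>p\<close>, and \<open>a_deriv\<close> makes the squared distance from
  \<open>p\<close> strictly subharmonic there. Together they yield the maximum principle although
  the potential may vanish on an open set.\<close>

locale torus_operator =
 fixes p :: "real^'n" and a :: "'n => 'n => real^'n => real"
  and A :: "'n => real^'n => real^'k^'k" and X :: "real^'n => real"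
 assumes a: "smooth (a i l)" "periodic (a i l)" "a i l x = a l i x"
  and A: "smooth (A i)" "periodic (A i)" "transpose (A i x) = - A i x"
  and X: "smooth X" "periodic X" "0 <= X x" "X x <= 1"
  and ellipticity: "\<bar>a i l x - (kd i l)\<bar> <= 1 / (2 * real CARD('n))"
  and X_cover: "1 <= X x + X (x + ax 5 i)"
  and X_zero: "X x = 0 ==> wrap p x \<in> ball p (12/5)"
  and a_deriv: "x \<in> ball p (5/2) ==> \<bar>pd i (a i l) x\<bar> <= 1 / (10 * real CARD('n))"
begin

definition cd :: "(real^'n => real^'k) => 'n => real^'n => real^'k" where
 "cd u l x = pd l u x + A l x *v u x"

definition flux :: "(real^'n => real^'k) => 'n => real^'n => real^'k" where
 "flux u i x = (SUM l. a i l x *\<^sub>R cd u l x)"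

definition sol :: "real^'k => (real^'n => real^'k) => bool" where
 "sol e u \<longleftrightarrow> smooth u & periodic u &
   (ALL x. (SUM i. pd i (flux u i) x + A i x *v flux u i x) = X x *\<^sub>R (u x - e))"

lemma smooth_cd: "smooth u ==> smooth (cd u l)"
 unfolding cd_def[abs_def]
 by (intro smooth_on_add smooth_on_pd smooth_on_bilinear[OF bounded_bilinear_matrix_vector] A(1) open_UNIV)

lemma smooth_flux: "smooth u ==> smooth (flux u i)"
 unfolding flux_def[abs_def] by (intro smooth_on_sum smooth_on_scaleR smooth_cd a(1) open_UNIV)

lemma skew: "(A i x *v v) \<bullet> w = - (v \<bullet> (A i x *v w))"
 using inner_transpose_vector[of "A i x" v w] by (simp add: A(3) matrix_vector_minus_left del: transpose_matrix_vector)

lemma skew_self: "v \<bullet> (A i x *v v) = 0"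
 using skew[of i x v v] by (simp add: inner_commute)

lemma sol_exists: "EX u. sol e u"
proof -
 have f: "smooth (%x. X x *\<^sub>R e)" "periodic (%x. X x *\<^sub>R e)"
  using X(1,2) by (auto intro!: smooth_on_scaleR simp: periodic_def)
 obtain u :: "real^'n => real^'k" where u: "smooth u" "periodic u"
  "!!x. (SUM i. transpose (A i x) *v (SUM l. a i l x *\<^sub>R (pd l u x + A l x *v u x)) - pd i (%x. SUM l. a i l x *\<^sub>R (pd l u x + A l x *v u x)) x) + X x *\<^sub>R u x = X x *\<^sub>R e"
  by (rule torus_solution[where A = A, OF a(1,2) A(1,2) X(1,2) f ellipticity X(3,4) X_cover]) blast
 have "(SUM i. pd i (flux u i) x + A i x *v flux u i x) = X x *\<^sub>R (u x - e)" for x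
 proof -
  have "(SUM i. transpose (A i x) *v flux u i x - pd i (flux u i) x) + X x *\<^sub>R u x = X x *\<^sub>R e"
   using u(3)[of x] unfolding flux_def[abs_def] cd_def .
  moreover have "(SUM i. transpose (A i x) *v flux u i x - pd i (flux u i) x) = - (SUM i. pd i (flux u i) x + A i x *v flux u i x)"
   unfolding sum_negf[symmetric] by (intro sum.cong) (simp_all add: A(3) matrix_vector_minus_left del: transpose_matrix_vector)
  ultimately show ?thesis by (simp add: algebra_simps)
 qed
 with u show ?thesis unfolding sol_def by blast
qed

subsection \<open>The maximum principle\<close>

definition Ediv :: "(real^'n => real) => real^'n => real" where
 "Ediv f x = (SUM i. pd i (%y. SUM l. a i l y * pd l f y) x)"

lemma form_bounds:
 fixes P :: "'n => real^'k"
 shows "(1/2) * (SUM i. nsq (P i)) <= (SUM i l. a i l x * (P l \<bullet> P i))"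
  "(SUM i l. a i l x * (P l \<bullet> P i)) <= (3/2) * (SUM i. nsq (P i))"
proof -
 have "\<bar>z - N\<bar> <= 1 / (2 * c) * c * N ==> c > 0 ==> N <= 2 * z & 2 * z <= 3 * N" for z N c :: real
  by (auto simp: abs_if split: if_splits)
 from this[OF quadratic_close[where H = "%i l. a i l x" and w = P, OF ellipticity]]
 show "(1/2) * (SUM i. nsq (P i)) <= (SUM i l. a i l x * (P l \<bullet> P i))"
  "(SUM i l. a i l x * (P l \<bullet> P i)) <= (3/2) * (SUM i. nsq (P i))" by (simp_all add: inner_commute)
qed

lemma Ediv_expand:
 assumes "smooth f"
 shows "Ediv f x = (SUM i l. pd i (a i l) x * pd l f x + a i l x * pd i (pd l f) x)"
proof -
 have d: "a i l differentiable (at x)" "pd l f differentiable (at x)" for i l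
  using a(1) smooth_on_pd[OF assms] smooth_on_differentiable by blast+
 have "pd i (%y. \<Sum>l\<in>L. a i l y * pd l f y) x = (\<Sum>l\<in>L. pd i (a i l) x * pd l f x + a i l x * pd i (pd l f) x)" if "finite L" for i L
  using that
 proof (induction L)
  case (insert l L)
  have "(%y. \<Sum>l\<in>L. a i l y * pd l f y) differentiable (at x)"
   by (rule smooth_on_differentiable[OF smooth_on_sum[OF open_UNIV smooth_on_mult[OF open_UNIV a(1) smooth_on_pd[OF assms]]]]) simp
  moreover have "(%y. a i l y * pd l f y) differentiable (at x)"
   by (rule smooth_on_differentiable[OF smooth_on_mult[OF open_UNIV a(1) smooth_on_pd[OF assms]]]) simp
  ultimately have "pd i (%y. a i l y * pd l f y + (\<Sum>l\<in>L. a i l y * pd l f y)) x = pd i (%y. a i l y * pd l f y) x + pd i (%y. \<Sum>l\<in>L. a i l y * pd l f y) x"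
   by (rule pd_add[rotated])
  then show ?case using insert pd_bilinear[OF bounded_bilinear_mult d(1)[of i l] d(2)[of l], of i] by simp
 qed simp
 then show ?thesis by (simp add: Ediv_def)
qed

lemma Ediv_max:
 assumes "smooth f" "open S" "x \<in> S" "!!y. y \<in> S ==> f y <= f x"
 shows "Ediv f x <= 0"
proof -
 note t = second_derivative_test[OF assms(2,3) smooth_on_subset[OF assms(1) subset_UNIV] assms(4)]
 have "(SUM i l. a i l x * pd i (pd l f) x) <= 0"
  by (rule contract_nonpos[OF a(3) ellipticity t(2)])
 then show ?thesis by (simp add: Ediv_expand[OF assms(1)] t(1))
qed

text \<open>Bochner-type identity. By skewness the connection drops out of the derivative of the
  squared length, and the second derivative produces the equation paired with
  \<open>u\<close>.\<close>

lemma Ediv_norm_sq: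
 assumes "sol e u"
 shows "Ediv (%x. u x \<bullet> u x) x = 2 * ((SUM i. cd u i x \<bullet> flux u i x) + X x * (u x \<bullet> (u x - e)))"
proof -
 have u: "smooth u" using assms by (simp add: sol_def)
 have d: "u differentiable (at y)" "flux u i differentiable (at y)" for i y
  using u smooth_flux[OF u] smooth_on_differentiable by blast+
 have "pd l (%x. u x \<bullet> u x) y = 2 * (u y \<bullet> cd u l y)" for l y
  using pd_bilinear[OF bounded_bilinear_inner d(1) d(1), of l y] by (simp add: cd_def inner_add_right skew_self inner_commute)
 then have "(SUM l. a i l y * pd l (%x. u x \<bullet> u x) y) = 2 *\<^sub>R (u y \<bullet> flux u i y)" for i y
  by (simp add: flux_def inner_sum_right sum_distrib_left mult_ac)
 then have "Ediv (%x. u x \<bullet> u x) x = (SUM i. pd i (%y. 2 *\<^sub>R (u y \<bullet> flux u i y)) x)"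
  unfolding Ediv_def by (simp only:)
 also have "... = 2 * (SUM i. pd i u x \<bullet> flux u i x + u x \<bullet> pd i (flux u i) x)"
  using pd_bounded_linear[OF bounded_linear_scaleR_right, of "%y. u y \<bullet> flux u _ y" x _ 2]
   bounded_bilinear_differentiable[OF bounded_bilinear_inner d(1) d(2)]
   pd_bilinear[OF bounded_bilinear_inner d(1) d(2)] by (simp add: sum_distrib_left)
 also have "(SUM i. pd i u x \<bullet> flux u i x + u x \<bullet> pd i (flux u i) x)
  = (SUM i. cd u i x \<bullet> flux u i x) + u x \<bullet> (SUM i. pd i (flux u i) x + A i x *v flux u i x)"
  by (simp add: cd_def inner_add_left inner_add_right inner_sum_right skew flip: sum.distrib)
 also have "(SUM i. pd i (flux u i) x + A i x *v flux u i x) = X x *\<^sub>R (u x - e)"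
  using assms by (simp add: sol_def)
 finally show ?thesis by simp
qed

lemma cd_flux: "(SUM i. cd v i x \<bullet> flux u i x) = (SUM i l. a i l x * (cd u l x \<bullet> cd v i x))"
 by (simp add: flux_def inner_sum_right inner_commute)

lemma cd_flux_nonneg: "(SUM i. cd u i x \<bullet> flux u i x) >= 0"
 unfolding cd_flux by (rule order_trans[OF _ form_bounds(1)]) (simp add: sum_nonneg)

text \<open>The diagonal entries are at least 1/2, so the second-order part contributes at least n.
  The first-order part loses at most n/2: each of its n^2 terms is at most 1/(2n), because the
  distance from \<open>p\<close> is at most 5/2.\<close>

lemma Ediv_radius:
 assumes x: "x \<in> ball p (5/2)"
 shows "Ediv (%y. (y - p) \<bullet> (y - p)) x > 0"
proof -
 let ?n = "real CARD('n)"
 have sm: "smooth (%y. (y - p) \<bullet> (y - p))" by (intro smooth_on_inner smooth_on_diff smooth_on_ident smooth_on_const open_UNIV)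
 have pdr: "pd l (%y. (y - p) \<bullet> (y - p)) y = 2 * (y $ l - p $ l)" for l y
 proof -
  have "((%y. (y - p) \<bullet> (y - p)) has_derivative (%v. (y - p) \<bullet> v + v \<bullet> (y - p))) (at y)"
   by (auto intro!: derivative_eq_intros)
  from pd_eq[OF this, of l] show ?thesis by (simp add: inner_axis inner_commute[of "axis l 1"])
 qed
 have pdd: "pd i (%y. 2 * (y $ l - p $ l)) y = (if i = l then 2 else 0)" for i l y
 proof -
  have "((%y. 2 * (y $ l - p $ l)) has_derivative (%v. 2 * v $ l)) (at y)"
   by (auto intro!: derivative_eq_intros bounded_linear.has_derivative[OF bounded_linear_vec_nth])
  from pd_eq[OF this, of i] show ?thesis by (simp add: axis_def)
 qed
 have eq: "Ediv (%y. (y - p) \<bullet> (y - p)) x = (SUM i l. pd i (a i l) x * (2 * (x $ l - p $ l)) + a i l x * (if i = l then 2 else 0))"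
  unfolding Ediv_expand[OF sm] pdr[abs_def] pdd ..
 have "(SUM i. \<Sum>l\<in>(UNIV::'n set). - (1 / (10 * ?n) * 5) + (kd i l)) <= Ediv (%y. (y - p) \<bullet> (y - p)) x"
  unfolding eq
 proof (intro sum_mono add_mono)
  fix i l
  have "\<bar>x $ l - p $ l\<bar> <= 5/2" using component_le_norm_cart[of "x - p" l] x by (simp add: dist_norm norm_minus_commute)
  then have "\<bar>pd i (a i l) x * (2 * (x $ l - p $ l))\<bar> <= 1 / (10 * ?n) * 5"
   unfolding abs_mult by (intro mult_mono a_deriv[OF x]) auto
  then show "- (1 / (10 * ?n) * 5) <= pd i (a i l) x * (2 * (x $ l - p $ l))" by (meson abs_le_D2 minus_le_iff)
  have "1 / (2 * ?n) <= 1/2" by (simp add: divide_simps Suc_leI)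
  moreover have "\<bar>a l l x - 1\<bar> <= 1 / (2 * ?n)" using ellipticity[of l l x] by simp
  ultimately have "a l l x >= 1/2" by linarith
  then show "(kd i l) <= a i l x * (if i = l then 2 else 0)" by auto
 qed
 moreover have "(SUM i. \<Sum>l\<in>(UNIV::'n set). - (1 / (10 * ?n) * 5) + (kd i l)) = ?n / 2"
  by (simp add: sum.distrib sum_subtractf)
 ultimately show ?thesis by (smt (verit) zero_less_card_finite of_nat_0_less_iff half_gt_zero)
qed

lemma Ediv_add_scale:
 assumes "smooth f" "smooth g"
 shows "Ediv (%x. f x + t * g x) x = Ediv f x + t * Ediv g x"
proof -
 have tg1: "smooth (%x. t * g x)" by (rule smooth_on_mult[OF open_UNIV smooth_on_const assms(2)])
 have tg: "smooth (%x. f x + t * g x)" by (rule smooth_on_add[OF open_UNIV assms(1) tg1])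
 have p1: "pd l (%x. f x + t * g x) = (%y. pd l f y + t * pd l g y)" if "smooth f" "smooth g" for l and f g :: "real^'n => real"
 proof
  fix y
  have df: "f differentiable (at y)" "g differentiable (at y)" "(%x. t * g x) differentiable (at y)"
   using that smooth_on_mult[OF open_UNIV smooth_on_const that(2), of t] smooth_on_differentiable by blast+
  show "pd l (%x. f x + t * g x) y = pd l f y + t * pd l g y"
   using pd_add[OF df(1,3), of l] pd_bounded_linear[OF bounded_linear_mult_right df(2), of l t] by simp
 qed
 show ?thesis
  unfolding Ediv_expand[OF assms(1)] Ediv_expand[OF assms(2)] Ediv_expand[OF tg] p1[OF assms] p1[OF smooth_on_pd[OF assms(1)] smooth_on_pd[OF assms(2)]]
  by (simp add: sum_distrib_left sum.distrib[symmetric] algebra_simps)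
qed

text \<open>A maximum of the length exceeding 1 where the potential is positive contradicts the
  equation at once. A maximum at a zero of \<open>X\<close> lies in the ball of radius 12/5; there a
  small multiple of the squared distance makes the function strictly subharmonic, too small a
  multiple to move the maximum to the sphere, where \<open>X\<close> is positive.\<close>

theorem sol_norm_le_1:
 assumes s: "sol e u" and e: "norm e = 1"
 shows "norm (u x) <= 1"
proof (rule ccontr)
 assume "\<not> norm (u x) <= 1"
 define \<phi> where "\<phi> y = u y \<bullet> u y" for y
 have u: "smooth u" "periodic u" using s by (auto simp: sol_def)
 have sm: "smooth \<phi>" unfolding \<phi>_def[abs_def] by (intro smooth_on_inner u open_UNIV)
 have c: "continuous_on UNIV \<phi>" by (rule smooth_on_continuous_on[OF sm])
 have per: "periodic \<phi>" using u(2) by (simp add: periodic_def \<phi>_def)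
 have E: "Ediv \<phi> y >= 2 * (X y * (u y \<bullet> (u y - e)))" for y
  using Ediv_norm_sq[OF s, of y] cd_flux_nonneg[of u y] unfolding \<phi>_def[abs_def] by simp
 have pos: "u y \<bullet> (u y - e) > 0" if "\<phi> y > 1" for y
 proof -
  have n: "norm (u y) > 1" using that unfolding \<phi>_def power2_norm_eq_inner[symmetric] by (metis abs_norm_cancel one_power2 power2_le_iff_abs_le not_le zero_le_one abs_one)
  have "u y \<bullet> e <= norm (u y)" using norm_cauchy_schwarz[of "u y" e] e by simp
  also have "... < norm (u y) * norm (u y)"
   using mult_strict_right_mono[OF n, of "norm (u y)"] n by (metis less_trans mult_1 zero_less_one)
  finally show ?thesis by (simp add: inner_diff_right power2_norm_eq_inner[symmetric] power2_eq_square)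
 qed
 have "compact (cell p)" "cell p ~= {}" using wrap_cell[of p p] by (auto simp: cell_def)
 then obtain x0 where x0: "x0 \<in> cell p" "!!y. y \<in> cell p ==> \<phi> y <= \<phi> x0"
  using continuous_attains_sup[OF _ _ continuous_on_subset[OF c]] by (metis subset_UNIV)
 have mx: "\<phi> y <= \<phi> x0" for y using x0(2)[OF wrap_cell[of p y]] periodic_wrap[OF per] by simp
 define N where "N = \<phi> x0"
 have "\<phi> x > 1"
  using `\<not> norm (u x) <= 1` unfolding \<phi>_def power2_norm_eq_inner[symmetric] by simp
 then have N: "N > 1" using mx[of x] by (simp add: N_def)
 have claim: "X y = 0" if "\<phi> y = N" for y
 proof (rule ccontr)
  assume "X y ~= 0"
  then have "X y > 0" using X(3)[of y] by simp
  then have "X y * (u y \<bullet> (u y - e)) > 0" using pos[of y] that N by simp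
  moreover have "Ediv \<phi> y <= 0" by (rule Ediv_max[OF sm open_UNIV]) (use mx that in \<open>auto simp: N_def\<close>)
  ultimately show False using E[of y] by simp
 qed
 define z where "z = wrap p x0"
 have z: "\<phi> z = N" "z \<in> ball p (12/5)"
  using periodic_wrap[OF per, of p x0] X_zero[OF claim[of x0]] by (auto simp: z_def N_def)
 have "sphere p (12/5) ~= {}"
  by (auto simp: set_eq_iff dist_norm intro!: exI[of _ "p + ax (12/5) undefined"])
 then obtain y0 where y0: "y0 \<in> sphere p (12/5)" "!!y. y \<in> sphere p (12/5) ==> \<phi> y <= \<phi> y0"
  using continuous_attains_sup[OF compact_sphere _ continuous_on_subset[OF c]] by (metis subset_UNIV)
 have "\<phi> y0 ~= N"
 proof
  assume "\<phi> y0 = N"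
  then have "wrap p y0 \<in> ball p (12/5)" using claim X_zero by blast
  moreover have "wrap p y0 = y0"
  proof (rule wrap_eq)
   show "\<bar>y0 $ i - p $ i\<bar> < 5" for i
    using component_le_norm_cart[of "y0 - p" i] y0(1) by (simp add: dist_norm norm_minus_commute)
  qed
  ultimately show False using y0(1) by simp
 qed
 then have y0N: "\<phi> y0 < N" using mx[of y0] by (simp add: N_def)
 \<comment> \<open>On the ball of radius 12/5 the squared distance is at most 6, so that the added
   term uses up at most half of either gap.\<close>
 define \<tau> where "\<tau> = min (N - \<phi> y0) (N - 1) / 12"
 have \<tau>: "\<tau> > 0" "6 * \<tau> < N - \<phi> y0" "6 * \<tau> < N - 1" using y0N N by (auto simp: \<tau>_def)
 define f where "f y = \<phi> y + \<tau> * ((y - p) \<bullet> (y - p))" for y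
 have r: "smooth (%y. (y - p) \<bullet> (y - p))" by (intro smooth_on_inner smooth_on_diff smooth_on_ident smooth_on_const open_UNIV)
 have smf: "smooth f" unfolding f_def[abs_def] by (intro smooth_on_add smooth_on_mult sm r smooth_on_const open_UNIV)
 obtain x1 where x1: "x1 \<in> cball p (12/5)" "!!y. y \<in> cball p (12/5) ==> f y <= f x1"
  using continuous_attains_sup[OF compact_cball _ continuous_on_subset[OF smooth_on_continuous_on[OF smf]], of p "12/5"] by auto
 have f1: "f x1 >= N" using x1(2)[of z] z \<tau>(1) by (simp add: f_def) (smt (verit) inner_ge_zero mult_nonneg_nonneg)
 have rad: "(y - p) \<bullet> (y - p) <= 6" if "y \<in> cball p (12/5)" for y
 proof -
  have "nsq (y - p) <= (12/5)^2" using that by (intro power_mono) (auto simp: dist_norm norm_minus_commute)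
  also have "... <= 6" by (simp add: power2_eq_square)
  finally show ?thesis by (simp add: power2_norm_eq_inner)
 qed
 have "\<tau> * ((x1 - p) \<bullet> (x1 - p)) <= \<tau> * 6" using \<tau>(1) by (intro mult_left_mono rad[OF x1(1)]) simp
 then have \<phi>1: "\<phi> x1 >= N - 6 * \<tau>" using f1 unfolding f_def by linarith
 have x1b: "x1 \<in> ball p (12/5)"
 proof (rule ccontr)
  assume "x1 \<notin> ball p (12/5)"
  then have "\<phi> x1 <= \<phi> y0" using x1(1) by (intro y0(2)) auto
  with \<phi>1 \<tau>(2) show False by simp
 qed
 have "Ediv f x1 <= 0" by (rule Ediv_max[OF smf open_ball x1b]) (use x1(2) in auto)
 moreover have "Ediv f x1 = Ediv \<phi> x1 + \<tau> * Ediv (%y. (y - p) \<bullet> (y - p)) x1"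
  unfolding f_def[abs_def] by (rule Ediv_add_scale[OF sm r])
 moreover have "Ediv (%y. (y - p) \<bullet> (y - p)) x1 > 0" by (rule Ediv_radius) (use x1b in auto)
 moreover have "X x1 * (u x1 \<bullet> (u x1 - e)) >= 0" using pos[of x1] \<phi>1 \<tau>(3) X(3)[of x1] by simp
 ultimately show False using E[of x1] mult_pos_pos[OF \<tau>(1)] by fastforce
qed

end

context torus_operator begin

subsection \<open>Energy estimates\<close>

lemma periodic_pd_vec: "smooth u ==> periodic u ==> periodic (pd l u)"
 by (rule periodic_pd) (use smooth_on_differentiable in blast)+

lemma periodic_cd:
 assumes "smooth u" "periodic u" shows "periodic (cd u l)"
 using periodic_pd_vec[OF assms, of l] A(2)[of l] assms(2) by (simp add: periodic_def cd_def)

lemma periodic_flux: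
 assumes "smooth u" "periodic u" shows "periodic (flux u i)"
 using periodic_cd[OF assms] a(2) by (simp add: periodic_def flux_def)

lemma cd_scaled_const:
 assumes "smooth \<psi>"
 shows "cd (%x. \<psi> x *\<^sub>R e) i x = pd i \<psi> x *\<^sub>R e + \<psi> x *\<^sub>R (A i x *v e)"
proof -
 have "pd i (%x. \<psi> x *\<^sub>R e) x = pd i \<psi> x *\<^sub>R e"
  using pd_bounded_linear[OF bounded_linear_scaleR_left smooth_on_differentiable[OF assms UNIV_I]] .
 then show ?thesis by (simp add: cd_def matrix_vector_mult_scaleR)
qed

lemma cd_diff:
 assumes "smooth u" "smooth w"
 shows "cd (%x. u x - w x) i x = cd u i x - cd w i x"
proof -
 have d: "u differentiable (at x)" "w differentiable (at x)" using assms smooth_on_differentiable by blast+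
 have "pd i (%x. u x + - w x) x = pd i u x + pd i (%x. - w x) x"
  by (rule pd_add) (use d in auto)
 moreover have "pd i (%x. - w x) x = - pd i w x"
  using pd_bounded_linear[OF bounded_linear_minus[OF bounded_linear_ident] d(2)] .
 ultimately show ?thesis by (simp add: cd_def matrix_vector_mult_diff_distrib)
qed

lemma weak_form:
 assumes s: "sol e u" and v: "smooth v" "periodic v"
 shows "intc p (%x. (SUM i. cd v i x \<bullet> flux u i x) + X x * ((u x - e) \<bullet> v x)) = 0"
proof -
 have u: "smooth u" "periodic u" using s by (auto simp: sol_def)
 let ?f = "%i x. flux u i x \<bullet> v x"
 have f: "smooth (?f i)" "periodic (?f i)" for i
  using smooth_on_inner[OF open_UNIV smooth_flux[OF u(1)] v(1)] periodic_flux[OF u] v(2) by (auto simp: periodic_def)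
 have d: "flux u i differentiable (at x)" "v differentiable (at x)" for i x
  using smooth_flux[OF u(1)] v smooth_on_differentiable by blast+
 have eq: "(SUM i. pd i (?f i) x) = (SUM i. cd v i x \<bullet> flux u i x) + X x * ((u x - e) \<bullet> v x)" for x
 proof -
  have "(SUM i. pd i (?f i) x) = (SUM i. cd v i x \<bullet> flux u i x) + (SUM i. pd i (flux u i) x + A i x *v flux u i x) \<bullet> v x"
   using pd_bilinear[OF bounded_bilinear_inner d]
   by (simp add: cd_def inner_add_left inner_add_right inner_sum_left inner_sum_right skew inner_commute sum.distrib sum_subtractf sum_negf)
  then show ?thesis using s by (simp add: sol_def)
 qed
 have "intc p (%x. SUM i. pd i (?f i) x) = (SUM i. intc p (pd i (?f i)))"
  by (rule integral_sum) (auto intro!: integrable_cell smooth_periodic_pd f)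
 then show ?thesis unfolding eq integral_cell_pd[OF f] by simp
qed

definition energy_density :: "real^'k => (real^'n => real^'k) => real^'n => real" where
 "energy_density e u x = (1/2) * (SUM i. nsq (cd u i x)) + X x * nsq (u x - e)"

lemma continuous_energy_density:
 assumes u: "smooth u" shows "continuous_on UNIV (energy_density e u)"
proof -
 note c = smooth_on_continuous_on[OF smooth_cd[OF u]] smooth_on_continuous_on[OF u] smooth_on_continuous_on[OF X(1)]
 show ?thesis unfolding energy_density_def[abs_def] by (intro continuous_intros c)
qed

text \<open>An upper bound for the energy of the section \<open>\<psi> x *\<^sub>R e\<close>: the
  upper ellipticity constant is 3/2, splitting the covariant derivative into two squares gives
  another factor 2, and the potential is at most 1.\<close>

definition competitor_density :: "real^'k => (real^'n => real) => real^'n => real" where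
 "competitor_density e \<psi> x = 3 * (SUM i. (pd i \<psi> x)^2 + (\<psi> x)^2 * nsq (A i x *v e)) + (1 - \<psi> x)^2"

lemma continuous_competitor_density:
 assumes \<psi>: "smooth \<psi>" shows "continuous_on UNIV (competitor_density e \<psi>)"
proof -
 note c = smooth_on_continuous_on[OF smooth_on_pd[OF \<psi>]] smooth_on_continuous_on[OF \<psi>]
  smooth_on_continuous_on[OF smooth_on_bilinear[OF bounded_bilinear_matrix_vector open_UNIV A(1) smooth_on_const]]
 show ?thesis unfolding competitor_density_def[abs_def] by (intro continuous_intros c)
qed

text \<open>The weak equation is tested with the difference of \<open>u\<close> and the competitor.
  Nonnegativity of the quadratic form on that difference removes the mixed terms, so the comparison
  holds without a variational characterisation of \<open>u\<close>.\<close>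

theorem energy_le:
 assumes s: "sol e u" and e: "norm e = 1" and \<psi>: "smooth \<psi>" "periodic \<psi>"
 shows "intc p (energy_density e u) <= intc p (competitor_density e \<psi>)"
proof -
 have u: "smooth u" "periodic u" using s by (auto simp: sol_def)
 define w where "w x = \<psi> x *\<^sub>R e" for x
 have w: "smooth w" "periodic w" 
  unfolding w_def[abs_def] using \<psi> by (auto intro!: smooth_on_scaleR simp: periodic_def)
 define v where "v x = u x - w x" for x
 have v: "smooth v" "periodic v" 
  unfolding v_def[abs_def] using u w by (auto intro!: smooth_on_diff simp: periodic_def)
 define G where "G x = (SUM i. cd v i x \<bullet> flux u i x) + X x * ((u x - e) \<bullet> v x)" for x
 have G0: "intc p G = 0" unfolding G_def[abs_def] by (rule weak_form[OF s v])
 have cG: "continuous_on UNIV G"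
  unfolding G_def[abs_def]
  by (intro continuous_intros smooth_on_continuous_on[OF smooth_cd] smooth_on_continuous_on[OF smooth_flux] smooth_on_continuous_on X(1) u v) 
 have pt: "energy_density e u x - competitor_density e \<psi> x <= 2 * G x" for x
 proof -
  define Q where "Q P R = (SUM i l. a i l x * (P l \<bullet> R i))" for P R :: "'n => real^'k"
  have Qd: "Q P (%i. R i - S i) = Q P R - Q P S" "Q (%i. R i - S i) P = Q R P - Q S P" for P R S
   by (simp_all add: Q_def inner_diff_right inner_diff_left right_diff_distrib sum_subtractf)
  have Qs: "Q P R = Q R P" for P R
   unfolding Q_def by (subst sum.swap) (simp add: a(3)[of _ _ x] inner_commute)
  let ?U = "%i. cd u i x" and ?W = "%i. cd w i x"
  have "0 <= Q (%i. ?U i - ?W i) (%i. ?U i - ?W i)"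
   unfolding Q_def by (rule order_trans[OF _ form_bounds(1)]) (simp add: sum_nonneg)
  then have 1: "2 * Q ?U ?W <= Q ?U ?U + Q ?W ?W" unfolding Qd using Qs[of ?U ?W] by linarith
  have "(SUM i. cd v i x \<bullet> flux u i x) = Q ?U (%i. ?U i - ?W i)"
  proof -
   have "cd v i x = ?U i - ?W i" for i unfolding v_def[abs_def] by (rule cd_diff[OF u(1) w(1)])
   then show ?thesis using cd_flux[of v x u] by (simp only: Q_def)
  qed
  then have 2: "(SUM i. cd v i x \<bullet> flux u i x) = Q ?U ?U - Q ?U ?W" by (simp only: Qd)
  have 3: "(1/2) * (SUM i. nsq (?U i)) <= Q ?U ?U" "Q ?W ?W <= (3/2) * (SUM i. nsq (?W i))"
   unfolding Q_def by (rule form_bounds)+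
  have "nsq (?W i) <= 2 * ((pd i \<psi> x)^2 + (\<psi> x)^2 * nsq (A i x *v e))" for i
   unfolding w_def[abs_def] cd_scaled_const[OF \<psi>(1)]
   by (rule order_trans[OF norm_add_sq_le]) (simp add: e power_mult_distrib)
  then have "(SUM i. nsq (?W i)) <= (SUM i. 2 * ((pd i \<psi> x)^2 + (\<psi> x)^2 * nsq (A i x *v e)))"
   by (rule sum_mono)
  then have 4: "(3/2) * (SUM i. nsq (?W i)) <= 3 * (SUM i. (pd i \<psi> x)^2 + (\<psi> x)^2 * nsq (A i x *v e))"
   unfolding sum_distrib_left[symmetric] by linarith
  have 5: "X x * nsq (u x - e) - (1 - \<psi> x)^2 <= 2 * (X x * ((u x - e) \<bullet> v x))"
  proof -
   have "v x = (u x - e) + (1 - \<psi> x) *\<^sub>R e" by (simp add: v_def w_def algebra_simps)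
   then have "(u x - e) \<bullet> v x = nsq (u x - e) + (1 - \<psi> x) * ((u x - e) \<bullet> e)"
    by (simp add: inner_add_right power2_norm_eq_inner)
   moreover have "2 * ((1 - \<psi> x) * ((u x - e) \<bullet> e)) >= - (nsq (u x - e) + (1 - \<psi> x)^2)"
   proof -
    have "0 <= nsq ((u x - e) + (1 - \<psi> x) *\<^sub>R e)" by simp
    also have "... = nsq (u x - e) + 2 * ((1 - \<psi> x) * ((u x - e) \<bullet> e)) + (1 - \<psi> x)^2 * nsq e"
     by (simp only: power2_norm_eq_inner inner_add_left inner_add_right inner_scaleR_left inner_scaleR_right inner_commute[of e "u x - e"])
       (simp add: power2_eq_square algebra_simps)
    finally show ?thesis using e by simp
   qed
   ultimately have "2 * ((u x - e) \<bullet> v x) >= nsq (u x - e) - (1 - \<psi> x)^2" by linarith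
   then have "X x * (2 * ((u x - e) \<bullet> v x)) >= X x * (nsq (u x - e) - (1 - \<psi> x)^2)"
    by (rule mult_left_mono[OF _ X(3)])
   moreover have "X x * (1 - \<psi> x)^2 <= 1 * (1 - \<psi> x)^2" by (intro mult_right_mono X(4)) simp
   ultimately show ?thesis by (simp add: right_diff_distrib)
  qed
  have "1 / 2 * su + xn - (3 * c + q) <= 2 * (uu - uw + xv)"
   if "2 * uw <= uu + ww" "1 / 2 * su <= uu" "ww <= 3 / 2 * sw" "3 / 2 * sw <= 3 * c" "xn - q <= 2 * xv"
   for su xn c q uu uw ww sw xv :: real using that by argo
  from this[OF 1 3 4 5] show ?thesis unfolding G_def energy_density_def competitor_density_def 2 .
 qed
 note c = continuous_energy_density[OF u(1), of e] continuous_competitor_density[OF \<psi>(1), of e]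
 have "intc p (%x. energy_density e u x - competitor_density e \<psi> x) <= intc p (%x. 2 * G x)"
  by (rule integral_cell_mono[OF _ _ pt]) (intro continuous_intros c cG)+
 also have "... = 0" using G0 by simp
 finally show ?thesis
  using integral_diff[OF integrable_cell[OF c(1)] integrable_cell[OF c(2)], of p] by simp
qed

text \<open>The Poincare inequality is applied to
  \<open>u x \<bullet> u' x - e \<bullet> e'\<close>. As the sections have length at most 1, this
  function is at most the sum of the distances of \<open>u\<close> and \<open>u'\<close> from their
  targets, and by skewness its derivatives involve only covariant ones. The inequality t <= \<kappa>
  + t^2/\<kappa> turns these linear terms into energies.\<close>

theorem orthonormality_defect:
 assumes s: "sol e u" "sol e' u'" and e: "norm e = 1" "norm e' = 1" and \<kappa>: "\<kappa> > 0"
 shows "intc p (%x. \<bar>u x \<bullet> u' x - e \<bullet> e'\<bar>) <= 14 * \<kappa> * 10 ^ CARD('n) +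
   12 / \<kappa> * (intc p (energy_density e u) + intc p (energy_density e' u'))"
proof -
 obtain i :: 'n where True by blast
 have u: "smooth u" "periodic u" "smooth u'" "periodic u'" using s by (auto simp: sol_def)
 define w where "w x = u x \<bullet> u' x - e \<bullet> e'" for x
 have w: "smooth w" "periodic w"
  unfolding w_def[abs_def] using u by (auto intro!: smooth_on_diff smooth_on_inner simp: periodic_def)
 have 1: "intc p (%x. \<bar>w x\<bar>) <= 2 * intc p (%x. X x * \<bar>w x\<bar>) + 5 * intc p (%x. \<bar>pd i w x\<bar>)"
  by (rule integral_cell_poincare[OF w smooth_on_continuous_on[OF X(1)] X(2) X_cover X(3,4)])
 define E where "E x = energy_density e u x + energy_density e' u' x" for x
 have cE: "continuous_on UNIV E" unfolding E_def[abs_def] by (intro continuous_intros continuous_energy_density u)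
 have young: "t <= \<kappa> + t^2 / \<kappa>" for t
 proof (cases "t <= \<kappa>")
  case True then show ?thesis using \<kappa> by (simp add: add_increasing2)
 next
  case False
  then have "t * \<kappa> <= t^2" using \<kappa> by (simp add: power2_eq_square)
  then have "t <= t^2 / \<kappa>" using \<kappa> by (simp add: field_simps)
  then show ?thesis using \<kappa> by simp
 qed
 have 2: "2 * (X x * \<bar>w x\<bar>) + 5 * \<bar>pd i w x\<bar> <= 14 * \<kappa> + 12 / \<kappa> * E x" for x
 proof -
  have n: "norm (u x) <= 1" "norm (u' x) <= 1" using sol_norm_le_1 s e by blast+
  define P Q S T where "P = norm (u x - e)" and "Q = norm (u' x - e')" and "S = norm (cd u i x)" and "T = norm (cd u' i x)"
  have "w x = (u x - e) \<bullet> u' x + e \<bullet> (u' x - e')" by (simp add: w_def inner_diff_left inner_diff_right)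
  also have "\<bar>...\<bar> <= P * norm (u' x) + norm e * Q"
   unfolding P_def Q_def by (intro order_trans[OF abs_triangle_ineq] add_mono Cauchy_Schwarz_ineq2)
  also have "... <= P * 1 + 1 * Q" using n e by (intro add_mono mult_left_mono mult_right_mono) (auto simp: P_def Q_def)
  finally have "\<bar>w x\<bar> <= P + Q" by simp
  also have "... <= 2 * \<kappa> + (P^2 + Q^2) / \<kappa>" using young[of P] young[of Q] by (simp add: add_divide_distrib)
  finally have "X x * \<bar>w x\<bar> <= X x * (2 * \<kappa> + (P^2 + Q^2) / \<kappa>)" by (intro mult_left_mono X(3))
  also have "... <= 2 * \<kappa> + (X x * P^2 + X x * Q^2) / \<kappa>"
   using mult_right_mono[OF X(4)[of x], of "2 * \<kappa>"] \<kappa> by (simp add: distrib_left)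
  finally have A1: "X x * \<bar>w x\<bar> <= 2 * \<kappa> + (X x * P^2 + X x * Q^2) / \<kappa>" .
  have d: "u differentiable (at x)" "u' differentiable (at x)" using u smooth_on_differentiable by blast+
  have "pd i w x = pd i u x \<bullet> u' x + u x \<bullet> pd i u' x"
   unfolding w_def[abs_def]
   using pd_add[OF bounded_bilinear_differentiable[OF bounded_bilinear_inner d] differentiable_const, of i "- (e \<bullet> e')"]
    pd_bilinear[OF bounded_bilinear_inner d, of i] by (simp add: add.commute)
  also have "... = cd u i x \<bullet> u' x + u x \<bullet> cd u' i x"
   by (simp add: cd_def inner_add_left inner_add_right skew)
  also have "\<bar>...\<bar> <= S * norm (u' x) + norm (u x) * T"
   unfolding S_def T_def by (intro order_trans[OF abs_triangle_ineq] add_mono Cauchy_Schwarz_ineq2)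
  also have "... <= S * 1 + 1 * T" using n by (intro add_mono mult_left_mono mult_right_mono) (auto simp: S_def T_def)
  also have "... <= 2 * \<kappa> + (S^2 + T^2) / \<kappa>" using young[of S] young[of T] by (simp add: add_divide_distrib)
  finally have A2: "\<bar>pd i w x\<bar> <= 2 * \<kappa> + (S^2 + T^2) / \<kappa>" .
  define U V where "U = (SUM i. nsq (cd u i x))" and "V = (SUM i. nsq (cd u' i x))"
  define XP XQ where "XP = X x * P^2" and "XQ = X x * Q^2"
  have B1: "S\<^sup>2 <= U" "T\<^sup>2 <= V"
   unfolding S_def T_def U_def V_def by (rule member_le_sum[of i UNIV "%i. nsq (cd _ i x)"]; simp)+
  have B2: "XP >= 0" "XQ >= 0" unfolding XP_def XQ_def using X(3)[of x] by auto
  have B3: "12 * E x = 6 * U + 6 * V + 12 * XP + 12 * XQ"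
   unfolding E_def energy_density_def P_def[symmetric] Q_def[symmetric] U_def XP_def XQ_def V_def by (simp add: algebra_simps)
  have "2 * (XP + XQ) + 5 * (S^2 + T^2) <= 12 * E x"
  proof -
   have "2 * (q + r) + 5 * (s + t) <= z" if "0 <= s" "0 <= t" "s <= U" "t <= V" "0 <= q" "0 <= r"
    "z = 6 * U + 6 * V + 12 * q + 12 * r" for q r s t z :: real using that by argo
   then show ?thesis using zero_le_power2 B1 B2 B3 by blast
  qed
  then have "(2 * (X x * P^2 + X x * Q^2) + 5 * (S^2 + T^2)) / \<kappa> <= 12 * E x / \<kappa>"
   unfolding XP_def XQ_def using \<kappa> by (intro divide_right_mono) auto
  then show ?thesis using A1 A2 by (simp add: add_divide_distrib)
 qed
 have c: "continuous_on UNIV (%x. X x * \<bar>w x\<bar>)" "continuous_on UNIV (%x. \<bar>pd i w x\<bar>)"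
  by (intro continuous_intros smooth_on_continuous_on X(1) w(1) smooth_on_pd)+
 have "2 * intc p (%x. X x * \<bar>w x\<bar>) + 5 * intc p (%x. \<bar>pd i w x\<bar>) = intc p (%x. 2 * (X x * \<bar>w x\<bar>) + 5 * \<bar>pd i w x\<bar>)"
  using integral_add[of "%x. 2 * (X x * \<bar>w x\<bar>)" "cell p" "%x. 5 * \<bar>pd i w x\<bar>"]
  by (simp add: integrable_cell c continuous_on_mult_left)
 also have "... <= intc p (%x. 14 * \<kappa> + 12 / \<kappa> * E x)"
  by (rule integral_cell_mono[OF _ _ 2]) (intro continuous_intros c cE)+
 also have "... = 14 * \<kappa> * 10 ^ CARD('n) + 12 / \<kappa> * intc p E"
 proof -
  have "intc p (%x. 14 * \<kappa> + 12 / \<kappa> * E x) = intc p (%x. 14 * \<kappa>) + intc p (%x. 12 / \<kappa> * E x)"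
   by (intro integral_add integrable_cell continuous_intros cE)
  moreover have "intc p (%x. 14 * \<kappa>) = 14 * \<kappa> * 10 ^ CARD('n)"
   using content_cell[of p] by (simp add: cell_def)
  ultimately show ?thesis by simp
 qed
 also have "intc p E = intc p (energy_density e u) + intc p (energy_density e' u')"
  unfolding E_def[abs_def] by (intro integral_add integrable_cell continuous_energy_density u)
 finally show ?thesis using 1 unfolding w_def by linarith
qed

end

section \<open>Almost parallel solutions on a Euclidean ball\<close>

subsection \<open>Cutoff functions and periodic extension\<close>

lemma smooth_step_deriv_bound:
 "\<exists>D>0. ALL t. EX d. (smooth_step has_real_derivative d) (at t) & \<bar>d\<bar> <= D"
proof -
 define den where "den t = flat_fun 0 t + flat_fun 0 (1 - t)" for t
 define den' where "den' t = flat_fun 1 t - flat_fun 1 (1 - t)" for t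
 define s where "s t = (flat_fun 1 t * den t - flat_fun 0 t * den' t) / (den t * den t)" for t
 have den: "den t ~= 0" for t using flat_fun_denom[of t] by (simp add: den_def)
 have f: "(flat_fun 0 has_real_derivative flat_fun 1 t) (at t)" for t
  using flat_fun_deriv[of 0 t] by simp
 have f': "((%t. flat_fun 0 (1 - t)) has_real_derivative - flat_fun 1 (1 - t)) (at t)" for t
 proof -
  have "((%t. 1 - t) has_real_derivative - 1) (at t)" by (auto intro!: derivative_eq_intros)
  from DERIV_chain2[OF f this] show ?thesis by simp
 qed
 have "(den has_real_derivative den' t) (at t)" for t
  using DERIV_add[OF f f'] by (simp add: den_def[abs_def] den'_def)
 from DERIV_divide[OF f this den] have s: "(smooth_step has_real_derivative s t) (at t)" for t
  by (simp add: s_def smooth_step_def[abs_def] den_def[abs_def])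
 have c: "isCont (flat_fun k) t" for k t by (rule DERIV_isCont[OF flat_fun_deriv])
 have c': "isCont (%t. flat_fun k (1 - t)) t" for k t
  by (rule isCont_o2[OF _ c]) (intro continuous_intros)
 have "isCont s t" for t
  unfolding s_def den_def den'_def using den[of t] unfolding den_def by (intro continuous_intros c c') simp_all
 then have "continuous_on {0..1} s" by (simp add: continuous_at_imp_continuous_on)
 from compact_imp_bounded[OF compact_continuous_image[OF this compact_Icc]]
 obtain D where D: "!!t. t \<in> {0..1} ==> \<bar>s t\<bar> <= D" unfolding bounded_iff by force
 have "\<bar>s t\<bar> <= max D 1" for t
 proof (cases "t \<in> {0..1}")
  case True then show ?thesis using D[of t] by simp
 next
  case False
  then have "s t = 0" by (auto simp: s_def den_def den'_def flat_fun_def)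
  then show ?thesis by simp
 qed
 then show ?thesis using s by (intro exI[of _ "max D 1"]) fastforce
qed

definition bump :: "real^'n => real => real => real^'n => real" where
 "bump p r s x = smooth_step ((s^2 - (x - p) \<bullet> (x - p)) / (s^2 - r\<^sup>2))"

lemma smooth_on_bump: "open S ==> smooth_on S (bump p r s)"
 unfolding bump_def[abs_def] divide_inverse
 by (intro smooth_on_smooth_step smooth_on_mult smooth_on_diff smooth_on_inner smooth_on_const smooth_on_ident)

lemma bump:
 assumes "0 < r" "r < s"
 shows "0 <= bump p r s x" "bump p r s x <= 1" "x \<in> cball p r ==> bump p r s x = 1" "x \<notin> ball p s ==> bump p r s x = 0"
proof -
 have sq: "s\<^sup>2 - r\<^sup>2 > 0" using assms by (simp add: power_strict_mono)
 have d: "(x - p) \<bullet> (x - p) = (dist p x)^2" by (subst dist_commute) (simp only: dist_norm power2_norm_eq_inner)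
 show "0 <= bump p r s x" "bump p r s x <= 1" by (simp_all add: bump_def smooth_step)
 show "bump p r s x = 1" if "x \<in> cball p r"
 proof -
  have "(dist p x)^2 <= r^2" using that by (simp add: power_mono)
  then show ?thesis unfolding bump_def d using sq by (intro smooth_step(4)) simp
 qed
 show "bump p r s x = 0" if "x \<notin> ball p s"
 proof -
  have "s\<^sup>2 <= (dist p x)^2" using that assms by (simp add: power_mono)
  then show ?thesis unfolding bump_def d using sq by (intro smooth_step(3)) (simp add: divide_le_0_iff)
 qed
qed

lemma smooth_on_extend_zero:
 assumes S: "open S" "smooth_on S f" and K: "closed K" "K \<subseteq> S" "!!x. x \<in> S ==> x \<notin> K ==> f x = 0"
 shows "smooth (%x. if x \<in> S then f x else 0)"
proof -
 have "smooth_on (S \<union> - K) (%x. if x \<in> S then f x else 0)"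
 proof (rule smooth_on_open_Un)
  show "smooth_on S (%x. if x \<in> S then f x else 0)"
   by (rule smooth_on_cong[OF S(1) _ S(2)]) simp
  show "smooth_on (- K) (%x. if x \<in> S then f x else 0)"
   by (rule smooth_on_cong[OF _ _ smooth_on_const[of _ 0]]) (use K in auto)
 qed (use S K in auto)
 moreover have "S \<union> - K = UNIV" using K by auto
 ultimately show ?thesis by simp
qed

lemma periodic_wrap_compose: "periodic (%x. f (wrap p x))"
proof -
 have "wrap p (x + ax 10 i) = wrap p x" for x i
 proof -
  have "\<lfloor>((x + ax 10 i) $ k - p $ k + 5) / 10\<rfloor> = \<lfloor>(x $ k - p $ k + 5) / 10\<rfloor> + (kd k i)" for k
  proof -
   have "((x + ax 10 i) $ k - p $ k + 5) / 10 = (x $ k - p $ k + 5) / 10 + of_int (kd k i)"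
    by (simp add: axis_def field_simps)
   then show ?thesis by (metis floor_add_int)
  qed
  then show ?thesis by (simp add: wrap_def vec_eq_iff axis_def)
 qed
 then show ?thesis by (simp add: periodic_def)
qed

text \<open>A point of the cube of half-side 6 that is moved has a coordinate at distance at least 4
  from that of \<open>p\<close> both before and after wrapping, where \<open>f\<close> is constant.
  The margin beyond 5 covers the faces of the cell.\<close>

lemma wrap_near:
 assumes f: "!!x. x \<notin> ball p 4 ==> f x = c" and z: "!!i. \<bar>z $ i - p $ i\<bar> < 6"
 shows "f (wrap p z) = f z"
proof (cases "ALL i. \<bar>z $ i - p $ i\<bar> < 5")
 case True then show ?thesis by (simp add: wrap_eq)
next
 case False
 then obtain i where i: "\<bar>z $ i - p $ i\<bar> >= 5" by (meson not_le)
 have out: "f y = c" if "\<bar>y $ i - p $ i\<bar> >= 4" for y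
 proof (rule f)
  have "\<bar>(y - p) $ i\<bar> <= norm (y - p)" by (rule component_le_norm_cart)
  then show "y \<notin> ball p 4" using that by (simp add: dist_norm norm_minus_commute)
 qed
 have "\<bar>wrap p z $ i - p $ i\<bar> >= 4"
 proof (cases "z $ i - p $ i >= 5")
  case True
  then have "\<lfloor>(z $ i - p $ i + 5) / 10\<rfloor> = 1" using z[of i] by (simp add: floor_eq_iff)
  then show ?thesis using z[of i] by (simp add: wrap_def)
 next
  case False
  show ?thesis
  proof (cases "z $ i - p $ i = - 5")
   case True then have "\<lfloor>(z $ i - p $ i + 5) / 10\<rfloor> = 0" by simp
   then show ?thesis using True by (simp add: wrap_def)
  next
   case F: False
   then have "\<lfloor>(z $ i - p $ i + 5) / 10\<rfloor> = -1" using z[of i] i False by (simp add: floor_eq_iff)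
   then show ?thesis using z[of i] i False by (simp add: wrap_def)
  qed
 qed
 then show ?thesis using out i by auto
qed

lemma open_cube: "open {y :: real^'n. ALL i. \<bar>y $ i - q $ i\<bar> < r}"
proof -
 have "{y :: real^'n. ALL i. \<bar>y $ i - q $ i\<bar> < r} = (\<Inter>i. {y. \<bar>y $ i - q $ i\<bar> < r})" by auto
 also have "open ..." by (intro open_INT ballI open_Collect_less continuous_intros finite)
 finally show ?thesis .
qed

text \<open>Near a given point, even on a face of a cell, the wrapped function coincides with the
  translate of \<open>f\<close> by one fixed period vector.\<close>

lemma smooth_on_wrap:
 assumes s: "smooth f" and f: "!!x. x \<notin> ball p 4 ==> f x = c"
 shows "smooth (%x. f (wrap p x))"
proof (rule smooth_on_local)
 fix y0
 define v where "v = y0 - wrap p y0"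
 define T where "T = {y. ALL i. \<bar>y $ i - (p + v) $ i\<bar> < 6}"
 have T: "open T" unfolding T_def by (rule open_cube)
 have y0: "y0 \<in> T"
 proof -
  have "\<bar>wrap p y0 $ i - p $ i\<bar> < 6" for i using wrap_bounds(1)[of p i y0] wrap_bounds(2)[of p y0 i] by (simp add: abs_less_iff)
  then show ?thesis by (simp add: T_def v_def)
 qed
 have v: "v = (\<chi> i. 10 * of_int \<lfloor>(y0 $ i - p $ i + 5) / 10\<rfloor>)" by (simp add: v_def wrap_def vec_eq_iff)
 have eq: "f (y - v) = f (wrap p y)" if "y \<in> T" for y
 proof -
  have "f (wrap p ((y - v) + v)) = f (wrap p (y - v))"
   unfolding v by (rule periodic_ints[OF periodic_wrap_compose])
  also have "... = f (y - v)" using f by (rule wrap_near) (use that in \<open>auto simp: T_def algebra_simps\<close>)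
  finally show ?thesis by simp
 qed
 have "smooth_on T (%y. f (y - v))"
  by (rule smooth_on_compose[where T = UNIV, OF T open_UNIV _ smooth_on_diff[OF T smooth_on_ident smooth_on_const] s]) simp
 from smooth_on_cong[OF T eq this] have "smooth_on T (%x. f (wrap p x))" .
 then show "EX T. open T & y0 \<in> T & smooth_on T (%x. f (wrap p x))" using T y0 by blast
qed

lemma pd_wrap:
 assumes s: "smooth f" and f: "!!x. x \<notin> ball p 4 ==> f x = c" and x: "!!i. \<bar>x $ i - p $ i\<bar> < 6"
 shows "pd i (%x. f (wrap p x)) x = pd i f x"
proof -
 define T where "T = {y. ALL i. \<bar>y $ i - p $ i\<bar> < 6}"
 have T: "open T" unfolding T_def by (rule open_cube)
 show ?thesis
  by (rule pd_cong_open[OF T], simp add: T_def x, rule wrap_near[where f = f, OF f]) (auto simp: T_def)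
qed

lemma cell_near: "x \<in> cell p ==> \<bar>x $ i - p $ i\<bar> < 6"
 unfolding mem_cell by (drule spec[of _ i]) simp

text \<open>Two points half a period apart cannot both be within 5/2 of the centre; this yields the
  covering condition for the potential.\<close>

lemma wrap_disjoint:
 assumes "r < 5/2" "wrap p x \<in> ball p r"
 shows "wrap p (x + ax 5 i) \<notin> ball p r"
proof
 assume "wrap p (x + ax 5 i) \<in> ball p r"
 then have 1: "\<bar>wrap p (x + ax 5 i) $ i - p $ i\<bar> < 5/2"
  using component_le_norm_cart[of "wrap p (x + ax 5 i) - p" i] assms(1) by (simp add: dist_norm norm_minus_commute)
 have 2: "\<bar>wrap p x $ i - p $ i\<bar> < 5/2"
  using component_le_norm_cart[of "wrap p x - p" i] assms by (simp add: dist_norm norm_minus_commute)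
 obtain k m :: int where "wrap p (x + ax 5 i) $ i = x $ i + 5 - 10 * of_int k" "wrap p x $ i = x $ i - 10 * of_int m"
  by (simp add: wrap_def)
 then have "\<bar>5 - 10 * real_of_int k + 10 * of_int m\<bar> < 5" using 1 2 unfolding abs_less_iff by linarith
 then have "\<bar>5 - 10 * k + 10 * m\<bar> < 5" by linarith
 then show False by presburger
qed

subsection \<open>A cutoff vanishing near a subspace of codimension three\<close>

definition orthonormal :: "(real^'n) set => bool" where
 "orthonormal T \<longleftrightarrow> finite T & (\<forall>e\<in>T. \<forall>f\<in>T. e \<bullet> f = (kd e f))"

lemma orthonormal_norm: "orthonormal T ==> e \<in> T ==> norm e = 1"
 by (simp add: orthonormal_def norm_eq_1)

text \<open>For orthonormal \<open>T\<close>, the squared distance of \<open>x\<close> from the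
  affine subspace through \<open>p\<close> orthogonal to \<open>T\<close>.\<close>

definition height2 :: "real^'n => (real^'n) set => real^'n => real" where
 "height2 p T x = (\<Sum>e\<in>T. ((x - p) \<bullet> e)^2)"

definition slab :: "real^'n => (real^'n) set => real => (real^'n) set" where
 "slab p T r = {x \<in> ball p 4. height2 p T x <= 4 * r^2}"

lemma smooth_on_height2: "open S ==> smooth_on S (height2 p T)"
 unfolding height2_def[abs_def] power2_eq_square
 by (intro smooth_on_sum smooth_on_mult smooth_on_inner smooth_on_diff smooth_on_ident smooth_on_const)

lemma slab_component:
 assumes "orthonormal T" "x \<in> slab p T r" "0 <= r" "e \<in> T"
 shows "\<bar>(x - p) \<bullet> e\<bar> <= 2 * r"
proof -
 have "((x - p) \<bullet> e)^2 <= height2 p T x"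
  unfolding height2_def by (rule member_le_sum[OF assms(4), of "%e. ((x - p) \<bullet> e)^2"]) (use assms(1) in \<open>auto simp: orthonormal_def\<close>)
 then have "((x - p) \<bullet> e)^2 <= (2 * r)^2" using assms(2) by (simp add: slab_def power_mult_distrib)
 then show ?thesis using assms(3) unfolding abs_le_square_iff[symmetric] by simp
qed

lemma slab_lmeasurable: "slab p T r \<in> lmeasurable"
proof -
 have eq: "slab p T r = ball p 4 \<inter> {x. height2 p T x <= 4 * r^2}" by (auto simp: slab_def)
 have "closed {x. height2 p T x <= 4 * r^2}"
  by (intro closed_Collect_le smooth_on_continuous_on[OF smooth_on_height2] continuous_intros) simp
 then show ?thesis unfolding eq
  by (intro fmeasurable_Int_fmeasurable lmeasurable_ball) (auto intro: borel_closed sets_completionI_sets)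
qed

text \<open>Translates of the slab by multiples of five times its width, in the directions of \<open>T\<close>, are disjoint
 and stay in a fixed cube.\<close>

lemma slab_measure:
 fixes T :: "(real^'n) set"
 assumes T: "orthonormal T" "card T = 3" and M: "M >= 1"
 shows "measure lebesgue (slab p T (1 / real M)) <= 40 ^ CARD('n) / real M ^ 3"
proof -
 define r where "r = 1 / real M"
 have r: "r > 0" "r * real M = 1" using M by (auto simp: r_def)
 define I where "I = T \<rightarrow>\<^sub>E {..<M}"
 have fin: "finite T" using T by (simp add: orthonormal_def)
 have I: "finite I" "card I = M ^ 3" using fin T(2) by (auto simp: I_def finite_PiE card_PiE)
 \<comment> \<open>The spacing \<open>5 * r\<close> exceeds the width \<open>4 * r\<close> of the
   slab, and since \<open>r * real M = 1\<close> each of the three displacements stays below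
   5.\<close>
 define w where "w m = (\<Sum>e\<in>T. (5 * r * real (m e)) *\<^sub>R e)" for m
 have we: "w m \<bullet> e = 5 * r * real (m e)" if "e \<in> T" for m e
 proof -
  have "w m \<bullet> e = (\<Sum>f\<in>T. 5 * r * real (m f) * (kd f e))"
   unfolding w_def inner_sum_left by (intro sum.cong) (use T that in \<open>auto simp: orthonormal_def\<close>)
  also have "... = 5 * r * real (m e)" using that fin by (simp add: if_distrib[of "%z. _ * z"] cong: if_cong)
  finally show ?thesis .
 qed
 have nw: "norm (w m) <= 15" if "m \<in> I" for m
 proof -
  have "norm (w m) <= (\<Sum>e\<in>T. 5)"
   unfolding w_def
  proof (rule order_trans[OF norm_sum sum_mono])
   fix e assume e: "e \<in> T"
   have "m e < M" using that e by (auto simp: I_def PiE_iff)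
   then have "r * real (m e) <= r * real M" using r by (intro mult_left_mono) auto
   then show "norm ((5 * r * real (m e)) *\<^sub>R e) <= 5" using r orthonormal_norm[OF T(1) e] by simp
  qed
  then show ?thesis using T(2) by simp
 qed
 define N where "N m = (+) (w m) ` slab p T r" for m
 have mN: "measure lebesgue (N m) = measure lebesgue (slab p T r)" "N m \<in> lmeasurable" for m
  unfolding N_def using slab_lmeasurable[of p T r] by (simp_all add: measure_translation measurable_translation)
 have disj: "disjoint_family_on N I"
  unfolding disjoint_family_on_def
 proof (intro ballI impI)
  fix m m' assume m: "m \<in> I" "m' \<in> I" "m ~= m'"
  show "N m \<inter> N m' = {}"
  proof (rule ccontr)
   assume "N m \<inter> N m' ~= {}"
   then obtain x y where xy: "x \<in> slab p T r" "y \<in> slab p T r" "w m + x = w m' + y" by (auto simp: N_def)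
   have "m e = m' e" if e: "e \<in> T" for e
   proof -
    have "w m \<bullet> e - w m' \<bullet> e = (y - p) \<bullet> e - (x - p) \<bullet> e"
     using arg_cong[OF xy(3), of "%z. z \<bullet> e"] by (simp add: inner_add_left inner_diff_left)
    then have "\<bar>5 * r * real (m e) - 5 * r * real (m' e)\<bar> <= 4 * r"
     unfolding we[OF e] using slab_component[OF T(1) xy(1) _ e] slab_component[OF T(1) xy(2) _ e] r by linarith
    then have "\<bar>r * (5 * (real (m e) - real (m' e)))\<bar> <= r * 4" by (simp add: algebra_simps)
    then have "\<bar>5 * (real (m e) - real (m' e))\<bar> <= 4" using r by (simp add: abs_mult)
    then have "\<bar>real_of_int (5 * (int (m e) - int (m' e)))\<bar> <= 4" by simp
    then have "\<bar>5 * (int (m e) - int (m' e))\<bar> <= 4" by linarith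
    then show ?thesis by presburger
   qed
   then have "m = m'" using m by (auto simp: I_def intro: PiE_ext)
   then show False using m by blast
  qed
 qed
 have "real (M ^ 3) * measure lebesgue (slab p T r) = (\<Sum>m\<in>I. measure lebesgue (N m))" by (simp add: mN I)
 also have "... = measure lebesgue (\<Union>m\<in>I. N m)"
 proof (rule measure_finite_Union[symmetric, OF I(1) _ disj])
  show "N ` I \<subseteq> sets lebesgue" using mN(2) by auto
  show "emeasure lebesgue (N m) ~= \<infinity>" for m using fmeasurableD2[OF mN(2)] by simp
 qed
 \<comment> \<open>Displacements of length at most 15 and the radius 4 stay below 20, which explains
   the cube of side 40.\<close>
 also have "... <= measure lebesgue (cbox (\<chi> i. p $ i - 20) (\<chi> i. p $ i + 20))"
 proof (rule measure_mono_fmeasurable)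
  show "(\<Union>m\<in>I. N m) \<subseteq> cbox (\<chi> i. p $ i - 20) (\<chi> i. p $ i + 20)"
  proof
   fix y assume "y \<in> (\<Union>m\<in>I. N m)"
   then obtain m x where m: "m \<in> I" "x \<in> ball p 4" "y = w m + x" by (auto simp: N_def slab_def)
   have "norm (y - p) <= norm (w m) + norm (x - p)" unfolding m(3) using norm_triangle_ineq[of "w m" "x - p"] by (simp add: add_diff_eq)
   then have "norm (y - p) <= 20" using nw[OF m(1)] m(2) by (simp add: dist_norm norm_minus_commute)
   then have "\<bar>(y - p) $ i\<bar> <= 20" for i using component_le_norm_cart[of "y - p" i] by linarith
   then have "p $ i - 20 <= y $ i & y $ i <= p $ i + 20" for i by (simp add: abs_le_iff algebra_simps)
   then show "y \<in> cbox (\<chi> i. p $ i - 20) (\<chi> i. p $ i + 20)" by (simp add: mem_box_cart)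
  qed
  show "(\<Union>m\<in>I. N m) \<in> sets lebesgue" using mN(2) I(1) by (intro sets.finite_UN) auto
 qed simp
 also have "... = 40 ^ CARD('n)"
  by (simp, subst content_cbox_cart) (auto simp: interval_ne_empty_cart(1))
 finally show ?thesis using M by (simp add: r_def field_simps)
qed

subsection \<open>Sections on a ball\<close>

text \<open>The data are given on radius 16/5 and will be cut off between 5/2 and 3; the derivative
  bound is asked for on radius 5/2, where the cutoff leaves the coefficients unaltered.\<close>

locale local_operator =
 fixes p :: "real^'n" and a :: "'n => 'n => real^'n => real"
  and A :: "'n => real^'n => real^'k^'k"
 assumes a: "smooth_on (ball p (16/5)) (a i l)" "x \<in> ball p (16/5) ==> a i l x = a l i x"
   "x \<in> ball p (16/5) ==> \<bar>a i l x - (kd i l)\<bar> <= 1 / (2 * real CARD('n))"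
   "x \<in> ball p (5/2) ==> \<bar>pd i (a i l) x\<bar> <= 1 / (10 * real CARD('n))"
  and A: "smooth_on (ball p (16/5)) (A i)" "x \<in> ball p (16/5) ==> transpose (A i x) = - A i x"
begin

definition cut :: "(real^'n => 'b::real_normed_vector) => real^'n => 'b" where
 "cut f x = (if x \<in> ball p (16/5) then bump p (5/2) 3 x *\<^sub>R f x else 0)"

lemma smooth_on_cut: "smooth_on (ball p (16/5)) f ==> smooth (cut f)"
 unfolding cut_def[abs_def]
 by (rule smooth_on_extend_zero[where K = "cball p 3"])
   (use bump(4)[of "5/2" 3 _ p] in \<open>auto intro!: smooth_on_scaleR smooth_on_bump\<close>)

lemma cut_outside: "x \<notin> ball p 3 ==> cut f x = 0"
 using bump(4)[of "5/2" 3 x p] by (simp add: cut_def)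

lemma cut_inside: "x \<in> ball p (5/2) ==> cut f x = f x"
 using bump(3)[of "5/2" 3 x p] by (simp add: cut_def)

lemma ball_4: "x \<notin> ball p 4 ==> x \<notin> ball p 3" by simp

definition ta :: "'n => 'n => real^'n => real" where
 "ta i l x = (kd i l) + cut (%x. a i l x - (kd i l)) (wrap p x)"

definition tA :: "'n => real^'n => real^'k^'k" where
 "tA i x = cut (A i) (wrap p x)"

text \<open>Rises from 0 to 1 between the radii 11/5 and 23/10. Metric balls of radius 2 will lie
  within the first, and the second is below 5/2, as \<open>wrap_disjoint\<close> requires.\<close>

definition tX :: "real^'n => real" where
 "tX x = 1 - bump p (11/5) (23/10) (wrap p x)"

lemma smooth_on_cut_wrap: "smooth_on (ball p (16/5)) f ==> smooth (%x. cut f (wrap p x))"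
 by (rule smooth_on_wrap[OF smooth_on_cut, of f p 0]) (use cut_outside[OF ball_4] in auto)

lemma tA_inside: "x \<in> ball p (5/2) ==> tA i x = A i x"
 and ta_inside: "x \<in> ball p (5/2) ==> ta i l x = a i l x"
 and tX_inside: "x \<in> ball p (11/5) ==> tX x = 0"
proof -
 have w: "wrap p x = x" if "x \<in> ball p (5/2)"
 proof (rule wrap_eq)
  show "\<bar>x $ i - p $ i\<bar> < 5" for i using component_le_norm_cart[of "x - p" i] that by (simp add: dist_norm norm_minus_commute)
 qed
 show "x \<in> ball p (5/2) ==> tA i x = A i x" "x \<in> ball p (5/2) ==> ta i l x = a i l x"
  by (simp_all add: tA_def ta_def w cut_inside)
 show "tX x = 0" if "x \<in> ball p (11/5)"
  using that w bump(3)[of "11/5" "23/10" x p] by (simp add: tX_def)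
qed

lemma torus: "torus_operator p ta tA tX"
proof
 show "smooth (ta i l)" for i l
  unfolding ta_def[abs_def] by (intro smooth_on_add smooth_on_const smooth_on_cut_wrap smooth_on_diff a open_ball open_UNIV)
 show "periodic (ta i l)" "periodic (tA i)" "periodic tX" for i l
  unfolding ta_def[abs_def] tA_def[abs_def] tX_def[abs_def] by (rule periodic_wrap_compose)+
 show "ta i l x = ta l i x" for i l x
  by (auto simp: ta_def cut_def a(2)[of _ i l])
 show "smooth (tA i)" for i
  unfolding tA_def[abs_def] by (intro smooth_on_cut_wrap A)
 show "transpose (tA i x) = - tA i x" for i x
 proof -
  have "transpose (c *\<^sub>R B) = c *\<^sub>R transpose B" "transpose 0 = (0 :: real^'k^'k)" for c and B :: "real^'k^'k"
   by (simp_all add: transpose_def vec_eq_iff)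
  then show ?thesis by (simp add: tA_def cut_def A(2))
 qed
 show "smooth tX"
  unfolding tX_def[abs_def]
  by (intro smooth_on_diff smooth_on_const open_UNIV smooth_on_wrap[where c = 0] smooth_on_bump bump(4)) auto
 show "0 <= tX x" "tX x <= 1" for x
  using bump(1,2)[of "11/5" "23/10" p "wrap p x"] by (simp_all add: tX_def)
 show "\<bar>ta i l x - (kd i l)\<bar> <= 1 / (2 * real CARD('n))" for i l x
 proof (cases "wrap p x \<in> ball p (16/5)")
  case True
  have "bump p (5/2) 3 (wrap p x) * \<bar>a i l (wrap p x) - (kd i l)\<bar> <= 1 * (1 / (2 * real CARD('n)))"
   by (intro mult_mono bump a(3) True) auto
  then show ?thesis using True bump(1)[of "5/2" 3 p "wrap p x"] by (simp add: ta_def cut_def abs_mult)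
 qed (simp add: ta_def cut_def)
 show "1 <= tX x + tX (x + ax 5 i)" for x i
 proof (cases "wrap p x \<in> ball p (23/10)")
  case True
  then have "bump p (11/5) (23/10) (wrap p (x + ax 5 i)) = 0" using wrap_disjoint[of "23/10" p x i] by (intro bump(4)) auto
  then show ?thesis using bump(2)[of "11/5" "23/10" p "wrap p x"] by (simp add: tX_def)
 next
  case False
  then have "bump p (11/5) (23/10) (wrap p x) = 0" by (intro bump(4)) auto
  then show ?thesis using bump(2)[of "11/5" "23/10" p "wrap p (x + ax 5 i)"] by (simp add: tX_def)
 qed
 show "tX x = 0 ==> wrap p x \<in> ball p (12/5)" for x
  using bump(4)[of "11/5" "23/10" "wrap p x" p] by (force simp: tX_def)
 show "\<bar>pd i (ta i l) x\<bar> <= 1 / (10 * real CARD('n))" if "x \<in> ball p (5/2)" for i l x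
  using a(4)[OF that] pd_cong_open[OF open_ball that, of "ta i l" "a i l" i] ta_inside by simp
qed

sublocale torus_operator p ta tA tX by (rule torus)

lemma cd_inside: "x \<in> ball p (5/2) ==> cd u l x = pd l u x + A l x *v u x"
 by (simp add: cd_def tA_inside)

lemma equation_inside:
 assumes s: "sol e u" and x: "x \<in> ball p (11/5)"
 shows "(SUM i. pd i (%y. SUM l. a i l y *\<^sub>R (pd l u y + A l y *v u y)) x
  + A i x *v (SUM l. a i l x *\<^sub>R (pd l u x + A l x *v u x))) = 0"
proof -
 have x': "x \<in> ball p (5/2)" using x by simp
 have f: "flux u i y = (SUM l. a i l y *\<^sub>R (pd l u y + A l y *v u y))" if "y \<in> ball p (5/2)" for i y
  unfolding flux_def by (intro sum.cong refl) (simp only: cd_inside[OF that] ta_inside[OF that])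
 have "pd i (%y. SUM l. a i l y *\<^sub>R (pd l u y + A l y *v u y)) x = pd i (flux u i) x" for i
  by (rule pd_cong_open[OF open_ball x']) (rule f[symmetric])
 moreover have "(SUM i. pd i (flux u i) x + tA i x *v flux u i x) = tX x *\<^sub>R (u x - e)" using s by (simp add: sol_def)
 ultimately show ?thesis by (simp add: f[OF x', symmetric] tA_inside[OF x'] tX_inside[OF x])
qed

text \<open>Vanishes within height \<open>r\<close> in the ball of radius 3, outside of which the
  cut-off form is zero anyway, and equals 1 beyond height \<open>2 * r\<close> or radius 4, so that
  it extends periodically.\<close>

definition competitor :: "(real^'n) set => real => real^'n => real" where
 "competitor T r x = 1 - bump p 3 4 x * (1 - smooth_step ((height2 p T x / r^2 - 1) / 3))"

lemma competitor_basic: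
 "smooth (competitor T r)" "x \<notin> ball p 4 ==> competitor T r x = 1"
 "0 <= competitor T r x" "competitor T r x <= 1" 
proof -
 let ?s = "smooth_step ((height2 p T x / r^2 - 1) / 3)"
 show "smooth (competitor T r)"
  unfolding competitor_def[abs_def] divide_inverse
  by (intro smooth_on_diff smooth_on_mult smooth_on_const smooth_on_bump smooth_on_smooth_step smooth_on_height2 open_UNIV)
 show "x \<notin> ball p 4 ==> competitor T r x = 1" using bump(4)[of 3 4 x p] by (simp add: competitor_def)
 have "0 <= bump p 3 4 x" "bump p 3 4 x <= 1" "0 <= ?s" "?s <= 1" using smooth_step(1,2) bump(1,2)[of 3 4 p x] by auto
 then have "0 <= bump p 3 4 x * (1 - ?s)" "bump p 3 4 x * (1 - ?s) <= 1 * 1" by (simp, intro mult_mono) auto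
 then show "0 <= competitor T r x" "competitor T r x <= 1" by (simp_all add: competitor_def)
qed

lemma competitor_low:
 assumes "x \<in> ball p 3" "height2 p T x <= r^2" "r > 0" shows "competitor T r x = 0"
proof -
 have "height2 p T x / r^2 <= 1" using assms by simp
 then show ?thesis using assms bump(3)[of 3 4 x p] by (simp add: competitor_def smooth_step)
qed

lemma competitor_high:
 assumes "x \<notin> slab p T r" "r > 0" shows "competitor T r x = 1" "pd i (competitor T r) x = 0"
proof -
 show 1: "competitor T r x = 1"
 proof (cases "x \<in> ball p 4")
  case True
  then have "height2 p T x / r^2 >= 4" using assms by (simp add: slab_def field_simps)
  then show ?thesis by (simp add: competitor_def smooth_step)
 qed (rule competitor_basic(2))
 have d: "competitor T r differentiable (at x)" using smooth_on_differentiable[OF competitor_basic(1) UNIV_I] .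
 have "frechet_derivative (competitor T r) (at x) = (%v. 0)"
  by (rule differential_zero_maxmin[where S = UNIV and f = "competitor T r" and x = x])
   (use d competitor_basic(4) 1 in \<open>auto simp: frechet_derivative_works[symmetric]\<close>)
 then show "pd i (competitor T r) x = 0" by (simp add: pd_def)
qed

text \<open>Only the slab matters. There the three components of \<open>x - p\<close> are at most
  \<open>2 * r\<close>, so the rescaled height has partial derivatives at most \<open>4 / r\<close>;
  the radial cutoff contributes at most 2, which is at most \<open>2 / r\<close>.\<close>

lemma competitor_pd:
 assumes D: "!!t. EX d. (smooth_step has_real_derivative d) (at t) & \<bar>d\<bar> <= D"
  and T: "orthonormal T" "card T = 3" and r: "0 < r" "r <= 1"
 shows "\<bar>pd i (competitor T r) x\<bar> <= 6 * D / r"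
proof (cases "x \<in> slab p T r")
 case True
 have D0: "D >= 0" using D[of 0] by auto
 define q where "q x = (4^2 - (x - p) \<bullet> (x - p)) / (4^2 - 3\<^sup>2)" for x
 define h where "h x = (height2 p T x / r^2 - 1) / 3" for x
 have sm: "smooth q" "smooth h" 
  unfolding q_def[abs_def] h_def[abs_def] divide_inverse
  by (intro smooth_on_diff smooth_on_mult smooth_on_inner smooth_on_const smooth_on_ident smooth_on_height2 open_UNIV)+
 note df = smooth_on_differentiable[OF sm(1) UNIV_I] smooth_on_differentiable[OF sm(2) UNIV_I]
 obtain d1 d2 where d: "(smooth_step has_real_derivative d1) (at (q x))" "\<bar>d1\<bar> <= D"
  "(smooth_step has_real_derivative d2) (at (h x))" "\<bar>d2\<bar> <= D" using D by meson
 have ident: "((%x. x - p) has_derivative (%v. v)) (at x)" by (auto intro!: derivative_eq_intros)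
 have nx: "norm (x - p) <= 4" using True by (simp add: slab_def dist_norm norm_minus_commute)
 have pq: "pd i q x = - (2 / 7) * (x - p) $ i"
 proof -
  have "(q has_derivative (%v. - (2 / 7) * ((x - p) \<bullet> v))) (at x)"
   unfolding q_def[abs_def] by (auto intro!: derivative_eq_intros ident simp: inner_commute)
  from pd_eq[OF this, of i] show ?thesis by (simp add: inner_axis)
 qed
 then have bq: "\<bar>pd i q x\<bar> <= 2"
  using nx component_le_norm_cart[of "x - p" i] by (simp add: abs_mult)
 have ph: "pd i h x = (2 / (3 * r^2)) * (\<Sum>e\<in>T. ((x - p) \<bullet> e) * e $ i)"
 proof -
  have "(h has_derivative (%v. (2 / (3 * r^2)) * (\<Sum>e\<in>T. ((x - p) \<bullet> e) * (v \<bullet> e)))) (at x)"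
   unfolding h_def[abs_def] height2_def power2_eq_square
   using r by (auto intro!: derivative_eq_intros ident ext simp: sum_distrib_left sum_divide_distrib mult_ac intro!: sum.cong)
  from pd_eq[OF this, of i] show ?thesis by (simp add: inner_axis')
 qed
 have "\<bar>\<Sum>e\<in>T. ((x - p) \<bullet> e) * e $ i\<bar> <= (\<Sum>e\<in>T. 2 * r * 1)"
 proof (rule order_trans[OF sum_abs sum_mono])
  fix e assume e: "e \<in> T"
  show "\<bar>(x - p) \<bullet> e * e $ i\<bar> <= 2 * r * 1"
   unfolding abs_mult using slab_component[OF T(1) True _ e] r component_le_norm_cart[of e i] orthonormal_norm[OF T(1) e]
   by (intro mult_mono) auto
 qed
 then have "\<bar>pd i h x\<bar> <= (2 / (3 * r^2)) * (6 * r)"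
  unfolding ph abs_mult using T(2) r by (intro mult_mono) auto
 then have bh: "\<bar>pd i h x\<bar> <= 4 / r" using r by (simp add: power2_eq_square)
 have e: "competitor T r = (%x. 1 - smooth_step (q x) * (1 - smooth_step (h x)))"
  by (simp add: competitor_def[abs_def] bump_def q_def h_def)
 have "pd i (competitor T r) x = - (d1 * pd i q x) * (1 - smooth_step (h x)) + smooth_step (q x) * (d2 * pd i h x)"
 proof -
  have 1: "(%x. smooth_step (q x)) differentiable (at x)" "(%x. smooth_step (h x)) differentiable (at x)"
   using differentiable_compose_real[OF df(1) d(1)] differentiable_compose_real[OF df(2) d(3)] .
  have 2: "pd i (%x. 1 - smooth_step (h x)) x = - (d2 * pd i h x)" if "(%x. smooth_step (h x)) differentiable (at x)" "pd i (%x. smooth_step (h x)) x = d2 * pd i h x" for d2 h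
  proof -
   have m: "(%x. - smooth_step (h x)) differentiable (at x)" using that by simp
   have "pd i (%x. 1 + - smooth_step (h x)) x = 0 + pd i (%x. - smooth_step (h x)) x"
    using pd_add[OF differentiable_const m, of i 1] by simp
   then show ?thesis using that pd_bounded_linear[OF bounded_linear_minus[OF bounded_linear_ident] that(1), of i] by simp
  qed
  have m: "(%x. 1 - smooth_step (h x)) differentiable (at x)" using 1 by simp
  have mm: "(%x. smooth_step (q x) * (1 - smooth_step (h x))) differentiable (at x)" using 1 m by simp
  have "pd i (%x. 1 + - (smooth_step (q x) * (1 - smooth_step (h x)))) x = 0 + - pd i (%x. smooth_step (q x) * (1 - smooth_step (h x))) x"
   using pd_add[OF differentiable_const, of "%x. - (smooth_step (q x) * (1 - smooth_step (h x)))" x i 1] mm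
    pd_bounded_linear[OF bounded_linear_minus[OF bounded_linear_ident] mm, of i] by simp
  then show ?thesis
   using pd_bilinear[OF bounded_bilinear_mult 1(1) m, of i] 2[OF 1(2) pd_compose_real[OF df(2) d(3)]] pd_compose_real[OF df(1) d(1), of i]
   by (simp add: e)
 qed
 also have "\<bar>...\<bar> <= \<bar>(d1 * pd i q x) * (1 - smooth_step (h x))\<bar> + \<bar>smooth_step (q x) * (d2 * pd i h x)\<bar>"
  using abs_triangle_ineq[of "- (d1 * pd i q x) * (1 - smooth_step (h x))"] by simp
 also have "... <= D * 2 * 1 + 1 * (D * (4 / r))"
  unfolding abs_mult
  by (intro add_mono mult_mono d bq bh) (use smooth_step(1,2) D0 r in auto)
 also have "... <= 6 * D / r"
 proof -
  have "D * 2 * 1 <= D * 2 * (1 / r)" using r D0 by (intro mult_left_mono) auto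
  then show ?thesis by simp
 qed
 finally show ?thesis .
next
 case False
 then show ?thesis using competitor_high(2)[OF False r(1)] D[of 0] r by fastforce
qed


lemma integral_indicator_cell:
 assumes "B \<in> lmeasurable" "B \<subseteq> cell p"
 shows "((%x. indicator B x :: real) has_integral measure lebesgue B) (cell p)"
proof -
 have eq: "indicator B = (%x. if x \<in> B then 1 else (0::real))" by (auto simp: indicator_def)
 have "((%x. if x \<in> B then 1 else (0::real)) has_integral measure lebesgue B) UNIV"
  using assms(1) unfolding lmeasurable_iff_has_integral eq .
 then show ?thesis unfolding eq has_integral_restrict_UNIV has_integral_restrict[OF assms(2)] .
qed

text \<open>The form contributes at most \<sigma>^2 wherever the competitor does not vanish. The
  squared gradient, at most 36 D^2 / r^2 per direction, lives on a slab of volume at most 40^n r^3,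
  which leaves one factor r = 1/M; the number 108 is 3 times 36.\<close>

lemma competitor_energy:
 assumes D: "!!t. EX d. (smooth_step has_real_derivative d) (at t) & \<bar>d\<bar> <= D"
  and T: "orthonormal T" "card T = 3" and M: "M >= 1" and \<sigma>: "\<sigma> >= 0"
  and Ab: "!!x i v. x \<in> ball p 3 ==> (1 / real M)^2 <= height2 p T x ==> norm (A i x *v v) <= \<sigma> * norm v"
  and e: "norm e = 1"
 shows "EX \<psi>. smooth \<psi> & periodic \<psi> &
  intc p (competitor_density e \<psi>) <=
   3 * real CARD('n) * \<sigma>^2 * 10 ^ CARD('n) + (108 * real CARD('n) * D^2 + 1) * 40 ^ CARD('n) / real M"
proof -
 define r where "r = 1 / real M"
 have r: "0 < r" "r <= 1" using M by (auto simp: r_def)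
 define \<psi> where "\<psi> x = competitor T r (wrap p x)" for x
 have \<psi>: "smooth \<psi>" "periodic \<psi>"
  unfolding \<psi>_def[abs_def] using competitor_basic(2) by (blast intro!: smooth_on_wrap competitor_basic(1) periodic_wrap_compose)+
 let ?n = "real CARD('n)"
 define K where "K = 108 * ?n * D^2 / r^2 + 1"
 have K: "K >= 0" by (simp add: K_def)
 have pt: "competitor_density e \<psi> x <= 3 * ?n * \<sigma>^2 + K * indicator (slab p T r) x" if x: "x \<in> cell p" for x
 proof -
  have near: "\<bar>x $ i - p $ i\<bar> < 6" for i by (rule cell_near[OF x])
  have ev: "\<psi> x = competitor T r x"
   unfolding \<psi>_def by (rule wrap_near[where f = "competitor T r", OF competitor_basic(2) near])
  have pv: "pd i \<psi> x = pd i (competitor T r) x" for i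
   unfolding \<psi>_def[abs_def] by (rule pd_wrap[where f = "competitor T r", OF competitor_basic(1,2) near])
  have Ae: "tA i x = cut (A i) x" for i unfolding tA_def by (rule wrap_near[where f = "cut (A i)", OF cut_outside[OF ball_4] near])
  have A1: "(\<psi> x)^2 * nsq (tA i x *v e) <= \<sigma>^2" for i
  proof (cases "x \<in> ball p 3 & r\<^sup>2 < height2 p T x")
   case True
   have "norm (A i x *v e) <= \<sigma>" using Ab[of x i e] True e by (simp add: r_def)
   moreover have "norm (tA i x *v e) <= 1 * norm (A i x *v e)"
    using True bump(1,2)[of "5/2" 3 p x]
    by (simp add: Ae cut_def scaleR_matrix_vector_assoc[symmetric] mult_left_le_one_le)
   ultimately have "\<bar>\<psi> x * norm (tA i x *v e)\<bar> <= 1 * \<sigma>"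
    unfolding abs_mult ev using competitor_basic(3,4)[of T r x] by (intro mult_mono) auto
   then show ?thesis using \<sigma> unfolding power_mult_distrib[symmetric] by (simp add: abs_le_square_iff[symmetric])
  next
   case False
   then have "tA i x = 0 \<or> \<psi> x = 0"
    using cut_outside[of x "A i"] competitor_low[of x T r] r(1) unfolding Ae ev by linarith
   then show ?thesis by auto
  qed
  have "(SUM i. (pd i \<psi> x)^2 + (\<psi> x)^2 * nsq (tA i x *v e)) <= (\<Sum>i\<in>(UNIV::'n set). 36 * D^2 / r^2 * indicator (slab p T r) x + \<sigma>^2)"
  proof (intro sum_mono add_mono A1)
   fix i
   have "(pd i (competitor T r) x)^2 <= (6 * D / r)^2"
    using power_mono[OF competitor_pd[OF D T r, of i x], of 2] by simp
   then show "(pd i \<psi> x)^2 <= 36 * D^2 / r^2 * indicator (slab p T r) x"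
    using competitor_high(2)[of x T r i] r(1) by (auto simp: pv indicator_def power_mult_distrib power_divide)
  qed
  moreover have "(1 - \<psi> x)^2 <= indicator (slab p T r) x"
   using competitor_basic(3,4)[of T r x] competitor_high(1)[of x T r] r(1) by (auto simp: ev indicator_def power2_eq_square mult_le_one)
  ultimately have "competitor_density e \<psi> x <= 3 * (\<Sum>i\<in>(UNIV::'n set). 36 * D^2 / r^2 * indicator (slab p T r) x + \<sigma>^2) + indicator (slab p T r) x"
   unfolding competitor_density_def by (intro add_mono mult_left_mono) auto
  also have "... = 3 * ?n * \<sigma>^2 + K * indicator (slab p T r) x" by (simp add: K_def algebra_simps)
  finally show ?thesis .
 qed
 have sl: "slab p T r \<subseteq> cell p"
 proof
  fix x assume "x \<in> slab p T r"
  then have "norm (x - p) < 4" by (simp add: slab_def dist_norm norm_minus_commute)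
  then have "\<bar>(x - p) $ i\<bar> <= 5" for i using component_le_norm_cart[of "x - p" i] by linarith
  then show "x \<in> cell p" by (simp add: mem_cell)
 qed
 have "((%x. 3 * ?n * \<sigma>^2) has_integral 10 ^ CARD('n) * (3 * ?n * \<sigma>^2)) (cell p)"
  using has_integral_const[of "3 * ?n * \<sigma>^2" "p - (\<chi> i. 5)" "p + (\<chi> i. 5)"] content_cell[of p] by (simp add: cell_def)
 from has_integral_add[OF this has_integral_mult_right[OF integral_indicator_cell[OF slab_lmeasurable sl]], of K]
 have I: "((%x. 3 * ?n * \<sigma>^2 + K * indicator (slab p T r) x) has_integral
   10 ^ CARD('n) * (3 * ?n * \<sigma>^2) + K * measure lebesgue (slab p T r)) (cell p)" .
 have "intc p (competitor_density e \<psi>) <= 10 ^ CARD('n) * (3 * ?n * \<sigma>^2) + K * measure lebesgue (slab p T r)"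
  by (rule has_integral_le[OF integrable_integral[OF integrable_cell[OF continuous_competitor_density[OF \<psi>(1)]]] I pt])
 also have "K * measure lebesgue (slab p T r) <= K * (40 ^ CARD('n) / real M ^ 3)"
  unfolding r_def by (intro mult_left_mono slab_measure T M K)
 also have "... <= (108 * ?n * D^2 + 1) * 40 ^ CARD('n) / real M"
 proof -
  have "K * r^2 <= 108 * ?n * D^2 + 1" using r by (simp add: K_def distrib_right power_le_one)
  then have "(K * r^2) * (40 ^ CARD('n) * r) <= (108 * ?n * D^2 + 1) * (40 ^ CARD('n) * r)" using r by (intro mult_right_mono) auto
  then show ?thesis by (simp add: r_def field_simps power2_eq_square power3_eq_cube)
 qed
 finally show ?thesis using \<psi> by (intro exI[of _ \<psi>]) (simp add: mult_ac)
qed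

end

lemma nn_integral_le_cell:
 fixes f :: "real^'n => real"
 assumes f: "continuous_on UNIV f" "!!x. 0 <= f x" and B: "B \<subseteq> cell p" "!!x. x \<in> B ==> g x <= f x"
 shows "(\<integral>\<^sup>+x\<in>B. ennreal (g x) \<partial>lborel) <= ennreal (intc p f)"
proof -
 have "(\<integral>\<^sup>+x\<in>B. ennreal (g x) \<partial>lborel) <= (\<integral>\<^sup>+x. ennreal (if x \<in> cell p then f x else 0) \<partial>lborel)"
  using B f(2) by (intro nn_integral_mono) (auto simp: indicator_def intro: ennreal_leI)
 also have "... = ennreal (intc p f)"
 proof (rule nn_integral_has_integral_lborel)
  show "(%x. if x \<in> cell p then f x else 0) \<in> borel_measurable borel"
   by (intro measurable_If_set borel_measurable_continuous_onI f) (auto simp: cell_def)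
  show "((%x. if x \<in> cell p then f x else 0) has_integral intc p f) UNIV"
   unfolding has_integral_restrict_UNIV by (intro integrable_integral integrable_cell f)
 qed (simp add: f)
 finally show ?thesis .
qed

definition almost_parallel ::
  "real^'n => ('n => 'n => real^'n => real) => ('n => real^'n => real^'k^'k) => real
   => ('k => real^'n => real^'k) => bool" where
 "almost_parallel p a A \<epsilon> u \<longleftrightarrow>
   (ALL b. smooth (u b)) & (ALL b x. norm (u b x) <= 1) &
   (ALL b. \<forall>x\<in>ball p (11/5). (SUM i. pd i (%y. SUM l. a i l y *\<^sub>R (pd l (u b) y + A l y *v u b y)) x
     + A i x *v (SUM l. a i l x *\<^sub>R (pd l (u b) x + A l x *v u b x))) = 0) &
   (ALL b. (\<integral>\<^sup>+x\<in>ball p (11/5). ennreal (SUM i. nsq (pd i (u b) x + A i x *v u b x)) \<partial>lborel) <= ennreal \<epsilon>) &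
   (ALL b c. (\<integral>\<^sup>+x\<in>ball p (11/5). ennreal \<bar>u b x \<bullet> u c x - (kd b c)\<bar> \<partial>lborel) <= ennreal \<epsilon>)"

theorem almost_parallel_sections:
 fixes \<epsilon> :: real
 assumes "\<epsilon> > 0"
 shows "EX \<rho> \<sigma>. 0 < \<rho> & \<rho> <= 1 & 0 < \<sigma> & (\<forall>(p :: real^'n) a (A :: 'n => real^'n => real^'k^'k) T.
  local_operator p a A & orthonormal T & card T = 3 &
  (\<forall>x\<in>ball p 3. \<rho>\<^sup>2 <= height2 p T x --> (ALL i v. norm (A i x *v v) <= \<sigma> * norm v)) -->
  (EX u. almost_parallel p a A \<epsilon> u))"
proof -
 let ?n = "real CARD('n)" and ?N = "CARD('n)"
 obtain D where D: "D > 0" "!!t. EX d. (smooth_step has_real_derivative d) (at t) & \<bar>d\<bar> <= D"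
  using smooth_step_deriv_bound by blast
 \<comment> \<open>The budget: \<kappa> makes the first term of \<open>orthonormality_defect\<close>
   equal to \<epsilon>/2, and the bound \<open>E\<close> on each energy makes the second at most
   \<epsilon>/2. Of \<open>E\<close>, one half pays for the slab, by the choice of \<open>M\<close>,
   and one half for the form, by the choice of \<sigma>.\<close>
 define \<kappa> where "\<kappa> = \<epsilon> / (28 * 10 ^ ?N)"
 have \<kappa>: "\<kappa> > 0" "14 * \<kappa> * 10 ^ ?N = \<epsilon> / 2" using assms by (simp_all add: \<kappa>_def)
 define E where "E = min (\<epsilon> / 2) (\<epsilon> * \<kappa> / 48)"
 have E: "E > 0" "2 * E <= \<epsilon>" "12 / \<kappa> * (E + E) <= \<epsilon> / 2" using assms \<kappa>(1) by (auto simp: E_def min_def field_simps)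
 define c where "c = (108 * ?n * D^2 + 1) * 40 ^ ?N"
 have c: "c > 0" unfolding c_def by (intro mult_pos_pos add_nonneg_pos) auto
 obtain M :: nat where M: "M > 2 * c / E" using reals_Archimedean2 by blast
 moreover have "2 * c / E > 0" using c E(1) by simp
 ultimately have M1: "M >= 1" by (cases M) auto
 have M2: "c / real M <= E / 2" using M M1 E(1) by (simp add: field_simps)
 define \<sigma> where "\<sigma> = sqrt (E / (6 * ?n * 10 ^ ?N))"
 have \<sigma>: "\<sigma> > 0" "3 * ?n * \<sigma>^2 * 10 ^ ?N = E / 2" using E(1) by (simp_all add: \<sigma>_def)
 show ?thesis
 proof (rule exI[of _ "1 / real M"], rule exI[of _ \<sigma>], intro conjI allI impI)
  show "0 < 1 / real M" "1 / real M <= 1" "0 < \<sigma>" using M1 \<sigma> by auto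
  fix p :: "real^'n" and a A and T :: "(real^'n) set"
  assume H: "local_operator p a (A :: 'n => real^'n => real^'k^'k) & orthonormal T & card T = 3 &
   (\<forall>x\<in>ball p 3. (1 / real M)^2 <= height2 p T x --> (ALL i v. norm (A i x *v v) <= \<sigma> * norm v))"
  then interpret local_operator p a A by blast
  have Ab: "!!x i v. x \<in> ball p 3 ==> (1 / real M)^2 <= height2 p T x ==> norm (A i x *v v) <= \<sigma> * norm v"
   using H by blast
  define u where "u b = (SOME u. sol (axis b 1) u)" for b
  have u: "sol (axis b 1) (u b)" for b unfolding u_def by (rule someI_ex[OF sol_exists])
  have us: "smooth (u b)" for b using u[of b] by (simp add: sol_def)
  have en: "intc p (energy_density (axis b 1) (u b)) <= E" for b
  proof -
   obtain \<psi> where \<psi>: "smooth \<psi>" "periodic \<psi>"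
    "intc p (competitor_density (axis b 1) \<psi>) <= 3 * ?n * \<sigma>^2 * 10 ^ ?N + c / real M"
    using competitor_energy[OF D(2) _ _ M1 less_imp_le[OF \<sigma>(1)] Ab, of T "axis b 1"] H unfolding c_def by auto
   have "intc p (energy_density (axis b 1) (u b)) <= intc p (competitor_density (axis b 1) \<psi>)"
    by (rule energy_le[OF u[of b] _ \<psi>(1,2)]) simp
   then show ?thesis using \<psi>(3) M2 unfolding \<sigma>(2) by linarith
  qed
  have sub: "ball p (11/5) \<subseteq> cell p"
  proof
   fix x assume "x \<in> ball p (11/5)"
   then have "norm (x - p) < 4" by (simp add: dist_norm norm_minus_commute)
   then have "\<bar>(x - p) $ i\<bar> <= 5" for i using component_le_norm_cart[of "x - p" i] by linarith
   then show "x \<in> cell p" by (simp add: mem_cell)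
  qed
  show "EX u. almost_parallel p a A \<epsilon> u"
   unfolding almost_parallel_def
  proof (intro exI[of _ u] conjI allI ballI us)
   show "norm (u b x) <= 1" for b x by (rule sol_norm_le_1[OF u]) simp
   show "(SUM i. pd i (%y. SUM l. a i l y *\<^sub>R (pd l (u b) y + A l y *v u b y)) x
     + A i x *v (SUM l. a i l x *\<^sub>R (pd l (u b) x + A l x *v u b x))) = 0" if "x \<in> ball p (11/5)" for b x
    by (rule equation_inside[OF u that])
   show "(\<integral>\<^sup>+x\<in>ball p (11/5). ennreal (SUM i. nsq (pd i (u b) x + A i x *v u b x)) \<partial>lborel) <= ennreal \<epsilon>" for b
   proof (rule order_trans[OF nn_integral_le_cell[where f = "%x. 2 * energy_density (axis b 1) (u b) x", OF _ _ sub]])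
    show "continuous_on UNIV (%x. 2 * energy_density (axis b 1) (u b) x)" by (intro continuous_intros continuous_energy_density us)
    show "0 <= 2 * energy_density (axis b 1) (u b) x" for x by (simp add: energy_density_def sum_nonneg X)
    show "(SUM i. nsq (pd i (u b) x + A i x *v u b x)) <= 2 * energy_density (axis b 1) (u b) x" if x: "x \<in> ball p (11/5)" for x
    proof -
     have "x \<in> ball p (5/2)" using x by simp
     then show ?thesis by (simp add: energy_density_def cd_inside X)
    qed
    show "ennreal (intc p (%x. 2 * energy_density (axis b 1) (u b) x)) <= ennreal \<epsilon>"
     using en[of b] E(2) by (intro ennreal_leI) simp
   qed
   show "(\<integral>\<^sup>+x\<in>ball p (11/5). ennreal \<bar>u b x \<bullet> u c x - (kd b c)\<bar> \<partial>lborel) <= ennreal \<epsilon>" for b c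
   proof (rule order_trans[OF nn_integral_le_cell[where f = "%x. \<bar>u b x \<bullet> u c x - (axis b 1 :: real^'k) \<bullet> axis c 1\<bar>", OF _ _ sub]])
    show "continuous_on UNIV (%x. \<bar>u b x \<bullet> u c x - (axis b 1 :: real^'k) \<bullet> axis c 1\<bar>)" by (intro continuous_intros smooth_on_continuous_on us)
    show "\<bar>u b x \<bullet> u c x - (kd b c)\<bar> <= \<bar>u b x \<bullet> u c x - (axis b 1 :: real^'k) \<bullet> axis c 1\<bar>" for x
     by (simp add: inner_axis_axis inner_real_def)
    have "intc p (%x. \<bar>u b x \<bullet> u c x - (axis b 1 :: real^'k) \<bullet> axis c 1\<bar>) <= 14 * \<kappa> * 10 ^ ?N + 12 / \<kappa> * (E + E)"
     by (rule order_trans[OF orthonormality_defect[OF u u _ _ \<kappa>(1)]])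
       ((simp; fail)+, intro add_left_mono mult_left_mono add_mono en, use \<kappa>(1) in simp)
    then show "ennreal (intc p (%x. \<bar>u b x \<bullet> u c x - (axis b 1 :: real^'k) \<bullet> axis c 1\<bar>)) <= ennreal \<epsilon>"
     using E(3) \<kappa>(2) by (intro ennreal_leI) simp
   qed simp
  qed
 qed
qed

section \<open>Global frames\<close>

lemma matrix_add_rdistrib: "(A + B) ** C = A ** C + B ** (C :: real^'l^'m)" for A B :: "real^'m^'n"
 by (simp add: matrix_matrix_mult_def vec_eq_iff distrib_right sum.distrib)

lemma matrix_scaleR_mult: "(c *\<^sub>R A) ** B = c *\<^sub>R (A ** B)" "A ** (c *\<^sub>R B) = c *\<^sub>R (A ** B)"
 for A :: "real^'m^'n" and B :: "real^'l^'m"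
 by (simp_all add: matrix_matrix_mult_def vec_eq_iff sum_distrib_left mult_ac)

lemma bounded_bilinear_matrix_mult:
 "bounded_bilinear ((**) :: real^'m^'n => real^'l^'m => real^'l^'n)"
proof (rule bilinear_conv_bounded_bilinear[THEN iffD1])
 show "bilinear ((**) :: real^'m^'n => real^'l^'m => real^'l^'n)"
  by (auto simp: bilinear_def matrix_add_ldistrib matrix_add_rdistrib matrix_scaleR_mult intro!: linearI)
qed

lemma bounded_linear_transpose: "bounded_linear (transpose :: real^'m^'n => real^'n^'m)"
 by (rule linear_conv_bounded_linear[THEN iffD1], rule linearI) (auto simp: transpose_def vec_eq_iff)

text \<open>The columns of \<open>R x z\<close> are orthonormal sections of the vector bundle,
  written in the trivialisation over \<open>U x\<close>. The frame takes values in the orthogonal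
  group and not in \<open>G\<close>, which suffices because lengths and skewness are all that is
  used of the structure.\<close>

definition orthonormal_frame ::
  "(real^'n) set => (real^'n => (real^'n) set) => (real^'n => real^'n => real^'n => real^'k^'k)
   => (real^'n) set => (real^'n => real^'n => real^'k^'k) => bool" where
 "orthonormal_frame M U \<tau> W R \<longleftrightarrow> open W & W \<subseteq> M &
   (\<forall>x\<in>M. smooth_on (U x \<inter> W) (R x) & (\<forall>z\<in>U x \<inter> W. orthogonal_matrix (R x z))) &
   (\<forall>x\<in>M. \<forall>y\<in>M. \<forall>z\<in>U x \<inter> U y \<inter> W. R x z = \<tau> x y z ** R y z)"

lemma orthonormal_frameD:
 assumes "orthonormal_frame M U \<tau> W R"
 shows "open W" "W \<subseteq> M" "x \<in> M ==> smooth_on (U x \<inter> W) (R x)"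
  "x \<in> M ==> z \<in> U x ==> z \<in> W ==> orthogonal_matrix (R x z)"
  "x \<in> M ==> y \<in> M ==> z \<in> U x ==> z \<in> U y ==> z \<in> W ==> R x z = \<tau> x y z ** R y z"
 using assms unfolding orthonormal_frame_def by blast+

definition framed ::
  "(real^'n) set => (real^'n => (real^'n) set) => (real^'n => real^'n => real^'n => real^'k^'k)
   => (real^'n) set => bool" where
 "framed M U \<tau> K \<longleftrightarrow> (EX W R. K \<subseteq> W & orthonormal_frame M U \<tau> W R)"

lemma framed_subset: "framed M U \<tau> K ==> L \<subseteq> K ==> framed M U \<tau> L"
 unfolding framed_def by blast

text \<open>A smooth substitute for the projection to the hyperplane where coordinate
  \<open>i\<close> equals \<open>c\<close>: it is uniformly close to the projection, but the
  identity near the hyperplane, so that composition with it extends a function instead of only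
  interpolating its values.\<close>

definition slice_map :: "'n::finite => real => real => real^'n => real^'n" where
 "slice_map i c \<kappa> x = x + ax ((x $ i - c) * (smooth_step (2 - (x $ i - c)^2 / \<kappa>^2) - 1)) i"

lemma slice_map:
 assumes "\<kappa> > 0"
 shows "open S ==> smooth_on S (slice_map i c \<kappa>)"
  and "\<bar>x $ i - c\<bar> < \<kappa> ==> slice_map i c \<kappa> x = x"
  and "dist (slice_map i c \<kappa> x) (x + ax (c - x $ i) i) <= 2 * \<kappa>"
proof -
 show "smooth_on S (slice_map i c \<kappa>)" if S: "open S"
  unfolding slice_map_def[abs_def] power2_eq_square divide_inverse
  by (intro smooth_on_add smooth_on_scaleR smooth_on_mult smooth_on_diff smooth_on_smooth_step smooth_on_nth smooth_on_ident smooth_on_const S)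
 let ?s = "smooth_step (2 - (x $ i - c)^2 / \<kappa>^2)"
 show "slice_map i c \<kappa> x = x" if "\<bar>x $ i - c\<bar> < \<kappa>"
 proof -
  have "(x $ i - c)^2 <= \<kappa>^2" using power_mono[of "\<bar>x $ i - c\<bar>" \<kappa> 2] that by simp
  then have "?s = 1" using assms by (intro smooth_step(4)) (simp add: divide_simps)
  then show ?thesis by (simp add: slice_map_def)
 qed
 have "slice_map i c \<kappa> x - (x + ax (c - x $ i) i) = ax ((x $ i - c) * ?s) i"
  by (simp add: slice_map_def algebra_simps)
 then have d: "dist (slice_map i c \<kappa> x) (x + ax (c - x $ i) i) = \<bar>x $ i - c\<bar> * ?s"
  by (simp add: dist_norm abs_mult smooth_step)
 show "dist (slice_map i c \<kappa> x) (x + ax (c - x $ i) i) <= 2 * \<kappa>"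
 proof (cases "\<bar>x $ i - c\<bar> <= 2 * \<kappa>")
  case True
  have "\<bar>x $ i - c\<bar> * ?s <= \<bar>x $ i - c\<bar> * 1" by (intro mult_left_mono smooth_step) auto
  then show ?thesis using True d by simp
 next
  case False
  then have "(2 * \<kappa>)^2 <= (x $ i - c)^2" using assms power_mono[of "2 * \<kappa>" "\<bar>x $ i - c\<bar>" 2] by simp
  then have "2 * \<kappa>^2 <= (x $ i - c)^2"
   by (rule order_trans[rotated]) (simp add: power_mult_distrib)
  then have "?s = 0" using assms by (intro smooth_step(3)) (simp add: divide_simps)
  then show ?thesis using d assms by simp
 qed
qed

lemma orthogonal_matrix_transpose_mult:
 "orthogonal_matrix Q ==> transpose Q ** Q = mat 1" "orthogonal_matrix Q ==> Q ** transpose Q = mat 1"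
 for Q :: "real^'k^'k"
 by (auto simp: orthogonal_matrix_def)

lemma orthogonal_matrix_T: "orthogonal_matrix Q ==> orthogonal_matrix (transpose Q)"
 for Q :: "real^'k^'k"
 by (auto simp: orthogonal_matrix_def)

locale so_bundle =
 fixes G :: "(real^'k^'k) set" and M :: "(real^'n) set" and U and \<tau>
 assumes G: "compact_subgroup_SO G" and P: "principal_bundle G M U \<tau>"
begin

lemma U: "x \<in> M ==> open (U x)" "x \<in> M ==> x \<in> U x" "x \<in> M ==> U x \<subseteq> M"
 and tau: "x \<in> M ==> y \<in> M ==> smooth_on (U x \<inter> U y) (\<tau> x y)"
  "x \<in> M ==> z \<in> U x ==> \<tau> x x z = mat 1"
  "x \<in> M ==> y \<in> M ==> w \<in> M ==> z \<in> U x ==> z \<in> U y ==> z \<in> U w ==> \<tau> x y z ** \<tau> y w z = \<tau> x w z"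
 using P unfolding principal_bundle_def by blast+

lemma tau_orth: "x \<in> M ==> y \<in> M ==> z \<in> U x ==> z \<in> U y ==> orthogonal_matrix (\<tau> x y z)"
 using P G unfolding principal_bundle_def compact_subgroup_SO_def by blast

lemma framed_U: "x \<in> M ==> framed M U \<tau> (U x)"
 unfolding framed_def orthonormal_frame_def
 by (rule exI[of _ "U x"], rule exI[of _ "%y. \<tau> y x"]) (use U tau(1,3) tau_orth in auto)

text \<open>The transition function \<open>T\<close> between two frames is composed with a map onto a neighbourhood
 of the common face, which extends it over the whole second piece.\<close>

lemma framed_glue:
 fixes i :: 'n
 assumes s: "s = 1 \<or> s = -1" and K: "compact K"
  and f1: "framed M U \<tau> (K \<inter> {x. s * (x $ i - c) <= 0})" and f2: "framed M U \<tau> (K \<inter> {x. s * (x $ i - c) >= 0})"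
  and proj: "!!x. x \<in> K ==> s * (x $ i - c) >= 0 ==> x + ax (c - x $ i) i \<in> K"
 shows "framed M U \<tau> K"
proof -
 obtain W1 R1 where 1: "K \<inter> {x. s * (x $ i - c) <= 0} \<subseteq> W1" "orthonormal_frame M U \<tau> W1 R1" using f1 unfolding framed_def by blast
 obtain W2 R2 where 2: "K \<inter> {x. s * (x $ i - c) >= 0} \<subseteq> W2" "orthonormal_frame M U \<tau> W2 R2" using f2 unfolding framed_def by blast
 note f1 = orthonormal_frameD[OF 1(2)] and f2 = orthonormal_frameD[OF 2(2)]
 note o = f1(1) f2(1) f1(2) f2(2) and sm = f1(3) f2(3) and ort = f1(4) f2(4) and eqv = f1(5) f2(5)
 \<comment> \<open>Both frames pick up the same transition factor, so \<open>T\<close> does not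
   depend on the trivialisation in which it is computed.\<close>
 define T where "T z = transpose (R2 z z) ** R1 z z" for z
 have T: "T z = transpose (R2 x z) ** R1 x z" if "x \<in> M" "z \<in> U x" "z \<in> W1" "z \<in> W2" for x z
 proof -
  have z: "z \<in> M" "z \<in> U z" using that o U by auto
  have "transpose (R2 x z) ** R1 x z = transpose (R2 z z) ** ((transpose (\<tau> x z z) ** \<tau> x z z) ** R1 z z)"
   unfolding eqv(1)[OF that(1) z(1) that(2) z(2) that(3)] eqv(2)[OF that(1) z(1) that(2) z(2) that(4)]
   by (simp only: matrix_transpose_mul matrix_mul_assoc)
  then show ?thesis by (simp add: T_def orthogonal_matrix_transpose_mult tau_orth that z)
 qed
 have R12: "R1 x z = R2 x z ** T z" if "x \<in> M" "z \<in> U x" "z \<in> W1" "z \<in> W2" for x z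
  unfolding T[OF that] matrix_mul_assoc by (simp add: orthogonal_matrix_transpose_mult ort that)
 have To: "orthogonal_matrix (T z)" if "z \<in> W1" "z \<in> W2" for z
  unfolding T_def using that o U by (intro orthogonal_matrix_mul orthogonal_matrix_T ort) auto
 have Ts: "smooth_on (W1 \<inter> W2) T"
 proof (rule smooth_on_local)
  fix z assume z: "z \<in> W1 \<inter> W2"
  then have zM: "z \<in> M" using o by auto
  let ?S = "U z \<inter> (W1 \<inter> W2)"
  have S: "open ?S" using U(1)[OF zM] o by auto
  have "smooth_on ?S (%y. transpose (R2 z y) ** R1 z y)"
   by (intro smooth_on_bilinear[OF bounded_bilinear_matrix_mult S] smooth_on_bounded_linear[OF bounded_linear_transpose S])
     (auto intro: smooth_on_subset[OF sm(1)[OF zM]] smooth_on_subset[OF sm(2)[OF zM]])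
  then have "smooth_on ?S T" by (rule smooth_on_cong[OF S _, rotated]) (use T[OF zM] in auto)
  then show "EX S. open S & z \<in> S & smooth_on S T" using S z U(2)[OF zM] by blast
 qed
 let ?F = "K \<inter> {x. x $ i = c}"
 have "closed {x :: real^'n. x $ i = c}" by (intro closed_Collect_eq continuous_intros)
 then have Fc: "compact ?F" using K by (rule compact_Int_closed[rotated])
 have Fsub: "?F \<subseteq> W1 \<inter> W2" using 1(1) 2(1) by auto
 obtain \<kappa> where \<kappa>: "\<kappa> > 0" "!!x y. x \<in> ?F ==> dist y x <= 2 * \<kappa> ==> y \<in> W1 \<inter> W2"
 proof -
  obtain e where e: "e > 0" "(\<Union>x\<in>?F. cball x e) \<subseteq> W1 \<inter> W2"
   using compact_subset_open_imp_cball_epsilon_subset[OF Fc _ Fsub] o by blast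
  show thesis
  proof (rule that[of "e / 2"])
   show "e / 2 > 0" using e(1) by simp
   show "y \<in> W1 \<inter> W2" if "x \<in> ?F" "dist y x <= 2 * (e / 2)" for x y
   proof -
    have "y \<in> (\<Union>x\<in>?F. cball x e)" using that by (auto simp: dist_commute)
    then show ?thesis using e(2) by blast
   qed
  qed
 qed
 let ?f = "slice_map i c \<kappa>"
 define V where "V = {z \<in> W2. ?f z \<in> W1 \<inter> W2}"
 have cont: "continuous_on UNIV ?f" by (rule smooth_on_continuous_on[OF slice_map(1)[OF \<kappa>(1) open_UNIV]])
 have Vo: "open V"
 proof -
  have "V = W2 \<inter> ?f -` (W1 \<inter> W2)" by (auto simp: V_def)
  moreover have "open (?f -` (W1 \<inter> W2))" using open_vimage[OF open_Int[OF o(1,2)] cont] .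
  ultimately show ?thesis using o by auto
 qed
 have VK: "x \<in> V" if x: "x \<in> K" "s * (x $ i - c) >= 0" for x
 proof -
  have "x + ax (c - x $ i) i \<in> ?F" using proj[OF x] by (auto simp: axis_def)
  from \<kappa>(2)[OF this slice_map(3)[OF \<kappa>(1)]] show ?thesis using 2(1) x by (auto simp: V_def)
 qed
 \<comment> \<open>Close to the face \<open>?f\<close> is the identity and \<open>R2\<close> times
   \<open>T\<close> is \<open>R1\<close>; hence both formulas agree on the open set \<open>N\<close>
   below, and smoothness has to be checked only on \<open>N\<close>, \<open>B\<close> and
   \<open>D\<close>.\<close>
 define R where "R x z = (if s * (z $ i - c) <= 0 then R1 x z else R2 x z ** T (?f z))" for x z
 define N where "N = W1 \<inter> V \<inter> {x. \<bar>x $ i - c\<bar> < \<kappa>}"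
 define B where "B = W1 \<inter> {x. s * (x $ i - c) < 0}"
 define D where "D = V \<inter> {x. s * (x $ i - c) > 0}"
 have op: "open N" "open B" "open D"
  unfolding N_def B_def D_def using o Vo by (auto intro!: open_Int open_Collect_less continuous_intros)
 have RB: "R x z = R1 x z" if "z \<in> B" for x z using that by (auto simp: R_def B_def)
 have RD: "R x z = R2 x z ** T (?f z)" if "z \<in> D" for x z using that by (auto simp: R_def D_def)
 have RN: "R x z = R1 x z" if "x \<in> M" "z \<in> U x" "z \<in> N" for x z
  using that R12[of x z] slice_map(2)[OF \<kappa>(1), of z i c] by (auto simp: R_def N_def V_def)
 have "K \<subseteq> N \<union> B \<union> D"
 proof
  fix x assume x: "x \<in> K"
  consider "s * (x $ i - c) < 0" | "x $ i = c" | "s * (x $ i - c) > 0" using s by (cases "x $ i = c"; force)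
  then show "x \<in> N \<union> B \<union> D"
  proof cases
   case 1 then show ?thesis using x `K \<inter> _ \<subseteq> W1` by (auto simp: B_def)
  next
   case 2 then show ?thesis using x `K \<inter> _ \<subseteq> W1` VK[OF x] \<kappa>(1) by (auto simp: N_def)
  next
   case 3 then show ?thesis using VK[OF x] by (auto simp: D_def)
  qed
 qed
 moreover have "orthonormal_frame M U \<tau> (N \<union> B \<union> D) R"
  unfolding orthonormal_frame_def
 proof (intro conjI ballI)
  show "open (N \<union> B \<union> D)" using op by auto
  show "N \<union> B \<union> D \<subseteq> M" using o by (auto simp: N_def B_def D_def V_def)
  fix x assume x: "x \<in> M"
  show "orthogonal_matrix (R x z)" if z: "z \<in> U x \<inter> (N \<union> B \<union> D)" for z
  proof -
   consider "z \<in> N \<or> z \<in> B" "z \<in> W1" | "z \<in> D" "z \<in> W2" "?f z \<in> W1" "?f z \<in> W2"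
    using z unfolding N_def B_def D_def V_def by blast
   then show ?thesis
    by cases (use z x RN[OF x] RB RD in \<open>auto intro!: ort orthogonal_matrix_mul To\<close>)
  qed
  show "smooth_on (U x \<inter> (N \<union> B \<union> D)) (R x)"
  proof -
   have oN: "open (U x \<inter> N)" "open (U x \<inter> B)" "open (U x \<inter> D)" using U(1)[OF x] op by auto
   have "smooth_on (U x \<inter> N) (R x)"
    by (rule smooth_on_cong[OF oN(1) _ smooth_on_subset[OF sm(1)[OF x]]]) (auto simp: RN[OF x] N_def)
   moreover have "smooth_on (U x \<inter> B) (R x)"
    by (rule smooth_on_cong[OF oN(2) _ smooth_on_subset[OF sm(1)[OF x]]]) (auto simp: RB B_def)
   moreover have "smooth_on (U x \<inter> D) (R x)"
   proof (rule smooth_on_cong[OF oN(3)])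
    have "smooth_on (U x \<inter> D) (%z. T (?f z))"
     by (rule smooth_on_compose[where T = "W1 \<inter> W2", OF oN(3) _ _ slice_map(1)[OF \<kappa>(1) oN(3)] Ts])
       (use o in \<open>auto simp: D_def V_def\<close>)
    then show "smooth_on (U x \<inter> D) (%z. R2 x z ** T (?f z))"
     by (intro smooth_on_bilinear[OF bounded_bilinear_matrix_mult oN(3)] smooth_on_subset[OF sm(2)[OF x]])
       (auto simp: D_def V_def)
   qed (simp add: RD)
   ultimately have "smooth_on ((U x \<inter> N \<union> U x \<inter> B) \<union> U x \<inter> D) (R x)"
    using oN by (intro smooth_on_open_Un) auto
   then show ?thesis by (simp only: Int_Un_distrib)
  qed
  show "R x z = \<tau> x y z ** R y z" if y: "y \<in> M" and z: "z \<in> U x \<inter> U y \<inter> (N \<union> B \<union> D)" for y z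
  proof -
   consider "z \<in> N" "z \<in> W1" | "z \<in> B" "z \<in> W1" | "z \<in> D" "z \<in> W2"
    using z unfolding N_def B_def D_def V_def by blast
   then show ?thesis
   proof cases
    case 1 then show ?thesis using z x y RN[of x z] RN[of y z] eqv(1)[of x y z] by simp
   next
    case 2 then show ?thesis using z x y RB[of z] eqv(1)[of x y z] by simp
   next
    case 3 then show ?thesis using z x y RD[of z] eqv(2)[of x y z] by (simp add: matrix_mul_assoc)
   qed
  qed
 qed
 ultimately show ?thesis unfolding framed_def by blast
qed


text \<open>Projecting along coordinate \<open>i\<close> stays inside the ball if it moves towards
  the centre. Hence the frame is extended over the side of the cut facing away from
  \<open>p\<close>, which decides the sign in \<open>framed_glue\<close>.\<close>

lemma framed_split_box:
 assumes r: "cball p r \<subseteq> M" 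
  and f1: "framed M U \<tau> (cball p r \<inter> cbox a (\<chi> j. if j = i then c else b $ j))"
  and f2: "framed M U \<tau> (cball p r \<inter> cbox (\<chi> j. if j = i then c else a $ j) b)"
  and c: "a $ i <= c" "c <= b $ i"
 shows "framed M U \<tau> (cball p r \<inter> cbox a b)"
proof -
 let ?K = "cball p r \<inter> cbox a b"
 have K: "compact ?K" by (intro compact_Int compact_cball compact_cbox)
 have lo: "framed M U \<tau> (?K \<inter> {x. x $ i <= c})"
  by (rule framed_subset[OF f1]) (auto simp: mem_box_cart)
 have hi: "framed M U \<tau> (?K \<inter> {x. x $ i >= c})"
  by (rule framed_subset[OF f2]) (auto simp: mem_box_cart)
 have proj: "x + ax (c - x $ i) i \<in> ?K" if x: "x \<in> ?K" and "\<bar>c - p $ i\<bar> <= \<bar>x $ i - p $ i\<bar>" for x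
 proof -
  have e: "(x + ax (c - x $ i) i) $ j = (if j = i then c else x $ j)" for j by (simp add: axis_def)
  have "norm (x + ax (c - x $ i) i - p) <= norm (x - p)"
   by (rule norm_le_componentwise_cart) (use e that in auto)
  then show ?thesis using x c by (simp add: mem_box_cart e dist_norm norm_minus_commute del: vector_add_component)
 qed
 show ?thesis
 proof (cases "p $ i <= c")
  case True
  show ?thesis by (rule framed_glue[of 1 _ i c, OF _ K]) (use lo hi proj True in auto)
 next
  case False
  show ?thesis by (rule framed_glue[of "-1" _ i c, OF _ K]) (use lo hi proj False in auto)
 qed
qed

text \<open>By the Lebesgue number, small boxes lie in a single trivialising set. The outer
  induction is on the set of directions in which a box may be long, the inner one on the number of
  layers of thickness \<open>h\<close> in one such direction.\<close>

theorem framed_cball: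
 assumes r: "cball p r \<subseteq> M"
 shows "framed M U \<tau> (cball p r)"
proof -
 let ?K = "cball p r"
 have "?K \<subseteq> \<Union> (U ` M)" using r U(2) by blast
 show ?thesis
 proof (cases "?K = {}")
  case True
  have "orthonormal_frame M U \<tau> {} (%x z. 0)" by (simp add: orthonormal_frame_def smooth_on_def)
  then show ?thesis using True unfolding framed_def by blast
 next
  case False
  then have "U ` M ~= {}" using r by auto
  obtain d where d: "0 < d" "!!T. T \<subseteq> ?K ==> diameter T < d ==> \<exists>B\<in>U ` M. T \<subseteq> B"
   by (rule Lebesgue_number_lemma[OF compact_cball \<open>U ` M ~= {}\<close> \<open>?K \<subseteq> \<Union> (U ` M)\<close>]) (use U(1) in auto)
  \<comment> \<open>Boxes with sides at most \<open>h\<close> have diameter at most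
    \<open>d / 2\<close>, strictly below the Lebesgue number \<open>d\<close>.\<close>
  define h where "h = d / (2 * real CARD('n))"
  have h: "h > 0" using d(1) by (simp add: h_def)
  have base: "framed M U \<tau> (?K \<inter> cbox a b)" if ab: "!!i. b $ i - a $ i <= h" for a b :: "real^'n"
  proof -
   have "diameter (?K \<inter> cbox a b) <= d / 2"
   proof (rule diameter_le)
    fix x y assume xy: "x \<in> ?K \<inter> cbox a b" "y \<in> ?K \<inter> cbox a b"
    have "norm (x - y) <= (SUM i. \<bar>(x - y) $ i\<bar>)" by (rule norm_le_l1_cart)
    also have "... <= (\<Sum>i\<in>(UNIV::'n set). h)"
    proof (rule sum_mono)
     fix i
     have "a $ i <= x $ i" "x $ i <= b $ i" "a $ i <= y $ i" "y $ i <= b $ i" using xy by (auto simp: mem_box_cart)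
     then show "\<bar>(x - y) $ i\<bar> <= h" using ab[of i] by simp
    qed
    also have "... = d / 2" by (simp add: h_def)
    finally show "norm (x - y) <= d / 2" .
   qed (use d in auto)
   then obtain x where "x \<in> M" "?K \<inter> cbox a b \<subseteq> U x" using d(2)[of "?K \<inter> cbox a b"] d(1) by auto
   then show ?thesis using framed_subset[OF framed_U] by blast
  qed
  have "framed M U \<tau> (?K \<inter> cbox a b)" if "finite I" "!!i. i \<notin> I ==> b $ i - a $ i <= h" for I :: "'n set" and a b
   using that
  proof (induction I arbitrary: a b)
   case empty then show ?case using base by auto
  next
   case (insert i I)
   have "framed M U \<tau> (?K \<inter> cbox a b)"
    if "!!j. j \<notin> insert i I ==> b $ j - a $ j <= h" "b $ i - a $ i <= real (Suc N) * h" for N b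
    using that
   proof (induction N arbitrary: b)
    case 0
    have "b $ j - a $ j <= h" if "j \<notin> I" for j using that 0 by (cases "j = i") auto
    then show ?case by (rule insert.IH)
   next
    case (Suc N)
    show ?case
    proof (cases "b $ i - a $ i <= h")
     case True
     have "b $ j - a $ j <= h" if "j \<notin> I" for j using that Suc.prems True by (cases "j = i") auto
     then show ?thesis by (rule insert.IH)
    next
     case False
     show ?thesis
     proof (rule framed_split_box[OF r, of a i "b $ i - h"])
      show "framed M U \<tau> (?K \<inter> cbox a (\<chi> j. if j = i then b $ i - h else b $ j))"
       by (rule Suc.IH) (use Suc.prems in \<open>auto simp: algebra_simps\<close>)
      show "framed M U \<tau> (?K \<inter> cbox (\<chi> j. if j = i then b $ i - h else a $ j) b)"
       by (rule insert.IH) (use Suc.prems in auto)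
     qed (use False h in auto)
    qed
   qed
   moreover obtain N :: nat where "(b $ i - a $ i) / h < real N" using reals_Archimedean2 by blast
   then have "b $ i - a $ i <= real (Suc N) * h" using h by (simp add: field_simps)
   ultimately show ?case using insert.prems by blast
  qed
  from this[of UNIV] have *: "framed M U \<tau> (?K \<inter> cbox a b)" for a b by simp
  obtain a b where "?K \<subseteq> cbox a b" using bounded_subset_cbox_symmetric[OF bounded_cball] by blast
  then show ?thesis using *[of a b] by (simp add: Int_absorb2)
 qed
qed

end

subsection \<open>Change of frame\<close>

lemma second_difference:
 fixes f :: "real^'n => real"
 assumes f: "smooth_on S f" and h: "h > 0" and S: "cball x (2 * h) \<subseteq> S"
 shows "\<exists>y\<in>cball x (2 * h). f (x + ax h i + ax h j) - f (x + ax h i) - f (x + ax h j) + f x = h * h * pd j (pd i f) y"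
proof -
 let ?e = "%i. axis i (1::real) :: real^'n"
 have inb: "x + s *\<^sub>R ?e i + t *\<^sub>R ?e j \<in> cball x (2 * h)" if "0 <= s" "s <= h" "0 <= t" "t <= h" for s t
 proof -
  have "norm (s *\<^sub>R ?e i + t *\<^sub>R ?e j) <= s + t" using norm_triangle_ineq[of "s *\<^sub>R ?e i" "t *\<^sub>R ?e j"] that by simp
  then show ?thesis using that by (simp add: dist_norm norm_minus_commute algebra_simps)
 qed
 have d: "g differentiable (at y)" if "smooth_on S g" "y \<in> cball x (2 * h)" for g :: "real^'n => real" and y
  using smooth_on_differentiable[OF that(1)] that(2) S by blast
 have sw: "x + h *\<^sub>R ?e j + s *\<^sub>R ?e i = x + s *\<^sub>R ?e i + h *\<^sub>R ?e j" for s by (simp add: add_ac)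
 have "\<exists>s>0. s < h & (f (x + h *\<^sub>R ?e j + h *\<^sub>R ?e i) - f (x + h *\<^sub>R ?e i)) - (f (x + h *\<^sub>R ?e j + 0 *\<^sub>R ?e i) - f (x + 0 *\<^sub>R ?e i))
   = (h - 0) * (pd i f (x + h *\<^sub>R ?e j + s *\<^sub>R ?e i) - pd i f (x + s *\<^sub>R ?e i))"
  by (rule MVT2[OF h, where f = "%t. f (x + h *\<^sub>R ?e j + t *\<^sub>R ?e i) - f (x + t *\<^sub>R ?e i)"],
    intro DERIV_diff line_derivative d[OF f])
    (use inb[of _ h] inb[of _ 0] h in \<open>auto simp: sw\<close>)
 then obtain s where s: "0 < s" "s < h" "f (x + h *\<^sub>R ?e i + h *\<^sub>R ?e j) - f (x + h *\<^sub>R ?e i) - f (x + h *\<^sub>R ?e j) + f x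
   = h * (pd i f (x + s *\<^sub>R ?e i + h *\<^sub>R ?e j) - pd i f (x + s *\<^sub>R ?e i))"
  by (auto simp: sw)
 have "\<exists>t>0. t < h & pd i f (x + s *\<^sub>R ?e i + h *\<^sub>R ?e j) - pd i f (x + s *\<^sub>R ?e i + 0 *\<^sub>R ?e j)
   = (h - 0) * pd j (pd i f) (x + s *\<^sub>R ?e i + t *\<^sub>R ?e j)"
  by (rule MVT2[OF h], rule line_derivative, rule d[OF smooth_on_pd[OF f]]) (use inb s h in auto)
 then obtain t where "0 < t" "t < h" "pd i f (x + s *\<^sub>R ?e i + h *\<^sub>R ?e j) - pd i f (x + s *\<^sub>R ?e i) = h * pd j (pd i f) (x + s *\<^sub>R ?e i + t *\<^sub>R ?e j)"
  by auto
 then show ?thesis using s inb[of s t] by (intro bexI[of _ "x + s *\<^sub>R ?e i + t *\<^sub>R ?e j"]) auto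
qed

lemma pd_commute_real:
 fixes f :: "real^'n => real"
 assumes S: "open S" "x \<in> S" and f: "smooth_on S f"
 shows "pd i (pd j f) x = pd j (pd i f) x"
proof (rule ccontr)
 let ?P = "pd i (pd j f)" and ?Q = "pd j (pd i f)"
 assume ne: "?P x ~= ?Q x"
 define e where "e = \<bar>?P x - ?Q x\<bar> / 2"
 have e: "e > 0" using ne by (simp add: e_def)
 have c: "isCont ?P x" "isCont ?Q x"
  using smooth_on_isCont[OF smooth_on_pd[OF smooth_on_pd[OF f]] S] by blast+
 obtain d1 where d1: "d1 > 0" "!!y. dist y x < d1 ==> dist (?P y) (?P x) < e"
  using c(1) e unfolding continuous_at_eps_delta by blast
 obtain d2 where d2: "d2 > 0" "!!y. dist y x < d2 ==> dist (?Q y) (?Q x) < e"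
  using c(2) e unfolding continuous_at_eps_delta by blast
 obtain d3 where d3: "d3 > 0" "cball x d3 \<subseteq> S" using S open_contains_cball by blast
 define h where "h = min d1 (min d2 d3) / 3"
 have h: "h > 0" "2 * h < d1" "2 * h < d2" "2 * h <= d3" using d1 d2 d3 by (auto simp: h_def min_def)
 have sub: "cball x (2 * h) \<subseteq> S" using d3 h by (auto intro: subset_trans[OF subset_cball])
 obtain y where y: "y \<in> cball x (2 * h)"
  "f (x + ax h i + ax h j) - f (x + ax h i) - f (x + ax h j) + f x = h * h * ?Q y"
  using second_difference[OF f h(1) sub, of i j] by blast
 obtain z where z: "z \<in> cball x (2 * h)"
  "f (x + ax h j + ax h i) - f (x + ax h j) - f (x + ax h i) + f x = h * h * ?P z"
  using second_difference[OF f h(1) sub, of j i] by blast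
 have sw: "x + ax h j + ax h i = x + ax h i + ax h j" by (simp add: add_ac)
 have "h * h * ?P z = h * h * ?Q y" using y(2) z(2)[unfolded sw] by linarith
 then have eq: "?P z = ?Q y" using h by simp
 have "dist (?P z) (?P x) < e" "dist (?Q y) (?Q x) < e"
  using d1(2)[of z] d2(2)[of y] y(1) z(1) h by (auto simp: dist_commute)
 then show False unfolding eq e_def dist_real_def by (simp add: abs_if split: if_splits)
qed

lemma pd_commute:
 fixes f :: "real^'n => real^'k"
 assumes S: "open S" "x \<in> S" and f: "smooth_on S f"
 shows "pd i (pd j f) x = pd j (pd i f) x"
proof -
 have "pd i (pd j f) x $ m = pd i (pd j (%x. f x $ m)) x" for m i j
 proof -
  have "pd i (pd j f) x $ m = pd i (%x. pd j f x $ m) x"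
   by (rule pd_nth[OF smooth_on_differentiable[OF smooth_on_pd[OF f] S(2)]])
  also have "... = pd i (pd j (%x. f x $ m)) x"
   by (rule pd_cong_open[OF S]) (rule pd_nth[OF smooth_on_differentiable[OF f]])
  finally show ?thesis .
 qed
 then show ?thesis using pd_commute_real[OF S smooth_on_nth[OF S(1) f]] by (simp add: vec_eq_iff)
qed

lemma smooth_on_matrix_vector:
 fixes f :: "real^'n => real^'l^'m"
 shows "open S ==> smooth_on S f ==> smooth_on S g ==> smooth_on S (%x. f x *v g x)"
 by (rule smooth_on_bilinear[OF bounded_bilinear_matrix_vector])

lemma smooth_on_matrix_mult:
 fixes f :: "real^'n => real^'l^'m" and g :: "real^'n => real^'j^'l"
 shows "open S ==> smooth_on S f ==> smooth_on S g ==> smooth_on S (%x. f x ** g x)"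
 by (rule smooth_on_bilinear[OF bounded_bilinear_matrix_mult])

lemma smooth_on_transpose: "open S ==> smooth_on S f ==> smooth_on S (%x. transpose (f x))"
 for f :: "real^'n => real^'l^'m"
 by (rule smooth_on_bounded_linear[OF bounded_linear_transpose])

lemma matrix_vector_mult_sum_right: "A *v (\<Sum>i\<in>I. f i) = (\<Sum>i\<in>I. A *v f i)" for A :: "real^'l^'m"
 by (rule linear_sum) simp

section \<open>Covariant derivatives and curvature under a change of frame\<close>

lemma smooth_on_cov:
 fixes v :: "real^'n => real^'k"
 assumes "open S" "!!i. smooth_on S (%z. a z i)" "smooth_on S v"
 shows "smooth_on S (cov a v i)"
 unfolding cov_def[abs_def] by (intro smooth_on_add smooth_on_matrix_vector smooth_on_pd assms)

lemma cov_cong_open: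
 assumes "open S" "z \<in> S" "!!y. y \<in> S ==> f y = g y"
 shows "cov a f i z = cov a g i z"
 using pd_cong_open[OF assms] assms by (simp add: cov_def)

lemma curv_commutator:
 fixes v :: "real^'n => real^'k"
 assumes S: "open S" "z \<in> S" and a: "!!i. smooth_on S (%z. a z i)" and v: "smooth_on S v"
 shows "cov a (cov a v j) i z - cov a (cov a v i) j z = curv a i j z *v v z"
proof -
 have d: "(%z. a z i) differentiable (at z)" "v differentiable (at z)" "pd i v differentiable (at z)" for i
  using smooth_on_differentiable[OF a S(2)] smooth_on_differentiable[OF v S(2)] smooth_on_differentiable[OF smooth_on_pd[OF v] S(2)] .
 have "cov a (cov a v j) i z = pd i (pd j v) z + (pd i (%z. a z j) z *v v z + a z j *v pd i v z) + (a z i *v pd j v z + (a z i ** a z j) *v v z)" for i j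
  unfolding cov_def[abs_def]
  using pd_add[OF d(3) bounded_bilinear_differentiable[OF bounded_bilinear_matrix_vector d(1) d(2)], of i j j]
   pd_bilinear[OF bounded_bilinear_matrix_vector d(1) d(2), of i j]
  by (simp add: matrix_vector_right_distrib matrix_vector_mul_assoc)
 then show ?thesis
  by (simp add: curv_def pd_commute[OF S v, of i j] matrix_vector_mult_add_rdistrib matrix_vector_mult_diff_rdistrib)
qed

text \<open>The connection form with respect to the frame formed by the columns of \<open>Q\<close>;
  for orthogonal \<open>Q\<close> transposition is inversion.\<close>

definition gauge_form ::
  "(real^'n => 'n => real^'k^'k) => (real^'n => real^'k^'k) => real^'n => 'n => real^'k^'k" where
 "gauge_form a Q z i = transpose (Q z) ** (a z i ** Q z + pd i Q z)"

locale gauge_change =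
 fixes S :: "(real^'n) set" and a :: "real^'n => 'n => real^'k^'k" and Q :: "real^'n => real^'k^'k"
 assumes S: "open S" and a: "smooth_on S (%z. a z i)" and Q: "smooth_on S Q"
  and orth: "z \<in> S ==> orthogonal_matrix (Q z)"
begin

lemma smooth: "smooth_on S (%z. gauge_form a Q z i)"
 unfolding gauge_form_def by (intro smooth_on_matrix_mult smooth_on_transpose smooth_on_add smooth_on_pd S a Q)

lemma diff_Q: "z \<in> S ==> Q differentiable (at z)"
 by (rule smooth_on_differentiable[OF Q])

lemma Q_gauge: "z \<in> S ==> Q z ** gauge_form a Q z i = a z i ** Q z + pd i Q z"
 using orthogonal_matrix_transpose_mult(2)[OF orth] by (simp add: gauge_form_def matrix_mul_assoc)

lemma cov_gauge:
 assumes z: "z \<in> S" and u: "u differentiable (at z)"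
 shows "cov a (%w. Q w *v u w) i z = Q z *v cov (gauge_form a Q) u i z"
proof -
 have "pd i (%w. Q w *v u w) z = pd i Q z *v u z + Q z *v pd i u z"
  by (rule pd_bilinear[OF bounded_bilinear_matrix_vector diff_Q[OF z] u])
 then show ?thesis
  by (simp add: cov_def matrix_vector_right_distrib matrix_vector_mul_assoc Q_gauge[OF z] matrix_vector_mult_add_rdistrib)
qed

lemma skew_gauge:
 assumes z: "z \<in> S" and sk: "transpose (a z i) = - a z i"
 shows "transpose (gauge_form a Q z i) = - gauge_form a Q z i"
proof -
 have dT: "(%w. transpose (Q w)) differentiable (at z)"
  by (rule smooth_on_differentiable[OF smooth_on_transpose[OF S Q] z])
 have "pd i (%w. transpose (Q w) ** Q w) z = pd i (%w. mat 1) z"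
  by (rule pd_cong_open[OF S z]) (rule orthogonal_matrix_transpose_mult(1)[OF orth])
 moreover have "pd i (%w. transpose (Q w) ** Q w) z = transpose (pd i Q z) ** Q z + transpose (Q z) ** pd i Q z"
  using pd_bilinear[OF bounded_bilinear_matrix_mult dT diff_Q[OF z], of i] pd_bounded_linear[OF bounded_linear_transpose diff_Q[OF z], of i] by simp
 ultimately have e: "transpose (pd i Q z) ** Q z = - (transpose (Q z) ** pd i Q z)" by (simp add: eq_neg_iff_add_eq_0)
 have m: "(- B) ** D = - (B ** D)" "D ** (- B) = - (D ** B)" for B D :: "real^'k^'k"
  using matrix_scaleR_mult(1)[where c = "-1" and A = B and B = D] matrix_scaleR_mult(2)[where c = "-1" and A = D and B = B] by simp_all
 have t: "transpose (B + D) = transpose B + transpose D" for B D :: "real^'k^'k" by (simp add: transpose_def vec_eq_iff)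
 show ?thesis
  by (simp add: gauge_form_def matrix_transpose_mul t matrix_add_rdistrib matrix_add_ldistrib e sk matrix_mul_assoc[symmetric] m)
qed

text \<open>Follows from the commutator identity for the sections with constant components in the
  frame \<open>Q\<close>, rather than from expanding the derivatives of the transformed
  form.\<close>

lemma curv_gauge:
 assumes z: "z \<in> S"
 shows "curv (gauge_form a Q) i j z = transpose (Q z) ** curv a i j z ** Q z"
proof -
 have "Q z ** curv (gauge_form a Q) i j z = curv a i j z ** Q z"
 proof (rule matrix_eq[THEN iffD2], rule allI)
  fix e :: "real^'k"
  let ?w = "%i. cov (gauge_form a Q) (%_. e) i"
  have w: "smooth_on S (?w i)" for i by (rule smooth_on_cov[OF S smooth]) simp
  have 1: "cov a (cov a (%w. Q w *v e) j) i z = Q z *v cov (gauge_form a Q) (?w j) i z" for i j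
  proof -
   have "cov a (cov a (%w. Q w *v e) j) i z = cov a (%y. Q y *v ?w j y) i z"
    by (rule cov_cong_open[OF S z]) (rule cov_gauge, auto)
   then show ?thesis using cov_gauge[OF z smooth_on_differentiable[OF w z]] by simp
  qed
  have "curv a i j z *v (Q z *v e) = Q z *v (cov (gauge_form a Q) (?w j) i z - cov (gauge_form a Q) (?w i) j z)"
   using curv_commutator[where a = a and i = i and j = j, OF S z a smooth_on_matrix_vector[OF S Q smooth_on_const[of S e]]]
   unfolding 1 matrix_vector_mult_diff_distrib by simp
  also have "... = Q z *v (curv (gauge_form a Q) i j z *v e)"
   using curv_commutator[where a = "gauge_form a Q" and i = i and j = j, OF S z smooth smooth_on_const[of S e]] by simp
  finally show "(Q z ** curv (gauge_form a Q) i j z) *v e = (curv a i j z ** Q z) *v e"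
   by (simp add: matrix_vector_mul_assoc)
 qed
 then have "transpose (Q z) ** (Q z ** curv (gauge_form a Q) i j z) = transpose (Q z) ** (curv a i j z ** Q z)" by simp
 then show ?thesis by (simp add: matrix_mul_assoc orthogonal_matrix_transpose_mult[OF orth[OF z]])
qed

lemma divergence_gauge:
 assumes z: "z \<in> S" and u: "smooth_on S u" and c: "!!i j. smooth_on S (c i j)"
 shows "(SUM i. cov a (%w. SUM j. c i j w *\<^sub>R cov a (%w. Q w *v u w) j w) i z)
  = Q z *v (SUM i. cov (gauge_form a Q) (%w. SUM j. c i j w *\<^sub>R cov (gauge_form a Q) u j w) i z)"
proof -
 let ?f = "%i w. SUM j. c i j w *\<^sub>R cov (gauge_form a Q) u j w"
 have f: "smooth_on S (?f i)" for i by (intro smooth_on_sum smooth_on_scaleR S c smooth_on_cov smooth u)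
 have "cov a (%w. SUM j. c i j w *\<^sub>R cov a (%w. Q w *v u w) j w) i z = Q z *v cov (gauge_form a Q) (?f i) i z" for i
 proof -
  have "cov a (%w. SUM j. c i j w *\<^sub>R cov a (%w. Q w *v u w) j w) i z = cov a (%w. Q w *v ?f i w) i z"
   by (rule cov_cong_open[OF S z])
     (simp add: cov_gauge smooth_on_differentiable[OF u] matrix_vector_mult_sum_right matrix_vector_mult_scaleR)
  then show ?thesis using cov_gauge[OF z smooth_on_differentiable[OF f z]] by simp
 qed
 then show ?thesis by (simp add: matrix_vector_mult_sum_right)
qed

lemma gauge_form_compose:
 assumes z: "z \<in> S" and T: "T differentiable (at z)"
 shows "gauge_form a (%w. Q w ** T w) z i = gauge_form (gauge_form a Q) T z i"
proof -
 have "pd i (%w. Q w ** T w) z = pd i Q z ** T z + Q z ** pd i T z"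
  by (rule pd_bilinear[OF bounded_bilinear_matrix_mult diff_Q[OF z] T])
 then show ?thesis
  using orthogonal_matrix_transpose_mult(1)[OF orth[OF z]]
  by (simp add: gauge_form_def matrix_transpose_mul matrix_add_ldistrib matrix_add_rdistrib matrix_mul_assoc)
    (simp add: matrix_mul_assoc[symmetric])
qed

end

text \<open>Differentiate the orthogonality relation of the one-parameter subgroup at 0; the
  subgroup starts at the identity because its value there is an idempotent orthogonal
  matrix.\<close>

lemma lie_algebra_skew:
 assumes G: "compact_subgroup_SO G" and X: "X \<in> lie_algebra G"
 shows "transpose X = - X"
proof -
 obtain \<gamma> where \<gamma>: "range \<gamma> \<subseteq> G" "!!s t. \<gamma> (s + t) = \<gamma> s ** \<gamma> t" "(\<gamma> has_vector_derivative X) (at 0)"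
  using X by (auto simp: lie_algebra_def)
 have o: "orthogonal_matrix (\<gamma> t)" for t using G \<gamma>(1) by (auto simp: compact_subgroup_SO_def)
 have "\<gamma> 0 ** (transpose (\<gamma> 0)) = \<gamma> 0 ** (\<gamma> 0 ** transpose (\<gamma> 0))" using \<gamma>(2)[of 0 0] by (simp add: matrix_mul_assoc)
 then have g0: "\<gamma> 0 = mat 1" by (simp add: orthogonal_matrix_transpose_mult[OF o])
 have "((%t. transpose (\<gamma> t) ** \<gamma> t) has_vector_derivative transpose (\<gamma> 0) ** X + transpose X ** \<gamma> 0) (at 0)"
  by (rule bounded_bilinear.has_vector_derivative[OF bounded_bilinear_matrix_mult
     bounded_linear.has_vector_derivative[OF bounded_linear_transpose \<gamma>(3)] \<gamma>(3)])
 then have "((%t. mat 1) has_vector_derivative X + transpose X) (at (0::real))"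
  by (simp add: orthogonal_matrix_transpose_mult[OF o] g0)
 then have "X + transpose X = 0" using vector_derivative_unique_at has_vector_derivative_const by blast
 then show ?thesis by (simp add: eq_neg_iff_add_eq_0 add.commute)
qed

subsection \<open>An approximately radial frame\<close>

text \<open>A bound for the operator norm. The \<open>norm\<close> of a matrix is the Frobenius
  norm, in which an orthogonal matrix is not a contraction factor for products, whereas here it has
  bound 1.\<close>

definition bnd :: "real => real^'l^'m => bool" where
 "bnd c A \<longleftrightarrow> 0 <= c & (ALL v. norm (A *v v) <= c * norm v)"

lemma bnd_mono: "bnd c A ==> c <= d ==> bnd d A"
 unfolding bnd_def by (meson mult_right_mono norm_ge_zero order_trans)

lemma bnd_mult:
 fixes A :: "real^'l^'m" and B :: "real^'j^'l"
 assumes "bnd c A" "bnd d B" shows "bnd (c * d) (A ** B)"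
 unfolding bnd_def
proof (intro conjI allI)
 show "norm (A ** B *v v) <= c * d * norm v" for v
 proof -
  have "norm (A *v (B *v v)) <= c * norm (B *v v)" using assms by (simp add: bnd_def)
  also have "... <= c * (d * norm v)" using assms by (intro mult_left_mono) (auto simp: bnd_def)
  finally show ?thesis by (simp add: matrix_vector_mul_assoc)
 qed
qed (use assms in \<open>auto simp: bnd_def\<close>)

lemma bnd_add: "bnd c A ==> bnd d B ==> bnd (c + d) (A + B)"
 unfolding bnd_def
 by (simp add: matrix_vector_mult_add_rdistrib distrib_right) (meson add_mono norm_triangle_ineq order_trans)

lemma bnd_scaleR: "bnd c A ==> bnd (\<bar>s\<bar> * c) (s *\<^sub>R A)"
 by (simp add: bnd_def scaleR_matrix_vector_assoc[symmetric] mult.assoc mult_left_mono)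

lemma bnd_minus: "bnd c A ==> bnd c (- A)"
 by (simp add: bnd_def matrix_vector_minus_left)

lemma bnd_diff: "bnd c A ==> bnd d B ==> bnd (c + d) (A - B)"
 using bnd_add[OF _ bnd_minus, of c A d B] by simp

lemma bnd_0: "bnd 0 0"
 by (simp add: bnd_def)

lemma bnd_sum: "(!!i. i \<in> I ==> bnd (c i) (A i)) ==> bnd (\<Sum>i\<in>I. c i) (\<Sum>i\<in>I. A i)"
 by (induction I rule: infinite_finite_induct) (auto intro: bnd_0 bnd_add)

lemma bnd_norm: "bnd (norm A) A" for A :: "real^'l^'m"
proof -
 have "norm (A *v v) <= norm A * norm v" for v
 proof -
  have "nsq (A *v v) = (SUM i. (A $ i \<bullet> v)^2)"
   unfolding power2_norm_eq_inner inner_vec_def[of "A *v v"] by (simp add: matrix_vector_mul_component power2_eq_square)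
  also have "... <= (SUM i. (A $ i \<bullet> A $ i) * (v \<bullet> v))"
   by (intro sum_mono Cauchy_Schwarz_ineq)
  also have "... = (norm A * norm v)^2"
   by (simp add: power_mult_distrib power2_norm_eq_inner inner_vec_def[of A] sum_distrib_right)
  finally show ?thesis by (simp add: abs_le_square_iff[symmetric])
 qed
 then show ?thesis by (simp add: bnd_def)
qed

lemma bnd_orthogonal: "orthogonal_matrix Q ==> bnd 1 Q" for Q :: "real^'k^'k"
proof -
 assume "orthogonal_matrix Q"
 then have "norm (Q *v v) = norm v" for v
  using orthogonal_transformation_matrix[of "(*v) Q"] by (simp add: orthogonal_transformation)
 then show ?thesis by (simp add: bnd_def)
qed

text \<open>Multiplication of \<open>E\<close> by \<open>N\<close> from both sides removes the inverse matrix \<open>S\<close>.\<close>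

lemma radial_step:
 fixes A A' P H D T B N Q S dQ :: "real^'k^'k" and c J t \<phi> :: real
 assumes b: "bnd c A" "bnd c A'" "bnd c P" "bnd c D" "bnd (c / J^2) T" "bnd (c / J) (A - A')" "bnd 1 S"
  and J: "J >= 1" and t: "1 / J <= t" "t <= 1"
  and B: "B = (1 / (2 * J)) *\<^sub>R P" and N: "N = mat 1 + B" "N ** Q = mat 1 - B" "Q ** N = mat 1 - B" "S ** N = mat 1" "N ** S = mat 1"
  and dQ: "N ** dQ ** N = - ((1 / J) *\<^sub>R (A + t *\<^sub>R H))"
  and T: "A - A' = (1 / J) *\<^sub>R D - T"
  and \<phi>: "bnd \<phi> (H - D + A ** P - P ** A)"
 shows "bnd (\<phi> / J + (2 * c + 2 * c^2 + c ^ 3) / J^2) (dQ + t *\<^sub>R (A ** Q) - (t - 1 / J) *\<^sub>R (Q ** A'))"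
proof -
 let ?E = "dQ + t *\<^sub>R (A ** Q) - (t - 1 / J) *\<^sub>R (Q ** A')"
 note ms = matrix_add_ldistrib matrix_add_rdistrib matrix_scaleR_mult
 have md: "X ** (Y - Z) = X ** Y - X ** Z" "(Y - Z) ** X = Y ** X - Z ** X" for X Y Z :: "real^'k^'k"
  using bounded_bilinear.diff_right[OF bounded_bilinear_matrix_mult, of X Y Z] bounded_bilinear.diff_left[OF bounded_bilinear_matrix_mult, of Y Z X] .
 have c: "c >= 0" using b by (simp add: bnd_def)
 define De where "De = A - A'"
 \<comment> \<open>After multiplication by \<open>N\<close> on both sides the terms of first order
   in 1/J collect to a multiple of \<open>F\<close>, in the application the contraction of the
   curvature with the direction of the segment; \<open>Rm\<close> gathers what is of second
   order.\<close>
 define F where "F = H - D + A ** P - P ** A"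
 define Rm where "Rm = (t - 1 / J) *\<^sub>R (- T) - (1 / J^2) *\<^sub>R D - (1 / J) *\<^sub>R (B ** A' - A' ** B) - t *\<^sub>R (B ** De - De ** B)
  - t *\<^sub>R (B ** A ** B) + (t - 1 / J) *\<^sub>R (B ** A' ** B)"
 have "N ** ?E ** N = N ** dQ ** N + t *\<^sub>R ((N ** A) ** (Q ** N)) - (t - 1 / J) *\<^sub>R ((N ** Q) ** (A' ** N))"
  by (simp add: ms md matrix_mul_assoc)
 also have "... = - ((t / J) *\<^sub>R F) + Rm"
 proof -
  have P: "P = (2 * J) *\<^sub>R B" using B J by simp
  have A': "A' = A - De" by (simp add: De_def)
  have T': "T = (1 / J) *\<^sub>R D - De" using T unfolding De_def by simp
  show ?thesis
   unfolding dQ N(2,3) unfolding N(1) Rm_def F_def P A' T'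
   by (simp add: ms md matrix_mul_assoc vec_eq_iff) (use J in \<open>simp add: field_simps power2_eq_square\<close>)
 qed
 finally have NEN: "N ** ?E ** N = - ((t / J) *\<^sub>R F) + Rm" .
 have "?E = S ** (N ** ?E ** N) ** S"
  by (metis N(4,5) matrix_mul_assoc matrix_mul_lid matrix_mul_rid)
 moreover have "bnd (1 * (\<phi> / J + (2 * c + 2 * c^2 + c ^ 3) / J^2) * 1) (S ** (N ** ?E ** N) ** S)"
  unfolding NEN
 proof (intro bnd_mult b bnd_add)
  show "bnd (\<phi> / J) (- ((t / J) *\<^sub>R F))"
  proof (rule bnd_mono[OF bnd_minus[OF bnd_scaleR[OF \<phi>[folded F_def], of "t / J"]]])
   have "\<phi> >= 0" using \<phi> by (simp add: bnd_def)
   then have "t * \<phi> <= 1 * \<phi>" using t by (intro mult_right_mono) auto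
   moreover have "0 < 1 / J" using J by simp
   then have "t > 0" using t by linarith
   ultimately show "\<bar>t / J\<bar> * \<phi> <= \<phi> / J" using J t by (simp add: divide_right_mono)
  qed
  have Bb: "bnd (c / (2 * J)) B" using bnd_scaleR[OF b(3), of "1 / (2 * J)"] J by (simp add: B)
  have De: "bnd (c / J) De" using b(6) by (simp add: De_def)
  have "bnd (\<bar>t - 1 / J\<bar> * (c / J^2) + \<bar>1 / J^2\<bar> * c + \<bar>1 / J\<bar> * (c / (2 * J) * c + c * (c / (2 * J)))
   + \<bar>t\<bar> * (c / (2 * J) * (c / J) + c / J * (c / (2 * J))) + \<bar>t\<bar> * (c / (2 * J) * c * (c / (2 * J)))
   + \<bar>t - 1 / J\<bar> * (c / (2 * J) * c * (c / (2 * J)))) Rm"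
   unfolding Rm_def by (intro bnd_add bnd_diff bnd_scaleR bnd_minus bnd_mult b Bb De)
  then show "bnd ((2 * c + 2 * c^2 + c ^ 3) / J^2) Rm"
  proof (rule bnd_mono)
   define x where "x = 1 / J"
   have x: "0 < x" "x <= t" using J t by (auto simp: x_def)
   have u: "(t - x) * (c * x^2) <= 1 * (c * x^2)" "t * (c^2 * x^2) <= 1 * (c^2 * x^2)"
    "t * (c ^ 3 * x^2 / 4) <= 1 * (c ^ 3 * x^2 / 4)" "(t - x) * (c ^ 3 * x^2 / 4) <= 1 * (c ^ 3 * x^2 / 4)"
    using t x c by (intro mult_right_mono; simp)+
   have m: "0 <= c ^ 3 * x^2" using c by simp
   have "u1 + m1 + m2 + u2 + u3 + u4 <= 2 * m1 + 2 * m2 + m3"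
    if "u1 <= 1 * m1" "u2 <= 1 * m2" "u3 <= 1 * (m3 / 4)" "u4 <= 1 * (m3 / 4)" "0 <= m3" for u1 u2 u3 u4 m1 m2 m3 :: real
    using that by linarith
   from this[OF u m] have main: "(t - x) * (c * x^2) + x^2 * c + x^2 * c^2 + t * (c^2 * x^2) + t * (c ^ 3 * x^2 / 4) + (t - x) * (c ^ 3 * x^2 / 4)
    <= (2 * c + 2 * c^2 + c ^ 3) * x^2"
    by (simp only: distrib_right mult.commute[of "x\<^sup>2"] mult.assoc times_divide_eq_right)
   have eq: "(t - x) * (c * x^2) + x^2 * c + x^2 * c^2 + t * (c^2 * x^2) + t * (c ^ 3 * x^2 / 4) + (t - x) * (c ^ 3 * x^2 / 4)
    = (t - x) * (c * x^2) + x^2 * c + x * (c * x / 2 * c + c * (c * x / 2)) + t * (c * x / 2 * (c * x) + c * x * (c * x / 2))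
     + t * (c * x / 2 * c * (c * x / 2)) + (t - x) * (c * x / 2 * c * (c * x / 2))"
    by (simp add: power2_eq_square power3_eq_cube algebra_simps)
   from main[unfolded eq] have "(t - x) * (c * x^2) + x^2 * c + x * (c * x / 2 * c + c * (c * x / 2)) + t * (c * x / 2 * (c * x) + c * x * (c * x / 2))
     + t * (c * x / 2 * c * (c * x / 2)) + (t - x) * (c * x / 2 * c * (c * x / 2)) <= (2 * c + 2 * c^2 + c ^ 3) * x^2" .
   moreover have "1 / J^2 = x^2" "1 / J = x" "c / J^2 = c * x^2" "c / J = c * x" "c / (2 * J) = c * x / 2"
    "(2 * c + 2 * c^2 + c ^ 3) / J^2 = (2 * c + 2 * c^2 + c ^ 3) * x^2"
    by (simp_all add: x_def power_divide)
   moreover have "\<bar>t - x\<bar> = t - x" "\<bar>t\<bar> = t" "\<bar>x\<bar> = x" "\<bar>x\<^sup>2\<bar> = x^2" using x by auto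
   ultimately show "\<bar>t - 1 / J\<bar> * (c / J^2) + \<bar>1 / J^2\<bar> * c + \<bar>1 / J\<bar> * (c / (2 * J) * c + c * (c / (2 * J)))
   + \<bar>t\<bar> * (c / (2 * J) * (c / J) + c / J * (c / (2 * J))) + \<bar>t\<bar> * (c / (2 * J) * c * (c / (2 * J)))
   + \<bar>t - 1 / J\<bar> * (c / (2 * J) * c * (c / (2 * J))) <= (2 * c + 2 * c^2 + c ^ 3) / J^2"
    by (simp only:)
  qed
 qed
 ultimately show ?thesis by simp
qed

section \<open>Mean value and Taylor estimates\<close>

lemma mean_value_bound:
 fixes f :: "real^'n => 'b::real_normed_vector"
 assumes S: "convex S" and f: "!!z. z \<in> S ==> (f has_derivative (%v. SUM l. (v $ l) *\<^sub>R H l z)) (at z)"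
  and c: "!!z l. z \<in> S ==> norm (H l z) <= c" and xy: "x \<in> S" "y \<in> S"
 shows "norm (f x - f y) <= real CARD('n) * c * norm (x - y)"
proof -
 have "norm (f x - f y) <= (real CARD('n) * c) * norm (x - y)"
 proof (rule differentiable_bound[OF S _ _ xy])
  fix z assume z: "z \<in> S"
  show "(f has_derivative (%v. SUM l. (v $ l) *\<^sub>R H l z)) (at z within S)" by (rule has_derivative_at_withinI[OF f[OF z]])
  have "norm (SUM l. (v $ l) *\<^sub>R H l z) <= (real CARD('n) * c) * norm v" for v
  proof -
   have "norm (SUM l. (v $ l) *\<^sub>R H l z) <= (\<Sum>l\<in>(UNIV::'n set). norm v * c)"
   proof (rule order_trans[OF norm_sum sum_mono])
    show "norm ((v $ l) *\<^sub>R H l z) <= norm v * c" for l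
     using component_le_norm_cart[of v l] c[OF z, of l] by (simp add: mult_mono)
   qed
   then show ?thesis by (simp add: mult_ac)
  qed
  then show "onorm (%v. SUM l. (v $ l) *\<^sub>R H l z) <= real CARD('n) * c" by (rule onorm_le)
 qed
 then show ?thesis by simp
qed

lemma taylor_bound:
 fixes f :: "real^'n => 'b::real_normed_vector"
 assumes S: "convex S" "open S" and f: "smooth_on S f"
  and c: "!!z l m. z \<in> S ==> norm (pd m (pd l f) z) <= c" and yz: "y \<in> S" "z \<in> S"
 shows "norm (f y - f z - (SUM m. ((y - z) $ m) *\<^sub>R pd m f y)) <= (real CARD('n))^2 * c * nsq (y - z)"
proof -
 let ?n = "real CARD('n)"
 define w where "w u = f u - (SUM m. (u $ m) *\<^sub>R pd m f y)" for u
 let ?T = "S \<inter> cball y (norm (y - z))"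
 have "norm (w y - w z) <= ?n * (?n * c * norm (y - z)) * norm (y - z)"
 proof (rule mean_value_bound[where S = ?T and H = "%l u. pd l f u - pd l f y"])
  show "convex ?T" using S by (intro convex_Int convex_cball)
  fix u assume u: "u \<in> ?T"
  have "(f has_derivative (%v. SUM l. (v $ l) *\<^sub>R pd l f u)) (at u)"
   using u by (intro differentiable_has_derivative_pd smooth_on_differentiable[OF f]) auto
  moreover have "((%u. SUM m. (u $ m) *\<^sub>R pd m f y) has_derivative (%v. SUM m. (v $ m) *\<^sub>R pd m f y)) (at u)"
   by (auto intro!: derivative_eq_intros bounded_linear.has_derivative[OF bounded_linear_vec_nth])
  ultimately show "(w has_derivative (%v. SUM l. (v $ l) *\<^sub>R (pd l f u - pd l f y))) (at u)"
   unfolding w_def[abs_def] by (rule has_derivative_eq_rhs[OF has_derivative_diff]) (simp add: scaleR_diff_right sum_subtractf)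
  fix l
  have "norm (pd l f u - pd l f y) <= ?n * c * norm (u - y)"
   by (rule mean_value_bound[OF S(1) _ c]) 
     (use u yz in \<open>auto intro!: differentiable_has_derivative_pd smooth_on_differentiable[OF smooth_on_pd[OF f]]\<close>)
  also have "... <= ?n * c * norm (y - z)"
   using u order_trans[OF norm_ge_zero c[OF yz(1)]] by (intro mult_left_mono) (auto simp: dist_norm norm_minus_commute)
  finally show "norm (pd l f u - pd l f y) <= ?n * c * norm (y - z)" .
 qed (use yz in \<open>auto simp: dist_norm\<close>)
 moreover have "w y - w z = f y - f z - (SUM m. ((y - z) $ m) *\<^sub>R pd m f y)"
  by (simp add: w_def scaleR_diff_left sum_subtractf)
 ultimately show ?thesis by (simp add: power2_eq_square mult_ac)
qed

lemma matrix_diff_distrib: "X ** (Y - Z) = X ** Y - X ** Z" "(Y - Z) ** X = Y ** X - Z ** X" for X Y Z :: "real^'k^'k"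
 using bounded_bilinear.diff_right[OF bounded_bilinear_matrix_mult, of X Y Z] bounded_bilinear.diff_left[OF bounded_bilinear_matrix_mult, of Y Z X] .

lemma bnd_norm_le: "norm A <= c ==> bnd c A" for A :: "real^'l^'m"
 by (rule bnd_mono[OF bnd_norm])

lemma pd_affine:
 fixes f :: "real^'n => 'b::real_normed_vector"
 assumes "f differentiable (at (q + s *\<^sub>R (x - q)))"
 shows "pd i (%x. f (q + s *\<^sub>R (x - q))) x = s *\<^sub>R pd i f (q + s *\<^sub>R (x - q))"
  and "(%x. f (q + s *\<^sub>R (x - q))) differentiable (at x)"
proof -
 have "((%x. q + s *\<^sub>R (x - q)) has_derivative (%v. s *\<^sub>R v)) (at x)" by (auto intro!: derivative_eq_intros)
 from has_derivative_compose[OF this assms[unfolded frechet_derivative_works]]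
 have d: "((%x. f (q + s *\<^sub>R (x - q))) has_derivative (%v. frechet_derivative f (at (q + s *\<^sub>R (x - q))) (s *\<^sub>R v))) (at x)" .
 then show "(%x. f (q + s *\<^sub>R (x - q))) differentiable (at x)" unfolding differentiable_def by blast
 show "pd i (%x. f (q + s *\<^sub>R (x - q))) x = s *\<^sub>R pd i f (q + s *\<^sub>R (x - q))"
  using pd_eq[OF d, of i] linear_scale[OF linear_frechet_derivative[OF assms]] by (simp add: pd_def)
qed

text \<open>The segment from \<open>q\<close> to \<open>x\<close> is divided into \<open>J\<close>
  steps. The Cayley transform of the skew matrix \<open>B j x\<close> approximates parallel
  transport over one step and is exactly orthogonal. Being rational in the form, the product of
  these transforms is smooth in \<open>x\<close> without any theorem on the dependence of
  differential equations on parameters.\<close>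

locale radial_construction =
 fixes p q :: "real^'n" and r :: real and a :: "real^'n => 'n => real^'k^'k" and J :: nat
 assumes q: "q \<in> ball p r" and a: "smooth_on (ball p r) (%z. a z i)"
  and skew: "x \<in> ball p r ==> transpose (a x i) = - a x i" and J: "J >= 1"
begin

definition seg :: "nat => real^'n => real^'n" where
 "seg j x = q + (real j / real J) *\<^sub>R (x - q)"

definition P :: "nat => real^'n => real^'k^'k" where
 "P j x = (SUM m. ((x - q) $ m) *\<^sub>R a (seg j x) m)"

definition B :: "nat => real^'n => real^'k^'k" where
 "B j x = (1 / (2 * real J)) *\<^sub>R P j x"

definition N :: "nat => real^'n => real^'k^'k" where
 "N j x = mat 1 + B j x"

definition S :: "nat => real^'n => real^'k^'k" where
 "S j x = matrix_inv (N j x)"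

definition Q :: "nat => real^'n => real^'k^'k" where
 "Q j x = S j x ** (mat 1 - B j x)"

fun R :: "nat => real^'n => real^'k^'k" where
 "R 0 x = mat 1"
| "R (Suc j) x = Q (Suc j) x ** R j x"

lemma seg_closed_segment: "j <= J ==> seg j x \<in> closed_segment q x"
 using J unfolding in_segment seg_def
 by (intro exI[of _ "real j / real J"]) (auto simp: algebra_simps)

lemma seg_ball: "j <= J ==> x \<in> ball p r ==> seg j x \<in> ball p r"
 using closed_segment_subset[OF q _ convex_ball] seg_closed_segment by blast

lemma smooth_P: "j <= J ==> smooth_on (ball p r) (P j)"
 unfolding P_def[abs_def]
proof (intro smooth_on_sum smooth_on_scaleR smooth_on_nth smooth_on_diff smooth_on_ident smooth_on_const open_ball)
 fix m assume j: "j <= J"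
 have "smooth_on (ball p r) (seg j)"
  unfolding seg_def[abs_def] by (intro smooth_on_add smooth_on_scaleR smooth_on_diff smooth_on_const smooth_on_ident open_ball)
 moreover have "seg j ` ball p r \<subseteq> ball p r" using seg_ball[OF j] by blast
 ultimately show "smooth_on (ball p r) (%x. a (seg j x) m)"
  using smooth_on_compose[where T = "ball p r" and f = "%z. a z m", OF open_ball open_ball _ _ a] by blast
qed

lemma smooth_B: "j <= J ==> smooth_on (ball p r) (B j)"
 unfolding B_def[abs_def] by (intro smooth_on_scaleR smooth_on_const smooth_P open_ball)

lemma inner_B: "v \<bullet> (B j x *v v) = 0" if "j <= J" "x \<in> ball p r"
proof -
 have t: "transpose (X + Y) = transpose X + transpose Y" "transpose (c *\<^sub>R X) = c *\<^sub>R transpose X" for X Y :: "real^'k^'k" and c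
  by (simp_all add: transpose_def vec_eq_iff)
 have "transpose (\<Sum>m\<in>I. ((x - q) $ m) *\<^sub>R a (seg j x) m) = - (\<Sum>m\<in>I. ((x - q) $ m) *\<^sub>R a (seg j x) m)" for I
 proof (induction I rule: infinite_finite_induct)
  case (insert i I) then show ?case by (simp add: t skew[OF seg_ball[OF that]])
 qed (simp_all add: transpose_def vec_eq_iff)
 then have "transpose (B j x) = - B j x" by (simp add: B_def P_def t)
 then show ?thesis using inner_transpose_vector[of "B j x" v v]
  by (simp add: matrix_vector_minus_left inner_commute del: transpose_matrix_vector)
qed

text \<open>Skewness of \<open>B\<close> makes the mixed term vanish. Invertibility of
  \<open>N\<close>, the bound 1 for its inverse and orthogonality of \<open>Q\<close> all come from
  these two identities.\<close>

lemma norm_N: "j <= J ==> x \<in> ball p r ==> nsq (N j x *v v) = nsq v + nsq (B j x *v v)"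
 and norm_N': "j <= J ==> x \<in> ball p r ==> nsq ((mat 1 - B j x) *v v) = nsq v + nsq (B j x *v v)"
 using inner_B[of j x v]
 by (simp_all add: N_def power2_norm_eq_inner matrix_vector_mult_add_rdistrib matrix_vector_mult_diff_rdistrib
   inner_add_left inner_add_right inner_diff_left inner_diff_right inner_commute)

lemma
 assumes "j <= J" "x \<in> ball p r"
 shows det_N: "det (N j x) ~= 0" and S_N: "S j x ** N j x = mat 1" and N_S: "N j x ** S j x = mat 1"
  and bnd_S: "bnd 1 (S j x)" and N_Q: "N j x ** Q j x = mat 1 - B j x" and Q_N: "Q j x ** N j x = mat 1 - B j x"
  and orthogonal_Q: "orthogonal_matrix (Q j x)"
proof -
 have "inj ((*v) (N j x))"
 proof (rule linear_injective_0[THEN iffD2], simp, intro allI impI)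
  fix v assume "N j x *v v = 0"
  then have "nsq v + nsq (B j x *v v) = 0" using norm_N[OF assms, of v] by simp
  then show "v = 0" by (simp add: sum_power2_eq_zero_iff)
 qed
 then have inv: "invertible (N j x)" using matrix_left_invertible_injective invertible_left_inverse by blast
 then show "det (N j x) ~= 0" by (simp add: invertible_det_nz)
 show SN: "S j x ** N j x = mat 1" and NS: "N j x ** S j x = mat 1"
  using inv unfolding S_def invertible_def matrix_inv_def by (metis (mono_tags, lifting) someI_ex)+
 show "bnd 1 (S j x)"
  unfolding bnd_def
 proof (intro conjI allI)
  fix v
  have "nsq (S j x *v v) <= nsq (N j x *v (S j x *v v))" unfolding norm_N[OF assms] by simp
  then show "norm (S j x *v v) <= 1 * norm v" by (simp add: matrix_vector_mul_assoc NS)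
 qed simp
 show "N j x ** Q j x = mat 1 - B j x" by (simp add: Q_def matrix_mul_assoc NS)
 have comm: "(mat 1 - B j x) ** N j x = N j x ** (mat 1 - B j x)"
  by (simp add: N_def matrix_add_ldistrib matrix_add_rdistrib matrix_diff_distrib)
 show QN: "Q j x ** N j x = mat 1 - B j x"
  unfolding Q_def matrix_mul_assoc[symmetric] comm by (simp add: matrix_mul_assoc SN)
 then have "Q j x ** N j x ** S j x = (mat 1 - B j x) ** S j x" by simp
 then have Q: "Q j x = (mat 1 - B j x) ** S j x" by (simp add: matrix_mul_assoc[symmetric] NS)
 have "norm (Q j x *v v) = norm v" for v
 proof -
  have "nsq (Q j x *v v) = nsq (N j x *v (S j x *v v))"
   unfolding Q matrix_vector_mul_assoc[symmetric] norm_N[OF assms] norm_N'[OF assms] ..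
  then show ?thesis by (simp add: matrix_vector_mul_assoc NS)
 qed
 then have "orthogonal_transformation ((*v) (Q j x))" by (simp add: orthogonal_transformation)
 then show "orthogonal_matrix (Q j x)" by (simp add: orthogonal_transformation_matrix)
qed

lemma smooth_Q: "j <= J ==> smooth_on (ball p r) (Q j)"
 unfolding Q_def[abs_def] S_def N_def
 by (intro smooth_on_matrix_mult smooth_on_matrix_inv smooth_on_add smooth_on_diff smooth_on_const smooth_B open_ball)
   (use det_N in \<open>auto simp: N_def\<close>)

lemma smooth_R: "j <= J ==> smooth_on (ball p r) (R j)"
proof (induction j)
 case (Suc j)
 then show ?case using smooth_on_matrix_mult[OF open_ball smooth_Q[of "Suc j"], of "R j"] by simp
qed (simp add: R.simps(1)[abs_def])

lemma orthogonal_R: "j <= J ==> x \<in> ball p r ==> orthogonal_matrix (R j x)"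
 by (induction j) (auto simp: orthogonal_Q orthogonal_matrix_mul orthogonal_matrix_id)

text \<open>Differentiating N Q = 1 - B gives N dQ = - dB (1 + Q). Multiplying by \<open>N\<close>
  on the right and using Q N = 1 - B leaves -2 dB, free of inverse matrices.\<close>

lemma pd_Q:
 assumes j: "j <= J" and x: "x \<in> ball p r"
 shows "N j x ** pd i (Q j) x ** N j x = - ((1 / real J) *\<^sub>R (a (seg j x) i + (real j / real J) *\<^sub>R (SUM m. ((x - q) $ m) *\<^sub>R pd i (%z. a z m) (seg j x))))"
proof -
 have d: "B j differentiable (at x)" "Q j differentiable (at x)"
  using smooth_on_differentiable[OF smooth_B[OF j] x] smooth_on_differentiable[OF smooth_Q[OF j] x] .
 have da: "(%z. a z m) differentiable (at (q + (real j / real J) *\<^sub>R (x - q)))" for m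
  using smooth_on_differentiable[OF a seg_ball[OF j x]] by (simp add: seg_def)
 let ?t = "real j / real J"
 have "pd i (P j) x = (SUM m. (axis i 1 $ m) *\<^sub>R a (seg j x) m + ((x - q) $ m) *\<^sub>R (?t *\<^sub>R pd i (%z. a z m) (seg j x)))"
 proof -
  have h: "((%x. a (seg j x) m) has_derivative frechet_derivative (%x. a (seg j x) m) (at x)) (at x)" for m
   using pd_affine(2)[OF da] unfolding seg_def frechet_derivative_works .
  have "((%x. (x - q) $ m) has_derivative (%v. v $ m)) (at x)" for m
   by (auto intro!: derivative_eq_intros bounded_linear.has_derivative[OF bounded_linear_vec_nth])
  from has_derivative_sum[where I = UNIV, OF has_derivative_scaleR[OF this h]]
  have "(P j has_derivative (%v. SUM m. ((x - q) $ m) *\<^sub>R frechet_derivative (%x. a (seg j x) m) (at x) v + (v $ m) *\<^sub>R a (seg j x) m)) (at x)"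
   unfolding P_def[abs_def] .
  from pd_eq[OF this, of i] show ?thesis
   using pd_affine(1)[OF da, of i] by (simp add: pd_def seg_def add.commute)
 qed
 also have "... = a (seg j x) i + ?t *\<^sub>R (SUM m. ((x - q) $ m) *\<^sub>R pd i (%z. a z m) (seg j x))"
  by (simp add: sum.distrib axis_def if_distrib[of "%z. z *\<^sub>R _"] scaleR_sum_right mult.commute cong: if_cong)
 finally have dP: "pd i (P j) x = a (seg j x) i + ?t *\<^sub>R (SUM m. ((x - q) $ m) *\<^sub>R pd i (%z. a z m) (seg j x))" .
 have dB: "pd i (B j) x = (1 / (2 * real J)) *\<^sub>R pd i (P j) x"
  unfolding B_def[abs_def]
  by (rule pd_bounded_linear[OF bounded_linear_scaleR_right smooth_on_differentiable[OF smooth_P[OF j] x]])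
 have dN: "pd i (N j) x = pd i (B j) x" "N j differentiable (at x)"
  using pd_add[OF differentiable_const d(1), of i "mat 1"] d(1) by (simp_all add: N_def[abs_def])
 have "pd i (%x. N j x ** Q j x) x = pd i (%x. mat 1 + - B j x) x"
  by (rule pd_cong_open[OF open_ball x]) (simp add: N_Q[OF j])
 then have "pd i (N j) x ** Q j x + N j x ** pd i (Q j) x = - pd i (B j) x"
  using pd_bilinear[OF bounded_bilinear_matrix_mult dN(2) d(2), of i] pd_add[OF differentiable_const, of "%x. - B j x" x i "mat 1"] d(1)
   pd_bounded_linear[OF bounded_linear_minus[OF bounded_linear_ident] d(1), of i] by simp
 then have e: "N j x ** pd i (Q j) x = - pd i (B j) x - pd i (B j) x ** Q j x" by (simp add: dN algebra_simps)
 have "N j x ** pd i (Q j) x ** N j x = - pd i (B j) x ** N j x - pd i (B j) x ** (mat 1 - B j x)"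
  unfolding e matrix_diff_distrib matrix_mul_assoc[symmetric] Q_N[OF j x] ..
 also have "... = - (2 *\<^sub>R pd i (B j) x)"
  using matrix_scaleR_mult(1)[where c = "-1" and A = "pd i (B j) x" and B = "B j x"]
  by (simp add: N_def matrix_add_ldistrib matrix_diff_distrib matrix_scaleR_mult scaleR_2)
 finally show ?thesis unfolding dB dP by simp
qed


text \<open>The product of \<open>R j\<close> with its gauge form, computed from the connection
  pulled back along \<open>seg j\<close>, whence the factor \<open>j / J\<close>. At
  \<open>j = J\<close> this is the actual connection, at \<open>j = 0\<close> it vanishes.\<close>

definition Z :: "'n => nat => real^'n => real^'k^'k" where
 "Z i j x = pd i (R j) x + (real j / real J) *\<^sub>R (a (seg j x) i ** R j x)"

definition E :: "'n => nat => real^'n => real^'k^'k" where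
 "E i j x = pd i (Q (Suc j)) x + (real (Suc j) / real J) *\<^sub>R (a (seg (Suc j) x) i ** Q (Suc j) x)
  - (real j / real J) *\<^sub>R (Q (Suc j) x ** a (seg j x) i)"

lemma Z_Suc:
 assumes j: "Suc j <= J" and x: "x \<in> ball p r"
 shows "Z i (Suc j) x = Q (Suc j) x ** Z i j x + E i j x ** R j x"
proof -
 have d: "Q (Suc j) differentiable (at x)" "R j differentiable (at x)"
  using smooth_on_differentiable[OF smooth_Q[OF j] x] smooth_on_differentiable[OF smooth_R x, of j] j by auto
 have "pd i (R (Suc j)) x = pd i (Q (Suc j)) x ** R j x + Q (Suc j) x ** pd i (R j) x"
  using pd_bilinear[OF bounded_bilinear_matrix_mult d, of i] by (simp add: R.simps(2)[abs_def])
 then show ?thesis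
  unfolding Z_def E_def
  by (simp add: matrix_add_ldistrib matrix_add_rdistrib matrix_diff_distrib matrix_scaleR_mult matrix_mul_assoc del: of_nat_Suc)
qed

text \<open>Local error of one Cayley step. The distance of \<open>x\<close> from \<open>q\<close>
  is at most \<open>2 * r\<close>; the factor in \<open>c\<close> lets it dominate the form, its
  contractions with \<open>x - q\<close> and the Taylor remainders at once.\<close>

lemma bnd_E:
 assumes j: "Suc j <= J" and x: "x \<in> ball p r" and c0: "c0 >= 0"
  and b: "!!y i. y \<in> ball p r ==> norm (a y i) <= c0"
   "!!y i l. y \<in> ball p r ==> norm (pd l (%z. a z i) y) <= c0"
   "!!y i l m. y \<in> ball p r ==> norm (pd m (pd l (%z. a z i)) y) <= c0"
  and \<phi>: "!!i m. bnd \<phi> (curv a i m (seg (Suc j) x))"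
  and c: "c = (1 + real CARD('n) * (2 * r))^2 * c0"
 shows "bnd (real CARD('n) * (2 * r) * \<phi> / real J + (2 * c + 2 * c^2 + c ^ 3) / (real J)^2) (E i j x)"
proof -
 let ?y = "seg (Suc j) x" and ?z = "seg j x" and ?L = "2 * r" and ?n = "real CARD('n)"
 let ?t = "real (Suc j) / real J"
 have J': "real J >= 1" using J by simp
 have r: "r > 0" using x by (metis ball_eq_empty empty_iff not_le)
 have yz: "?y \<in> ball p r" "?z \<in> ball p r" using seg_ball[OF j x] seg_ball[OF Suc_leD[OF j] x] .
 have v: "norm (x - q) <= ?L"
  using x q dist_triangle2[of x q p] by (simp add: dist_norm[symmetric] dist_commute)
 have yz_diff: "?y - ?z = (1 / real J) *\<^sub>R (x - q)"
  by (simp add: seg_def add_divide_distrib algebra_simps)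
 then have yz_norm: "norm (?y - ?z) <= ?L / real J" using v J' by (simp add: divide_right_mono)
 have one: "1 <= (1 + ?n * ?L)^2" "?n * ?L <= (1 + ?n * ?L)^2" "(?n * ?L)^2 <= (1 + ?n * ?L)^2"
 proof -
  have s: "1 <= (1 + s)^2" "s <= (1 + s)^2" "s\<^sup>2 <= (1 + s)^2" if "0 <= s" for s :: real
   using that zero_le_power2[of s] by (simp_all add: power2_sum)
  show "1 <= (1 + ?n * ?L)^2" "?n * ?L <= (1 + ?n * ?L)^2" "(?n * ?L)^2 <= (1 + ?n * ?L)^2" using s[of "?n * ?L"] r by auto
 qed
 have cs: "c0 <= c" "?n * ?L * c0 <= c" "(?n * ?L)^2 * c0 <= c"
  unfolding c using mult_right_mono[OF one(1) c0] mult_right_mono[OF one(2) c0] mult_right_mono[OF one(3) c0] by simp_all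
 have sum_le: "bnd (?n * ?L * k) (SUM m. ((x - q) $ m) *\<^sub>R W m)" if "!!m. bnd k (W m)" for W :: "'n => real^'k^'k" and k
 proof (rule bnd_mono[OF bnd_sum[OF bnd_scaleR[OF that]]])
  have k: "k >= 0" using that[of undefined] by (simp add: bnd_def)
  have "(SUM m. \<bar>(x - q) $ m\<bar> * k) <= (\<Sum>m\<in>(UNIV::'n set). ?L * k)"
   using k by (intro sum_mono mult_right_mono order_trans[OF component_le_norm_cart v]) auto
  then show "(SUM m. \<bar>(x - q) $ m\<bar> * k) <= ?n * ?L * k" by (simp add: mult_ac)
 qed
 define D where "D = (SUM m. ((x - q) $ m) *\<^sub>R pd m (%z. a z i) ?y)"
 define H where "H = (SUM m. ((x - q) $ m) *\<^sub>R pd i (%z. a z m) ?y)"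
 have "norm (a ?y i - a ?z i) <= ?n * c0 * norm (?y - ?z)"
  by (rule mean_value_bound[where f = "%z. a z i" and H = "%l z. pd l (%z. a z i) z", OF convex_ball _ b(2) yz])
    (intro differentiable_has_derivative_pd smooth_on_differentiable[OF a])
 also have "... <= ?n * c0 * (?L / real J)" using yz_norm c0 by (intro mult_left_mono) auto
 also have "... <= c / real J" using cs(2) J' by (simp add: mult_ac divide_right_mono)
 finally have De: "bnd (c / real J) (a ?y i - a ?z i)" by (rule bnd_norm_le)
 define T where "T = (1 / real J) *\<^sub>R D - (a ?y i - a ?z i)"
 have T: "bnd (c / (real J)^2) T"
 proof (rule bnd_norm_le)
  have "(1 / real J) *\<^sub>R D = (SUM m. ((?y - ?z) $ m) *\<^sub>R pd m (%z. a z i) ?y)"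
   unfolding yz_diff D_def by (simp add: scaleR_sum_right)
  then have "norm T = norm (a ?y i - a ?z i - (SUM m. ((?y - ?z) $ m) *\<^sub>R pd m (%z. a z i) ?y))"
   unfolding T_def by (simp only: norm_minus_commute)
  also have "... <= ?n\<^sup>2 * c0 * nsq (?y - ?z)"
   by (rule taylor_bound[where f = "%z. a z i", OF convex_ball open_ball a b(3) yz])
  also have "... <= ?n\<^sup>2 * c0 * (?L / real J)^2" using yz_norm c0 by (intro mult_left_mono power_mono) auto
  also have "... <= c / (real J)^2" using cs(3) J' by (simp add: power_divide power_mult_distrib mult_ac divide_right_mono)
  finally show "norm T <= c / (real J)^2" .
 qed
 have F: "H - D + a ?y i ** P (Suc j) x - P (Suc j) x ** a ?y i = (SUM m. ((x - q) $ m) *\<^sub>R curv a i m ?y)"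
  unfolding H_def D_def P_def curv_def bounded_bilinear.sum_right[OF bounded_bilinear_matrix_mult] bounded_bilinear.sum_left[OF bounded_bilinear_matrix_mult]
  by (simp add: matrix_scaleR_mult sum_subtractf sum.distrib scaleR_diff_right scaleR_add_right)
 have "bnd ((?n * ?L * \<phi>) / real J + (2 * c + 2 * c^2 + c ^ 3) / (real J)^2)
   (pd i (Q (Suc j)) x + ?t *\<^sub>R (a ?y i ** Q (Suc j) x) - (?t - 1 / real J) *\<^sub>R (Q (Suc j) x ** a ?z i))"
 proof (rule radial_step[OF _ _ _ _ T De bnd_S[OF j x] J' _ _ _ N_def N_Q[OF j x] Q_N[OF j x] S_N[OF j x] N_S[OF j x]])
  show "bnd c (a ?y i)" "bnd c (a ?z i)" using b(1) yz cs(1) by (blast intro: bnd_norm_le order_trans)+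
  show "bnd c (P (Suc j) x)" unfolding P_def by (rule bnd_mono[OF sum_le cs(2)]) (rule bnd_norm_le[OF b(1)[OF yz(1)]])
  show "bnd c D" unfolding D_def by (rule bnd_mono[OF sum_le cs(2)]) (rule bnd_norm_le[OF b(2)[OF yz(1)]])
  show "1 / real J <= ?t" "?t <= 1" using J' j by (auto simp: divide_right_mono)
  show "B (Suc j) x = (1 / (2 * real J)) *\<^sub>R P (Suc j) x" by (rule B_def)
  show "N (Suc j) x ** pd i (Q (Suc j)) x ** N (Suc j) x = - ((1 / real J) *\<^sub>R (a ?y i + ?t *\<^sub>R H))"
   unfolding H_def by (rule pd_Q[OF j x])
  show "a ?y i - a ?z i = (1 / real J) *\<^sub>R D - T" by (simp add: T_def)
  show "bnd (?n * ?L * \<phi>) (H - D + a ?y i ** P (Suc j) x - P (Suc j) x ** a ?y i)"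
   unfolding F by (rule sum_le[OF \<phi>])
 qed
 moreover have "?t - 1 / real J = real j / real J" by (simp add: add_divide_distrib)
 ultimately show ?thesis by (simp add: E_def)
qed

text \<open>The local errors are summed over \<open>J\<close> steps and multiplied only by
  orthogonal matrices. The curvature term adds up to a quantity independent of \<open>J\<close>, the
  second-order error to one of size 1/J.\<close>

lemma bnd_gauge_form:
 assumes x: "x \<in> ball p r" and c0: "c0 >= 0"
  and b: "!!y i. y \<in> ball p r ==> norm (a y i) <= c0"
   "!!y i l. y \<in> ball p r ==> norm (pd l (%z. a z i) y) <= c0"
   "!!y i l m. y \<in> ball p r ==> norm (pd m (pd l (%z. a z i)) y) <= c0"
  and \<phi>: "!!y i m. y \<in> closed_segment q x ==> bnd \<phi> (curv a i m y)"
  and c: "c = (1 + real CARD('n) * (2 * r))^2 * c0"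
 shows "bnd (real CARD('n) * (2 * r) * \<phi> + (2 * c + 2 * c^2 + c ^ 3) / real J) (gauge_form a (R J) x i)"
proof -
 let ?e = "real CARD('n) * (2 * r) * \<phi> / real J + (2 * c + 2 * c^2 + c ^ 3) / (real J)^2"
 have "bnd (real j * ?e) (Z i j x)" if "j <= J" for j
  using that
 proof (induction j)
  case 0
  have "Z i 0 x = 0" by (simp add: Z_def R.simps(1)[abs_def])
  then show ?case by (simp add: bnd_0)
 next
  case (Suc j)
  have "bnd (1 * (real j * ?e) + ?e * 1) (Z i (Suc j) x)"
   unfolding Z_Suc[OF Suc.prems x]
  proof (intro bnd_add bnd_mult)
   show "bnd 1 (Q (Suc j) x)" by (rule bnd_orthogonal[OF orthogonal_Q[OF Suc.prems x]])
   show "bnd 1 (R j x)" using Suc.prems by (intro bnd_orthogonal orthogonal_R x) simp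
   show "bnd ?e (E i j x)"
    by (rule bnd_E[OF Suc.prems x c0 b \<phi>[OF seg_closed_segment[OF Suc.prems]] c])
  qed (use Suc in auto)
  moreover have "1 * (real j * ?e) + ?e * 1 = real (Suc j) * ?e" by (simp only: of_nat_Suc distrib_right mult_1_left mult_1_right add.commute)
  ultimately show ?case by (simp only:)
 qed
 from this[of J] have "bnd (1 * (real J * ?e)) (transpose (R J x) ** Z i J x)"
  by (intro bnd_mult bnd_orthogonal orthogonal_matrix_T orthogonal_R x) auto
 moreover have "transpose (R J x) ** Z i J x = gauge_form a (R J) x i"
  using J by (simp add: Z_def gauge_form_def seg_def add.commute)
 moreover have "1 * (real J * ?e) = real CARD('n) * (2 * r) * \<phi> + (2 * c + 2 * c^2 + c ^ 3) / real J"
 proof -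
  have "real J * (u / real J + K / (real J)^2) = u + K / real J" for u K
   using J by (simp add: power2_eq_square field_simps)
  then show ?thesis by (simp only: mult_1_left)
 qed
 ultimately show ?thesis by simp
qed

end

text \<open>The number of steps depends on bounds for the derivatives of \<open>a\<close>, on which
  there is no uniform control; the conclusion involves only the curvature on the segment from
  \<open>q\<close> and the chosen \<eta>.\<close>

theorem radial_frame:
 fixes a :: "real^'n => 'n => real^'k^'k"
 assumes W: "open W" "cball p r \<subseteq> W" and a: "!!i. smooth_on W (%z. a z i)"
  and skew: "!!x i. x \<in> W ==> transpose (a x i) = - a x i" and q: "q \<in> ball p r" and \<eta>: "\<eta> > 0"
 shows "EX Q. smooth_on (ball p r) Q & (\<forall>x\<in>ball p r. orthogonal_matrix (Q x)) &
  (\<forall>x\<in>ball p r. ALL \<phi>. (\<forall>y\<in>closed_segment q x. ALL i m. bnd \<phi> (curv a i m y)) -->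
    (ALL i. bnd (real CARD('n) * (2 * r) * \<phi> + \<eta>) (gauge_form a Q x i)))"
proof -
 have bd: "EX K. \<forall>y\<in>cball p r. norm (f y) <= K" if "smooth_on W f" for f :: "real^'n => real^'k^'k"
 proof -
  have "compact (f ` cball p r)"
   by (rule compact_continuous_image[OF continuous_on_subset[OF smooth_on_continuous_on[OF that] W(2)] compact_cball])
  then show ?thesis by (auto simp: bounded_iff dest!: compact_imp_bounded)
 qed
 obtain K1 where K1: "!!i y. y \<in> cball p r ==> norm (a y i) <= K1 i" using bd[OF a] by metis
 obtain K2 where K2: "!!l i y. y \<in> cball p r ==> norm (pd l (%z. a z i) y) <= K2 l i" using bd[OF smooth_on_pd[OF a]] by metis
 obtain K3 where K3: "!!m l i y. y \<in> cball p r ==> norm (pd m (pd l (%z. a z i)) y) <= K3 m l i"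
  using bd[OF smooth_on_pd[OF smooth_on_pd[OF a]]] by metis
 define c0 where "c0 = (SUM i. \<bar>K1 i\<bar>) + (SUM l i. \<bar>K2 l i\<bar>) + (SUM m l i. \<bar>K3 m l i\<bar>)"
 have c0: "c0 >= 0" by (simp add: c0_def sum_nonneg)
 have le: "f i <= (SUM i. \<bar>f i\<bar>)" for f :: "'n => real" and i
  using abs_ge_self[of "f i"] member_le_sum[of i UNIV "%i. \<bar>f i\<bar>"] by simp
 have n0: "0 <= (SUM i. \<bar>K1 i\<bar>)" "0 <= (SUM l i. \<bar>K2 l i\<bar>)" "0 <= (SUM m l i. \<bar>K3 m l i\<bar>)"
  by (intro sum_nonneg abs_ge_zero)+
 have l2: "K2 l i <= (SUM l i. \<bar>K2 l i\<bar>)" for l i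
  using le[of "K2 l" i] le[of "%l. SUM i. \<bar>K2 l i\<bar>" l] by (simp add: sum_nonneg)
 have l3: "K3 m l i <= (SUM m l i. \<bar>K3 m l i\<bar>)" for m l i
  using le[of "K3 m l" i] le[of "%l. SUM i. \<bar>K3 m l i\<bar>" l] le[of "%m. SUM l i. \<bar>K3 m l i\<bar>" m] by (simp add: sum_nonneg)
 have b: "!!y i. y \<in> ball p r ==> norm (a y i) <= c0"
   "!!y i l. y \<in> ball p r ==> norm (pd l (%z. a z i) y) <= c0"
   "!!y i l m. y \<in> ball p r ==> norm (pd m (pd l (%z. a z i)) y) <= c0"
 proof -
  show "norm (a y i) <= c0" if "y \<in> ball p r" for y i
   using K1[OF subsetD[OF ball_subset_cball that], of i] le[of K1 i] n0 unfolding c0_def by linarith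
  show "norm (pd l (%z. a z i) y) <= c0" if "y \<in> ball p r" for y i l
   using K2[OF subsetD[OF ball_subset_cball that], of l i] l2[of l i] n0 unfolding c0_def by linarith
  show "norm (pd m (pd l (%z. a z i)) y) <= c0" if "y \<in> ball p r" for y i l m
   using K3[OF subsetD[OF ball_subset_cball that], of m l i] l3[of m l i] n0 unfolding c0_def by linarith
 qed
 define c where "c = (1 + real CARD('n) * (2 * r))^2 * c0"
 obtain J :: nat where J: "(2 * c + 2 * c^2 + c ^ 3) / \<eta> < real J" using reals_Archimedean2 by blast
 have "c >= 0" using c0 by (simp add: c_def)
 then have "(2 * c + 2 * c^2 + c ^ 3) / \<eta> >= 0" using \<eta> by simp
 then have J1: "J >= 1" using J by (cases J) auto
 have J2: "(2 * c + 2 * c^2 + c ^ 3) / real J <= \<eta>" using J J1 \<eta> by (simp add: field_simps)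
 have BW: "ball p r \<subseteq> W" using W(2) ball_subset_cball by blast
 interpret radial_construction p q r a J
  by unfold_locales (use q skew BW J1 smooth_on_subset[OF a BW] in blast)+
 show ?thesis
 proof (intro exI[of _ "R J"] conjI ballI allI impI)
  show "smooth_on (ball p r) (R J)" by (rule smooth_R) simp
  show "orthogonal_matrix (R J x)" if "x \<in> ball p r" for x by (rule orthogonal_R[OF _ that]) simp
  fix x \<phi> i assume x: "x \<in> ball p r" and \<phi>: "\<forall>y\<in>closed_segment q x. ALL i m. bnd \<phi> (curv a i m y)"
  have "bnd (real CARD('n) * (2 * r) * \<phi> + (2 * c + 2 * c^2 + c ^ 3) / real J) (gauge_form a (R J) x i)"
   by (rule bnd_gauge_form[OF x c0 b \<phi>[rule_format] c_def])
  then show "bnd (real CARD('n) * (2 * r) * \<phi> + \<eta>) (gauge_form a (R J) x i)" by (rule bnd_mono) (use J2 in simp)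
 qed
qed

section \<open>Nearly Euclidean metrics\<close>

lemma metric_form:
 fixes B :: "real^'n^'n"
 assumes B: "!!i j. \<bar>B $ i $ j - (kd i j)\<bar> <= \<eta>"
 shows "\<bar>v \<bullet> (B *v v) - nsq v\<bar> <= \<eta> * real CARD('n) * nsq v"
proof -
 have "v \<bullet> (B *v v) = (SUM i k. B $ i $ k * (v $ i \<bullet> v $ k))"
  by (simp add: inner_vec_def matrix_vector_mult_def sum_distrib_left mult_ac)
 moreover have "nsq v = (SUM i. nsq (v $ i))"
  unfolding power2_norm_eq_inner inner_vec_def ..
 ultimately show ?thesis using quadratic_close[where H = "%i k. B $ i $ k" and w = "%i. v $ i", OF B] by simp
qed

text \<open>A distortion of at most two percent fits the radii in use: 2 is below 49/50 of 11/5,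
  51/50 of 39/10 is below 4, and 51/50 of 4/5 is below 1.\<close>

locale near_euclidean =
 fixes p :: "real^'n" and R :: real and M :: "(real^'n) set" and g :: "real^'n => real^'n^'n" and \<kappa> :: real
 assumes M: "M = ball p R" "R > 0" and g: "continuous_on M g" and \<kappa>: "0 <= \<kappa>" "\<kappa> <= 1/50"
  and form: "x \<in> M ==> \<bar>v \<bullet> (g x *v v) - nsq v\<bar> <= \<kappa> * nsq v"
begin

lemma speed_bounds:
 assumes x: "x \<in> M"
 shows "(1 - \<kappa>) * norm v <= sqrt (v \<bullet> (g x *v v))" "sqrt (v \<bullet> (g x *v v)) <= (1 + \<kappa>) * norm v"
proof -
 have f: "(1 - \<kappa>) * nsq v <= v \<bullet> (g x *v v)" "v \<bullet> (g x *v v) <= (1 + \<kappa>) * nsq v"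
  using form[OF x, of v] by (simp_all add: abs_le_iff algebra_simps)
 have "((1 - \<kappa>) * norm v)^2 <= (1 - \<kappa>) * nsq v"
  unfolding power_mult_distrib using \<kappa> by (intro mult_right_mono) (auto simp: power2_eq_square mult_left_le)
 then show "(1 - \<kappa>) * norm v <= sqrt (v \<bullet> (g x *v v))" using f(1) by (intro real_le_rsqrt) linarith
 have "(1 + \<kappa>) * nsq v <= ((1 + \<kappa>) * norm v)^2"
  unfolding power_mult_distrib using \<kappa> by (intro mult_right_mono) (auto simp: power2_eq_square algebra_simps)
 then show "sqrt (v \<bullet> (g x *v v)) <= (1 + \<kappa>) * norm v" using f(2) \<kappa> by (intro real_le_lsqrt) auto
qed

lemma curve_length_lower:
 assumes \<gamma>: "\<gamma> C1_differentiable_on {0..1}" "\<gamma> ` {0..1} \<subseteq> M"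
 shows "(1 - \<kappa>) * norm (\<gamma> 1 - \<gamma> 0) <= curve_length g \<gamma>"
proof -
 obtain D where D: "!!t. t \<in> {0..1} ==> (\<gamma> has_vector_derivative D t) (at t)" "continuous_on {0..1} D"
  using \<gamma>(1) unfolding C1_differentiable_on_def by blast
 have cg: "continuous_on {0..1} \<gamma>"
  using D(1) by (meson continuous_at_imp_continuous_on has_vector_derivative_continuous)
 have cgg: "continuous_on {0..1} (%t. g (\<gamma> t))" by (rule continuous_on_compose2[OF g cg \<gamma>(2)])
 have c: "continuous_on {0..1} (%t. sqrt (D t \<bullet> (g (\<gamma> t) *v D t)))"
  by (intro continuous_intros D(2) bounded_bilinear.continuous_on[OF bounded_bilinear_matrix_vector] cgg)
 have len: "curve_length g \<gamma> = integral {0..1} (%t. sqrt (D t \<bullet> (g (\<gamma> t) *v D t)))"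
  unfolding curve_length_def Let_def by (intro integral_cong) (simp add: vector_derivative_at[OF D(1)])
 have "(D has_integral \<gamma> 1 - \<gamma> 0) {0..1}"
  by (rule fundamental_theorem_of_calculus) (auto intro!: has_vector_derivative_at_within[OF D(1)])
 then have "norm (\<gamma> 1 - \<gamma> 0) <= integral {0..1} (%t. norm (D t))"
  using integral_norm_bound_integral[OF integrable_continuous_real[OF D(2)] integrable_continuous_real[OF continuous_on_norm[OF D(2)]]]
  by (simp add: integral_unique)
 then have "(1 - \<kappa>) * norm (\<gamma> 1 - \<gamma> 0) <= (1 - \<kappa>) * integral {0..1} (%t. norm (D t))" using \<kappa> by (intro mult_left_mono) auto
 also have "... = integral {0..1} (%t. (1 - \<kappa>) * norm (D t))" by simp
 also have "... <= curve_length g \<gamma>"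
  unfolding len
 proof (rule integral_le)
  show "(%t. (1 - \<kappa>) * norm (D t)) integrable_on {0..1}"
   by (intro integrable_continuous_real continuous_intros D(2))
  show "(1 - \<kappa>) * norm (D t) <= sqrt (D t \<bullet> (g (\<gamma> t) *v D t))" if "t \<in> {0..1}" for t
   using speed_bounds(1) \<gamma>(2) that by blast
 qed (rule integrable_continuous_real[OF c])
 finally show ?thesis .
qed

text \<open>Every admissible curve is at least as long as its chord up to the factor, and the
  straight segment, which stays in the convex set \<open>M\<close>, gives the upper bound.\<close>

lemma gdist_bounds:
 assumes x: "x \<in> M" and y: "y \<in> M"
 shows "(1 - \<kappa>) * dist x y <= gdist M g x y" "gdist M g x y <= (1 + \<kappa>) * dist x y"
proof -
 let ?X = "{curve_length g \<gamma> | \<gamma>. \<gamma> C1_differentiable_on {0..1} & \<gamma> ` {0..1} \<subseteq> M & \<gamma> 0 = x & \<gamma> 1 = y}"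
 have lower: "(1 - \<kappa>) * dist x y <= l" if "l \<in> ?X" for l
  using that curve_length_lower by (auto simp: dist_norm norm_minus_commute)
 define \<gamma> where "\<gamma> t = x + t *\<^sub>R (y - x)" for t
 have d: "(\<gamma> has_vector_derivative y - x) (at t)" for t
  unfolding \<gamma>_def[abs_def] by (auto intro!: derivative_eq_intros)
 have "\<gamma> C1_differentiable_on {0..1}"
  unfolding C1_differentiable_on_def using d by (intro exI[of _ "%_. y - x"]) auto
 moreover have sub: "\<gamma> ` {0..1} \<subseteq> M"
 proof -
  have "\<gamma> t \<in> closed_segment x y" if "t \<in> {0..1}" for t
   using that by (auto simp: in_segment \<gamma>_def algebra_simps intro!: exI[of _ t])
  moreover have "closed_segment x y \<subseteq> M" using x y M by (simp add: closed_segment_subset)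
  ultimately show ?thesis by auto
 qed
 ultimately have mem: "curve_length g \<gamma> \<in> ?X" by (auto simp: \<gamma>_def intro!: exI[of _ \<gamma>])
 show "(1 - \<kappa>) * dist x y <= gdist M g x y"
  unfolding gdist_def by (rule cInf_greatest) (use mem lower in blast)+
 have "curve_length g \<gamma> = integral {0..1} (%t. sqrt ((y - x) \<bullet> (g (\<gamma> t) *v (y - x))))"
  unfolding curve_length_def Let_def by (simp add: vector_derivative_at[OF d])
 also have "... <= integral {0..1} (%t::real. (1 + \<kappa>) * norm (y - x))"
 proof (rule integral_le)
  have "continuous_on {0..1} \<gamma>" unfolding \<gamma>_def[abs_def] by (intro continuous_intros)
  then have "continuous_on {0..1} (%t. g (\<gamma> t))" by (rule continuous_on_compose2[OF g _ sub])
  then show "(%t. sqrt ((y - x) \<bullet> (g (\<gamma> t) *v (y - x)))) integrable_on {0..1}"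
   by (intro integrable_continuous_real continuous_intros bounded_bilinear.continuous_on[OF bounded_bilinear_matrix_vector])
  show "sqrt ((y - x) \<bullet> (g (\<gamma> t) *v (y - x))) <= (1 + \<kappa>) * norm (y - x)" if "t \<in> {0..1}" for t
   using speed_bounds(2) sub that by blast
 qed auto
 also have "... = (1 + \<kappa>) * dist x y" by (simp add: dist_norm norm_minus_commute)
 finally have "curve_length g \<gamma> <= (1 + \<kappa>) * dist x y" .
 then show "gdist M g x y <= (1 + \<kappa>) * dist x y"
  unfolding gdist_def using cInf_lower[OF mem bdd_belowI, OF lower] by linarith
qed

lemma center: "p \<in> M"
 using M by simp

text \<open>Otherwise all of \<open>M\<close> would be a closed metric ball of radius less than 4,
  hence compact; but a nonempty open ball is not closed.\<close>

lemma genuine_radius: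
 assumes "genuine_ball M g p 4" shows "R > 39/10"
proof (rule ccontr)
 assume "\<not> R > 39/10"
 then have "(1 + \<kappa>) * R <= (1 + 1/50) * (39/10)" using \<kappa> M by (intro mult_mono) auto
 then have s: "(1 + \<kappa>) * R < 4" by simp
 have "gdist M g p x <= (1 + \<kappa>) * R" if "x \<in> M" for x
  by (rule order_trans[OF gdist_bounds(2)[OF center that] mult_left_mono]) (use that M \<kappa> in auto)
 then have "{x\<in>M. gdist M g p x <= (1 + \<kappa>) * R} = M" by blast
 then have "compact M" using assms s unfolding genuine_ball_def by metis
 then have "closed (ball p R)" using M compact_imp_closed by blast
 then have "closure (ball p R) = ball p R" by simp
 then have "cball p R = ball p R" using M by simp
 moreover have "p + ax R undefined \<in> cball p R" "p + ax R undefined \<notin> ball p R" using M by (auto simp: dist_norm)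
 ultimately show False by blast
qed

lemma gball_2:
 assumes "R > 39/10" shows "gball M g p 2 \<subseteq> ball p (11/5)" "ball p 1 \<subseteq> gball M g p 2"
proof -
 show "gball M g p 2 \<subseteq> ball p (11/5)"
 proof
  fix y assume "y \<in> gball M g p 2"
  then have y: "y \<in> M" "gdist M g p y < 2" by (auto simp: gball_def)
  have "49/50 * dist p y <= (1 - \<kappa>) * dist p y" using \<kappa> by (intro mult_right_mono) auto
  then show "y \<in> ball p (11/5)" using gdist_bounds(1)[OF center y(1)] y(2) by simp
 qed
 show "ball p 1 \<subseteq> gball M g p 2"
 proof
  fix y assume y: "y \<in> ball p 1"
  then have yM: "y \<in> M" using assms M by simp
  have "(1 + \<kappa>) * dist p y <= (1 + 1/50) * 1" using \<kappa> y by (intro mult_mono) auto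
  then show "y \<in> gball M g p 2" using gdist_bounds(2)[OF center yM] yM by (simp add: gball_def)
 qed
qed

end

text \<open>Entries of the metric as coordinates of a vector indexed by pairs, to which the chain rule applies.\<close>

definition mat_of :: "real^('n::finite \<times> 'n) => real^'n^'n" where
 "mat_of y = (\<chi> i j. y $ (i, j))"

definition vec_of :: "real^'n^'n => real^('n \<times> 'n)" where
 "vec_of B = (\<chi> ij. B $ fst ij $ snd ij)"

lemma mat_of_vec_of [simp]: "mat_of (vec_of B) = B"
 by (simp add: mat_of_def vec_of_def vec_eq_iff)

lemma smooth_on_mat_of: "open S ==> smooth_on S mat_of"
 unfolding mat_of_def[abs_def] by (intro smooth_on_vec) (auto intro!: smooth_on_nth)

lemma smooth_on_vec_of: "open S ==> smooth_on S g ==> smooth_on S (%x. vec_of (g x))"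
 unfolding vec_of_def by (intro smooth_on_vec) (auto intro!: smooth_on_nth)

definition laplace_coeff :: "(real^'n => real^'n^'n) => 'n => 'n => real^'n => real" where
 "laplace_coeff g i j x = sqrt (det (g x)) * ginv g x i j"

text \<open>Continuity of \<open>F\<close> and of its first derivatives at the identity matrix. The
  derivatives are merely bounded; their smallness will come from the inner derivatives in the chain
  rule.\<close>

lemma smooth_near_identity:
 fixes F :: "real^('n::finite \<times> 'n) => real"
 assumes F: "smooth_on S F" "open S" "vec_of (mat 1) \<in> S" and e: "e > 0"
 shows "\<exists>c>0. \<forall>\<^sub>F y in nhds (vec_of (mat 1)). \<bar>F y - F (vec_of (mat 1))\<bar> < e & (ALL m. \<bar>pd m F y\<bar> <= c)"
proof -
 let ?I = "vec_of (mat 1 :: real^'n^'n)"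
 have near: "\<forall>\<^sub>F y in nhds ?I. \<bar>f y - f ?I\<bar> < r" if "smooth_on S f" "r > 0" for f :: "real^('n \<times> 'n) => real" and r
  using smooth_on_isCont[OF that(1) F(2,3)] that(2)
  unfolding continuous_at_eps_delta eventually_nhds_metric dist_real_def by blast
 define c where "c = 1 + (SUM m. \<bar>pd m F ?I\<bar>)"
 have c: "\<bar>pd m F ?I\<bar> <= c - 1" for m using member_le_sum[of m UNIV "%m. \<bar>pd m F ?I\<bar>"] by (simp add: c_def)
 have "\<forall>\<^sub>F y in nhds ?I. \<bar>F y - F ?I\<bar> < e & (ALL m. \<bar>pd m F y - pd m F ?I\<bar> < 1)"
  by (intro eventually_conj eventually_all_finite near F(1) e smooth_on_pd zero_less_one)
 then have "\<forall>\<^sub>F y in nhds ?I. \<bar>F y - F ?I\<bar> < e & (ALL m. \<bar>pd m F y\<bar> <= c)"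
 proof (rule eventually_mono)
  have "\<bar>pd m F y\<bar> <= c" if "\<bar>pd m F y - pd m F ?I\<bar> < 1" for m y using that c[of m] by linarith
  then show "\<bar>F y - F ?I\<bar> < e & (ALL m. \<bar>pd m F y\<bar> <= c)" if "\<bar>F y - F ?I\<bar> < e & (ALL m. \<bar>pd m F y - pd m F ?I\<bar> < 1)" for y
   using that by blast
 qed
 moreover have "c > 0" by (simp add: c_def add_pos_nonneg sum_nonneg)
 ultimately show ?thesis by blast
qed

definition metric_close :: "real => (real^'n) set => (real^'n => real^'n^'n) => bool" where
 "metric_close c S g \<longleftrightarrow> (\<forall>x\<in>S. ALL i j. \<bar>g x $ i $ j - (kd i j)\<bar> <= c & (ALL l. \<bar>pd l (%x. g x $ i $ j) x\<bar> <= c))"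

definition coefficients_close :: "real => (real^'n) set => (real^'n => real^'n^'n) => bool" where
 "coefficients_close c S g \<longleftrightarrow> (\<forall>x\<in>S. det (g x) > 0 & 1/2 <= sqrt (det (g x)) & sqrt (det (g x)) <= 2 &
   (ALL i j. \<bar>ginv g x i j - (kd i j)\<bar> <= c & \<bar>laplace_coeff g i j x - (kd i j)\<bar> <= c &
    (ALL l. \<bar>pd l (laplace_coeff g i j) x\<bar> <= c)))"

text \<open>The coefficients are fixed smooth functions of the metric entries near the identity:
  values are close by continuity, and first derivatives are small by the chain rule because those of
  the metric are.\<close>

lemma metric_coefficients:
 fixes \<eta> :: real
 assumes \<eta>: "\<eta> > 0"
 shows "\<exists>c>0. \<forall>S (g :: real^'n => real^'n^'n). open S & smooth_on S g & metric_close c S g --> coefficients_close \<eta> S g"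
proof -
 define Om where "Om = {y :: real^('n \<times> 'n). det (mat_of y) > 0}"
 have cm: "continuous_on UNIV (%y :: real^('n \<times> 'n). det (mat_of y))"
  unfolding mat_of_def det_def by (intro continuous_intros)
 then have Om: "open Om" unfolding Om_def by (intro open_Collect_less continuous_intros)
 have I: "vec_of (mat 1 :: real^'n^'n) \<in> Om" by (simp add: Om_def)
 define s where "s y = sqrt (det (mat_of y))" for y :: "real^('n \<times> 'n)"
 define iv where "iv i j y = matrix_inv (mat_of y) $ i $ j" for i j and y :: "real^('n \<times> 'n)"
 define F where "F i j y = s y * iv i j y" for i j and y :: "real^('n \<times> 'n)"
 have sm: "smooth_on Om s" "smooth_on Om (iv i j)" "smooth_on Om (F i j)" for i j
 proof -
  note mo = smooth_on_mat_of[OF Om]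
  show 1: "smooth_on Om s" unfolding s_def[abs_def] by (rule smooth_on_sqrt[OF Om smooth_on_det[OF Om mo]]) (simp add: Om_def)
  show 2: "smooth_on Om (iv i j)" unfolding iv_def[abs_def]
   by (rule smooth_on_nth[OF Om smooth_on_nth[OF Om smooth_on_matrix_inv[OF Om mo]]]) (auto simp: Om_def)
  show "smooth_on Om (F i j)" unfolding F_def[abs_def] by (intro smooth_on_mult 1 2 Om)
 qed
 have inv1: "matrix_inv (mat 1 :: real^'n^'n) = mat 1"
 proof -
  have "mat 1 ** matrix_inv (mat 1 :: real^'n^'n) = mat 1"
   unfolding matrix_inv_def by (rule someI2[of _ "mat 1"]) auto
  then show ?thesis by simp
 qed
 have at_I: "s (vec_of (mat 1)) = 1" "iv i j (vec_of (mat 1)) = (kd i j)" "F i j (vec_of (mat 1)) = (kd i j)" for i j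
  unfolding s_def iv_def F_def mat_of_vec_of inv1 det_I by (simp_all add: mat_def)
 let ?near = "%F e c y. \<bar>F y - F (vec_of (mat 1))\<bar> < e & (ALL m. \<bar>pd m F y\<bar> <= c)"
 obtain c1 where c1: "\<forall>\<^sub>F y in nhds (vec_of (mat 1)). ?near s (1/2) c1 y"
  using smooth_near_identity[OF sm(1) Om I, of "1/2"] by auto
 have "EX c. ALL i j. 0 < c i j & (\<forall>\<^sub>F y in nhds (vec_of (mat 1)). ?near (G i j) \<eta> (c i j) y)"
  if "!!i j. smooth_on Om (G i j)" for G :: "'n => 'n => _"
  by (rule choice, rule allI, rule choice, rule allI) (rule smooth_near_identity[OF that Om I \<eta>])
 from this[of iv, OF sm(2)] this[of F, OF sm(3)] obtain c2 c3
  where c2: "!!i j. \<forall>\<^sub>F y in nhds (vec_of (mat 1)). ?near (iv i j) \<eta> (c2 i j) y"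
  and c3: "!!i j. c3 i j > 0" "!!i j. \<forall>\<^sub>F y in nhds (vec_of (mat 1)). ?near (F i j) \<eta> (c3 i j) y" by blast
 have "\<forall>\<^sub>F y in nhds (vec_of (mat 1)). y \<in> Om & ?near s (1/2) c1 y & (ALL i j. ?near (iv i j) \<eta> (c2 i j) y & ?near (F i j) \<eta> (c3 i j) y)"
  by (intro eventually_conj eventually_all_finite c1 c2 c3(2) eventually_nhds_in_open[OF Om I])
 from this[unfolded eventually_nhds_metric dist_norm] obtain d where d: "d > 0" and dn: "!!y. norm (y - vec_of (mat 1)) < d ==>
  y \<in> Om & ?near s (1/2) c1 y & (ALL i j. ?near (iv i j) \<eta> (c2 i j) y & ?near (F i j) \<eta> (c3 i j) y)"
  by blast
 define N where "N = real CARD('n \<times> 'n)"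
 have "card (UNIV :: ('n \<times> 'n) set) > 0" by (rule card_gt_0_iff[THEN iffD2]) simp
 then have N: "N >= 1" unfolding N_def by linarith
 define cc where "cc = (SUM i j. c3 i j)"
 have cc: "c3 i j <= cc" for i j
 proof -
  have "c3 i j <= (SUM j. c3 i j)" using c3(1) by (intro member_le_sum) (auto intro: less_imp_le)
  also have "... <= cc" unfolding cc_def by (rule member_le_sum[of i UNIV "%i. SUM j. c3 i j"]) (simp_all add: sum_nonneg less_imp_le[OF c3(1)])
  finally show ?thesis .
 qed
 have cc0: "cc > 0" using cc[of undefined undefined] c3(1)[of undefined undefined] by linarith
 \<comment> \<open>The first entry keeps the metric inside the neighbourhood of the identity, the
   second makes the chain rule sum over all pairs of indices at most \<eta>.\<close>
 define c where "c = min (d / (2 * N)) (\<eta> / (N * cc))"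
 have c: "c > 0" "N * c < d" "N * (cc * c) <= \<eta>" using d N cc0 \<eta> by (auto simp: c_def min_def field_simps)
 show ?thesis
 proof (rule exI[of _ c], rule conjI[OF c(1)], intro allI impI, goal_cases)
  case (1 S g)
  then have S: "open S" "smooth_on S g"
   and gb: "!!x i j. x \<in> S ==> \<bar>g x $ i $ j - (kd i j)\<bar> <= c" "!!x i j l. x \<in> S ==> \<bar>pd l (%x. g x $ i $ j) x\<bar> <= c"
   by (auto simp: metric_close_def)
  have "det (g x) > 0 & 1/2 <= sqrt (det (g x)) & sqrt (det (g x)) <= 2 &
   (ALL i j. \<bar>ginv g x i j - (kd i j)\<bar> <= \<eta> & \<bar>laplace_coeff g i j x - (kd i j)\<bar> <= \<eta> &
    (ALL l. \<bar>pd l (laplace_coeff g i j) x\<bar> <= \<eta>))" if x: "x \<in> S" for x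
  proof -
  define y where "y x = vec_of (g x)" for x
  have ym: "mat_of (y x) = g x" for x by (simp add: y_def)
  have near: "norm (y x - vec_of (mat 1)) < d" if "x \<in> S" for x
  proof -
   have "norm (y x - vec_of (mat 1)) <= (SUM m. \<bar>(y x - vec_of (mat 1)) $ m\<bar>)" by (rule norm_le_l1_cart)
   also have "... <= (\<Sum>m\<in>(UNIV :: ('n \<times> 'n) set). c)"
    using gb(1)[OF that] by (intro sum_mono) (simp add: y_def vec_of_def mat_def)
   also have "... < d" using c(2) by (simp add: N_def)
   finally show ?thesis .
  qed
  have dy: "y x \<in> Om" "\<bar>s (y x) - s (vec_of (mat 1))\<bar> < 1/2" "\<bar>iv i j (y x) - iv i j (vec_of (mat 1))\<bar> < \<eta>"
   "\<bar>F i j (y x) - F i j (vec_of (mat 1))\<bar> < \<eta>" "\<bar>pd m (F i j) (y x)\<bar> <= c3 i j" for i j m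
   using dn[OF near[OF x]] by blast+
  have det: "det (g x) > 0" using dy(1) by (simp add: Om_def ym)
  have sq: "1/2 <= sqrt (det (g x))" "sqrt (det (g x)) <= 2" using dy(2)[unfolded at_I] unfolding s_def ym by linarith+
  have iv: "\<bar>ginv g x i j - (kd i j)\<bar> <= \<eta>" for i j using dy(3)[of i j, unfolded at_I] unfolding iv_def ym by simp
  have Fy: "F i j (y x) = laplace_coeff g i j x" for i j x by (simp add: F_def s_def iv_def ym laplace_coeff_def)
  have co: "\<bar>laplace_coeff g i j x - (kd i j)\<bar> <= \<eta>" for i j using dy(4)[of i j, unfolded at_I] unfolding Fy by simp
  have pdc: "\<bar>pd l (laplace_coeff g i j) x\<bar> <= \<eta>" for i j l
  proof -
   have sy: "smooth_on S y" unfolding y_def[abs_def] by (rule smooth_on_vec_of[OF S])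
   have "pd l (%x. F i j (y x)) x = (SUM m. pd l (%x. y x $ m) x *\<^sub>R pd m (F i j) (y x))"
    using pd_compose[OF smooth_on_differentiable[OF sy x] smooth_on_differentiable[OF sm(3) dy(1)], of l i j]
    by (simp add: pd_nth[OF smooth_on_differentiable[OF sy x]])
   also have "\<bar>...\<bar> <= (\<Sum>m\<in>(UNIV :: ('n \<times> 'n) set). c * cc)"
   proof (rule order_trans[OF sum_abs sum_mono])
    fix m :: "'n \<times> 'n"
    have "\<bar>pd m (F i j) (y x)\<bar> <= cc" using dy(5)[of m i j] cc[of i j] by linarith
    moreover have "\<bar>pd l (%x. y x $ m) x\<bar> <= c" using gb(2)[OF x] by (simp add: y_def vec_of_def)
    ultimately show "\<bar>pd l (%x. y x $ m) x *\<^sub>R pd m (F i j) (y x)\<bar> <= c * cc"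
     using c(1) by (simp add: abs_mult mult_mono)
   qed
   also have "... <= \<eta>" using c(3) by (simp add: N_def mult_ac)
   finally show ?thesis by (simp add: Fy[abs_def])
  qed
  from det sq iv co pdc show ?thesis by blast
  qed
  then show ?case by (simp add: coefficients_close_def)
 qed
qed

text \<open>The exponent 1/2 is one admissible choice; the first two parts of the norm are read off.
  The absolute value allows for negative \<open>C (1/2)\<close>, where \<open>ennreal\<close>
  truncates to zero.\<close>

lemma metric_bound_entries:
 fixes g :: "real^'n => real^'n^'n"
 assumes b: "metric_bound C M g K" and x: "x \<in> M" and d: "(%x. g x $ i $ j) differentiable (at x)"
 shows "\<bar>g x $ i $ j - (kd i j)\<bar> <= \<bar>C (1/2) * K\<bar>" "\<bar>pd l (%x. g x $ i $ j) x\<bar> <= \<bar>C (1/2) * K\<bar>"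
proof -
 let ?u = "%x. g x $ i $ j - (kd i j)"
 have "C1_holder_norm (1/2) M ?u <= ennreal (C (1/2) * K)"
  using b unfolding metric_bound_def by (auto dest!: spec[of _ "1/2 :: real"])
 also have "... <= ennreal \<bar>C (1/2) * K\<bar>" by (rule ennreal_leI) simp
 finally have n: "C1_holder_norm (1/2) M ?u <= ennreal \<bar>C (1/2) * K\<bar>" .
 have "ennreal \<bar>?u x\<bar> <= (SUP x\<in>M. ennreal \<bar>?u x\<bar>)" by (rule SUP_upper[OF x])
 also have "... <= C1_holder_norm (1/2) M ?u" unfolding C1_holder_norm_def by (simp add: add.assoc)
 finally show "\<bar>?u x\<bar> <= \<bar>C (1/2) * K\<bar>" using n by (simp add: order_trans[THEN ennreal_le_iff[THEN iffD1, rotated]])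
 have "ennreal \<bar>pd l ?u x\<bar> <= (SUP x\<in>M. ennreal \<bar>pd l ?u x\<bar>)" by (rule SUP_upper[OF x])
 also have "... <= (SUM l. SUP x\<in>M. ennreal \<bar>pd l ?u x\<bar>)" by (rule member_le_sum[of l UNIV "%l. SUP x\<in>M. ennreal \<bar>pd l ?u x\<bar>"]) auto
 also have "... <= C1_holder_norm (1/2) M ?u" unfolding C1_holder_norm_def by (simp add: add_increasing add_increasing2)
 finally have "ennreal \<bar>pd l ?u x\<bar> <= ennreal \<bar>C (1/2) * K\<bar>" using n by (rule order_trans)
 moreover have "pd l ?u x = pd l (%x. g x $ i $ j) x"
  using pd_add[OF d differentiable_const, of l "- (kd i j)"] by simp
 ultimately show "\<bar>pd l (%x. g x $ i $ j) x\<bar> <= \<bar>C (1/2) * K\<bar>" by simp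
qed

lemma pd_scale_map:
 assumes "f differentiable (at (scale_map p r z))"
 shows "pd i (%z. f (scale_map p r z)) z = r *\<^sub>R pd i f (scale_map p r z)"
  and "(%z. f (scale_map p r z)) differentiable (at z)"
 using pd_affine(1)[of f p r z i] pd_affine(2)[of f p r z] assms unfolding scale_map_def by auto

lemma curv_scale_map:
 fixes a :: "real^'n => 'n => real^'k^'k"
 assumes d: "!!i. (%w. a w i) differentiable (at (scale_map p r z))"
 shows "curv (%w i. r *\<^sub>R a (scale_map p r w) i) i j z = r^2 *\<^sub>R curv a i j (scale_map p r z)"
proof -
 have "pd i (%w. r *\<^sub>R a (scale_map p r w) j) z = r *\<^sub>R (r *\<^sub>R pd i (%w. a w j) (scale_map p r z))" for i j
  using pd_bounded_linear[OF bounded_linear_scaleR_right pd_scale_map(2)[OF d], of i r j] pd_scale_map(1)[OF d, of i j] by simp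
 then show ?thesis
  by (simp add: curv_def matrix_scaleR_mult power2_eq_square scaleR_diff_right scaleR_add_right)
qed

text \<open>Pairs of indices are treated as single ones. Products of two entries of the inverse
  metric differ from the identity by at most \<open>3 * e\<close>, so that the closeness estimate
  over n^2 pairs loses at most half.\<close>

lemma curv_norm2_lower:
 fixes g :: "real^'n => real^'n^'n" and A :: "real^'n => real^'n => 'n => real^'k^'k"
 assumes e: "!!i j. \<bar>ginv g z i j - (kd i j)\<bar> <= e" "e <= 1" "6 * e * (real CARD('n))^2 <= 1"
 shows "nsq (curv (A z) i j z) <= 2 * curv_norm2 g A z"
proof -
 let ?H = "%m m' :: 'n \<times> 'n. ginv g z (fst m) (fst m') * ginv g z (snd m) (snd m')"
 let ?w = "%m :: 'n \<times> 'n. curv (A z) (fst m) (snd m) z"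
 let ?S = "SUM m. nsq (?w m)"
 have H: "\<bar>?H m m' - (if m = m' then 1 else 0)\<bar> <= 3 * e" for m m'
 proof -
  have e0: "0 <= e" using e(1)[of undefined undefined] by (simp add: order_trans[OF abs_ge_zero])
  have p: "\<bar>x * y - s * t\<bar> <= 3 * e" if "\<bar>x - s\<bar> <= e" "\<bar>y - t\<bar> <= e" "\<bar>s\<bar> <= 1" "\<bar>t\<bar> <= 1" for x y s t :: real
  proof -
   have "x * y - s * t = (x - s) * (y - t) + (x - s) * t + s * (y - t)" by (simp add: algebra_simps)
   also have "\<bar>...\<bar> <= \<bar>(x - s) * (y - t)\<bar> + \<bar>(x - s) * t\<bar> + \<bar>s * (y - t)\<bar>"
    by (intro order_trans[OF abs_triangle_ineq] add_mono order_refl)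
   also have "... <= e * 1 + e * 1 + 1 * e"
    unfolding abs_mult using that e(2) e0 by (intro add_mono mult_mono) auto
   finally show ?thesis by simp
  qed
  have "(if m = m' then 1 else 0) = (if fst m = fst m' then 1 else 0) * (if snd m = snd m' then 1 else (0::real))"
   by (auto simp: prod_eq_iff)
  then show ?thesis using p[OF e(1) e(1), of "fst m" "fst m'" "snd m" "snd m'"] by simp
 qed
 have cn: "curv_norm2 g A z = (SUM m m'. ?H m m' * (?w m \<bullet> ?w m'))"
 proof -
  have pr: "(SUM m. f (fst m) (snd m)) = (SUM i j. f i j)" for f :: "'n => 'n => real"
   unfolding UNIV_Times_UNIV[symmetric] sum.cartesian_product by (simp add: case_prod_beta)
  show ?thesis
   unfolding curv_norm2_def pr[of "%i j. SUM k l. ginv g z i k * ginv g z j l * (curv (A z) i j z \<bullet> curv (A z) k l z)", symmetric]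
   by (intro sum.cong refl pr[symmetric])
 qed
 have "\<bar>curv_norm2 g A z - ?S\<bar> <= 3 * e * real CARD('n \<times> 'n) * ?S"
  unfolding cn by (rule quadratic_close[OF H])
 also have "... <= (1/2) * ?S"
  using e(3) by (intro mult_right_mono sum_nonneg) (auto simp: power2_eq_square)
 finally have "?S <= 2 * curv_norm2 g A z" by linarith
 moreover have "nsq (?w (i, j)) <= ?S" by (rule member_le_sum) auto
 ultimately show ?thesis by simp
qed

lemma orthonormal_complement:
 fixes L :: "(real^'n) set"
 assumes L: "subspace L" "dim L = CARD('n) - 4" and n: "CARD('n) >= 4"
 shows "EX T. orthonormal T & card T = 4 & (\<forall>e\<in>T. \<forall>l\<in>L. l \<bullet> e = 0)"
proof -
 let ?P = "{y \<in> UNIV. \<forall>x\<in>L. orthogonal x y}"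
 have "dim ?P + dim L = dim (UNIV :: (real^'n) set)"
  using dim_subspace_orthogonal_to_vectors[OF L(1) subspace_UNIV] by simp
 then have d: "dim ?P = 4" using L(2) n by (simp add: dim_UNIV)
 have sub: "subspace ?P" by (simp add: subspace_def orthogonal_def inner_add_right)
 obtain B where B: "B \<subseteq> ?P" "pairwise orthogonal B" "!!x. x \<in> B ==> norm x = 1" "independent B" "card B = dim ?P" "span B = ?P"
  by (rule orthonormal_basis_subspace[OF sub], rule that)
 have "orthonormal B" unfolding orthonormal_def
  using B(2,3) independent_imp_finite[OF B(4)] by (auto simp: pairwise_def orthogonal_def norm_eq_1)
 then show ?thesis using B(1,5) d by (intro exI[of _ B]) (auto simp: orthogonal_def)
qed

text \<open>Seen from \<open>p + e\<close> with \<open>e\<close> orthogonal to \<open>L\<close>, segments to points away from a subspace of codimension three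
 containing \<open>p + L\<close> avoid a neighbourhood of \<open>p + L\<close>.\<close>

lemma segment_height:
 fixes p :: "real^'n"
 assumes T: "orthonormal (insert e T)" "card T = 3" "e \<notin> T" and \<rho>: "0 < \<rho>" "\<rho> <= 1"
  and x: "x \<in> ball p (16/5)" "\<rho>\<^sup>2 <= height2 p T x" and y: "y \<in> closed_segment (p + e) x"
  and l: "!!f. f \<in> insert e T ==> (l - p) \<bullet> f = 0"
 shows "\<rho> / 16 <= dist y l"
proof -
 obtain t where t: "0 <= t" "t <= 1" "y = (1 - t) *\<^sub>R (p + e) + t *\<^sub>R x" using y by (auto simp: in_segment)
 then have yp: "y - p = (1 - t) *\<^sub>R e + t *\<^sub>R (x - p)" by (simp add: algebra_simps)
 have ip: "f \<bullet> f' = (if f = f' then 1 else 0)" if "f \<in> insert e T" "f' \<in> insert e T" for f f'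
  using T(1) that by (auto simp: orthonormal_def)
 have low: "\<bar>(y - p) \<bullet> f\<bar> <= dist y l" if f: "f \<in> insert e T" for f
 proof -
  have "(y - l) \<bullet> f = (y - p) \<bullet> f" using l[OF f] by (simp add: inner_diff_left)
  then have "\<bar>(y - p) \<bullet> f\<bar> <= norm (y - l) * norm f" using Cauchy_Schwarz_ineq2[of "y - l" f] by simp
  then show ?thesis using orthonormal_norm[OF T(1) f] by (simp add: dist_norm)
 qed
 show ?thesis
 \<comment> \<open>Away from the start of the segment, one of the three components of
   \<open>x - p\<close> along \<open>T\<close> is at least \<rho>/2 by pigeonhole, and at least an
   eighth of it survives at \<open>y\<close>. Near the start, the component along \<open>e\<close>
   is still bounded below.\<close>
 proof (cases "t >= 1/8")
  case True
  have "\<exists>f\<in>T. (\<rho> / 2)^2 <= ((x - p) \<bullet> f)^2"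
  proof (rule ccontr)
   assume "\<not> ?thesis"
   then have "height2 p T x <= (\<Sum>f\<in>T. (\<rho> / 2)^2)" unfolding height2_def by (intro sum_mono) auto
   also have "... = 3 * \<rho>^2 / 4" by (simp add: T(2) power_divide)
   finally show False using x(2) zero_less_power[OF \<rho>(1), of 2] by linarith
  qed
  then obtain f where f: "f \<in> T" "(\<rho> / 2)^2 <= ((x - p) \<bullet> f)^2" by blast
  then have "\<rho> / 2 <= \<bar>(x - p) \<bullet> f\<bar>" using \<rho>(1) by (simp add: abs_le_square_iff[symmetric])
  then have "1/8 * (\<rho> / 2) <= t * \<bar>(x - p) \<bullet> f\<bar>" using True \<rho>(1) by (intro mult_mono) auto
  moreover have "(y - p) \<bullet> f = t * ((x - p) \<bullet> f)" using ip[of e f] f(1) T(3) by (auto simp: yp inner_add_left)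
  ultimately show ?thesis using low[of f] f(1) t(1) by (simp add: abs_mult)
 next
  case False
  have "\<bar>(x - p) \<bullet> e\<bar> <= norm (x - p) * norm e" by (rule Cauchy_Schwarz_ineq2)
  then have "\<bar>(x - p) \<bullet> e\<bar> <= 16/5" using x(1) orthonormal_norm[OF T(1), of e] by (simp add: dist_norm norm_minus_commute)
  then have "t * \<bar>(x - p) \<bullet> e\<bar> <= 1/8 * (16/5)" using False t(1) by (intro mult_mono) auto
  then have "\<bar>t * ((x - p) \<bullet> e)\<bar> <= 2/5" using t(1) by (simp add: abs_mult)
  moreover have "(y - p) \<bullet> e = (1 - t) + t * ((x - p) \<bullet> e)" using ip[of e e] by (simp add: yp inner_add_left)
  ultimately have "(y - p) \<bullet> e >= 1/16" using False by (simp add: abs_le_iff)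
  then show ?thesis using low[of e] \<rho>(2) by simp
 qed
qed

lemma measurable_continuous_on_open:
 fixes h :: "'a::euclidean_space => real"
 assumes "open B" "continuous_on B h"
 shows "(%x. ennreal (h x) * indicator B x) \<in> borel_measurable lborel"
proof -
 have "(%x. indicator B x *\<^sub>R h x) \<in> borel_measurable borel"
  using assms by (intro borel_measurable_continuous_on_indicator) auto
 then have "(%x. ennreal (indicator B x *\<^sub>R h x)) \<in> borel_measurable lborel" by simp
 moreover have "(%x. ennreal (indicator B x *\<^sub>R h x)) = (%x. ennreal (h x) * indicator B x)"
  by (auto simp: indicator_def)
 ultimately show ?thesis by simp
qed

text \<open>The volume density is at most 2 in the numerator and at least 1/2 in the denominator,
  and \<open>B\<close> contains a Euclidean unit ball; hence the factor 4 over the volume of that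
  ball.\<close>

lemma gavg_le:
 fixes g :: "real^'n => real^'n^'n"
 assumes B: "ball p 1 \<subseteq> B" "B \<subseteq> ball p (11/5)"
  and g: "!!x. x \<in> B ==> 1/2 <= sqrt (det (g x))" "!!x. x \<in> B ==> sqrt (det (g x)) <= 2"
  and f: "!!x. x \<in> B ==> f x <= h x" and h: "continuous_on (ball p (11/5)) h" "!!x. x \<in> ball p (11/5) ==> 0 <= h x"
  and e: "(\<integral>\<^sup>+x\<in>ball p (11/5). ennreal (h x) \<partial>lborel) <= ennreal e" "e >= 0"
 shows "gavg g B f <= ennreal (4 * e / unit_ball_vol (real CARD('n)))"
proof -
 let ?v = "unit_ball_vol (real CARD('n))"
 have v: "?v > 0" by (rule unit_ball_vol_pos) simp
 have "(\<integral>\<^sup>+x\<in>B. ennreal (f x * sqrt (det (g x))) \<partial>lborel) <= (\<integral>\<^sup>+x. ennreal 2 * (ennreal (h x) * indicator (ball p (11/5)) x) \<partial>lborel)"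
 proof (rule nn_integral_mono)
  fix x
  show "ennreal (f x * sqrt (det (g x))) * indicator B x <= ennreal 2 * (ennreal (h x) * indicator (ball p (11/5)) x)"
  proof (cases "x \<in> B")
   case True
   have h0: "0 <= h x" using h(2) True B(2) by auto
   have "f x * sqrt (det (g x)) <= h x * sqrt (det (g x))" using f[OF True] g(1)[OF True] by (intro mult_right_mono) linarith+
   also have "... <= h x * 2" using g(2)[OF True] h0 by (intro mult_left_mono)
   finally have "ennreal (f x * sqrt (det (g x))) <= ennreal (2 * h x)" by (intro ennreal_leI) simp
   then show ?thesis using True B(2) h0 by (auto simp: ennreal_mult)
  qed simp
 qed
 also have "... = ennreal 2 * (\<integral>\<^sup>+x\<in>ball p (11/5). ennreal (h x) \<partial>lborel)"
  by (intro nn_integral_cmult measurable_continuous_on_open h) simp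
 also have "... <= ennreal 2 * ennreal e" by (intro mult_left_mono e) simp
 also have "... = ennreal (2 * e)" by (rule ennreal_mult[symmetric]) (use e in auto)
 finally have num: "(\<integral>\<^sup>+x\<in>B. ennreal (f x * sqrt (det (g x))) \<partial>lborel) <= ennreal (2 * e)" .
 have "ennreal (?v / 2) = ennreal (1/2) * emeasure lborel (ball p 1)"
 proof -
  have "emeasure lborel (ball p 1 :: (real^'n) set) = ennreal ?v" by (simp add: emeasure_ball)
  then show ?thesis using ennreal_mult[of "1/2" ?v] v by simp
 qed
 also have "... = (\<integral>\<^sup>+x. ennreal (1/2) * indicator (ball p 1) x \<partial>lborel)"
  by (subst nn_integral_cmult_indicator) auto
 also have "... <= (\<integral>\<^sup>+x\<in>B. ennreal (sqrt (det (g x))) \<partial>lborel)"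
 proof (rule nn_integral_mono)
  fix x
  show "ennreal (1/2) * indicator (ball p 1) x <= ennreal (sqrt (det (g x))) * indicator B x"
  proof (cases "x \<in> ball p 1")
   case True
   then have "x \<in> B" using B(1) by blast
   then show ?thesis using ennreal_leI[OF g(1)] by (auto simp: indicator_def)
  qed simp
 qed
 finally have den: "ennreal (?v / 2) <= (\<integral>\<^sup>+x\<in>B. ennreal (sqrt (det (g x))) \<partial>lborel)" .
 have "gavg g B f <= ennreal (2 * e) / ennreal (?v / 2)"
  unfolding gavg_def divide_ennreal_def
 proof (intro mult_mono num)
  show "inverse (\<integral>\<^sup>+x\<in>B. ennreal (sqrt (det (g x))) \<partial>lborel) <= inverse (ennreal (?v / 2))"
  proof (cases "\<integral>\<^sup>+x\<in>B. ennreal (sqrt (det (g x))) \<partial>lborel")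
   case (real d)
   then have "?v / 2 <= d" using den by simp
   moreover have v2: "0 < ?v / 2" using v by simp
   ultimately have "0 < d" "inverse d <= inverse (?v / 2)" by (linarith, intro le_imp_inverse_le)
   then show ?thesis unfolding real(2) inverse_ennreal[OF v2] by (subst inverse_ennreal) (auto intro: ennreal_leI)
  qed simp
 qed auto
 also have "... = ennreal (4 * e / ?v)" using v e by (simp add: divide_ennreal)
 finally show ?thesis .
qed

section \<open>Harmonic gauges\<close>

text \<open>Undoes the rescaling for the metric: the entries are unchanged, and the rescaled
  derivatives are four times the original ones, so that the same bound holds for the latter. The
  curvature bound is kept in rescaled form.\<close>

lemma weakly_flat_data:
 fixes g :: "real^'n => real^'n^'n"
 assumes M: "M = ball p R" and g: "smooth_on M g" and wf: "weakly_flat_ball C M g A \<delta> p 4"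
 shows "EX L. subspace L & dim L = CARD('n) - 4 & 0 < \<delta> &
  (\<forall>x\<in>M. ALL i j. \<bar>g x $ i $ j - (kd i j)\<bar> <= \<bar>C (1/2)\<bar> * \<delta> & (ALL l. \<bar>pd l (%x. g x $ i $ j) x\<bar> <= \<bar>C (1/2)\<bar> * \<delta>)) &
  (let \<phi> = scale_map p 4; M' = \<phi> -` M; g' = g \<circ> \<phi> in
   \<forall>y\<in>gball M' g' p 1 - gnbhd M' g' ((+) p ` L) \<delta>.
    sqrt (curv_norm2 g' (%x z i. 4 *\<^sub>R A (\<phi> x) (\<phi> z) i) y) <= \<delta> / (setgdist M' g' y ((+) p ` L))^2)"
proof -
 let ?\<phi> = "scale_map p 4"
 obtain L where L: "weakly_flat_unit C (?\<phi> -` M) (g \<circ> ?\<phi>) (%x z i. 4 *\<^sub>R A (?\<phi> x) (?\<phi> z) i) \<delta> p L"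
  using wf unfolding weakly_flat_ball_def Let_def by blast
 then obtain K where K: "0 <= K" "K < \<delta>" "metric_bound C (?\<phi> -` M) (g \<circ> ?\<phi>) K"
  unfolding weakly_flat_unit_def by blast
 have le: "\<bar>C (1/2) * K\<bar> <= \<bar>C (1/2)\<bar> * \<delta>" using K(1,2) by (simp add: abs_mult mult_left_mono)
 have "\<bar>g x $ i $ j - (kd i j)\<bar> <= \<bar>C (1/2)\<bar> * \<delta> & \<bar>pd l (%x. g x $ i $ j) x\<bar> <= \<bar>C (1/2)\<bar> * \<delta>" if x: "x \<in> M" for x i j l
 proof -
  define z where "z = p + (1/4) *\<^sub>R (x - p)"
  have z: "?\<phi> z = x" by (simp add: scale_map_def z_def)
  have d: "(%x. g x $ i $ j) differentiable (at (?\<phi> z))"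
   unfolding z using smooth_on_differentiable[OF smooth_on_nth[OF _ smooth_on_nth[OF _ g]] x] M by simp
  have m: "z \<in> ?\<phi> -` M" using x z by simp
  have dz: "(%z. (g \<circ> ?\<phi>) z $ i $ j) differentiable (at z)" using pd_scale_map(2)[OF d] by simp
  have "\<bar>(g \<circ> ?\<phi>) z $ i $ j - (kd i j)\<bar> <= \<bar>C (1/2)\<bar> * \<delta>"
   using metric_bound_entries(1)[OF K(3) m dz] le by linarith
  moreover have "\<bar>pd l (%z. (g \<circ> ?\<phi>) z $ i $ j) z\<bar> <= \<bar>C (1/2)\<bar> * \<delta>"
   using metric_bound_entries(2)[OF K(3) m dz, of l] le by linarith
  then have "4 * \<bar>pd l (%x. g x $ i $ j) x\<bar> <= \<bar>C (1/2)\<bar> * \<delta>"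
   using pd_scale_map(1)[OF d, of l] z by (simp add: abs_mult)
  ultimately show ?thesis using z by simp
 qed
 moreover have "0 < \<delta>" using K by simp
 ultimately show ?thesis using L unfolding weakly_flat_unit_def Let_def by blast
qed

text \<open>Rescaling divides distances from \<open>p + L\<close> by 4 and the metric changes them
  by at most two percent, which leaves at least \<open>d / 5\<close>. The rescaled curvature is 16
  times the original one, and 2 * 25 / 16 is below 4.\<close>

lemma curvature_bound:
 fixes g :: "real^'n => real^'n^'n" and A :: "real^'n => real^'n => 'n => real^'k^'k"
 assumes ne: "near_euclidean p R M g \<kappa>" "R > 39/10"
  and gi: "!!x i j. x \<in> M ==> \<bar>ginv g x i j - (kd i j)\<bar> <= e" "e <= 1" "6 * e * (real CARD('n))^2 <= 1"
  and L: "subspace L" and \<delta>: "0 < \<delta>" "\<delta> <= d / 5"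
  and flat: "let \<phi> = scale_map p 4; M' = \<phi> -` M; g' = g \<circ> \<phi> in
   \<forall>y\<in>gball M' g' p 1 - gnbhd M' g' ((+) p ` L) \<delta>.
    sqrt (curv_norm2 g' (%x z i. 4 *\<^sub>R A (\<phi> x) (\<phi> z) i) y) <= \<delta> / (setgdist M' g' y ((+) p ` L))^2"
  and y: "y \<in> ball p (16/5)" "!!l. l \<in> L ==> d <= dist y (p + l)" and dA: "!!i. (%w. A y w i) differentiable (at y)"
 shows "norm (curv (A y) i j y) <= 4 * \<delta> / d^2"
proof -
 interpret near_euclidean p R M g \<kappa> by (rule ne)
 define \<phi> where "\<phi> = scale_map p 4"
 define M' where "M' = \<phi> -` M"
 define g' where "g' = g \<circ> \<phi>"
 have M': "M' = ball p (R / 4)"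
  using M by (auto simp: M'_def \<phi>_def scale_map_def dist_norm norm_minus_commute)
 have c\<phi>: "continuous_on UNIV \<phi>" unfolding \<phi>_def scale_map_def[abs_def] by (intro continuous_intros)
 interpret S: near_euclidean p "R / 4" M' g' \<kappa>
 proof
  show "continuous_on M' g'" unfolding g'_def o_def
   by (rule continuous_on_compose2[OF g continuous_on_subset[OF c\<phi>]]) (auto simp: M'_def)
  show "\<bar>v \<bullet> (g' x *v v) - nsq v\<bar> <= \<kappa> * nsq v" if "x \<in> M'" for x v
   using form that by (simp add: g'_def M'_def)
 qed (use M M' \<kappa> in auto)
 define z where "z = p + (1/4) *\<^sub>R (y - p)"
 have z: "\<phi> z = y" by (simp add: \<phi>_def scale_map_def z_def)
 have yM: "y \<in> M" using y(1) M(1) ne(2) by simp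
 have zM: "z \<in> M'" using yM z by (simp add: M'_def)
 have dp: "dist p z <= 4/5" using y(1) by (simp add: z_def dist_norm norm_minus_commute)
 have "(1 + \<kappa>) * dist p z <= (1 + 1/50) * (4/5)" using S.\<kappa> dp by (intro mult_mono) auto
 then have z1: "z \<in> gball M' g' p 1" using S.gdist_bounds(2)[OF S.center zM] zM by (simp add: gball_def)
 have dpos: "d > 0" using \<delta> by simp
 have far: "d / 5 <= (1 - \<kappa>) * dist z (p + l)" if "l \<in> L" for l
 proof -
  have "4 *\<^sub>R l \<in> L" using L that by (rule subspace_scale)
  then have "d <= dist y (p + 4 *\<^sub>R l)" by (rule y(2))
  also have "... = 4 * dist z (p + l)"
  proof -
   have "y - (p + 4 *\<^sub>R l) = 4 *\<^sub>R (z - (p + l))" by (simp add: z_def algebra_simps)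
   then show ?thesis by (simp add: dist_norm)
  qed
  finally have "49/50 * (d / 4) <= (1 - \<kappa>) * dist z (p + l)" using S.\<kappa> dpos by (intro mult_mono) auto
  then show ?thesis using dpos by simp
 qed
 have gfar: "d / 5 <= gdist M' g' z x" if "x \<in> (+) p ` L \<inter> M'" for x
  using that S.gdist_bounds(1)[OF zM, of x] far by fastforce
 have z2: "z \<notin> gnbhd M' g' ((+) p ` L) \<delta>"
 proof
  assume "z \<in> gnbhd M' g' ((+) p ` L) \<delta>"
  then obtain x where x: "x \<in> (+) p ` L" "x \<in> M'" "gdist M' g' x z < \<delta>" by (auto simp: gnbhd_def gball_def)
  then obtain l where l: "l \<in> L" "x = p + l" by blast
  have "(1 - \<kappa>) * dist x z <= gdist M' g' x z" by (rule S.gdist_bounds(1)[OF x(2) zM])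
  then show False using far[OF l(1)] x(3) \<delta>(2) l(2) by (simp add: dist_commute)
 qed
 have "0 \<in> L" using L by (rule subspace_0)
 then have ne': "(+) p ` L \<inter> M' ~= {}" using S.center by force
 have sd: "d / 5 <= setgdist M' g' z ((+) p ` L)"
  unfolding setgdist_def by (rule cINF_greatest[OF ne' gfar])
 let ?A = "%x z i. 4 *\<^sub>R A (\<phi> x) (\<phi> z) i"
 have "sqrt (curv_norm2 g' ?A z) <= \<delta> / (setgdist M' g' z ((+) p ` L))^2"
  using flat z1 z2 unfolding Let_def \<phi>_def[symmetric] M'_def[symmetric] g'_def[symmetric] by blast
 also have "... <= \<delta> / (d / 5)^2" using sd \<delta>(1) dpos by (intro divide_left_mono power_mono mult_pos_pos) auto
 finally have sq: "sqrt (curv_norm2 g' ?A z) <= 25 * \<delta> / d^2" by (simp add: power_divide mult.commute)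
 have low: "nsq (curv (?A z) i j z) <= 2 * curv_norm2 g' ?A z"
  by (rule curv_norm2_lower[OF _ gi(2,3)]) (use gi(1)[OF yM] z in \<open>simp add: g'_def\<close>)
 have "curv (?A z) i j z = 4^2 *\<^sub>R curv (A y) i j y"
  using curv_scale_map[of "A y" p 4 z i j] dA z by (simp add: \<phi>_def)
 then have "(16 * norm (curv (A y) i j y))^2 <= 2 * curv_norm2 g' ?A z" using low by simp
 also have "... = 2 * (sqrt (curv_norm2 g' ?A z))^2"
  using order_trans[OF zero_le_power2 low] by simp
 also have "... <= (2 * sqrt (curv_norm2 g' ?A z))^2" unfolding power_mult_distrib by (intro mult_right_mono) auto
 finally have "16 * norm (curv (A y) i j y) <= 2 * sqrt (curv_norm2 g' ?A z)"
  by (rule power2_le_imp_le) (use order_trans[OF zero_le_power2 low] in simp)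
 then have "norm (curv (A y) i j y) <= 25 / 8 * (\<delta> / d^2)" using sq by simp
 also have "... <= 4 * (\<delta> / d^2)" using \<delta>(1) by (intro mult_right_mono) auto
 finally show ?thesis by simp
qed

section \<open>The connection in a global frame and sections given by components\<close>

context so_bundle
begin

context
 fixes A R W
 assumes A: "connection G M U \<tau> A" and R: "orthonormal_frame M U \<tau> W R"
begin

text \<open>Evaluated at each \<open>z\<close> in the trivialisation over \<open>U z\<close>, hence
  varying with the point; smoothness and derivatives are accessible because any other trivialisation
  gives the same value.\<close>

definition frame_form :: "real^'n => 'n => real^'k^'k" where
 "frame_form z i = gauge_form (A z) (R z) z i"

lemma A_smooth: "x \<in> M ==> smooth_on (U x) (%z. A x z i)"
 and A_skew: "x \<in> M ==> z \<in> U x ==> transpose (A x z i) = - A x z i"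
 and A_change: "x \<in> M ==> y \<in> M ==> z \<in> U x ==> z \<in> U y ==>
   A x z i = \<tau> x y z ** A y z i ** transpose (\<tau> x y z) - pd i (\<tau> x y) z ** transpose (\<tau> x y z)"
 using A G lie_algebra_skew unfolding connection_def by blast+

lemma frame_change: "x \<in> M ==> gauge_change (U x \<inter> W) (A x) (R x)"
 by unfold_locales
   ((simp add: open_Int U orthonormal_frameD[OF R]), (rule smooth_on_subset[OF A_smooth], assumption, blast),
   (rule orthonormal_frameD(3)[OF R], assumption), (rule orthonormal_frameD(4)[OF R], auto))

text \<open>The transition function from \<open>U z\<close> to \<open>U x\<close>, viewed as a
  frame, turns \<open>A x\<close> into \<open>A z\<close> by the transformation law of connections;
  composing with the frame over \<open>U z\<close> gives the claim.\<close>

lemma frame_form_eq: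
 assumes x: "x \<in> M" and z: "z \<in> U x" "z \<in> W"
 shows "gauge_form (A x) (R x) z i = frame_form z i"
proof -
 note RD = orthonormal_frameD[OF R]
 have zM: "z \<in> M" using RD(2) z by blast
 have zz: "z \<in> U z" by (rule U(2)[OF zM])
 interpret T: gauge_change "U x \<inter> U z" "A x" "\<tau> x z"
  by unfold_locales
    ((simp add: open_Int U x zM), (rule smooth_on_subset[OF A_smooth[OF x]], blast),
    (rule tau(1)[OF x zM]), (rule tau_orth[OF x zM], auto))
 let ?S = "U x \<inter> U z \<inter> W"
 have S: "open ?S" "z \<in> ?S" using U x zM z zz RD(1) by auto
 have t: "transpose (\<tau> x z z) ** \<tau> x z z = mat 1" "\<tau> x z z ** transpose (\<tau> x z z) = mat 1"
  using orthogonal_matrix_transpose_mult[OF tau_orth[OF x zM z(1) zz]] by auto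
 have g: "gauge_form (A x) (\<tau> x z) z i = A z z i"
 proof -
  have "A x z i ** \<tau> x z z = \<tau> x z z ** A z z i - pd i (\<tau> x z) z"
   unfolding A_change[OF x zM z(1) zz] matrix_diff_distrib matrix_mul_assoc[symmetric] t by simp
  then show ?thesis by (simp add: gauge_form_def matrix_mul_assoc t)
 qed
 have eq: "R x w = \<tau> x z w ** R z w" if "w \<in> ?S" for w using RD(5)[OF x zM] that by blast
 have d: "R z differentiable (at z)" using smooth_on_differentiable[OF RD(3)[OF zM]] zz z by auto
 have "gauge_form (A x) (R x) z i = gauge_form (A x) (%w. \<tau> x z w ** R z w) z i"
 proof -
  have "pd i (R x) z = pd i (%w. \<tau> x z w ** R z w) z" by (rule pd_cong_open[OF S eq])
  then show ?thesis by (simp only: gauge_form_def eq[OF S(2)])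
 qed
 also have "... = gauge_form (gauge_form (A x) (\<tau> x z)) (R z) z i"
  by (rule T.gauge_form_compose[OF _ d]) (use z zz in blast)
 also have "... = frame_form z i" by (simp add: gauge_form_def frame_form_def g[unfolded gauge_form_def])
 finally show ?thesis .
qed

lemma frame_form_local:
 assumes z: "z \<in> W"
 shows "open (U z \<inter> W)" "z \<in> U z \<inter> W" "!!w. w \<in> U z \<inter> W ==> gauge_form (A z) (R z) w i = frame_form w i" "z \<in> M"
proof -
 show zM: "z \<in> M" using orthonormal_frameD(2)[OF R] z by blast
 show "open (U z \<inter> W)" "z \<in> U z \<inter> W" using U[OF zM] orthonormal_frameD(1)[OF R] z by auto
 show "!!w. w \<in> U z \<inter> W ==> gauge_form (A z) (R z) w i = frame_form w i" using frame_form_eq[OF zM] by blast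
qed

lemma frame_form_smooth: "smooth_on W (%z. frame_form z i)"
proof (rule smooth_on_local)
 fix z assume z: "z \<in> W"
 note l = frame_form_local[OF z]
 interpret F: gauge_change "U z \<inter> W" "A z" "R z" by (rule frame_change[OF l(4)])
 have "smooth_on (U z \<inter> W) (%z. frame_form z i)" by (rule smooth_on_cong[OF l(1,3) F.smooth])
 then show "EX T. open T & z \<in> T & smooth_on T (%z. frame_form z i)" using l by blast
qed

lemma frame_form_skew:
 assumes z: "z \<in> W" shows "transpose (frame_form z i) = - frame_form z i"
proof -
 note l = frame_form_local[OF z]
 interpret F: gauge_change "U z \<inter> W" "A z" "R z" by (rule frame_change[OF l(4)])
 show ?thesis unfolding frame_form_def by (rule F.skew_gauge[OF l(2) A_skew[OF l(4)]]) (use l(2) in blast)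
qed

lemma frame_form_curv:
 assumes z: "z \<in> W"
 shows "curv frame_form i j z = transpose (R z z) ** curv (A z) i j z ** R z z"
proof -
 note l = frame_form_local[OF z]
 interpret F: gauge_change "U z \<inter> W" "A z" "R z" by (rule frame_change[OF l(4)])
 have "curv frame_form i j z = curv (gauge_form (A z) (R z)) i j z"
 proof -
  have "pd i (%w. gauge_form (A z) (R z) w j) z = pd i (%w. frame_form w j) z" for i j
   by (rule pd_cong_open[OF l(1,2) l(3)])
  then show ?thesis by (simp only: curv_def l(3)[OF l(2)])
 qed
 then show ?thesis using F.curv_gauge[OF l(2)] by simp
qed

context
 fixes B and Q :: "real^'n => real^'k^'k" and u :: "real^'n => real^'k" and g :: "real^'n => real^'n^'n"
 assumes B: "open B" "B \<subseteq> W" and Q: "smooth_on B Q" "\<forall>z\<in>B. orthogonal_matrix (Q z)" and u: "smooth_on B u"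
  and g: "!!i j. smooth_on B (laplace_coeff g i j)"
begin

text \<open>The section with components \<open>u\<close> in the frame obtained from the global frame
  \<open>R\<close> by the rotation \<open>Q\<close>.\<close>

abbreviation (input) lifted :: "real^'n => real^'n => real^'k" where
 "lifted x z \<equiv> (R x z ** Q z) *v u z"

lemma lifted_change: "x \<in> M ==> gauge_change (U x \<inter> B) (A x) (%z. R x z ** Q z)"
proof unfold_locales
 assume x: "x \<in> M"
 note RD = orthonormal_frameD[OF R]
 show S: "open (U x \<inter> B)" using U(1)[OF x] B by blast
 show "smooth_on (U x \<inter> B) (%z. A x z i)" for i by (rule smooth_on_subset[OF A_smooth[OF x]]) blast
 show "smooth_on (U x \<inter> B) (%z. R x z ** Q z)"
  by (rule smooth_on_matrix_mult[OF S smooth_on_subset[OF RD(3)[OF x]] smooth_on_subset[OF Q(1)]]) (use B in auto)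
 show "orthogonal_matrix (R x z ** Q z)" if "z \<in> U x \<inter> B" for z
  by (rule orthogonal_matrix_mul[OF RD(4)[OF x] Q(2)[rule_format]]) (use that B in auto)
qed

lemma lifted_form:
 assumes x: "x \<in> M" and z: "z \<in> U x" "z \<in> B"
 shows "gauge_form (A x) (%z. R x z ** Q z) z i = gauge_form frame_form Q z i"
proof -
 interpret F: gauge_change "U x \<inter> W" "A x" "R x" by (rule frame_change[OF x])
 have "gauge_form (A x) (%z. R x z ** Q z) z i = gauge_form (gauge_form (A x) (R x)) Q z i"
  by (rule F.gauge_form_compose) (use z B smooth_on_differentiable[OF Q(1)] in auto)
 then show ?thesis using frame_form_eq[OF x z(1)] z B by (auto simp: gauge_form_def)
qed

lemma lifted_section: "D \<subseteq> B ==> bundle_section M U \<tau> D lifted"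
 unfolding bundle_section_def
proof (intro conjI ballI)
 fix x assume D: "D \<subseteq> B" and x: "x \<in> M"
 interpret F: gauge_change "U x \<inter> B" "A x" "%z. R x z ** Q z" by (rule lifted_change[OF x])
 have "smooth_on (U x \<inter> B) (lifted x)"
  by (intro smooth_on_matrix_vector F.S F.Q smooth_on_subset[OF u]) auto
 then show "smooth_on (U x \<inter> D) (lifted x)" by (rule smooth_on_subset) (use D in auto)
 show "lifted x z = \<tau> x y z *v lifted y z" if "y \<in> M" "z \<in> U x \<inter> U y \<inter> D" for y z
  using orthonormal_frameD(5)[OF R x that(1), of z] that(2) D B by (auto simp: matrix_vector_mul_assoc matrix_mul_assoc)
qed

lemma lifted_cov:
 assumes z: "z \<in> B"
 shows "cov (A z) (lifted z) i z = (R z z ** Q z) *v (pd i u z + gauge_form frame_form Q z i *v u z)"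
proof -
 have "z \<in> W" using z B(2) by blast
 then have zM: "z \<in> M" using orthonormal_frameD(2)[OF R] by blast
 then have zU: "z \<in> U z" by (rule U(2))
 interpret F: gauge_change "U z \<inter> B" "A z" "%y. R z y ** Q y" by (rule lifted_change[OF zM])
 show ?thesis
  using F.cov_gauge[of z u i] smooth_on_differentiable[OF u z] lifted_form[OF zM zU z, of i] z zU by (simp add: cov_def)
qed

lemma lifted_orthogonal:
 assumes z: "z \<in> B" shows "orthogonal_matrix (R z z ** Q z)"
proof -
 have zW: "z \<in> W" using z B(2) by blast
 then have zM: "z \<in> M" using orthonormal_frameD(2)[OF R] by blast
 show ?thesis by (rule orthogonal_matrix_mul[OF orthonormal_frameD(4)[OF R zM U(2)[OF zM] zW] Q(2)[rule_format, OF z]])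
qed

lemma lifted_laplacian:
 assumes z: "z \<in> B"
  and eq: "(SUM i. pd i (%y. SUM l. laplace_coeff g i l y *\<^sub>R (pd l u y + gauge_form frame_form Q y l *v u y)) z
     + gauge_form frame_form Q z i *v (SUM l. laplace_coeff g i l z *\<^sub>R (pd l u z + gauge_form frame_form Q z l *v u z))) = 0"
 shows "laplacian g (A z) (lifted z) z = 0"
proof -
 have "z \<in> W" using z B(2) by blast
 then have zM: "z \<in> M" using orthonormal_frameD(2)[OF R] by blast
 then have zU: "z \<in> U z" by (rule U(2))
 interpret F: gauge_change "U z \<inter> B" "A z" "%y. R z y ** Q y" by (rule lifted_change[OF zM])
 let ?a = "gauge_form (A z) (%y. R z y ** Q y)"
 have zB: "z \<in> U z \<inter> B" using z zU by blast
 have c: "smooth_on (U z \<inter> B) (laplace_coeff g i j)" for i j by (rule smooth_on_subset[OF g]) auto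
 have "(SUM i. cov (A z) (%w. SUM j. laplace_coeff g i j w *\<^sub>R cov (A z) (lifted z) j w) i z)
  = (R z z ** Q z) *v (SUM i. cov ?a (%w. SUM j. laplace_coeff g i j w *\<^sub>R cov ?a u j w) i z)"
  by (rule F.divergence_gauge[OF zB smooth_on_subset[OF u] c]) auto
 also have "(SUM i. cov ?a (%w. SUM j. laplace_coeff g i j w *\<^sub>R cov ?a u j w) i z) = 0"
 proof -
  have cv: "cov ?a u j w = pd j u w + gauge_form frame_form Q w j *v u w" if "w \<in> U z \<inter> B" for j w
   using lifted_form[OF zM, of w j] that by (simp add: cov_def)
  have "cov ?a (%w. SUM j. laplace_coeff g i j w *\<^sub>R cov ?a u j w) i z
   = cov ?a (%w. SUM j. laplace_coeff g i j w *\<^sub>R (pd j u w + gauge_form frame_form Q w j *v u w)) i z" for i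
   by (rule cov_cong_open[OF F.S zB]) (simp add: cv)
  then show ?thesis using eq lifted_form[OF zM zU z] by (simp add: cov_def[of ?a "%w. SUM j. _ w j"])
 qed
 finally show ?thesis by (simp add: laplacian_def laplace_coeff_def)
qed

end

end

end

lemma matrix_inv_symmetric:
 fixes B :: "real^'n^'n"
 assumes "transpose B = B" "det B ~= 0"
 shows "matrix_inv B $ i $ j = matrix_inv B $ j $ i"
proof -
 have inv: "B ** matrix_inv B = mat 1" "matrix_inv B ** B = mat 1"
  using assms(2) invertible_det_nz[of B] unfolding invertible_def matrix_inv_def by (metis (mono_tags, lifting) someI_ex)+
 have "transpose (matrix_inv B) ** B = mat 1"
  using arg_cong[OF inv(1), of transpose] by (simp add: matrix_transpose_mul assms(1) transpose_mat)
 then have "transpose (matrix_inv B) ** B ** matrix_inv B = matrix_inv B" by simp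
 then have "transpose (matrix_inv B) = matrix_inv B" by (simp add: matrix_mul_assoc[symmetric] inv)
 then show ?thesis by (metis (no_types, lifting) transpose_def vec_lambda_beta)
qed

lemma cov_norm2_le:
 fixes g :: "real^'n => real^'n^'n"
 assumes "!!i j. \<bar>ginv g z i j - (kd i j)\<bar> <= e" "e * real CARD('n) <= 1"
 shows "cov_norm2 g A V z <= 2 * (SUM i. nsq (cov (A z) (V z) i z))"
proof -
 let ?S = "SUM i. nsq (cov (A z) (V z) i z)"
 have "\<bar>cov_norm2 g A V z - ?S\<bar> <= e * real CARD('n) * ?S" unfolding cov_norm2_def by (rule quadratic_close[OF assms(1)])
 also have "... <= 1 * ?S" by (intro mult_right_mono assms(2) sum_nonneg) auto
 finally show ?thesis by linarith
qed

theorem theorem6p2: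
  fixes C :: "real \<Rightarrow> real" and \<Lambda> \<epsilon> :: real
  assumes "CARD('n::finite) \<ge> 4" and "\<Lambda> \<ge> 0" and "\<epsilon> > 0"
  shows "\<exists>\<delta>\<^sub>0>0. \<forall>\<delta><\<delta>\<^sub>0.
    \<forall>(G :: (real^'k::finite^'k) set) (p :: real^'n) R M g U \<tau> A.
      compact_subgroup_SO G \<and>
      R > 0 \<and> M = ball p R \<and>
      riemannian_metric M g \<and>
      genuine_ball M g p 4 \<and>
      principal_bundle G M U \<tau> \<and>
      connection G M U \<tau> A \<and>
      yang_mills G M g U \<tau> A \<and>
      gavg g (gball M g p 4) (curv_norm2 g A) \<le> ennreal \<Lambda> \<and>
      weakly_flat_ball C M g A \<delta> p 4
      \<longrightarrow> (\<exists>V. harmonic_gauge M g U \<tau> A \<epsilon> p 2 V)"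
proof -
 let ?n = "real CARD('n)" and ?k = "real CARD('k)" and ?v = "unit_ball_vol (real CARD('n))"
 have n: "?n >= 4" using assms(1) by simp
 have v: "?v > 0" by (rule unit_ball_vol_pos) simp
 have k: "?k > 0" by simp
 \<comment> \<open>Averaging loses 4 over the volume of the unit ball. For the gradient there are
   further factors: \<open>CARD('k)\<close> sections, 2 from \<open>cov_norm2_le\<close>, and the
   squared radius 4. A surplus factor 2 gives strict inequalities.\<close>
 define \<epsilon>1 where "\<epsilon>1 = min (\<epsilon> * ?v / 8) (\<epsilon>^2 * ?v / (64 * ?k))"
 have \<epsilon>1: "\<epsilon>1 > 0" "4 * \<epsilon>1 / ?v < \<epsilon>" "4 * (4 * (?k * (2 * \<epsilon>1)) / ?v) < \<epsilon>\<^sup>2"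
 proof -
  show "\<epsilon>1 > 0" using assms(3) v k by (simp add: \<epsilon>1_def)
  have "4 * \<epsilon>1 <= \<epsilon> * ?v / 2" by (simp add: \<epsilon>1_def min_def)
  also have "... < \<epsilon> * ?v" using assms(3) v by simp
  finally show "4 * \<epsilon>1 / ?v < \<epsilon>" using v by (simp add: divide_less_eq)
  have "\<epsilon>1 <= \<epsilon>^2 * ?v / (64 * ?k)" by (simp add: \<epsilon>1_def)
  then have "32 * (?k * \<epsilon>1) <= \<epsilon>^2 * ?v / 2" using k by (simp add: field_simps)
  also have "... < \<epsilon>\<^sup>2 * ?v" using assms(3) v by simp
  finally show "4 * (4 * (?k * (2 * \<epsilon>1)) / ?v) < \<epsilon>\<^sup>2" using v by (simp add: divide_less_eq)
 qed
 obtain \<rho> \<sigma> where \<rho>: "0 < \<rho>" "\<rho> <= 1" and \<sigma>: "0 < \<sigma>" and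
  sections: "\<forall>(p :: real^'n) a (A :: 'n => real^'n => real^'k^'k) T. local_operator p a A & orthonormal T & card T = 3 &
   (\<forall>x\<in>ball p 3. \<rho>\<^sup>2 <= height2 p T x --> (ALL i v. norm (A i x *v v) <= \<sigma> * norm v)) --> (EX u. almost_parallel p a A \<epsilon>1 u)"
  using almost_parallel_sections[OF \<epsilon>1(1), where 'n = 'n and 'k = 'k] by auto
 \<comment> \<open>Small enough at once for both coefficient bounds of
   \<open>local_operator\<close>, for \<open>curv_norm2_lower\<close> and for
   \<open>cov_norm2_le\<close>.\<close>
 define \<eta> where "\<eta> = 1 / (10 * ?n\<^sup>2)"
 have \<eta>: "\<eta> > 0" "\<eta> <= 1" "6 * \<eta> * ?n\<^sup>2 <= 1" "\<eta> * ?n <= 1" "\<eta> <= 1 / (2 * ?n)" "\<eta> <= 1 / (10 * ?n)"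
 proof -
  have "1 / (10 * m^2) <= 1 / (10 * m)" "1 / (10 * m) <= 1 / (2 * m)" "1 / (10 * m) <= 1" if "m >= 4" for m :: real
   using that by (auto intro!: frac_le simp: power2_eq_square)
  from this[OF n] show "\<eta> <= 1" "\<eta> <= 1 / (2 * ?n)" "\<eta> <= 1 / (10 * ?n)" unfolding \<eta>_def by linarith+
  show "\<eta> > 0" "6 * \<eta> * ?n\<^sup>2 <= 1" using n by (simp_all add: \<eta>_def)
  show "\<eta> * ?n <= 1" using n by (simp add: \<eta>_def power2_eq_square)
 qed
 obtain c where c: "c > 0" and
  coeffs: "!!S (g :: real^'n => real^'n^'n). open S ==> smooth_on S g ==> metric_close c S g ==> coefficients_close \<eta> S g"
  using metric_coefficients[OF \<eta>(1), where 'n = 'n] by auto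
 \<comment> \<open>The summand 1 allows division by \<open>C0\<close> even if \<open>C (1/2)\<close>
   is zero.\<close>
 define C0 where "C0 = \<bar>C (1/2)\<bar> + 1"
 have C0: "C0 > 0" "\<bar>C (1/2)\<bar> <= C0" by (simp_all add: C0_def)
 \<comment> \<open>In order: \<rho>/80 is one fifth of the distance \<rho>/16 kept by the segments;
   \<open>c / C0\<close> controls the elliptic coefficients; the third entry gives the two percent
   distortion of the metric; the last makes the curvature contribute at most \<sigma>/2 to the
   form.\<close>
 define \<delta>\<^sub>0 where "\<delta>\<^sub>0 = min (min (\<rho> / 80) (c / C0)) (min (1 / (50 * ?n * C0)) (\<sigma> * \<rho>^2 / (20000 * ?n)))"
 have \<delta>0: "\<delta>\<^sub>0 > 0" using \<rho> c C0 n \<sigma> by (simp add: \<delta>\<^sub>0_def)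
 show ?thesis
 proof (intro exI[of _ \<delta>\<^sub>0] conjI allI impI \<delta>0)
  fix \<delta> :: real and G :: "(real^'k^'k) set" and p :: "real^'n" and R M g U \<tau> A
  assume \<delta>: "\<delta> < \<delta>\<^sub>0"
  assume H: "compact_subgroup_SO G &
   R > 0 & M = ball p R &
   riemannian_metric M g &
   genuine_ball M g p 4 &
   principal_bundle G M U \<tau> &
   connection G M U \<tau> A &
   yang_mills G M g U \<tau> A &
   gavg g (gball M g p 4) (curv_norm2 g A) <= ennreal \<Lambda> &
   weakly_flat_ball C M g A \<delta> p 4"
  then have MR: "R > 0" "M = ball p R" and gen: "genuine_ball M g p 4" and con: "connection G M U \<tau> A" by auto
  have gs: "smooth_on M g" and gsym: "!!x. x \<in> M ==> transpose (g x) = g x" using H by (auto simp: riemannian_metric_def)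
  have Mo: "open M" using MR by simp
  interpret so_bundle G M U \<tau> using H by unfold_locales auto
  obtain L where L: "subspace L" "dim L = CARD('n) - 4" and \<delta>pos: "0 < \<delta>" and
   ent: "!!x i j l. x \<in> M ==> \<bar>g x $ i $ j - (kd i j)\<bar> <= \<bar>C (1/2)\<bar> * \<delta> & \<bar>pd l (%x. g x $ i $ j) x\<bar> <= \<bar>C (1/2)\<bar> * \<delta>" and
   flat: "let \<phi> = scale_map p 4; M' = \<phi> -` M; g' = g \<circ> \<phi> in
   \<forall>y\<in>gball M' g' p 1 - gnbhd M' g' ((+) p ` L) \<delta>.
    sqrt (curv_norm2 g' (%x z i. 4 *\<^sub>R A (\<phi> x) (\<phi> z) i) y) <= \<delta> / (setgdist M' g' y ((+) p ` L))^2"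
   using weakly_flat_data[OF MR(2) gs, of C A \<delta>] H by blast
  have \<delta>s: "\<delta> <= \<rho> / 16 / 5" "\<bar>C (1/2)\<bar> * \<delta> <= c" "\<bar>C (1/2)\<bar> * \<delta> * ?n <= 1/50" "20000 * ?n * \<delta> <= \<sigma> * \<rho>^2"
  proof -
   have d: "\<delta> <= \<rho> / 80" "\<delta> <= c / C0" "\<delta> <= 1 / (50 * ?n * C0)" "\<delta> <= \<sigma> * \<rho>^2 / (20000 * ?n)" using \<delta> by (auto simp: \<delta>\<^sub>0_def)
   show "\<delta> <= \<rho> / 16 / 5" using d(1) by simp
   have "\<bar>C (1/2)\<bar> * \<delta> <= C0 * \<delta>" using C0 \<delta>pos by (intro mult_right_mono) auto
   moreover have "C0 * \<delta> <= c" "C0 * \<delta> * ?n <= 1/50" using d(2,3) C0 n by (simp_all add: field_simps)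
   ultimately show "\<bar>C (1/2)\<bar> * \<delta> <= c" "\<bar>C (1/2)\<bar> * \<delta> * ?n <= 1/50"
    using mult_right_mono[of "\<bar>C (1/2)\<bar> * \<delta>" "C0 * \<delta>" ?n] by linarith+
   show "20000 * ?n * \<delta> <= \<sigma> * \<rho>^2" using d(4) n by (simp add: field_simps)
  qed
  have gc: "det (g x) > 0" "1/2 <= sqrt (det (g x))" "sqrt (det (g x)) <= 2"
    "\<bar>ginv g x i j - (kd i j)\<bar> <= \<eta>" "\<bar>laplace_coeff g i j x - (kd i j)\<bar> <= \<eta>"
    "\<bar>pd l (laplace_coeff g i j) x\<bar> <= \<eta>" if "x \<in> M" for x i j l
  proof -
   have "metric_close c M g" unfolding metric_close_def using ent \<delta>s(2) by (meson order_trans)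
   from coeffs[OF Mo gs this]
   show "det (g x) > 0" "1/2 <= sqrt (det (g x))" "sqrt (det (g x)) <= 2"
    "\<bar>ginv g x i j - (kd i j)\<bar> <= \<eta>" "\<bar>laplace_coeff g i j x - (kd i j)\<bar> <= \<eta>"
    "\<bar>pd l (laplace_coeff g i j) x\<bar> <= \<eta>" using that unfolding coefficients_close_def by blast+
  qed
  have ne: "near_euclidean p R M g (\<bar>C (1/2)\<bar> * \<delta> * ?n)"
  proof
   show "continuous_on M g" by (rule smooth_on_continuous_on[OF gs])
   show "\<bar>v \<bullet> (g x *v v) - nsq v\<bar> <= \<bar>C (1/2)\<bar> * \<delta> * ?n * nsq v" if "x \<in> M" for x v
    by (rule metric_form) (use ent[OF that] in blast)
  qed (use MR \<delta>s(3) \<delta>pos in auto)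
  then interpret E: near_euclidean p R M g "\<bar>C (1/2)\<bar> * \<delta> * ?n" .
  have R: "R > 39/10" by (rule E.genuine_radius[OF gen])
  let ?B = "ball p (16/5)"
  have BM: "?B \<subseteq> M" "cball p (16/5) \<subseteq> M" using R MR(2) by auto
  obtain W F where W: "cball p (16/5) \<subseteq> W" and F: "orthonormal_frame M U \<tau> W F"
   using framed_cball[OF BM(2)] unfolding framed_def by blast
  have BW: "?B \<subseteq> W" using W ball_subset_cball by blast
  have Wo: "open W" by (rule orthonormal_frameD(1)[OF F])
  let ?a = "frame_form A F"
  obtain T4 where T4: "orthonormal T4" "card T4 = 4" "!!e l. e \<in> T4 ==> l \<in> L ==> l \<bullet> e = 0"
   using orthonormal_complement[OF L assms(1)] by blast
  then obtain e where e: "e \<in> T4" by fastforce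
  \<comment> \<open>One of the four normals of \<open>L\<close> displaces the centre of the radial
    frame; the remaining three define the exceptional subspace of codimension three.\<close>
  define T where "T = T4 - {e}"
  have ins: "insert e T = T4" "e \<notin> T" using e by (auto simp: T_def)
  have T: "orthonormal T" "card T = 3" using T4 e by (auto simp: T_def orthonormal_def)
  have q: "p + e \<in> ?B" using orthonormal_norm[OF T4(1) e] by (simp add: dist_norm)
  \<comment> \<open>The global frame \<open>F\<close> carries no estimate; the rotation
    \<open>Q\<close> makes it approximately radial about \<open>p + e\<close>. Half of \<sigma> is
    set aside for the discretisation error, half for the curvature.\<close>
  obtain Q where Q: "smooth_on ?B Q" "\<forall>x\<in>?B. orthogonal_matrix (Q x)"
   and rad: "!!x \<phi> i. x \<in> ?B ==> (!!y i m. y \<in> closed_segment (p + e) x ==> bnd \<phi> (curv ?a i m y)) ==>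
     bnd (?n * (2 * (16/5)) * \<phi> + \<sigma> / 2) (gauge_form ?a Q x i)"
  proof -
   have "EX Q. smooth_on ?B Q & (\<forall>x\<in>?B. orthogonal_matrix (Q x)) &
    (\<forall>x\<in>?B. ALL \<phi>. (\<forall>y\<in>closed_segment (p + e) x. ALL i m. bnd \<phi> (curv ?a i m y)) -->
    (ALL i. bnd (?n * (2 * (16/5)) * \<phi> + \<sigma> / 2) (gauge_form ?a Q x i)))"
    by (rule radial_frame[OF Wo W frame_form_smooth[OF con F] frame_form_skew[OF con F] q]) (use \<sigma> in auto)
   then show thesis using that by blast
  qed
  let ?b = "%i z. gauge_form ?a Q z i"
  have lc: "smooth_on M (laplace_coeff g i j)" for i j
  proof -
   have "det (g x) ~= 0" if "x \<in> M" for x using gc(1)[OF that] by simp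
   then show ?thesis unfolding laplace_coeff_def[abs_def]
    by (intro smooth_on_mult[OF Mo] smooth_on_sqrt[OF Mo smooth_on_det[OF Mo gs] gc(1)]
      smooth_on_nth[OF Mo] smooth_on_matrix_inv[OF Mo gs])
  qed
  interpret GC: gauge_change ?B ?a Q
   by unfold_locales (rule open_ball, rule smooth_on_subset[OF frame_form_smooth[OF con F] BW], rule Q(1), rule Q(2)[rule_format])
  have lo: "local_operator p (laplace_coeff g) ?b"
  proof
   fix i l x
   show "smooth_on ?B (laplace_coeff g i l)" by (rule smooth_on_subset[OF lc BM(1)])
   show "smooth_on ?B (?b i)" by (rule GC.smooth)
   show "transpose (?b i x) = - ?b i x" if "x \<in> ?B"
    by (rule GC.skew_gauge[OF that frame_form_skew[OF con F]]) (use that BW in blast)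
   show "laplace_coeff g i l x = laplace_coeff g l i x" if "x \<in> ?B"
   proof -
    have "x \<in> M" using that BM by blast
    then show ?thesis using matrix_inv_symmetric[OF gsym, of x i l] gc(1)[of x] by (simp add: laplace_coeff_def)
   qed
   show "\<bar>laplace_coeff g i l x - (kd i l)\<bar> <= 1 / (2 * real CARD('n))" if "x \<in> ?B"
    using gc(5)[of x i l] that BM \<eta>(5) by (meson order_trans subsetD)
   show "\<bar>pd i (laplace_coeff g i l) x\<bar> <= 1 / (10 * real CARD('n))" if "x \<in> ball p (5/2)"
   proof -
    have "x \<in> M" using that R MR by simp
    then show ?thesis using gc(6)[of x i i l] \<eta>(6) by linarith
   qed
  qed
  have small: "norm (?b i x *v v) <= \<sigma> * norm v" if x: "x \<in> ball p 3" "\<rho>\<^sup>2 <= height2 p T x" for x i v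
  proof -
   \<comment> \<open>The curvature bound at distance \<rho>/16 from \<open>p + L\<close>, which
     \<open>segment_height\<close> guarantees along the entire segment from \<open>p + e\<close> to
     \<open>x\<close>.\<close>
   define \<phi> where "\<phi> = 4 * \<delta> / (\<rho> / 16)^2"
   have xB: "x \<in> ?B" using x(1) by simp
   have "bnd \<phi> (curv ?a i m y)" if y: "y \<in> closed_segment (p + e) x" for y i m
   proof -
    have yB: "y \<in> ?B" using closed_segment_subset[OF q xB convex_ball] y by blast
    have yM: "y \<in> M" and yW: "y \<in> W" using yB BM BW by auto
    have "norm (curv (A y) i m y) <= 4 * \<delta> / (\<rho> / 16)^2"
    proof (rule curvature_bound[OF ne R gc(4) \<eta>(2,3) L(1) \<delta>pos \<delta>s(1) flat yB])
     show "\<rho> / 16 <= dist y (p + l)" if "l \<in> L" for l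
      by (rule segment_height[OF _ T(2) ins(2) \<rho> xB x(2) y]) (use T4 ins that in auto)
     show "(%w. A y w i) differentiable (at y)" for i
      by (rule smooth_on_differentiable[OF A_smooth[OF con F yM] U(2)[OF yM]])
    qed
    then have cb: "bnd \<phi> (curv (A y) i m y)" unfolding \<phi>_def by (rule bnd_norm_le)
    have "orthogonal_matrix (F y y)" by (rule orthonormal_frameD(4)[OF F yM U(2)[OF yM] yW])
    then have "bnd (1 * \<phi> * 1) (transpose (F y y) ** curv (A y) i m y ** F y y)"
     by (intro bnd_mult cb bnd_orthogonal orthogonal_matrix_T)
    then show ?thesis unfolding frame_form_curv[OF con F yW] by simp
   qed
   from rad[OF xB this] have rb: "bnd (?n * (2 * (16/5)) * \<phi> + \<sigma> / 2) (?b i x)" .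
   have "?n * (2 * (16/5)) * \<phi> <= \<sigma> / 2"
   proof -
    have "?n * (2 * (16/5)) * \<phi> = 32768 / 5 * (?n * \<delta>) / \<rho>^2" by (simp add: \<phi>_def power_divide)
    also have "... <= 10000 * (?n * \<delta>) / \<rho>^2" using \<delta>pos by (intro divide_right_mono mult_right_mono) auto
    also have "... <= \<sigma> / 2" using \<delta>s(4) \<rho>(1) by (simp add: field_simps)
    finally show ?thesis .
   qed
   then have "bnd \<sigma> (?b i x)" by (intro bnd_mono[OF rb]) simp
   then show ?thesis by (simp add: bnd_def)
  qed
  obtain u where "almost_parallel p (laplace_coeff g) ?b \<epsilon>1 u"
   using sections[rule_format, of p "laplace_coeff g" ?b T] lo T small by blast
  note u = this[unfolded almost_parallel_def]
  have us: "smooth (u b)" for b using u by simp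
  define V where "V b x z = (F x z ** Q z) *v u b z" for b x z
  have sub: "gball M g p 2 \<subseteq> ball p (11/5)" "ball p 1 \<subseteq> gball M g p 2" by (rule E.gball_2[OF R])+
  have sub': "ball p (11/5) \<subseteq> ?B" by auto
  have gM: "z \<in> M" if "z \<in> gball M g p 2" for z using that by (simp add: gball_def)
  have uB: "smooth_on ?B (u b)" for b by (rule smooth_on_subset[OF us]) simp
  have lcB: "smooth_on ?B (laplace_coeff g i j)" for i j by (rule smooth_on_subset[OF lc BM(1)])
  note lift = lifted_section[OF con F open_ball BW Q uB lcB] lifted_cov[OF con F open_ball BW Q uB lcB]
   lifted_orthogonal[OF con F open_ball BW Q uB lcB] lifted_laplacian[OF con F open_ball BW Q uB lcB]
  have zB: "z \<in> ?B" "z \<in> ball p (11/5)" if "z \<in> gball M g p 2" for z using that sub sub' by auto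
  \<comment> \<open>The combined frame is orthogonal, so scalar products and covariant derivatives
    of the sections have the sizes already estimated for the components \<open>u\<close>.\<close>
  have nV: "V b z z \<bullet> V b' z z = u b z \<bullet> u b' z" if z: "z \<in> gball M g p 2" for b b' z
  proof -
   have "transpose (F z z ** Q z) ** (F z z ** Q z) = mat 1"
    by (rule orthogonal_matrix_transpose_mult(1)[OF lift(3)[OF zB(1)[OF z]]])
   then have "(transpose (F z z ** Q z) *v ((F z z ** Q z) *v u b z)) \<bullet> u b' z = u b z \<bullet> u b' z"
    by (simp only: matrix_vector_mul_assoc matrix_vector_mul_lid)
   then show ?thesis by (simp only: V_def inner_transpose_vector)
  qed
  have cV: "norm (cov (A z) (V b z) i z) = norm (pd i (u b) z + ?b i z *v u b z)" if z: "z \<in> gball M g p 2" for b i z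
  proof -
   have "orthogonal_transformation ((*v) (F z z ** Q z))"
    by (simp add: orthogonal_transformation_matrix lift(3)[OF zB(1)[OF z]])
   then show ?thesis unfolding V_def[abs_def] lift(2)[OF zB(1)[OF z]] by (simp add: orthogonal_transformation)
  qed
  define h where "h b z = (SUM i. nsq (pd i (u b) z + ?b i z *v u b z))" for b z
  have h: "continuous_on (ball p (11/5)) (h b)" "0 <= h b z" for b z
  proof -
   have "smooth_on ?B (%z. pd i (u b) z + ?b i z *v u b z)" for i
    by (intro smooth_on_add smooth_on_matrix_vector smooth_on_pd uB GC.smooth open_ball)
   then have "continuous_on (ball p (11/5)) (%z. pd i (u b) z + ?b i z *v u b z)" for i
    by (rule continuous_on_subset[OF smooth_on_continuous_on sub'])
   then show "continuous_on (ball p (11/5)) (h b)" unfolding h_def[abs_def] by (intro continuous_on_sum continuous_on_power continuous_on_norm)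
   show "0 <= h b z" by (simp add: h_def sum_nonneg)
  qed
  have "harmonic_gauge M g U \<tau> A \<epsilon> p 2 V"
   unfolding harmonic_gauge_def Let_def
  proof (intro conjI allI ballI)
   fix b b' :: 'k
   show "bundle_section M U \<tau> (gball M g p 2) (V b)"
    unfolding V_def[abs_def] by (rule lift(1)) (use sub sub' in blast)
   show "norm (V b z z) <= 1 + \<epsilon>" if "z \<in> gball M g p 2" for z
   proof -
    have "norm (V b z z) = norm (u b z)" by (simp add: norm_eq_sqrt_inner nV[OF that])
    then show ?thesis using u assms(3) by (simp add: add_increasing2)
   qed
   show "laplacian g (A z) (V b z) z = 0" if "z \<in> gball M g p 2" for z
    unfolding V_def[abs_def] by (rule lift(4)[OF zB(1)[OF that]]) (use u zB(2)[OF that] in blast)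
   have "gavg g (gball M g p 2) (%z. \<bar>V b z z \<bullet> V b' z z - (kd b b')\<bar>) <= ennreal (4 * \<epsilon>1 / ?v)"
   proof (rule gavg_le[OF sub(2,1), where h = "%z. \<bar>u b z \<bullet> u b' z - (kd b b')\<bar>"])
    show "continuous_on (ball p (11/5)) (%z. \<bar>u b z \<bullet> u b' z - (kd b b')\<bar>)"
     by (intro continuous_intros continuous_on_subset[OF smooth_on_continuous_on[OF us]]) auto
    show "(\<integral>\<^sup>+x\<in>ball p (11/5). ennreal \<bar>u b x \<bullet> u b' x - (kd b b')\<bar> \<partial>lborel) <= ennreal \<epsilon>1"
     using u by blast
   qed (use gM gc(2,3) nV \<epsilon>1(1) in auto)
   also have "... < ennreal \<epsilon>" using \<epsilon>1(1,2) v by (intro ennreal_lessI) (auto simp: assms(3))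
   finally show "gavg g (gball M g p 2) (%z. \<bar>V b z z \<bullet> V b' z z - (kd b b')\<bar>) < ennreal \<epsilon>" .
  next
   have "gavg g (gball M g p 2) (%z. SUM b. cov_norm2 g A (V b) z) <= ennreal (4 * (?k * (2 * \<epsilon>1)) / ?v)"
   proof (rule gavg_le[OF sub(2,1), where h = "%z. SUM b. 2 * h b z"])
    show "(SUM b. cov_norm2 g A (V b) z) <= (SUM b. 2 * h b z)" if z: "z \<in> gball M g p 2" for z
    proof (rule sum_mono)
     show "cov_norm2 g A (V b) z <= 2 * h b z" for b
      using cov_norm2_le[of g z \<eta> A "V b"] gc(4)[OF gM[OF z]] \<eta>(4) by (simp add: cV[OF z] h_def)
    qed
    show "continuous_on (ball p (11/5)) (%z. SUM b. 2 * h b z)" by (intro continuous_intros h)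
    note meas = measurable_continuous_on_open[OF open_ball h(1)]
    have "(\<integral>\<^sup>+x\<in>ball p (11/5). ennreal (SUM b. 2 * h b x) \<partial>lborel)
     = (\<integral>\<^sup>+x. (\<Sum>b\<in>(UNIV::'k set). ennreal 2 * (ennreal (h b x) * indicator (ball p (11/5)) x)) \<partial>lborel)"
     using h(2) by (intro nn_integral_cong) (simp add: sum_ennreal[symmetric] ennreal_mult sum_distrib_right mult.assoc)
    also have "... = (\<Sum>b\<in>(UNIV::'k set). ennreal 2 * (\<integral>\<^sup>+x\<in>ball p (11/5). ennreal (h b x) \<partial>lborel))"
     using meas by (simp add: nn_integral_sum nn_integral_cmult)
    also have "... <= (\<Sum>b\<in>(UNIV::'k set). ennreal 2 * ennreal \<epsilon>1)"
     unfolding h_def using u by (intro sum_mono mult_left_mono) auto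
    also have "... = ennreal (?k * (2 * \<epsilon>1))"
    proof -
     have "ennreal 2 * ennreal \<epsilon>1 = ennreal (2 * \<epsilon>1)" by (rule ennreal_mult[symmetric]) (use \<epsilon>1(1) in auto)
     then have "(\<Sum>b\<in>(UNIV::'k set). ennreal 2 * ennreal \<epsilon>1) = (\<Sum>b\<in>(UNIV::'k set). ennreal (2 * \<epsilon>1))" by (simp only:)
     also have "... = ennreal (\<Sum>b\<in>(UNIV::'k set). 2 * \<epsilon>1)" by (rule sum_ennreal) (use \<epsilon>1(1) in simp)
     finally show ?thesis by simp
    qed
    finally show "(\<integral>\<^sup>+x\<in>ball p (11/5). ennreal (SUM b. 2 * h b x) \<partial>lborel) <= ennreal (?k * (2 * \<epsilon>1))" .
   qed (use gM gc(2,3) \<epsilon>1(1) h(2) in \<open>auto intro!: sum_nonneg\<close>)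
   then have "ennreal (2^2) * gavg g (gball M g p 2) (%z. SUM b. cov_norm2 g A (V b) z) <= ennreal (2^2) * ennreal (4 * (?k * (2 * \<epsilon>1)) / ?v)"
    by (rule mult_left_mono) simp
   also have "... = ennreal (4 * (4 * (?k * (2 * \<epsilon>1)) / ?v))"
    using \<epsilon>1(1) v by (subst ennreal_mult[symmetric]) auto
   also have "... < ennreal (\<epsilon>^2)" using \<epsilon>1(3) assms(3) by (intro ennreal_lessI) auto
   finally show "ennreal (2^2) * gavg g (gball M g p 2) (%z. SUM b. cov_norm2 g A (V b) z) < ennreal (\<epsilon>^2)" .
  qed
  then show "EX V. harmonic_gauge M g U \<tau> A \<epsilon> p 2 V" by blast
 qed
qed

end
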